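(* Let $k$ be a field and let $A$ be a $k$-algebra of finite transcendence degree over $k$ which is an AF-domain. Then $A$ is a GAF-domain.
   Context: All rings are commutative with identity and ring homomorphisms are unital. Throughout, $k$ is a field and all $k$-algebras considered are (not necessarily finitely generated) commutative $k$-algebras of finite transcendence degree over $k$. For a $k$-algebra $A$ that is a domain, $\mathrm{t.d.}(A)$ is the transcendence degree over $k$ of its fraction field; for a general $k$-algebra $A$, $\mathrm{t.d.}(A):=\sup\{\mathrm{t.d.}(A/p): p\in \mathrm{Spec}(A)\}$. The height $\mathrm{ht}$ of an ideal is the minimum of the heights of the prime ideals containing it. For $k$-algebras $A,B$, the rings $A$ and $B$ are identified with their images in $A\otimes_kB$, so $P\cap A$ and $P\cap B$ denote the contractions of a prime $P$ of $A\otimes_kB$. For ideals $p$ of $A$ and $q$ of $B$, $p\otimes_kB$ and $A\otimes_kq$ are regarded as ideals of $A\otimes_kB$, and $\frac{P}{p\otimes_kB+A\otimes_kq}$ is the corresponding prime ideal of the quotient ring $\frac{A\otimes_kB}{p\otimes_kB+A\otimes_kq}$. AF-domain: a $k$-algebra $A$ that is a domain with $\mathrm{ht}(p)+\mathrm{t.d.}(A/p)=\mathrm{t.d.}(A)$ for all prime ideals $p$ of $A$. GSCT: a $k$-algebra $A$ satisfies GSCT with respect to a $k$-algebra $B$ if for each prime ideal $P$ of $A\otimes_kB$, with $p=P\cap A$ and $q=P\cap B$, $$\mathrm{ht}(P)=\mathrm{ht}(p\otimes_kB+A\otimes_kq)+\mathrm{ht}\Big(\frac{P}{p\otimes_kB+A\otimes_kq}\Big).$$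 GAF-domain: a $k$-algebra $A$ that is a domain and satisfies GSCT with respect to every $k$-algebra $B$ (of finite transcendence degree over $k$). *)

theory Defs
  imports "HOL-Library.Extended_Nat" "HOL-Algebra.Algebra"
begin

text \<open>A commutative unital algebra over the field \<open>K\<close> is a record \<open>A\<close> satisfying the library
  locale predicate \<open>algebra K A\<close>; its structure map is \<open>c \<mapsto> c \<odot> \<one>\<close>.\<close>

section \<open>Heights\<close>

definition prime_ht :: "('a, 'm) ring_scheme \<Rightarrow> 'a set \<Rightarrow> enat" where
  "prime_ht R P = Sup {enat n | n. \<exists>C :: nat \<Rightarrow> 'a set.
     (\<forall>i\<le>n. primeideal (C i) R) \<and> (\<forall>i<n. C i \<subset> C (Suc i)) \<and> C n = P}"

text \<open>In \<^typ>\<open>enat\<close> every nonempty set contains its infimum, so for a proper ideal this is a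
  minimum. For the unit ideal the value is \<open>\<infinity>\<close>.\<close>

definition ht :: "('a, 'm) ring_scheme \<Rightarrow> 'a set \<Rightarrow> enat" where
  "ht R I = Inf {prime_ht R P | P. primeideal P R \<and> I \<subseteq> P}"

section \<open>Quotient algebras and fraction fields\<close>

definition quot_alg :: "('k, 'a) module \<Rightarrow> 'a set \<Rightarrow> ('k, 'a set) module" where
  "quot_alg A I = ring.extend (A Quot I)
     (module.fields (\<lambda>c U. \<Union>x\<in>U. I +>\<^bsub>A\<^esub> (c \<odot>\<^bsub>A\<^esub> x)))"

definition frac_rel :: "('a, 'm) ring_scheme \<Rightarrow> (('a \<times> 'a) \<times> ('a \<times> 'a)) set" where
  "frac_rel R = {((a, b), (c, d)). a \<in> carrier R \<and> b \<in> carrier R - {\<zero>\<^bsub>R\<^esub>} \<and>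
     c \<in> carrier R \<and> d \<in> carrier R - {\<zero>\<^bsub>R\<^esub>} \<and> a \<otimes>\<^bsub>R\<^esub> d = c \<otimes>\<^bsub>R\<^esub> b}"

definition fraction :: "('a, 'm) ring_scheme \<Rightarrow> 'a \<Rightarrow> 'a \<Rightarrow> ('a \<times> 'a) set" where
  "fraction R a b = frac_rel R `` {(a, b)}"

definition Frac :: "('k, 'a) module \<Rightarrow> ('k, ('a \<times> 'a) set) module" where
  "Frac A = \<lparr>carrier = (carrier A \<times> (carrier A - {\<zero>\<^bsub>A\<^esub>})) // frac_rel A,
     monoid.mult = \<lambda>U V. \<Union>(a, b)\<in>U. \<Union>(c, d)\<in>V. fraction A (a \<otimes>\<^bsub>A\<^esub> c) (b \<otimes>\<^bsub>A\<^esub> d),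
     one = fraction A \<one>\<^bsub>A\<^esub> \<one>\<^bsub>A\<^esub>,
     ring.zero = fraction A \<zero>\<^bsub>A\<^esub> \<one>\<^bsub>A\<^esub>,
     add = \<lambda>U V. \<Union>(a, b)\<in>U. \<Union>(c, d)\<in>V.
       fraction A (a \<otimes>\<^bsub>A\<^esub> d \<oplus>\<^bsub>A\<^esub> c \<otimes>\<^bsub>A\<^esub> b) (b \<otimes>\<^bsub>A\<^esub> d),
     smult = \<lambda>r U. \<Union>(a, b)\<in>U. fraction A (r \<odot>\<^bsub>A\<^esub> a) b\<rparr>"

section \<open>Transcendence degree\<close>

text \<open>Monomials in indeterminates indexed by \<open>S\<close> are multisets over \<open>S\<close>, and a polynomial is a
  family of coefficients \<open>c\<close> on a finite set \<open>M\<close> of monomials; \<open>S\<close> is algebraically independent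
  if the only polynomial over \<open>K\<close> vanishing at the elements of \<open>S\<close> is the zero polynomial.\<close>

definition monomial_value :: "('a, 'm) ring_scheme \<Rightarrow> 'a multiset \<Rightarrow> 'a" where
  "monomial_value L m = (\<Otimes>\<^bsub>L\<^esub>s\<in>set_mset m. s [^]\<^bsub>L\<^esub> count m s)"

definition alg_independent :: "'k ring \<Rightarrow> ('k, 'a) module \<Rightarrow> 'a set \<Rightarrow> bool" where
  "alg_independent K L S \<longleftrightarrow> S \<subseteq> carrier L \<and>
     (\<forall>M c. finite M \<and> (\<forall>m\<in>M. set_mset m \<subseteq> S) \<and> c \<in> M \<rightarrow> carrier K \<and>
        (\<Oplus>\<^bsub>L\<^esub>m\<in>M. c m \<odot>\<^bsub>L\<^esub> monomial_value L m) = \<zero>\<^bsub>L\<^esub>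
        \<longrightarrow> (\<forall>m\<in>M. c m = \<zero>\<^bsub>K\<^esub>))"

text \<open>Subsets of algebraically independent sets are algebraically independent, so it suffices to
  take the supremum over finite ones; the value is \<open>\<infinity>\<close> iff there is an infinite one.\<close>

definition trdeg :: "'k ring \<Rightarrow> ('k, 'a) module \<Rightarrow> enat" where
  "trdeg K L = Sup {enat (card S) | S. finite S \<and> alg_independent K L S}"

definition td :: "'k ring \<Rightarrow> ('k, 'a) module \<Rightarrow> enat" where
  "td K A = (if domain A then trdeg K (Frac A)
     else Sup {trdeg K (Frac (quot_alg A p)) | p. primeideal p A})"

section \<open>Tensor products\<close>

text \<open>The free abelian group on \<open>A \<times> B\<close>, a commutative ring under the multiplication extending
  \<open>(a, b)(a', b') = (aa', bb')\<close> biadditively, i.e. the integral monoid ring of the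
  multiplicative monoid \<open>A \<times> B\<close>.\<close>

definition free_tensor ::
    "('k, 'a) module \<Rightarrow> ('k, 'b) module \<Rightarrow> (('a \<times> 'b) \<Rightarrow>\<^sub>0 int) ring" where
  "free_tensor A B = \<lparr>carrier = {x. Poly_Mapping.keys x \<subseteq> carrier A \<times> carrier B},
     monoid.mult = \<lambda>x y. frag_extend (\<lambda>(a, b). frag_extend
       (\<lambda>(a', b'). frag_of (a \<otimes>\<^bsub>A\<^esub> a', b \<otimes>\<^bsub>B\<^esub> b')) y) x,
     one = frag_of (\<one>\<^bsub>A\<^esub>, \<one>\<^bsub>B\<^esub>), ring.zero = 0, add = (+)\<rparr>"

definition tensor_relations ::
    "'k ring \<Rightarrow> ('k, 'a) module \<Rightarrow> ('k, 'b) module \<Rightarrow> (('a \<times> 'b) \<Rightarrow>\<^sub>0 int) set" where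
  "tensor_relations K A B =
     {frag_of (a \<oplus>\<^bsub>A\<^esub> a', b) - frag_of (a, b) - frag_of (a', b) | a a' b.
        a \<in> carrier A \<and> a' \<in> carrier A \<and> b \<in> carrier B} \<union>
     {frag_of (a, b \<oplus>\<^bsub>B\<^esub> b') - frag_of (a, b) - frag_of (a, b') | a b b'.
        a \<in> carrier A \<and> b \<in> carrier B \<and> b' \<in> carrier B} \<union>
     {frag_of (c \<odot>\<^bsub>A\<^esub> a, b) - frag_of (a, c \<odot>\<^bsub>B\<^esub> b) | c a b.
        c \<in> carrier K \<and> a \<in> carrier A \<and> b \<in> carrier B}"

text \<open>The relations are stable under multiplication by the generators \<open>(a, b)\<close>, so the ideal
  they generate is the subgroup they generate, and the additive group of the quotient is the usual
  tensor product over \<open>K\<close>.\<close>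

definition tensor_ideal ::
    "'k ring \<Rightarrow> ('k, 'a) module \<Rightarrow> ('k, 'b) module \<Rightarrow> (('a \<times> 'b) \<Rightarrow>\<^sub>0 int) set" where
  "tensor_ideal K A B = Idl\<^bsub>free_tensor A B\<^esub> (tensor_relations K A B)"

definition tensor ::
    "'k ring \<Rightarrow> ('k, 'a) module \<Rightarrow> ('k, 'b) module \<Rightarrow> (('a \<times> 'b) \<Rightarrow>\<^sub>0 int) set ring" where
  "tensor K A B = free_tensor A B Quot tensor_ideal K A B"

definition pure_tensor :: "'k ring \<Rightarrow> ('k, 'a) module \<Rightarrow> ('k, 'b) module \<Rightarrow>
    'a \<Rightarrow> 'b \<Rightarrow> (('a \<times> 'b) \<Rightarrow>\<^sub>0 int) set" where
  "pure_tensor K A B a b = tensor_ideal K A B +>\<^bsub>free_tensor A B\<^esub> frag_of (a, b)"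

definition contr_left :: "'k ring \<Rightarrow> ('k, 'a) module \<Rightarrow> ('k, 'b) module \<Rightarrow>
    (('a \<times> 'b) \<Rightarrow>\<^sub>0 int) set set \<Rightarrow> 'a set" where
  "contr_left K A B P = {a \<in> carrier A. pure_tensor K A B a \<one>\<^bsub>B\<^esub> \<in> P}"

definition contr_right :: "'k ring \<Rightarrow> ('k, 'a) module \<Rightarrow> ('k, 'b) module \<Rightarrow>
    (('a \<times> 'b) \<Rightarrow>\<^sub>0 int) set set \<Rightarrow> 'b set" where
  "contr_right K A B P = {b \<in> carrier B. pure_tensor K A B \<one>\<^bsub>A\<^esub> b \<in> P}"

text \<open>The ideal generated by the \<open>a \<otimes> b\<close> with \<open>a \<in> U\<close> and \<open>b \<in> V\<close>.
  If \<open>U\<close> is an ideal of \<open>A\<close> and \<open>V\<close> is all of \<open>B\<close> (or the other way round), it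
  is the image of the tensor product of \<open>U\<close> and \<open>V\<close>.\<close>

definition tensor_span :: "'k ring \<Rightarrow> ('k, 'a) module \<Rightarrow> ('k, 'b) module \<Rightarrow>
    'a set \<Rightarrow> 'b set \<Rightarrow> (('a \<times> 'b) \<Rightarrow>\<^sub>0 int) set set" where
  "tensor_span K A B U V =
     Idl\<^bsub>tensor K A B\<^esub> {pure_tensor K A B a b | a b. a \<in> U \<and> b \<in> V}"

definition tensor_sum_ideal :: "'k ring \<Rightarrow> ('k, 'a) module \<Rightarrow> ('k, 'b) module \<Rightarrow>
    'a set \<Rightarrow> 'b set \<Rightarrow> (('a \<times> 'b) \<Rightarrow>\<^sub>0 int) set set" where
  "tensor_sum_ideal K A B p q =
     tensor_span K A B p (carrier B) <+>\<^bsub>tensor K A B\<^esub> tensor_span K A B (carrier A) q"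

section \<open>AF-domains and GAF-domains\<close>

definition AF_domain :: "'k ring \<Rightarrow> ('k, 'a) module \<Rightarrow> bool" where
  "AF_domain K A \<longleftrightarrow> domain A \<and>
     (\<forall>p. primeideal p A \<longrightarrow> prime_ht A p + td K (quot_alg A p) = td K A)"

definition GSCT :: "'k ring \<Rightarrow> ('k, 'a) module \<Rightarrow> ('k, 'b) module \<Rightarrow> bool" where
  "GSCT K A B \<longleftrightarrow> (\<forall>P. primeideal P (tensor K A B) \<longrightarrow>
     (let T = tensor K A B;
          J = tensor_sum_ideal K A B (contr_left K A B P) (contr_right K A B P)
      in prime_ht T P = ht T J + prime_ht (T Quot J) ((\<lambda>x. J +>\<^bsub>T\<^esub> x) ` P)))"

text \<open>Quantification over all algebras \<open>B\<close> is quantification over all algebras on subsets of a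
  type \<open>'b\<close>; a theorem with \<open>'b\<close> schematic covers all types.\<close>

definition GAF_domain :: "'b itself \<Rightarrow> 'k ring \<Rightarrow> ('k, 'a) module \<Rightarrow> bool" where
  "GAF_domain (_ :: 'b itself) K A \<longleftrightarrow> domain A \<and>
     (\<forall>B :: ('k, 'b) module. algebra K B \<and> td K B < \<infinity> \<longrightarrow> GSCT K A B)"

section \<open>The constructions yield rings, fields and algebra operations\<close>

lemma UN2_const:
  assumes "\<And>a b c d. (a,b) \<in> U \<Longrightarrow> (c,d) \<in> V \<Longrightarrow> f a b c d = Z" "(a,b) \<in> U" "(c,d) \<in> V"
  shows "(\<Union>(a,b)\<in>U. \<Union>(c,d)\<in>V. f a b c d) = Z"
proof (intro equalityI subsetI)
  fix x assume "x \<in> Z" then have "x \<in> f a b c d" using assms by blast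
  with assms(2,3) show "x \<in> (\<Union>(a,b)\<in>U. \<Union>(c,d)\<in>V. f a b c d)" by blast
qed (use assms(1) in blast)

lemma free_tensor_cring:
  fixes A :: "('k,'a) module" and B :: "('k,'b) module"
  assumes "cring A" "cring B" shows "cring (free_tensor A B)"
proof -
  interpret A: cring A by fact
  interpret B: cring B by fact
  define S where "S = carrier A \<times> carrier B"
  define m where "m = (\<lambda>(a, b) (a', b'). (a \<otimes>\<^bsub>A\<^esub> a', b \<otimes>\<^bsub>B\<^esub> b'))"
  define f where "f = (\<lambda>x y. frag_extend (\<lambda>s. frag_extend (\<lambda>t. frag_of (m s t)) y) x)"
  have mS: "m s t \<in> S" if "s \<in> S" "t \<in> S" for s t using that by (auto simp: S_def m_def)
  have eq: "free_tensor A B = \<lparr>carrier = {x. Poly_Mapping.keys x \<subseteq> S}, monoid.mult = f,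
      one = frag_of (\<one>\<^bsub>A\<^esub>, \<one>\<^bsub>B\<^esub>), ring.zero = 0, add = (+)\<rparr>"
    by (simp add: free_tensor_def S_def f_def m_def case_prod_unfold)
  have f_of: "f (frag_of s) (frag_of t) = frag_of (m s t)" for s t by (simp add: f_def)
  have fl: "f (x - x') y = f x y - f x' y" for x x' y by (simp add: f_def frag_extend_diff)
  have fla: "f (x + x') y = f x y + f x' y" for x x' y by (simp add: f_def frag_extend_add)
  have fe: "frag_extend (\<lambda>s. g s - h s) x = frag_extend g x - frag_extend h x" for g h :: "'a \<times> 'b \<Rightarrow> ('a\<times>'b) \<Rightarrow>\<^sub>0 int" and x :: "('a\<times>'b) \<Rightarrow>\<^sub>0 int"
    by (rule frag_induction[of x UNIV "\<lambda>x. frag_extend (\<lambda>s. g s - h s) x = frag_extend g x - frag_extend h x"]) (simp_all add: frag_extend_diff)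
  have fr: "f x (y - y') = f x y - f x y'" for x y y' by (simp add: f_def frag_extend_diff fe)
  have f0: "f 0 y = 0" "f x 0 = 0" for x y by (simp add: f_def) (metis fr diff_self)
  have ind: "P x" if "Poly_Mapping.keys x \<subseteq> S" "P 0" "\<And>s. s \<in> S \<Longrightarrow> P (frag_of s)"
     "\<And>x y. P x \<Longrightarrow> P y \<Longrightarrow> P (x - y)" for P and x :: "('a\<times>'b) \<Rightarrow>\<^sub>0 int"
    using frag_induction[of x S P] that by blast
  have kd: "Poly_Mapping.keys (x - y) \<subseteq> S" if "Poly_Mapping.keys x \<subseteq> S" "Poly_Mapping.keys y \<subseteq> S"
    for x y :: "('a\<times>'b) \<Rightarrow>\<^sub>0 int" using that keys_diff[of x y] by auto
  have ka: "Poly_Mapping.keys (x + y) \<subseteq> S" if "Poly_Mapping.keys x \<subseteq> S" "Poly_Mapping.keys y \<subseteq> S"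
    for x y :: "('a\<times>'b) \<Rightarrow>\<^sub>0 int" using that Poly_Mapping.keys_add[of x y] by blast
  have closed: "Poly_Mapping.keys (f x y) \<subseteq> S" if "Poly_Mapping.keys x \<subseteq> S" "Poly_Mapping.keys y \<subseteq> S" for x y
    using that(1)
  proof (rule ind)
    fix s assume s: "s \<in> S"
    show "Poly_Mapping.keys (f (frag_of s) y) \<subseteq> S"
      using that(2) by (rule ind) (simp_all add: f0 f_of fr kd mS s)
  qed (simp_all add: f0 fl kd)
  have comm: "f x y = f y x" if "Poly_Mapping.keys x \<subseteq> S" "Poly_Mapping.keys y \<subseteq> S" for x y
    using that(1)
  proof (rule ind)
    fix s assume s: "s \<in> S"
    show "f (frag_of s) y = f y (frag_of s)"
      using that(2) by (rule ind) (use s in \<open>auto simp: f0 f_of fr fl m_def S_def A.m_comm B.m_comm\<close>)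
  qed (auto simp: f0 fl fr)
  have assoc: "f (f x y) z = f x (f y z)" if "Poly_Mapping.keys x \<subseteq> S" "Poly_Mapping.keys y \<subseteq> S" "Poly_Mapping.keys z \<subseteq> S" for x y z
    using that(1)
  proof (rule ind)
    fix s assume s: "s \<in> S"
    show "f (f (frag_of s) y) z = f (frag_of s) (f y z)" using that(2)
    proof (rule ind)
      fix t assume t: "t \<in> S"
      show "f (f (frag_of s) (frag_of t)) z = f (frag_of s) (f (frag_of t) z)"
        using that(3) by (rule ind) (use s t in \<open>auto simp: f0 f_of fr fl m_def S_def A.m_assoc B.m_assoc\<close>)
    qed (auto simp: f0 fl fr)
  qed (auto simp: f0 fl fr)
  have one: "f (frag_of (\<one>\<^bsub>A\<^esub>, \<one>\<^bsub>B\<^esub>)) x = x" if "Poly_Mapping.keys x \<subseteq> S" for x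
    using that by (rule ind) (auto simp: f0 f_of fr m_def S_def)
  show ?thesis
  proof (rule cringI)
    show "abelian_group (free_tensor A B)"
    proof (rule abelian_groupI)
      show "\<exists>y\<in>carrier (free_tensor A B). y \<oplus>\<^bsub>free_tensor A B\<^esub> x = \<zero>\<^bsub>free_tensor A B\<^esub>"
        if "x \<in> carrier (free_tensor A B)" for x
        by (rule bexI[of _ "- x"]) (use that in \<open>auto simp: eq\<close>)
    qed (simp_all add: eq add_ac ka)
    show "comm_monoid (free_tensor A B)"
      by (rule comm_monoidI) (simp_all add: eq closed assoc one S_def[symmetric], simp_all add: comm, simp_all add: S_def)
  qed (auto simp: eq fla)
qed

lemma tensor_relations_subset:
  fixes A :: "('k,'a) module" and B :: "('k,'b) module"
  assumes "algebra K A" "algebra K B" shows "tensor_relations K A B \<subseteq> carrier (free_tensor A B)"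
proof -
  interpret A: algebra K A by fact
  interpret B: algebra K B by fact
  have *: "Poly_Mapping.keys (x - y) \<subseteq> S" if "Poly_Mapping.keys x \<subseteq> S" "Poly_Mapping.keys y \<subseteq> S"
    for x y :: "('a\<times>'b) \<Rightarrow>\<^sub>0 int" and S
    using that keys_diff[of x y] by auto
  have f: "frag_of (a,b) \<in> carrier (free_tensor A B)" if "a \<in> carrier A" "b \<in> carrier B" for a b
    using that by (simp add: free_tensor_def)
  have d: "x - y \<in> carrier (free_tensor A B)" if "x \<in> carrier (free_tensor A B)" "y \<in> carrier (free_tensor A B)" for x y
    using that * by (simp add: free_tensor_def)
  show ?thesis by (auto simp: tensor_relations_def intro!: f d)
qed

lemma tensor_ideal_ideal:
  assumes "algebra K A" "algebra K B" shows "ideal (tensor_ideal K A B) (free_tensor A B)"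
  unfolding tensor_ideal_def 
  by (intro ring.genideal_ideal cring.axioms(1) free_tensor_cring tensor_relations_subset assms algebra.axioms(2)[OF assms(1)] algebra.axioms(2)[OF assms(2)])

lemma tensor_cring:
  assumes "algebra K A" "algebra K B" shows "cring (tensor K A B)"
  unfolding tensor_def 
  by (intro ideal.quotient_is_cring tensor_ideal_ideal free_tensor_cring assms algebra.axioms(2)[OF assms(1)] algebra.axioms(2)[OF assms(2)])

lemma pure_left_hom:
  assumes "algebra K A" "algebra K B" shows "(\<lambda>a. pure_tensor K A B a \<one>\<^bsub>B\<^esub>) \<in> ring_hom A (tensor K A B)"
proof -
  interpret A: algebra K A by fact
  interpret B: algebra K B by fact
  interpret I: ideal "tensor_ideal K A B" "free_tensor A B" by (rule tensor_ideal_ideal; fact)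
  let ?F = "free_tensor A B"
  note h = I.rcos_ring_hom
  have c: "frag_of (a,b) \<in> carrier ?F" if "a \<in> carrier A" "b \<in> carrier B" for a b
    using that by (auto simp: free_tensor_def)
  { fix x y assume xy: "x \<in> carrier A" "y \<in> carrier A"
    have r1: "pure_tensor K A B x \<one>\<^bsub>B\<^esub> \<in> carrier (tensor K A B)"
      using ring_hom_closed[OF h c] xy by (simp add: pure_tensor_def tensor_def)
    have "frag_of (x \<otimes>\<^bsub>A\<^esub> y, \<one>\<^bsub>B\<^esub>) = frag_of (x, \<one>\<^bsub>B\<^esub>) \<otimes>\<^bsub>?F\<^esub> frag_of (y, \<one>\<^bsub>B\<^esub>)"
      by (simp add: free_tensor_def)
    then have r2: "pure_tensor K A B (x \<otimes>\<^bsub>A\<^esub> y) \<one>\<^bsub>B\<^esub> = pure_tensor K A B x \<one>\<^bsub>B\<^esub> \<otimes>\<^bsub>tensor K A B\<^esub> pure_tensor K A B y \<one>\<^bsub>B\<^esub>"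
      using ring_hom_mult[OF h c c] xy by (simp add: pure_tensor_def tensor_def)
    have "frag_of (x \<oplus>\<^bsub>A\<^esub> y, \<one>\<^bsub>B\<^esub>) - frag_of (x, \<one>\<^bsub>B\<^esub>) - frag_of (y, \<one>\<^bsub>B\<^esub>) \<in> tensor_ideal K A B" (is "?d \<in> _")
      unfolding tensor_ideal_def
      by (rule subsetD[OF ring.genideal_self[OF I.ring_axioms tensor_relations_subset[OF assms]]])
         (use xy in \<open>auto simp: tensor_relations_def\<close>)
    then have "tensor_ideal K A B +>\<^bsub>?F\<^esub> ?d = tensor_ideal K A B" using I.a_rcos_const by blast
    moreover have "frag_of (x \<oplus>\<^bsub>A\<^esub> y, \<one>\<^bsub>B\<^esub>) = ?d \<oplus>\<^bsub>?F\<^esub> (frag_of (x, \<one>\<^bsub>B\<^esub>) \<oplus>\<^bsub>?F\<^esub> frag_of (y, \<one>\<^bsub>B\<^esub>))"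
      by (simp add: free_tensor_def)
    moreover have d: "?d \<in> carrier ?F" using \<open>?d \<in> _\<close> I.Icarr by blast
    ultimately have "tensor_ideal K A B +>\<^bsub>?F\<^esub> frag_of (x \<oplus>\<^bsub>A\<^esub> y, \<one>\<^bsub>B\<^esub>)
       = tensor_ideal K A B +>\<^bsub>?F\<^esub> (frag_of (x, \<one>\<^bsub>B\<^esub>) \<oplus>\<^bsub>?F\<^esub> frag_of (y, \<one>\<^bsub>B\<^esub>))"
      using I.a_coset_add_assoc[of "tensor_ideal K A B" ?d "frag_of (x, \<one>\<^bsub>B\<^esub>) \<oplus>\<^bsub>?F\<^esub> frag_of (y, \<one>\<^bsub>B\<^esub>)"] c xy I.a_subset by simp
    then have r3: "pure_tensor K A B (x \<oplus>\<^bsub>A\<^esub> y) \<one>\<^bsub>B\<^esub> = pure_tensor K A B x \<one>\<^bsub>B\<^esub> \<oplus>\<^bsub>tensor K A B\<^esub> pure_tensor K A B y \<one>\<^bsub>B\<^esub>"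
      using ring_hom_add[OF h c c] xy by (simp add: pure_tensor_def tensor_def)
    note r1 r2 r3
  } note r = this
  have r4: "pure_tensor K A B \<one>\<^bsub>A\<^esub> \<one>\<^bsub>B\<^esub> = \<one>\<^bsub>tensor K A B\<^esub>"
      by (simp add: pure_tensor_def tensor_def FactRing_def free_tensor_def)
  show ?thesis by (rule ring_hom_memI) (use r r4 in auto)
qed

context fixes R :: "('k,'a) module" assumes dom: "domain R" begin
interpretation domain R by (rule dom)

lemma frac_equiv: "equiv (carrier R \<times> (carrier R - {\<zero>\<^bsub>R\<^esub>})) (frac_rel R)"
proof (rule equivI)
  show "trans (frac_rel R)"
  proof (rule transI, clarify)
    fix a b c d e g assume h: "((a,b),(c,d)) \<in> frac_rel R" "((c,d),(e,g)) \<in> frac_rel R"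
    then have C: "a\<in>carrier R" "b\<in>carrier R" "c\<in>carrier R" "d\<in>carrier R" "e\<in>carrier R" "g\<in>carrier R" "d \<noteq> \<zero>\<^bsub>R\<^esub>"
      and 1: "a \<otimes>\<^bsub>R\<^esub> d = c \<otimes>\<^bsub>R\<^esub> b" and 2: "c \<otimes>\<^bsub>R\<^esub> g = e \<otimes>\<^bsub>R\<^esub> d" by (auto simp: frac_rel_def)
    have "d \<otimes>\<^bsub>R\<^esub> (a \<otimes>\<^bsub>R\<^esub> g) = (a \<otimes>\<^bsub>R\<^esub> d) \<otimes>\<^bsub>R\<^esub> g" using C by (simp add: m_ac)
    also have "\<dots> = (c \<otimes>\<^bsub>R\<^esub> g) \<otimes>\<^bsub>R\<^esub> b" using C by (simp add: 1 m_ac)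
    also have "\<dots> = d \<otimes>\<^bsub>R\<^esub> (e \<otimes>\<^bsub>R\<^esub> b)" using C by (simp add: 2 m_ac)
    finally have "a \<otimes>\<^bsub>R\<^esub> g = e \<otimes>\<^bsub>R\<^esub> b" using C m_lcancel by auto
    then show "((a,b),(e,g)) \<in> frac_rel R" using h by (auto simp: frac_rel_def)
  qed
qed (auto simp: frac_rel_def refl_on_def sym_def)

lemma frac_eq_iff: "a\<in>carrier R \<Longrightarrow> b\<in>carrier R - {\<zero>\<^bsub>R\<^esub>} \<Longrightarrow> c\<in>carrier R \<Longrightarrow> d\<in>carrier R - {\<zero>\<^bsub>R\<^esub>} \<Longrightarrow>
   fraction R a b = fraction R c d \<longleftrightarrow> a \<otimes>\<^bsub>R\<^esub> d = c \<otimes>\<^bsub>R\<^esub> b"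
  unfolding fraction_def by (subst eq_equiv_class_iff[OF frac_equiv]) (auto simp: frac_rel_def)

lemma frac_mem: "(a,b) \<in> fraction R c d \<longleftrightarrow> c\<in>carrier R \<and> d\<in>carrier R - {\<zero>\<^bsub>R\<^esub>} \<and> a\<in>carrier R \<and> b\<in>carrier R - {\<zero>\<^bsub>R\<^esub>} \<and> fraction R a b = fraction R c d"
proof -
  have "(a,b) \<in> fraction R c d \<longleftrightarrow> c\<in>carrier R \<and> d\<in>carrier R - {\<zero>\<^bsub>R\<^esub>} \<and> a\<in>carrier R \<and> b\<in>carrier R - {\<zero>\<^bsub>R\<^esub>} \<and> a \<otimes>\<^bsub>R\<^esub> d = c \<otimes>\<^bsub>R\<^esub> b"
    by (auto simp: fraction_def frac_rel_def)
  then show ?thesis using frac_eq_iff[of a b c d] by blast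
qed

lemma Frac_carrier: "carrier (Frac R) = {fraction R a b | a b. a\<in>carrier R \<and> b\<in>carrier R - {\<zero>\<^bsub>R\<^esub>}}"
  by (auto simp: Frac_def quotient_def fraction_def)

lemma Frac_mult: assumes "a\<in>carrier R" "b\<in>carrier R - {\<zero>\<^bsub>R\<^esub>}" "c\<in>carrier R" "d\<in>carrier R - {\<zero>\<^bsub>R\<^esub>}"
  shows "fraction R a b \<otimes>\<^bsub>Frac R\<^esub> fraction R c d = fraction R (a \<otimes>\<^bsub>R\<^esub> c) (b \<otimes>\<^bsub>R\<^esub> d)"
proof -
  have "fraction R (a' \<otimes>\<^bsub>R\<^esub> c') (b' \<otimes>\<^bsub>R\<^esub> d') = fraction R (a \<otimes>\<^bsub>R\<^esub> c) (b \<otimes>\<^bsub>R\<^esub> d)"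
    if "(a',b') \<in> fraction R a b" "(c',d') \<in> fraction R c d" for a' b' c' d'
  proof -
    have C: "a'\<in>carrier R" "b'\<in>carrier R - {\<zero>\<^bsub>R\<^esub>}" "c'\<in>carrier R" "d'\<in>carrier R - {\<zero>\<^bsub>R\<^esub>}"
      and E: "a' \<otimes>\<^bsub>R\<^esub> b = a \<otimes>\<^bsub>R\<^esub> b'" "c' \<otimes>\<^bsub>R\<^esub> d = c \<otimes>\<^bsub>R\<^esub> d'"
      using that assms by (auto simp: frac_mem frac_eq_iff)
    have "(a' \<otimes>\<^bsub>R\<^esub> c') \<otimes>\<^bsub>R\<^esub> (b \<otimes>\<^bsub>R\<^esub> d) = (a' \<otimes>\<^bsub>R\<^esub> b) \<otimes>\<^bsub>R\<^esub> (c' \<otimes>\<^bsub>R\<^esub> d)" using C assms by (simp add: m_ac)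
    also have "\<dots> = (a \<otimes>\<^bsub>R\<^esub> c) \<otimes>\<^bsub>R\<^esub> (b' \<otimes>\<^bsub>R\<^esub> d')" unfolding E using C assms by (simp add: m_ac)
    finally show ?thesis using C assms by (subst frac_eq_iff) (auto simp: integral_iff)
  qed
  moreover have "(a,b) \<in> fraction R a b" "(c,d) \<in> fraction R c d" using assms by (auto simp: frac_mem)
  ultimately show ?thesis unfolding Frac_def monoid.simps ring.simps by (rule UN2_const)
qed

lemma Frac_add: assumes "a\<in>carrier R" "b\<in>carrier R - {\<zero>\<^bsub>R\<^esub>}" "c\<in>carrier R" "d\<in>carrier R - {\<zero>\<^bsub>R\<^esub>}"
  shows "fraction R a b \<oplus>\<^bsub>Frac R\<^esub> fraction R c d = fraction R (a \<otimes>\<^bsub>R\<^esub> d \<oplus>\<^bsub>R\<^esub> c \<otimes>\<^bsub>R\<^esub> b) (b \<otimes>\<^bsub>R\<^esub> d)"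
proof -
  have "fraction R (a' \<otimes>\<^bsub>R\<^esub> d' \<oplus>\<^bsub>R\<^esub> c' \<otimes>\<^bsub>R\<^esub> b') (b' \<otimes>\<^bsub>R\<^esub> d') = fraction R (a \<otimes>\<^bsub>R\<^esub> d \<oplus>\<^bsub>R\<^esub> c \<otimes>\<^bsub>R\<^esub> b) (b \<otimes>\<^bsub>R\<^esub> d)"
    if "(a',b') \<in> fraction R a b" "(c',d') \<in> fraction R c d" for a' b' c' d'
  proof -
    have C: "a'\<in>carrier R" "b'\<in>carrier R - {\<zero>\<^bsub>R\<^esub>}" "c'\<in>carrier R" "d'\<in>carrier R - {\<zero>\<^bsub>R\<^esub>}"
      and E: "a' \<otimes>\<^bsub>R\<^esub> b = a \<otimes>\<^bsub>R\<^esub> b'" "c' \<otimes>\<^bsub>R\<^esub> d = c \<otimes>\<^bsub>R\<^esub> d'"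
      using that assms by (auto simp: frac_mem frac_eq_iff)
    have "(a' \<otimes>\<^bsub>R\<^esub> d' \<oplus>\<^bsub>R\<^esub> c' \<otimes>\<^bsub>R\<^esub> b') \<otimes>\<^bsub>R\<^esub> (b \<otimes>\<^bsub>R\<^esub> d) = (a' \<otimes>\<^bsub>R\<^esub> b) \<otimes>\<^bsub>R\<^esub> (d' \<otimes>\<^bsub>R\<^esub> d) \<oplus>\<^bsub>R\<^esub> (c' \<otimes>\<^bsub>R\<^esub> d) \<otimes>\<^bsub>R\<^esub> (b' \<otimes>\<^bsub>R\<^esub> b)" using C assms by (simp add: m_ac l_distr r_distr)
    also have "\<dots> = (a \<otimes>\<^bsub>R\<^esub> d \<oplus>\<^bsub>R\<^esub> c \<otimes>\<^bsub>R\<^esub> b) \<otimes>\<^bsub>R\<^esub> (b' \<otimes>\<^bsub>R\<^esub> d')" unfolding E using C assms by (simp add: m_ac l_distr r_distr)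
    finally show ?thesis using C assms by (subst frac_eq_iff) (auto simp: integral_iff)
  qed
  moreover have "(a,b) \<in> fraction R a b" "(c,d) \<in> fraction R c d" using assms by (auto simp: frac_mem)
  ultimately have "(\<Union>(a', b')\<in>fraction R a b. \<Union>(c', d')\<in>fraction R c d.
      fraction R (a' \<otimes>\<^bsub>R\<^esub> d' \<oplus>\<^bsub>R\<^esub> c' \<otimes>\<^bsub>R\<^esub> b') (b' \<otimes>\<^bsub>R\<^esub> d'))
    = fraction R (a \<otimes>\<^bsub>R\<^esub> d \<oplus>\<^bsub>R\<^esub> c \<otimes>\<^bsub>R\<^esub> b) (b \<otimes>\<^bsub>R\<^esub> d)" by (rule UN2_const)
  then show ?thesis by (simp only: Frac_def ring_record_simps)
qed


lemma Frac_one: "\<one>\<^bsub>Frac R\<^esub> = fraction R \<one>\<^bsub>R\<^esub> \<one>\<^bsub>R\<^esub>" by (simp add: Frac_def)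
lemma Frac_zero: "\<zero>\<^bsub>Frac R\<^esub> = fraction R \<zero>\<^bsub>R\<^esub> \<one>\<^bsub>R\<^esub>" by (simp add: Frac_def)

lemma Frac_E: assumes "x \<in> carrier (Frac R)" obtains a b where "x = fraction R a b" "a\<in>carrier R" "b\<in>carrier R" "b \<noteq> \<zero>\<^bsub>R\<^esub>"
  using assms by (auto simp: Frac_carrier)
lemma Frac_I: "a\<in>carrier R \<Longrightarrow> b\<in>carrier R - {\<zero>\<^bsub>R\<^esub>} \<Longrightarrow> fraction R a b \<in> carrier (Frac R)"
  by (auto simp: Frac_carrier)

lemmas frac_simps = Frac_mult Frac_add Frac_one Frac_zero frac_eq_iff integral_iff Frac_I m_ac l_distr r_distr a_ac l_minus r_minus

lemma Frac_cring: "cring (Frac R)"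
proof (rule cringI)
  show "abelian_group (Frac R)"
  proof (rule abelian_groupI)
    fix x assume "x \<in> carrier (Frac R)"
    then show "\<exists>y\<in>carrier (Frac R). y \<oplus>\<^bsub>Frac R\<^esub> x = \<zero>\<^bsub>Frac R\<^esub>"
    proof (rule Frac_E)
      fix a b assume h: "x = fraction R a b" "a\<in>carrier R" "b\<in>carrier R" "b \<noteq> \<zero>\<^bsub>R\<^esub>"
      show ?thesis by (rule bexI[of _ "fraction R (\<ominus>\<^bsub>R\<^esub> a) b"]) (use h in \<open>simp_all add: frac_simps l_neg r_neg\<close>)
    qed
  qed (erule Frac_E | simp add: frac_simps)+
  show "comm_monoid (Frac R)"
    by (rule comm_monoidI) (erule Frac_E | simp add: frac_simps)+
  fix x y z assume "x \<in> carrier (Frac R)" "y \<in> carrier (Frac R)" "z \<in> carrier (Frac R)"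
  then show "(x \<oplus>\<^bsub>Frac R\<^esub> y) \<otimes>\<^bsub>Frac R\<^esub> z = x \<otimes>\<^bsub>Frac R\<^esub> z \<oplus>\<^bsub>Frac R\<^esub> y \<otimes>\<^bsub>Frac R\<^esub> z"
  proof (elim Frac_E)
    fix a b c d e g
    assume h: "x = fraction R a b" "y = fraction R c d" "z = fraction R e g"
      "a\<in>carrier R" "b\<in>carrier R" "b \<noteq> \<zero>\<^bsub>R\<^esub>" "c\<in>carrier R" "d\<in>carrier R" "d \<noteq> \<zero>\<^bsub>R\<^esub>"
      "e\<in>carrier R" "g\<in>carrier R" "g \<noteq> \<zero>\<^bsub>R\<^esub>"
    define P where "P = a \<otimes>\<^bsub>R\<^esub> d \<oplus>\<^bsub>R\<^esub> c \<otimes>\<^bsub>R\<^esub> b"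
    define Q where "Q = b \<otimes>\<^bsub>R\<^esub> d"
    have PQ: "P \<in> carrier R" "Q \<in> carrier R" "Q \<noteq> \<zero>\<^bsub>R\<^esub>" using h by (auto simp: P_def Q_def integral_iff)
    have 1: "(a \<otimes>\<^bsub>R\<^esub> e) \<otimes>\<^bsub>R\<^esub> (d \<otimes>\<^bsub>R\<^esub> g) \<oplus>\<^bsub>R\<^esub> (c \<otimes>\<^bsub>R\<^esub> e) \<otimes>\<^bsub>R\<^esub> (b \<otimes>\<^bsub>R\<^esub> g) = P \<otimes>\<^bsub>R\<^esub> (e \<otimes>\<^bsub>R\<^esub> g)"
      unfolding P_def using h by (simp add: l_distr r_distr m_ac)
    have 2: "(b \<otimes>\<^bsub>R\<^esub> g) \<otimes>\<^bsub>R\<^esub> (d \<otimes>\<^bsub>R\<^esub> g) = Q \<otimes>\<^bsub>R\<^esub> (g \<otimes>\<^bsub>R\<^esub> g)"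
      unfolding Q_def using h by (simp add: m_ac)
    have "(x \<oplus>\<^bsub>Frac R\<^esub> y) \<otimes>\<^bsub>Frac R\<^esub> z = fraction R (P \<otimes>\<^bsub>R\<^esub> e) (Q \<otimes>\<^bsub>R\<^esub> g)"
      using h PQ by (simp add: Frac_add Frac_mult P_def[symmetric] Q_def[symmetric])
    also have "\<dots> = fraction R (P \<otimes>\<^bsub>R\<^esub> (e \<otimes>\<^bsub>R\<^esub> g)) (Q \<otimes>\<^bsub>R\<^esub> (g \<otimes>\<^bsub>R\<^esub> g))"
      using h PQ by (subst frac_eq_iff) (auto simp: integral_iff m_ac)
    also have "\<dots> = x \<otimes>\<^bsub>Frac R\<^esub> z \<oplus>\<^bsub>Frac R\<^esub> y \<otimes>\<^bsub>Frac R\<^esub> z"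
      using h by (simp add: Frac_add Frac_mult integral_iff 1 2)
    finally show ?thesis .
  qed
qed

lemma Frac_field: "field (Frac R)"
proof (rule cring.cring_fieldI2[OF Frac_cring])
  show "\<zero>\<^bsub>Frac R\<^esub> \<noteq> \<one>\<^bsub>Frac R\<^esub>" by (simp add: frac_simps)
  fix x assume "x \<in> carrier (Frac R)" "x \<noteq> \<zero>\<^bsub>Frac R\<^esub>"
  then show "\<exists>y\<in>carrier (Frac R). x \<otimes>\<^bsub>Frac R\<^esub> y = \<one>\<^bsub>Frac R\<^esub>"
  proof (elim Frac_E)
    fix a b assume h: "x = fraction R a b" "a\<in>carrier R" "b\<in>carrier R" "b \<noteq> \<zero>\<^bsub>R\<^esub>" "x \<noteq> \<zero>\<^bsub>Frac R\<^esub>"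
    then have "a \<noteq> \<zero>\<^bsub>R\<^esub>" by (auto simp: frac_simps)
    with h show ?thesis by (intro bexI[of _ "fraction R b a"]) (simp_all add: frac_simps)
  qed
qed

lemma Frac_smult: assumes "algebra K R" "c \<in> carrier K" "a\<in>carrier R" "b\<in>carrier R - {\<zero>\<^bsub>R\<^esub>}"
  shows "c \<odot>\<^bsub>Frac R\<^esub> fraction R a b = fraction R (c \<odot>\<^bsub>R\<^esub> a) b"
proof -
  interpret al: algebra K R by fact
  have "fraction R (c \<odot>\<^bsub>R\<^esub> a') b' = fraction R (c \<odot>\<^bsub>R\<^esub> a) b" if "(a',b') \<in> fraction R a b" for a' b'
    using that assms by (auto simp: frac_mem frac_eq_iff al.smult_assoc2)
  moreover have "(a,b) \<in> fraction R a b" using assms by (auto simp: frac_mem)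
  ultimately show ?thesis unfolding Frac_def module.simps by (intro equalityI subsetI; blast)
qed

end

lemma quot_alg_simps:
  "carrier (quot_alg A I) = carrier (A Quot I)" "monoid.mult (quot_alg A I) = monoid.mult (A Quot I)"
  "one (quot_alg A I) = one (A Quot I)" "ring.zero (quot_alg A I) = ring.zero (A Quot I)"
  "add (quot_alg A I) = add (A Quot I)"
  by (simp_all add: quot_alg_def ring.defs module.defs FactRing_def)

lemma quot_alg_smult:
  assumes "algebra K A" "ideal I A" "c \<in> carrier K" "x \<in> carrier A"
  shows "c \<odot>\<^bsub>quot_alg A I\<^esub> (I +>\<^bsub>A\<^esub> x) = I +>\<^bsub>A\<^esub> (c \<odot>\<^bsub>A\<^esub> x)"
proof -
  interpret al: algebra K A by fact
  interpret I: ideal I A by fact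
  have "I +>\<^bsub>A\<^esub> (c \<odot>\<^bsub>A\<^esub> y) = I +>\<^bsub>A\<^esub> (c \<odot>\<^bsub>A\<^esub> x)" if "y \<in> I +>\<^bsub>A\<^esub> x" for y
  proof -
    from that obtain i where i: "i \<in> I" "y = i \<oplus>\<^bsub>A\<^esub> x" by (auto simp: a_r_coset_def')
    have "(c \<odot>\<^bsub>A\<^esub> \<one>\<^bsub>A\<^esub>) \<otimes>\<^bsub>A\<^esub> i \<in> I" using i assms by (intro I.I_l_closed) auto
    then have ci: "c \<odot>\<^bsub>A\<^esub> i \<in> I" using i assms I.Icarr by (simp add: al.smult_assoc2)
    have "c \<odot>\<^bsub>A\<^esub> y = c \<odot>\<^bsub>A\<^esub> i \<oplus>\<^bsub>A\<^esub> c \<odot>\<^bsub>A\<^esub> x" using i assms I.Icarr by (simp add: al.smult_r_distr)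
    then have "c \<odot>\<^bsub>A\<^esub> y \<in> I +>\<^bsub>A\<^esub> (c \<odot>\<^bsub>A\<^esub> x)" using ci by (auto simp: a_r_coset_def')
    then show ?thesis using assms by (intro I.a_repr_independence'[symmetric]) (use assms in auto)
  qed
  moreover have "x \<in> I +>\<^bsub>A\<^esub> x" using assms I.a_rcos_self by simp
  ultimately have "(\<Union>y\<in>I +>\<^bsub>A\<^esub> x. I +>\<^bsub>A\<^esub> (c \<odot>\<^bsub>A\<^esub> y)) = I +>\<^bsub>A\<^esub> (c \<odot>\<^bsub>A\<^esub> x)" by (intro equalityI subsetI; blast)
  then show ?thesis by (simp add: quot_alg_def ring.defs module.defs FactRing_def)
qed

end

(* Let P be a prime of A (x) B over p and q, and Q a prime containing J = (p,q). The heart of the matter is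
   to turn a chain of length m ending at P into a chain of length m - e ending at Q, where e is the
   length of a suitable chain from a prime over J up to P. By Noether normalization of the finitely many
   elements of A that distinguish the members of the chain, it contracts to a chain in a polynomial ring
   C = B[z_1,...,z_n] with z_i in A and n <= t.d.(A). There the special chain theorem gives a chain ending
   at q[z_1,...,z_n] that is shorter by at most n minus the transcendence degree of the z_i over B
   modulo P. Once the nonzero elements of k[z_1,...,z_n] are inverted, A (x) B is free over C, so going
   down holds and the chain lifts to primes of A (x) B over the zero ideal of A. A chain of length ht(p)
   ending at p lifts as well, and ht(p) + t.d.(A/p) = t.d.(A) >= n makes the lengths add up. *)
theory Submission
  imports Defs
begin

section \<open>Adjoining elements to subrings\<close>

text \<open>The constant e is t.d.(A/p) - r, where r is the transcendence degree over B, modulo P,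
  of elements \<open>ys\<close> of A that lift a transcendence basis of A/p. It is fixed before any
  chain is chosen, so infinite heights need no separate treatment. The obstacle is that A and B need
  not be noetherian or finitely generated, and the z_i change with the chain. They are tied to e
  because \<open>ys\<close> is normalized together with the distinguishing elements: the rank of the
  z_i over B modulo P is then at least r, and the loss n - rank is at most e + ht(p). A second
  obstacle is that p may meet k[z_1,...,z_n], which blocks lifting over p itself. This forces the
  detour over the zero ideal of A, and ht(p) is exactly what repays it. The lifting forms no
  localization or quotient of the tensor product: prime ideals of subrings are subsets of one ring,
  inverting elements of k[z_1,...,z_n] is replaced by an explicit factor, and bases are replaced by
  the maps id \<otimes> f for linear forms f on B.\<close>

primrec horner :: "('a, 'm) ring_scheme \<Rightarrow> 'a list \<Rightarrow> 'a \<Rightarrow> 'a" where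
  "horner R [] x = \<zero>\<^bsub>R\<^esub>"
| "horner R (c # cs) x = c \<oplus>\<^bsub>R\<^esub> x \<otimes>\<^bsub>R\<^esub> horner R cs x"

definition adjoin :: "('a, 'm) ring_scheme \<Rightarrow> 'a set \<Rightarrow> 'a \<Rightarrow> 'a set" where
  "adjoin R D z = {horner R cs z | cs. set cs \<subseteq> D}"

primrec adjoins :: "('a, 'm) ring_scheme \<Rightarrow> 'a set \<Rightarrow> 'a list \<Rightarrow> 'a set" where
  "adjoins R D [] = D"
| "adjoins R D (z # zs) = adjoins R (adjoin R D z) zs"

lemma adjoins_append: "adjoins R D (xs @ ys) = adjoins R (adjoins R D xs) ys"
  by (induction xs arbitrary: D) auto

text \<open>Only the operations enter the value of a polynomial. The chain theorems below are proved
  for a whole ring and applied to a subring by shrinking the carrier, so this and its companions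
  make the passage invisible.\<close>

lemma horner_carrier_update [simp]: "horner (R\<lparr>carrier := E\<rparr>) = horner R"
proof (intro ext)
  fix cs x show "horner (R\<lparr>carrier := E\<rparr>) cs x = horner R cs x" by (induction cs) auto
qed

lemma adjoin_carrier_update [simp]: "adjoin (R\<lparr>carrier := E\<rparr>) = adjoin R"
  by (intro ext) (simp add: adjoin_def)

lemma adjoins_carrier_update [simp]: "adjoins (R\<lparr>carrier := E\<rparr>) = adjoins R"
proof (intro ext)
  fix D zs show "adjoins (R\<lparr>carrier := E\<rparr>) D zs = adjoins R D zs" by (induction zs arbitrary: D) auto
qed

lemma adjoin_mono: "D \<subseteq> D' \<Longrightarrow> adjoin R D z \<subseteq> adjoin R D' z"
  by (auto simp: adjoin_def)

lemma adjoins_mono: "D \<subseteq> D' \<Longrightarrow> adjoins R D zs \<subseteq> adjoins R D' zs"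
  by (induction zs arbitrary: D D') (auto simp: adjoin_mono)

text \<open>The common generality of subrings and their ideals: \<open>adjoin R D z\<close> is the
  ring \<open>D[z]\<close> for a subring \<open>D\<close>, and \<open>adjoin R q z\<close> is the
  extended ideal \<open>q[z]\<close> for an ideal \<open>q\<close> of \<open>D\<close>.\<close>

definition add_closed :: "('a, 'm) ring_scheme \<Rightarrow> 'a set \<Rightarrow> bool" where
  "add_closed R U \<longleftrightarrow> U \<subseteq> carrier R \<and> \<zero>\<^bsub>R\<^esub> \<in> U \<and> (\<forall>x\<in>U. \<forall>y\<in>U. x \<oplus>\<^bsub>R\<^esub> y \<in> U)"

context cring begin

lemma horner_closed [simp, intro]: "set cs \<subseteq> carrier R \<Longrightarrow> x \<in> carrier R \<Longrightarrow> horner R cs x \<in> carrier R"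
  by (induction cs) auto

lemma adjoin_closed: "U \<subseteq> carrier R \<Longrightarrow> z \<in> carrier R \<Longrightarrow> adjoin R U z \<subseteq> carrier R"
  by (auto simp: adjoin_def)

lemma horner_zeros: "set cs \<subseteq> {\<zero>} \<Longrightarrow> x \<in> carrier R \<Longrightarrow> horner R cs x = \<zero>"
  by (induction cs) auto

lemma horner_mem:
  assumes "add_closed R U" "\<And>u. u \<in> U \<Longrightarrow> z \<otimes> u \<in> U" "set cs \<subseteq> U"
  shows "horner R cs z \<in> U"
  using assms(3) by (induction cs) (use assms in \<open>auto simp: add_closed_def\<close>)

lemma horner_add:
  assumes "add_closed R U" "z \<in> carrier R" "set cs \<subseteq> U" "set ds \<subseteq> U"
  shows "\<exists>es. set es \<subseteq> U \<and> horner R cs z \<oplus> horner R ds z = horner R es z"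
  using assms(3,4)
proof (induction cs arbitrary: ds)
  case Nil
  then show ?case using assms(1,2) by (intro exI[of _ ds]) (auto simp: add_closed_def)
next
  case (Cons c cs)
  note C = Cons
  have U: "U \<subseteq> carrier R" "\<And>x y. x \<in> U \<Longrightarrow> y \<in> U \<Longrightarrow> x \<oplus> y \<in> U" using assms(1) by (auto simp: add_closed_def)
  show ?case
  proof (cases ds)
    case Nil
    moreover have "horner R (c # cs) z \<in> carrier R" using Cons(2) U assms(2) by (intro horner_closed) auto
    ultimately show ?thesis using Cons(2)
      by (intro exI[of _ "c # cs"]) simp
  next
    case (Cons d ds')
    obtain es where es: "set es \<subseteq> U" "horner R cs z \<oplus> horner R ds' z = horner R es z"
      using C(1)[of ds'] C(2,3) Cons by auto
    have car: "set cs \<subseteq> carrier R" "set ds' \<subseteq> carrier R" "c \<in> carrier R" "d \<in> carrier R"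
      using C(2,3) Cons U by auto
    have h: "horner R cs z \<in> carrier R" "horner R ds' z \<in> carrier R" using car assms(2) by auto
    have "horner R (c # cs) z \<oplus> horner R ds z = (c \<oplus> d) \<oplus> z \<otimes> (horner R cs z \<oplus> horner R ds' z)"
      using car h assms(2) Cons by (simp add: r_distr a_ac)
    then show ?thesis using es C(2,3) Cons U by (intro exI[of _ "(c \<oplus> d) # es"]) auto
  qed
qed

lemma adjoin_add_closed:
  assumes "add_closed R U" "z \<in> carrier R" shows "add_closed R (adjoin R U z)"
  unfolding add_closed_def
proof (intro conjI ballI)
  show "adjoin R U z \<subseteq> carrier R" using assms adjoin_closed by (auto simp: add_closed_def)
  show "\<zero> \<in> adjoin R U z" unfolding adjoin_def by (rule CollectI, rule exI[of _ "[]"]) simp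
  fix x y assume "x \<in> adjoin R U z" "y \<in> adjoin R U z"
  then show "x \<oplus> y \<in> adjoin R U z" using horner_add[OF assms] by (fastforce simp: adjoin_def)
qed

lemma adjoin_self_mult:
  assumes "add_closed R U" "z \<in> carrier R" "x \<in> adjoin R U z" shows "z \<otimes> x \<in> adjoin R U z"
proof -
  obtain cs where cs: "set cs \<subseteq> U" "x = horner R cs z" using assms(3) by (auto simp: adjoin_def)
  then have "z \<otimes> x = horner R (\<zero> # cs) z" using assms by (auto simp: add_closed_def)
  moreover have "set (\<zero> # cs) \<subseteq> U" using cs assms(1) by (auto simp: add_closed_def)
  ultimately show ?thesis unfolding adjoin_def by blast
qed

lemma adjoin_base:
  assumes "add_closed R U" "z \<in> carrier R" shows "U \<subseteq> adjoin R U z"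
proof
  fix u assume "u \<in> U"
  then show "u \<in> adjoin R U z" unfolding adjoin_def
    by (intro CollectI exI[of _ "[u]"]) (use assms in \<open>auto simp: add_closed_def\<close>)
qed

lemma horner_smult:
  assumes "set cs \<subseteq> carrier R" "z \<in> carrier R" "d \<in> carrier R"
  shows "d \<otimes> horner R cs z = horner R (map ((\<otimes>) d) cs) z"
  using assms(1)
proof (induction cs)
  case (Cons c cs)
  then have "horner R cs z \<in> carrier R" using assms by auto
  moreover have "d \<otimes> (z \<otimes> horner R cs z) = z \<otimes> (d \<otimes> horner R cs z)" using calculation assms by (simp add: m_lcomm)
  ultimately show ?case using Cons assms by (simp add: r_distr)
qed (use assms in auto)

lemma adjoin_smult:
  assumes "U \<subseteq> carrier R" "V \<subseteq> carrier R" "z \<in> carrier R" "d \<in> carrier R" "\<And>u. u \<in> U \<Longrightarrow> d \<otimes> u \<in> V" "x \<in> adjoin R U z"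
  shows "d \<otimes> x \<in> adjoin R V z"
proof -
  obtain cs where cs: "set cs \<subseteq> U" "x = horner R cs z" using assms(6) by (auto simp: adjoin_def)
  then have "d \<otimes> x = horner R (map ((\<otimes>) d) cs) z" using horner_smult assms by auto
  moreover have "set (map ((\<otimes>) d) cs) \<subseteq> V" using cs assms(5) by auto
  ultimately show ?thesis unfolding adjoin_def by blast
qed

text \<open>Three coefficient sets serve two purposes: all equal to a subring \<open>D\<close> gives
  products inside \<open>D[z]\<close>, and \<open>V = W = q\<close> gives the action of
  \<open>D[z]\<close> on \<open>q[z]\<close>.\<close>

lemma adjoin_mult:
  assumes "add_closed R U" "add_closed R V" "add_closed R W" "z \<in> carrier R"
    "\<And>u v. u \<in> U \<Longrightarrow> v \<in> V \<Longrightarrow> u \<otimes> v \<in> W" "x \<in> adjoin R U z" "y \<in> adjoin R V z"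
  shows "x \<otimes> y \<in> adjoin R W z"
proof -
  obtain cs where cs: "set cs \<subseteq> U" "x = horner R cs z" using assms(6) by (auto simp: adjoin_def)
  have sub: "U \<subseteq> carrier R" "V \<subseteq> carrier R" "W \<subseteq> carrier R" using assms by (auto simp: add_closed_def)
  have y: "y \<in> carrier R" using assms(7) adjoin_closed[OF sub(2) assms(4)] by auto
  note Wa = adjoin_add_closed[OF assms(3,4)]
  have "horner R cs z \<otimes> y \<in> adjoin R W z" using cs(1)
  proof (induction cs)
    case Nil
    then show ?case using Wa y by (auto simp: add_closed_def)
  next
    case (Cons c cs)
    then have car: "c \<in> carrier R" "horner R cs z \<in> carrier R" using sub assms(4) by auto
    have "horner R (c # cs) z \<otimes> y = c \<otimes> y \<oplus> z \<otimes> (horner R cs z \<otimes> y)"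
      using car y assms(4) by (simp add: l_distr m_assoc)
    moreover have "c \<otimes> y \<in> adjoin R W z"
      by (rule adjoin_smult[OF sub(2,3) assms(4) car(1) _ assms(7)]) (use Cons.prems assms(5) in auto)
    moreover have "z \<otimes> (horner R cs z \<otimes> y) \<in> adjoin R W z"
      using Cons by (intro adjoin_self_mult assms) auto
    ultimately show ?case using Wa by (auto simp: add_closed_def)
  qed
  then show ?thesis using cs by simp
qed

lemma subring_add_closed: "subring D R \<Longrightarrow> add_closed R D"
  by (auto simp: add_closed_def dest: subringE)

lemma subringI2:
  assumes "add_closed R D" "\<one> \<in> D" "\<ominus> \<one> \<in> D" "\<And>x y. x \<in> D \<Longrightarrow> y \<in> D \<Longrightarrow> x \<otimes> y \<in> D"
  shows "subring D R"
proof (rule subringI)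
  fix h assume "h \<in> D"
  then have "(\<ominus> \<one>) \<otimes> h \<in> D" "h \<in> carrier R" using assms by (auto simp: add_closed_def)
  then show "\<ominus> h \<in> D" by (simp add: l_minus)
qed (use assms in \<open>auto simp: add_closed_def\<close>)

lemma adjoin_subring:
  assumes "subring D R" "z \<in> carrier R" shows "subring (adjoin R D z) R"
proof (rule subringI2)
  note A = subring_add_closed[OF assms(1)]
  show "add_closed R (adjoin R D z)" using adjoin_add_closed A assms by blast
  show "\<one> \<in> adjoin R D z" "\<ominus> \<one> \<in> adjoin R D z"
    using adjoin_base[OF A assms(2)] subringE(3,5)[OF assms(1)] by blast+
  show "x \<otimes> y \<in> adjoin R D z" if "x \<in> adjoin R D z" "y \<in> adjoin R D z" for x y
    using adjoin_mult[OF A A A assms(2) _ that] subringE(6)[OF assms(1)] by blast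
qed

lemma adjoins_subring:
  "subring D R \<Longrightarrow> set zs \<subseteq> carrier R \<Longrightarrow> subring (adjoins R D zs) R"
  by (induction zs arbitrary: D) (auto intro: adjoin_subring)

lemma adjoin_self:
  assumes "subring D R" "z \<in> carrier R" shows "z \<in> adjoin R D z"
  using adjoin_self_mult[OF subring_add_closed[OF assms(1)] assms(2), of \<one>]
    adjoin_base[OF subring_add_closed[OF assms(1)] assms(2)] subringE(3)[OF assms(1)] assms(2) by auto

lemma adjoins_base:
  "add_closed R D \<Longrightarrow> set zs \<subseteq> carrier R \<Longrightarrow> D \<subseteq> adjoins R D zs"
proof (induction zs arbitrary: D)
  case (Cons z zs)
  then show ?case using adjoin_base[of D z] Cons.IH[of "adjoin R D z"] adjoin_add_closed by auto
qed auto

lemma adjoins_self: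
  "subring D R \<Longrightarrow> set zs \<subseteq> carrier R \<Longrightarrow> set zs \<subseteq> adjoins R D zs"
proof (induction zs arbitrary: D)
  case (Cons z zs)
  have s: "subring (adjoin R D z) R" using Cons by (auto intro: adjoin_subring)
  have "z \<in> adjoins R (adjoin R D z) zs"
    using adjoin_self[of D z] adjoins_base[OF subring_add_closed[OF s], of zs] Cons.prems by auto
  then show ?case using Cons.IH[OF s] Cons.prems by auto
qed auto

lemma adjoin_least:
  assumes "subring E R" "D \<subseteq> E" "z \<in> E" shows "adjoin R D z \<subseteq> E"
proof
  fix x assume "x \<in> adjoin R D z"
  then obtain cs where "set cs \<subseteq> E" "x = horner R cs z" using assms by (auto simp: adjoin_def)
  then show "x \<in> E" using horner_mem[OF subring_add_closed[OF assms(1)], of z] subringE(6)[OF assms(1)] assms(3) by auto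
qed

lemma adjoins_least:
  "subring E R \<Longrightarrow> D \<subseteq> E \<Longrightarrow> set zs \<subseteq> E \<Longrightarrow> adjoins R D zs \<subseteq> E"
proof (induction zs arbitrary: D)
  case (Cons z zs)
  then show ?case using adjoin_least[of E D z] by auto
qed auto

section \<open>Polynomials in two variables and the interchange of the variables\<close>

lemma horner_map_closed [simp, intro]:
  assumes "\<forall>ds\<in>set dss. set ds \<subseteq> carrier R" "x \<in> carrier R" "y \<in> carrier R"
  shows "horner R (map (\<lambda>ds. horner R ds x) dss) y \<in> carrier R"
  using assms by (induction dss) auto

text \<open>Puts \<open>cs\<close> as a new first row on top of a coefficient matrix stored by
  columns. A short row is padded with \<open>z\<close>, and a missing column counts as empty; the
  coefficient lists need not have equal lengths.\<close>

primrec cons_columns :: "'a \<Rightarrow> 'a list \<Rightarrow> 'a list list \<Rightarrow> 'a list list" where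
  "cons_columns z [] dss = map ((#) z) dss"
| "cons_columns z (c # cs) dss = (case dss of [] \<Rightarrow> [c] # cons_columns z cs []
     | ds # dss' \<Rightarrow> (c # ds) # cons_columns z cs dss')"

lemma horner_cons_columns:
  assumes "set cs \<subseteq> carrier R" "\<forall>ds\<in>set dss. set ds \<subseteq> carrier R" "x \<in> carrier R" "y \<in> carrier R"
  shows "horner R (map (\<lambda>ds. horner R ds x) (cons_columns \<zero> cs dss)) y
    = horner R cs y \<oplus> x \<otimes> horner R (map (\<lambda>ds. horner R ds x) dss) y"
  using assms(1,2)
proof (induction cs arbitrary: dss)
  case Nil
  have "horner R (map (\<lambda>ds. horner R ds x) (map ((#) \<zero>) dss)) y = x \<otimes> horner R (map (\<lambda>ds. horner R ds x) dss) y"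
    using Nil(2)
  proof (induction dss)
    case (Cons ds dss)
    then have c: "horner R ds x \<in> carrier R" "horner R (map (\<lambda>ds. horner R ds x) dss) y \<in> carrier R"
      using assms(3,4) by auto
    have "x \<otimes> (y \<otimes> horner R (map (\<lambda>ds. horner R ds x) dss) y) = y \<otimes> (x \<otimes> horner R (map (\<lambda>ds. horner R ds x) dss) y)"
      using c assms by (simp add: m_lcomm)
    then show ?case using Cons c assms by (simp add: r_distr)
  qed (use assms in auto)
  moreover have "horner R (map (\<lambda>ds. horner R ds x) dss) y \<in> carrier R"
    using Nil(2) assms(3,4) by blast
  ultimately show ?case using assms by simp
next
  case (Cons c cs)
  show ?case
  proof (cases dss)
    case Nil
    have "horner R cs y \<in> carrier R" using Cons assms by auto
    then show ?thesis using Cons.IH[of "[]"] Cons.prems Nil assms by simp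
  next
    case (Cons ds dss')
    note IH = Cons.IH[of dss'] and pr = Cons.prems[unfolded Cons]
    let ?t = "horner R (map (\<lambda>ds. horner R ds x) dss') y"
    have c: "horner R ds x \<in> carrier R" "?t \<in> carrier R" "horner R cs y \<in> carrier R" "c \<in> carrier R"
      using pr assms(3,4) by auto
    have "y \<otimes> (x \<otimes> ?t) = x \<otimes> (y \<otimes> ?t)" using c assms by (simp add: m_lcomm)
    then show ?thesis using IH pr Cons c assms by (simp add: r_distr a_ac)
  qed
qed

lemma cons_columns_coeffs:
  assumes "z \<in> V"
  shows "(\<forall>ds\<in>set (cons_columns z cs dss). set ds \<subseteq> V) \<longleftrightarrow> set cs \<subseteq> V \<and> (\<forall>ds\<in>set dss. set ds \<subseteq> V)"
  using assms by (induction cs arbitrary: dss) (auto split: list.splits)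

text \<open>Interchanging the summations in a polynomial in two variables; the condition on \<open>V\<close>
  keeps track of the set of coefficients.\<close>

lemma horner_transpose:
  assumes "\<forall>cs\<in>set css. set cs \<subseteq> carrier R" "x \<in> carrier R" "y \<in> carrier R"
  shows "\<exists>dss. horner R (map (\<lambda>cs. horner R cs y) css) x = horner R (map (\<lambda>ds. horner R ds x) dss) y
    \<and> (\<forall>V. \<zero> \<in> V \<longrightarrow> (\<forall>ds\<in>set dss. set ds \<subseteq> V) \<longleftrightarrow> (\<forall>cs\<in>set css. set cs \<subseteq> V))"
  using assms(1)
proof (induction css)
  case Nil
  show ?case by (rule exI[of _ "[]"]) simp
next
  case (Cons cs css)
  then obtain dss where d: "horner R (map (\<lambda>cs. horner R cs y) css) x = horner R (map (\<lambda>ds. horner R ds x) dss) y"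
    "\<And>V. \<zero> \<in> V \<Longrightarrow> (\<forall>ds\<in>set dss. set ds \<subseteq> V) \<longleftrightarrow> (\<forall>cs\<in>set css. set cs \<subseteq> V)" by auto
  have "\<forall>ds\<in>set dss. set ds \<subseteq> carrier R" using d(2)[of "carrier R"] Cons.prems by auto
  then have "horner R (map (\<lambda>ds. horner R ds x) (cons_columns \<zero> cs dss)) y
    = horner R cs y \<oplus> x \<otimes> horner R (map (\<lambda>ds. horner R ds x) dss) y"
    using Cons.prems by (intro horner_cons_columns assms) auto
  then show ?case using d cons_columns_coeffs[of \<zero>] by (intro exI[of _ "cons_columns \<zero> cs dss"]) auto
qed

lemma adjoin_commute_le:
  assumes "add_closed R U" "x \<in> carrier R" "y \<in> carrier R"
  shows "adjoin R (adjoin R U x) y \<subseteq> adjoin R (adjoin R U y) x"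
proof
  fix t assume "t \<in> adjoin R (adjoin R U x) y"
  then obtain es where es: "set es \<subseteq> adjoin R U x" "t = horner R es y" by (auto simp: adjoin_def)
  have "\<exists>css. es = map (\<lambda>cs. horner R cs x) css \<and> (\<forall>cs\<in>set css. set cs \<subseteq> U)" using es(1)
  proof (induction es)
    case (Cons e es)
    then obtain css cs where "es = map (\<lambda>cs. horner R cs x) css \<and> (\<forall>cs\<in>set css. set cs \<subseteq> U)" "e = horner R cs x" "set cs \<subseteq> U"
      by (auto simp: adjoin_def)
    then show ?case by (intro exI[of _ "cs # css"]) auto
  qed simp
  then obtain css where css: "es = map (\<lambda>cs. horner R cs x) css" "\<forall>cs\<in>set css. set cs \<subseteq> U" by blast
  then obtain dss where "t = horner R (map (\<lambda>ds. horner R ds y) dss) x" "\<forall>ds\<in>set dss. set ds \<subseteq> U"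
    using horner_transpose[of css y x] assms es(2) by (fastforce simp: add_closed_def)
  then show "t \<in> adjoin R (adjoin R U y) x" unfolding adjoin_def[of R _ x] by (force simp: adjoin_def)
qed

lemma adjoin_commute:
  assumes "add_closed R U" "x \<in> carrier R" "y \<in> carrier R"
  shows "adjoin R (adjoin R U x) y = adjoin R (adjoin R U y) x"
  using adjoin_commute_le assms by blast

lemma adjoins_adjoin:
  assumes "add_closed R U" "x \<in> carrier R" "set zs \<subseteq> carrier R"
  shows "adjoins R (adjoin R U x) zs = adjoin R (adjoins R U zs) x"
  using assms(1,3)
proof (induction zs arbitrary: U)
  case (Cons z zs)
  then show ?case using adjoin_commute[of U x z] assms(2) adjoin_add_closed[of U z] by auto
qed simp

end

section \<open>Prime ideals of subrings\<close>

text \<open>A prime ideal of a subring is a subset of the ambient ring, so contraction is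
  intersection and no second ring is formed. Negatives are obtained by multiplying with
  \<ominus>\<one>, which lies in every subring \<open>E\<close>.\<close>

definition prime_in :: "('a, 'm) ring_scheme \<Rightarrow> 'a set \<Rightarrow> 'a set \<Rightarrow> bool" where
  "prime_in R E P \<longleftrightarrow> P \<subseteq> E \<and> \<zero>\<^bsub>R\<^esub> \<in> P \<and> \<one>\<^bsub>R\<^esub> \<notin> P \<and> (\<forall>x\<in>P. \<forall>y\<in>P. x \<oplus>\<^bsub>R\<^esub> y \<in> P)
    \<and> (\<forall>e\<in>E. \<forall>x\<in>P. e \<otimes>\<^bsub>R\<^esub> x \<in> P) \<and> (\<forall>x\<in>E. \<forall>y\<in>E. x \<otimes>\<^bsub>R\<^esub> y \<in> P \<longrightarrow> x \<in> P \<or> y \<in> P)"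

lemma prime_inD:
  assumes "prime_in R E P"
  shows "P \<subseteq> E" "\<zero>\<^bsub>R\<^esub> \<in> P" "\<one>\<^bsub>R\<^esub> \<notin> P" "\<And>x y. x \<in> P \<Longrightarrow> y \<in> P \<Longrightarrow> x \<oplus>\<^bsub>R\<^esub> y \<in> P"
    "\<And>e x. e \<in> E \<Longrightarrow> x \<in> P \<Longrightarrow> e \<otimes>\<^bsub>R\<^esub> x \<in> P"
    "\<And>x y. x \<in> E \<Longrightarrow> y \<in> E \<Longrightarrow> x \<otimes>\<^bsub>R\<^esub> y \<in> P \<Longrightarrow> x \<in> P \<or> y \<in> P"
  using assms by (auto simp: prime_in_def)

lemma prime_in_carrier_update [simp]: "prime_in (R\<lparr>carrier := F\<rparr>) = prime_in R"
  by (intro ext) (simp add: prime_in_def)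

lemma prime_in_contract:
  assumes "prime_in R E P" "subring D R" "D \<subseteq> E"
  shows "prime_in R D (P \<inter> D)"
  using assms(1,3) subringE[OF assms(2)] by (auto simp: prime_in_def subset_iff)

text \<open>The elements algebraic over \<open>D\<close> modulo \<open>P\<close>: the polynomial may not vanish modulo \<open>P\<close>.\<close>

definition cl :: "('a, 'm) ring_scheme \<Rightarrow> 'a set \<Rightarrow> 'a set \<Rightarrow> 'a set" where
  "cl R P D = {x \<in> carrier R. \<exists>cs. set cs \<subseteq> D \<and> horner R cs x \<in> P \<and> \<not> set cs \<subseteq> P}"

lemma cl_mono: "D \<subseteq> D' \<Longrightarrow> cl R P D \<subseteq> cl R P D'"
  by (auto simp: cl_def)

lemma clI: "x \<in> carrier R \<Longrightarrow> set cs \<subseteq> D \<Longrightarrow> horner R cs x \<in> P \<Longrightarrow> \<not> set cs \<subseteq> P \<Longrightarrow> x \<in> cl R P D"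
  by (auto simp: cl_def)

lemma not_clD: "x \<notin> cl R P D \<Longrightarrow> x \<in> carrier R \<Longrightarrow> set cs \<subseteq> D \<Longrightarrow> horner R cs x \<in> P \<Longrightarrow> set cs \<subseteq> P"
  by (auto simp: cl_def)

context cring begin

lemma primeideal_iff_prime_in: "primeideal P R \<longleftrightarrow> prime_in R (carrier R) P"
proof
  assume "primeideal P R"
  then interpret P: primeideal P R .
  show "prime_in R (carrier R) P" unfolding prime_in_def
    using P.I_l_closed P.I_prime P.Icarr P.I_notcarr P.one_imp_carrier by auto
next
  assume P: "prime_in R (carrier R) P"
  show "primeideal P R"
  proof (rule primeidealI2)
    show "additive_subgroup P R"
    proof (rule additive_subgroup.intro, rule add.subgroupI)
      fix x assume x: "x \<in> P"
      then have "(\<ominus> \<one>) \<otimes> x \<in> P" "x \<in> carrier R" using prime_inD[OF P] by auto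
      then show "\<ominus> x \<in> P" by (simp add: l_minus)
    qed (use prime_inD[OF P] in auto)
    show "carrier R \<noteq> P" using prime_inD(3)[OF P] by auto
    show "x \<otimes> a \<in> P" "a \<otimes> x \<in> P" if "a \<in> P" "x \<in> carrier R" for a x
      using prime_inD(1)[OF P] prime_inD(5)[OF P that(2,1)] that by (auto simp: m_comm)
  qed (use prime_inD[OF P] is_cring in auto)
qed

lemma prime_in_add_closed: "prime_in R E P \<Longrightarrow> E \<subseteq> carrier R \<Longrightarrow> add_closed R P"
  by (auto simp: prime_in_def add_closed_def)

lemma prime_in_minus:
  assumes "prime_in R E P" "subring E R" "x \<in> P" shows "\<ominus> x \<in> P"
proof -
  have "(\<ominus> \<one>) \<otimes> x \<in> P" "x \<in> carrier R"
    using prime_inD(1)[OF assms(1)] prime_inD(5)[OF assms(1), of "\<ominus> \<one>" x] subringE(1,3,5)[OF assms(2)] assms(3) by auto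
  then show ?thesis by (simp add: l_minus)
qed

lemma prime_in_cancel:
  assumes "prime_in R E P" "subring E R" "x \<oplus> y \<in> P" "x \<in> P" "y \<in> carrier R"
  shows "y \<in> P"
proof -
  have x: "x \<in> carrier R" using prime_inD(1)[OF assms(1)] subringE(1)[OF assms(2)] assms(4) by auto
  have "(\<ominus> x) \<oplus> (x \<oplus> y) \<in> P" by (rule prime_inD(4)[OF assms(1) prime_in_minus[OF assms(1,2,4)] assms(3)])
  then show ?thesis using x assms(5) by (simp add: r_neg1)
qed

lemma horner_in_ideal:
  assumes "prime_in R (carrier R) P" "set cs \<subseteq> P" "x \<in> carrier R"
  shows "horner R cs x \<in> P"
  using assms(2) by (induction cs) (use prime_inD[OF assms(1)] assms(3) in auto)

text \<open>Uniqueness of the coefficients at an element \<open>z\<close> free over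
  \<open>D\<close>. Lists for the same polynomial may differ by trailing zeros and cannot be
  compared entry by entry, but membership of all entries in sets containing zero is unaffected by
  this.\<close>

lemma horner_unique:
  assumes D: "add_closed R D" "\<And>x. x \<in> D \<Longrightarrow> \<ominus> x \<in> D" and z: "z \<in> carrier R" "z \<notin> cl R {\<zero>} D"
    and U: "\<zero> \<in> U" and V: "\<zero> \<in> V"
    and cs: "set cs \<subseteq> D" "set cs \<subseteq> U" and ds: "set ds \<subseteq> D" "set ds \<subseteq> V" and eq: "horner R cs z = horner R ds z"
  shows "set cs \<subseteq> U \<inter> V"
proof -
  have sub: "D \<subseteq> carrier R" using D by (auto simp: add_closed_def)
  \<comment> \<open>\<open>es\<close> lists the coefficients of the difference. If they all vanish,
    each entry of \<open>cs\<close> equals the matching entry of \<open>ds\<close>, or zero where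
    \<open>ds\<close> has ended, and so lies in \<open>V\<close>.\<close>
  have "\<exists>es. set es \<subseteq> D \<and> horner R es z = horner R cs z \<ominus> horner R ds z \<and> (set es \<subseteq> {\<zero>} \<longrightarrow> set cs \<subseteq> V)"
    using cs(1) ds
  proof (induction cs arbitrary: ds)
    case Nil
    let ?es = "map (\<lambda>c. \<ominus> c) ds"
    have "horner R ?es z = \<ominus> horner R ds z" using Nil(2)
    proof (induction ds)
      case (Cons d ds)
      then have "d \<in> carrier R" "horner R ds z \<in> carrier R" using sub z by auto
      then show ?case using Cons z by (simp add: minus_add r_minus)
    qed simp
    moreover have "horner R ds z \<in> carrier R" using Nil sub z by auto
    ultimately show ?case using Nil D(2) by (intro exI[of _ ?es]) (auto simp: minus_eq)
  next
    case (Cons c cs)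
    have c: "c \<in> D" "set cs \<subseteq> D" using Cons by auto
    obtain d ds' where d: "d \<in> D" "d \<in> V" "set ds' \<subseteq> D" "set ds' \<subseteq> V" "horner R ds z = d \<oplus> z \<otimes> horner R ds' z"
    proof (cases ds)
      case Nil
      then show ?thesis using that[of \<zero> "[]"] V z D by (auto simp: add_closed_def)
    next
      case (Cons d ds')
      then show ?thesis using that[of d ds'] \<open>set ds \<subseteq> D\<close> \<open>set ds \<subseteq> V\<close> by auto
    qed
    obtain es where es: "set es \<subseteq> D" "horner R es z = horner R cs z \<ominus> horner R ds' z" "set es \<subseteq> {\<zero>} \<Longrightarrow> set cs \<subseteq> V"
      using Cons.IH[OF c(2) d(3,4)] by blast
    have car: "c \<in> carrier R" "d \<in> carrier R" "horner R cs z \<in> carrier R" "horner R ds' z \<in> carrier R"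
      using c d sub z by auto
    have "horner R ((c \<ominus> d) # es) z = horner R (c # cs) z \<ominus> horner R ds z"
      unfolding d(5) horner.simps es(2) minus_eq using car z by (simp add: r_distr minus_add r_minus a_ac)
    moreover have "c \<ominus> d \<in> D" using c d D by (auto simp: add_closed_def minus_eq)
    moreover have "c \<ominus> d = \<zero> \<longrightarrow> c \<in> V" using car d(2) by (metis r_right_minus_eq)
    ultimately show ?case using es by (intro exI[of _ "(c \<ominus> d) # es"]) auto
  qed
  then obtain es where es: "set es \<subseteq> D" "horner R es z = horner R cs z \<ominus> horner R ds z" "set es \<subseteq> {\<zero>} \<Longrightarrow> set cs \<subseteq> V"
    by blast
  have "horner R ds z \<in> carrier R" using ds sub z by auto
  then have "horner R es z = \<zero>" using es(2) eq by simp
  then have "set es \<subseteq> {\<zero>}" using not_clD[OF z(2,1) es(1)] by simp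
  then show ?thesis using es cs by auto
qed

text \<open>If two polynomials outside \<open>q[X]\<close> had their product in \<open>q[X]\<close>, consider their lowest
  coefficients outside \<open>q\<close>.\<close>

lemma prime_in_adjoin:
  assumes D: "subring D R" and q: "prime_in R D q" and z: "z \<in> carrier R" "z \<notin> cl R {\<zero>} D"
  shows "prime_in R (adjoin R D z) (adjoin R q z)"
proof -
  have sub: "D \<subseteq> carrier R" using subringE(1)[OF D] .
  have qD: "q \<subseteq> D" using prime_inD[OF q] by auto
  note aq = prime_in_add_closed[OF q sub] and aD = subring_add_closed[OF D]
  note neg = subringE(5)[OF D]
  have uniq: "set cs \<subseteq> q" if h: "set cs \<subseteq> D" "horner R cs z \<in> adjoin R q z" for cs
  proof -
    obtain ds where ds: "set ds \<subseteq> q" "horner R cs z = horner R ds z"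
      using h(2) unfolding adjoin_def by blast
    show ?thesis
      using horner_unique[OF aD neg z, of D q cs ds] h ds qD aq aD by (auto simp: add_closed_def)
  qed
  have aaq: "add_closed R (adjoin R q z)" using adjoin_add_closed aq z by auto
  have mem: "x \<otimes> y \<in> adjoin R q z" if "x \<in> adjoin R D z" "y \<in> adjoin R q z" for x y
    using adjoin_mult[OF aD aq aq z(1) _ that] prime_inD(5)[OF q] by auto
  have minus: "\<ominus> x \<in> adjoin R q z" if "x \<in> adjoin R q z" for x
  proof -
    have "\<ominus> \<one> \<in> adjoin R D z" using adjoin_base[OF aD z(1)] subringE(3,5)[OF D] by auto
    moreover have "x \<in> carrier R" using that aaq by (auto simp: add_closed_def)
    ultimately show ?thesis using mem[of "\<ominus> \<one>" x] that by (simp add: l_minus)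
  qed
  have main: "set cs \<subseteq> q \<or> set ds \<subseteq> q" if "set cs \<subseteq> D" "set ds \<subseteq> D" "horner R cs z \<otimes> horner R ds z \<in> adjoin R q z" for cs ds
    using that
  proof (induction "length cs + length ds" arbitrary: cs ds rule: less_induct)
    case less
    show ?case
    proof (cases "cs = [] \<or> ds = []")
      case False
      then obtain c cs' d ds' where e: "cs = c # cs'" "ds = d # ds'" by (meson neq_Nil_conv)
      define x where "x = horner R cs' z"
      define y where "y = horner R ds' z"
      have car: "c \<in> carrier R" "d \<in> carrier R" "x \<in> carrier R" "y \<in> carrier R"
        using e less.prems sub z by (auto simp: x_def y_def)
      have xy: "x \<in> adjoin R D z" "y \<in> adjoin R D z" using e less.prems by (auto simp: x_def y_def adjoin_def)
      have cd: "c \<in> D" "d \<in> D" using e less.prems by auto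
      \<comment> \<open>This isolates the constant coefficient \<open>c \<otimes> d\<close>. It lies
        in \<open>q\<close> by uniqueness of coefficients, so \<open>c\<close> or \<open>d\<close>
        does.\<close>
      have eq: "horner R cs z \<otimes> horner R ds z = c \<otimes> d \<oplus> z \<otimes> (c \<otimes> y \<oplus> x \<otimes> d \<oplus> z \<otimes> (x \<otimes> y))"
        using e car z by (simp add: x_def[symmetric] y_def[symmetric] l_distr r_distr m_ac a_ac)
      note aaD = adjoin_add_closed[OF aD z(1)]
      have inD: "c \<otimes> y \<oplus> x \<otimes> d \<oplus> z \<otimes> (x \<otimes> y) \<in> adjoin R D z"
      proof -
        note S = adjoin_subring[OF D z(1)]
        have "c \<in> adjoin R D z" "d \<in> adjoin R D z" using cd adjoin_base[OF aD z(1)] by auto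
        then show ?thesis
          using xy adjoin_self[OF D z(1)] by (intro subringE(6,7)[OF S])
      qed
      then obtain es where es: "set es \<subseteq> D" "c \<otimes> y \<oplus> x \<otimes> d \<oplus> z \<otimes> (x \<otimes> y) = horner R es z" by (auto simp: adjoin_def)
      have "horner R (c \<otimes> d # es) z \<in> adjoin R q z" using less.prems(3) eq es by simp
      then have "set (c \<otimes> d # es) \<subseteq> q" using uniq[of "c \<otimes> d # es"] es cd subringE(6)[OF D] by auto
      then have "c \<in> q \<or> d \<in> q" using prime_inD(6)[OF q cd] by auto
      then show ?thesis
      proof
        assume c: "c \<in> q"
        have cz: "c \<otimes> horner R ds z \<in> adjoin R q z"
        proof -
          have "c \<in> adjoin R q z" using adjoin_base[OF aq z(1)] c by auto
          then have "horner R ds z \<otimes> c \<in> adjoin R q z" using mem less.prems(2) by (auto simp: adjoin_def)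
          moreover have "horner R ds z \<in> carrier R" using less.prems(2) sub z by auto
          ultimately show ?thesis using car by (simp add: m_comm)
        qed
        have w: "horner R ds z \<in> carrier R" using less.prems(2) sub z by auto
        \<comment> \<open>With \<open>c\<close> in \<open>q\<close> its contribution is subtracted.
          The remaining factor \<open>z\<close> is cancelled by reading the element as the value of
          \<open>\<zero> # fs\<close> and comparing coefficients; the induction then applies to the
          shorter pair \<open>cs'\<close>, \<open>ds\<close>.\<close>
        have "z \<otimes> (x \<otimes> horner R ds z) = \<ominus> (c \<otimes> horner R ds z) \<oplus> horner R cs z \<otimes> horner R ds z"
          using e car z w by (simp add: x_def[symmetric] l_distr m_assoc r_neg1)
        also have "\<dots> \<in> adjoin R q z" using minus[OF cz] less.prems(3) aaq by (auto simp: add_closed_def)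
        finally have "z \<otimes> (x \<otimes> horner R ds z) \<in> adjoin R q z" .
        moreover have "x \<otimes> horner R ds z \<in> adjoin R D z"
          using subringE(6)[OF adjoin_subring[OF D z(1)]] xy less.prems(2) by (auto simp: adjoin_def)
        then obtain fs where fs: "set fs \<subseteq> D" "x \<otimes> horner R ds z = horner R fs z" by (auto simp: adjoin_def)
        ultimately have "horner R (\<zero> # fs) z \<in> adjoin R q z" using sub z by auto
        then have "set fs \<subseteq> q" using uniq[of "\<zero> # fs"] fs aD by (auto simp: add_closed_def)
        then have "horner R cs' z \<otimes> horner R ds z \<in> adjoin R q z" using fs by (auto simp: x_def adjoin_def)
        then have "set cs' \<subseteq> q \<or> set ds \<subseteq> q" using less.hyps[of cs' ds] less.prems e by auto
        then show ?thesis using c e by auto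
      next
        assume d: "d \<in> q"
        have w: "horner R cs z \<in> carrier R" using less.prems(1) sub z by auto
        have dz: "horner R cs z \<otimes> d \<in> adjoin R q z"
          using mem[of "horner R cs z" d] less.prems(1) adjoin_base[OF aq z(1)] d by (auto simp: adjoin_def)
        have "z \<otimes> (horner R cs z \<otimes> y) = \<ominus> (horner R cs z \<otimes> d) \<oplus> horner R cs z \<otimes> horner R ds z"
          using e(2) car z w by (simp add: y_def[symmetric] r_distr m_lcomm r_neg1)
        also have "\<dots> \<in> adjoin R q z" using minus[OF dz] less.prems(3) aaq by (auto simp: add_closed_def)
        finally have "z \<otimes> (horner R cs z \<otimes> y) \<in> adjoin R q z" .
        moreover have "horner R cs z \<otimes> y \<in> adjoin R D z"
          using subringE(6)[OF adjoin_subring[OF D z(1)]] xy less.prems(1) by (auto simp: adjoin_def)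
        then obtain fs where fs: "set fs \<subseteq> D" "horner R cs z \<otimes> y = horner R fs z" by (auto simp: adjoin_def)
        ultimately have "horner R (\<zero> # fs) z \<in> adjoin R q z" using sub z by auto
        then have "set fs \<subseteq> q" using uniq[of "\<zero> # fs"] fs aD by (auto simp: add_closed_def)
        then have "horner R cs z \<otimes> horner R ds' z \<in> adjoin R q z" using fs by (auto simp: y_def adjoin_def)
        then have "set cs \<subseteq> q \<or> set ds' \<subseteq> q" using less.hyps[of cs ds'] less.prems e by auto
        then show ?thesis using d e by auto
      qed
    qed auto
  qed
  show ?thesis unfolding prime_in_def
  proof (intro conjI ballI impI)
    show "adjoin R q z \<subseteq> adjoin R D z" by (rule adjoin_mono[OF qD])
    show "\<zero> \<in> adjoin R q z" using aaq by (auto simp: add_closed_def)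
    show "\<one> \<notin> adjoin R q z"
      using uniq[of "[\<one>]"] prime_inD(3)[OF q] subringE(3)[OF D] z by auto
    show "x \<oplus> y \<in> adjoin R q z" if "x \<in> adjoin R q z" "y \<in> adjoin R q z" for x y
      using that aaq by (auto simp: add_closed_def)
    show "x \<in> adjoin R q z \<or> y \<in> adjoin R q z" if h: "x \<in> adjoin R D z" "y \<in> adjoin R D z" "x \<otimes> y \<in> adjoin R q z" for x y
    proof -
      obtain cs ds where "set cs \<subseteq> D" "x = horner R cs z" "set ds \<subseteq> D" "y = horner R ds z"
        using h(1,2) unfolding adjoin_def[of R D] by blast
      then show ?thesis using main[of cs ds] h(3) unfolding adjoin_def[of R q] by blast
    qed
  qed (use mem in auto)
qed

lemma adjoin_Int:
  assumes D: "subring D R" and z: "z \<in> carrier R" "z \<notin> cl R {\<zero>} D"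
    and U: "\<zero> \<in> U" "U \<subseteq> D" and V: "\<zero> \<in> V" "V \<subseteq> D"
  shows "adjoin R U z \<inter> adjoin R V z = adjoin R (U \<inter> V) z"
proof
  show "adjoin R U z \<inter> adjoin R V z \<subseteq> adjoin R (U \<inter> V) z"
  proof
    fix x assume "x \<in> adjoin R U z \<inter> adjoin R V z"
    then obtain cs ds where "set cs \<subseteq> U" "x = horner R cs z" "set ds \<subseteq> V" "x = horner R ds z" by (auto simp: adjoin_def)
    then show "x \<in> adjoin R (U \<inter> V) z"
      using horner_unique[OF subring_add_closed[OF D] subringE(5)[OF D] z U(1) V(1), of cs ds] U V by (auto simp: adjoin_def)
  qed
qed (auto simp: adjoin_def)

lemma adjoin_Int_base:
  assumes D: "subring D R" and z: "z \<in> carrier R" "z \<notin> cl R {\<zero>} D" and U: "\<zero> \<in> U" "U \<subseteq> D"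
  shows "adjoin R U z \<inter> D = U"
proof
  have sub: "D \<subseteq> carrier R" using subringE(1)[OF D] .
  show "adjoin R U z \<inter> D \<subseteq> U"
  proof
    fix x assume x: "x \<in> adjoin R U z \<inter> D"
    then obtain cs where cs: "set cs \<subseteq> U" "x = horner R cs z" by (auto simp: adjoin_def)
    have "horner R [x] z = horner R cs z" using x cs sub z by auto
    then show "x \<in> U" using horner_unique[OF subring_add_closed[OF D] subringE(5)[OF D] z, of D U "[x]" cs] U x cs by auto
  qed
  show "U \<subseteq> adjoin R U z \<inter> D"
  proof
    fix u assume "u \<in> U"
    then have "u = horner R [u] z" "u \<in> D" using sub z U by auto
    then show "u \<in> adjoin R U z \<inter> D" using \<open>u \<in> U\<close> unfolding adjoin_def by (intro IntI CollectI exI[of _ "[u]"]) auto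
  qed
qed

end

section \<open>Algebraic closure modulo a prime ideal\<close>

context field begin

text \<open>The link to the library notion \<open>algebraic\<close>, whose polynomials list the
  leading coefficient first.\<close>

lemma horner_eval:
  assumes "set cs \<subseteq> carrier R" "x \<in> carrier R" shows "horner R cs x = eval (rev cs) x"
  using assms(1)
proof (induction cs)
  case (Cons c cs)
  then have "eval (rev cs @ [c]) x = eval (rev cs) x \<otimes> x \<oplus> c" "eval (rev cs) x \<in> carrier R"
    using assms(2) by (auto intro!: eval_append_aux eval_in_carrier)
  then show ?case using Cons assms(2) by (simp add: m_comm a_comm)
qed simp

text \<open>\<open>E\<close> is the field of fractions of \<open>D\<close> inside \<open>R\<close>.
  The theory of algebraic elements wants a subfield as its base, whereas \<open>cl\<close> works
  over a subring.\<close>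

lemma fraction_subfield:
  assumes D: "subring D R"
  obtains E where "subfield E R" "D \<subseteq> E" "\<forall>x\<in>E. \<exists>d\<in>D - {\<zero>}. d \<otimes> x \<in> D"
proof
  note S = subringE[OF D]
  let ?E = "{x \<in> carrier R. \<exists>d\<in>D - {\<zero>}. d \<otimes> x \<in> D}"
  show "subfield ?E R"
  proof (rule subfieldI', rule subringI)
    show "\<one> \<in> ?E" using S by (auto intro!: bexI[of _ \<one>])
    fix x assume "x \<in> ?E"
    then obtain d where d: "d \<in> D" "d \<noteq> \<zero>" "d \<otimes> x \<in> D" "x \<in> carrier R" by auto
    have dc: "d \<in> carrier R" using d S by auto
    have "d \<otimes> (\<ominus> x) = \<ominus> (d \<otimes> x)" using d dc by (simp add: r_minus)
    then show "\<ominus> x \<in> ?E" using d S(5) by (auto intro!: bexI[of _ d])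
    fix y assume "y \<in> ?E"
    then obtain e where e: "e \<in> D" "e \<noteq> \<zero>" "e \<otimes> y \<in> D" "y \<in> carrier R" by auto
    have ec: "e \<in> carrier R" using e S by auto
    have de: "d \<otimes> e \<in> D - {\<zero>}" using d e dc ec S(6) integral_iff by auto
    have "(d \<otimes> e) \<otimes> (x \<otimes> y) = (d \<otimes> x) \<otimes> (e \<otimes> y)" using d e dc ec by (simp add: m_ac)
    then have "(d \<otimes> e) \<otimes> (x \<otimes> y) \<in> D" using d e S(6) by auto
    then show "x \<otimes> y \<in> ?E" using d e de by blast
    have "(d \<otimes> e) \<otimes> (x \<oplus> y) = e \<otimes> (d \<otimes> x) \<oplus> d \<otimes> (e \<otimes> y)" using d e dc ec by (simp add: m_ac r_distr)
    then have "(d \<otimes> e) \<otimes> (x \<oplus> y) \<in> D" using d e S(6,7) by auto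
    then show "x \<oplus> y \<in> ?E" using d e de by blast
  next
    fix x assume "x \<in> ?E - {\<zero>}"
    then obtain d where d: "d \<in> D" "d \<noteq> \<zero>" "d \<otimes> x \<in> D" "x \<in> carrier R" "x \<noteq> \<zero>" by auto
    have dc: "d \<in> carrier R" using d S by auto
    have ix: "inv x \<in> carrier R" "x \<otimes> inv x = \<one>" using field_Units d by auto
    have "(d \<otimes> x) \<otimes> inv x = d" using ix d dc by (simp add: m_assoc)
    moreover have "d \<otimes> x \<noteq> \<zero>" using d dc integral_iff by auto
    ultimately show "inv x \<in> ?E" using d ix by (auto intro!: bexI[of _ "d \<otimes> x"])
  qed auto
  show "D \<subseteq> ?E" using S by (auto intro!: bexI[of _ \<one>])
qed auto

text \<open>Finitely many elements of \<open>E\<close> have a common denominator in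
  \<open>D\<close>, so a relation over \<open>E\<close> becomes a nonzero relation over
  \<open>D\<close>.\<close>

lemma cl_zero_algebraic:
  assumes D: "subring D R" and E: "subfield E R" "D \<subseteq> E" "\<forall>x\<in>E. \<exists>d\<in>D - {\<zero>}. d \<otimes> x \<in> D"
  shows "cl R {\<zero>} D = {x \<in> carrier R. (algebraic over E) x}"
proof (intro equalityI subsetI)
  note S = subringE[OF D]
  fix x assume "x \<in> cl R {\<zero>} D"
  then obtain cs where cs: "x \<in> carrier R" "set cs \<subseteq> D" "horner R cs x = \<zero>" "\<not> set cs \<subseteq> {\<zero>}" by (auto simp: cl_def)
  have "eval (normalize (rev cs)) x = \<zero>"
    using cs S(1) horner_eval[of cs x] eval_normalize[of "rev cs" x] by auto
  moreover have "normalize (rev cs) \<in> carrier (E[X])"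
    using normalize_gives_polynomial[of "rev cs" E] cs E(2) unfolding univ_poly_def by auto
  moreover have "normalize ds = [] \<Longrightarrow> set ds \<subseteq> {\<zero>}" for ds
    by (induct ds) (auto split: if_splits)
  then have "normalize (rev cs) \<noteq> []" using cs(4) by fastforce
  ultimately show "x \<in> {x \<in> carrier R. (algebraic over E) x}" using algebraicI cs(1) by blast
next
  note S = subringE[OF D]
  fix x assume "x \<in> {x \<in> carrier R. (algebraic over E) x}"
  then obtain p where p: "x \<in> carrier R" "p \<in> carrier (E[X])" "p \<noteq> []" "eval p x = \<zero>"
    using algebraicE[OF subfieldE(1)[OF E(1)]] by blast
  have pE: "set p \<subseteq> E" "lead_coeff p \<noteq> \<zero>" using p unfolding univ_poly_def polynomial_def by auto
  have Ec: "E \<subseteq> carrier R" using subfieldE(3)[OF E(1)] .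
  have "\<exists>d\<in>D - {\<zero>}. set (map ((\<otimes>) d) cs) \<subseteq> D" if "set cs \<subseteq> E" for cs
    using that
  proof (induction cs)
    case Nil
    then show ?case using S by (auto intro!: bexI[of _ \<one>])
  next
    case (Cons c cs)
    then obtain d where d: "d \<in> D" "d \<noteq> \<zero>" "set (map ((\<otimes>) d) cs) \<subseteq> D" by auto
    obtain e where e: "e \<in> D" "e \<noteq> \<zero>" "e \<otimes> c \<in> D" using bspec[OF E(3), of c] Cons by auto
    have car: "d \<in> carrier R" "e \<in> carrier R" "c \<in> carrier R" using d e S Ec Cons by auto
    have "(d \<otimes> e) \<otimes> c' \<in> D" if c': "c' \<in> set (c # cs)" for c'
    proof -
      have cc: "c' \<in> carrier R" using c' Cons.prems Ec by auto
      have "(d \<otimes> e) \<otimes> c' = d \<otimes> (e \<otimes> c')" "(d \<otimes> e) \<otimes> c' = e \<otimes> (d \<otimes> c')" using car cc by (simp_all add: m_ac)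
      then show ?thesis using c' d e S(6)[OF d(1), of "e \<otimes> c'"] S(6)[OF e(1), of "d \<otimes> c'"] by auto
    qed
    moreover have "d \<otimes> e \<in> D - {\<zero>}" using d e S(6) integral_iff car by auto
    ultimately show ?case by (intro bexI[of _ "d \<otimes> e"]) auto
  qed
  then obtain d where d: "d \<in> D" "d \<noteq> \<zero>" "set (map ((\<otimes>) d) (rev p)) \<subseteq> D" using pE(1) by (metis Diff_iff insertI1 set_rev)
  have pc: "set (rev p) \<subseteq> carrier R" using pE Ec by auto
  have dc: "d \<in> carrier R" using d S by auto
  have "horner R (map ((\<otimes>) d) (rev p)) x = d \<otimes> horner R (rev p) x" using horner_smult[OF pc p(1) dc] by simp
  also have "\<dots> = \<zero>" using horner_eval[OF pc p(1)] p(4) dc by simp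
  finally have "horner R (map ((\<otimes>) d) (rev p)) x = \<zero>" .
  moreover have "lead_coeff p \<in> set p" using p(3) by simp
  then have "d \<otimes> lead_coeff p \<in> set (map ((\<otimes>) d) (rev p))" "d \<otimes> lead_coeff p \<noteq> \<zero>"
    using pE(2) d(2) dc pc integral_iff by auto
  ultimately show "x \<in> cl R {\<zero>} D" using d(3) p(1) by (intro clI[of _ _ "map ((\<otimes>) d) (rev p)"]) auto
qed

text \<open>Transitivity by degrees: the coefficients of a relation generate a finite extension
  \<open>M\<close> of \<open>E\<close>, adjoining \<open>x\<close> keeps it finite over
  \<open>E\<close>, and finite extensions are algebraic.\<close>

lemma cl_zero_field:
  assumes D: "subring D R"
  shows "subring (cl R {\<zero>} D) R" and "cl R {\<zero>} (cl R {\<zero>} D) \<subseteq> cl R {\<zero>} D"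
proof -
  obtain E where E: "subfield E R" "D \<subseteq> E" "\<forall>x\<in>E. \<exists>d\<in>D - {\<zero>}. d \<otimes> x \<in> D"
    using fraction_subfield[OF D] by blast
  note eq = cl_zero_algebraic[OF D E]
  show "subring (cl R {\<zero>} D) R" unfolding eq using subfieldE(1)[OF subfield_of_algebraics[OF E(1)]] .
  show "cl R {\<zero>} (cl R {\<zero>} D) \<subseteq> cl R {\<zero>} D"
  proof
    fix x assume "x \<in> cl R {\<zero>} (cl R {\<zero>} D)"
    then obtain cs where cs: "x \<in> carrier R" "set cs \<subseteq> cl R {\<zero>} D" "horner R cs x = \<zero>" "\<not> set cs \<subseteq> {\<zero>}"
      by (auto simp: cl_def[of R _ "cl R {\<zero>} D"])
    have csa: "set cs \<subseteq> carrier R" "\<And>c. c \<in> set cs \<Longrightarrow> (algebraic over E) c" using cs(2) unfolding eq by auto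
    let ?M = "finite_extension E cs"
    have M: "subfield ?M R" "finite_dimension E ?M"
      using finite_extension_is_subfield[OF E(1) csa] finite_extension_finite_dimension(1)[OF E(1) csa] by auto
    have "set cs \<subseteq> ?M" using finite_extension_mem[OF subfieldE(1)[OF E(1)] csa(1)] .
    then have "x \<in> cl R {\<zero>} ?M" using cs by (intro clI[of _ _ cs]) auto
    moreover have "cl R {\<zero>} ?M = {x \<in> carrier R. (algebraic over ?M) x}"
      by (rule cl_zero_algebraic[OF subfieldE(1)[OF M(1)] M(1)])
         (use subringE(3)[OF subfieldE(1)[OF M(1)]] subringE(1)[OF subfieldE(1)[OF M(1)]] in \<open>auto intro!: bexI[of _ \<one>]\<close>)
    ultimately have alg: "(algebraic over ?M) x" by auto
    have "finite_dimension ?M (simple_extension ?M x)" using finite_dimension_simple_extension[OF M(1) cs(1)] alg by auto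
    then have "finite_dimension E (simple_extension ?M x)" using telescopic_base_dim(1)[OF E(1) M] by auto
    then have "(algebraic over E) x"
      using finite_dimension_imp_algebraic[OF E(1) simple_extension_is_subring[OF subfieldE(1)[OF M(1)] cs(1)]]
        simple_extension_mem[OF subfieldE(1)[OF M(1)] cs(1)] by auto
    then show "x \<in> cl R {\<zero>} D" unfolding eq using cs(1) by auto
  qed
qed

end

section \<open>Transfer of algebraicity to the residue field of a prime\<close>

lemma (in ring_hom_cring) hom_horner:
  "set cs \<subseteq> carrier R \<Longrightarrow> x \<in> carrier R \<Longrightarrow> h (horner R cs x) = horner S (map h cs) (h x)"
  by (induction cs) (auto simp: R.horner_closed)

lemma (in ring_hom_cring) hom_cl:
  assumes "x \<in> carrier R" "D \<subseteq> carrier R" "\<And>y. y \<in> carrier R \<Longrightarrow> h y \<in> J \<longleftrightarrow> y \<in> I"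
  shows "h x \<in> cl S J (h ` D) \<longleftrightarrow> x \<in> cl R I D"
proof
  assume "x \<in> cl R I D"
  then obtain cs where cs: "set cs \<subseteq> D" "horner R cs x \<in> I" "\<not> set cs \<subseteq> I" by (auto simp: cl_def)
  have car: "set cs \<subseteq> carrier R" "horner R cs x \<in> carrier R" using cs assms by auto
  have "horner S (map h cs) (h x) \<in> J" using hom_horner[OF car(1) assms(1)] assms(3)[OF car(2)] cs(2) by auto
  moreover have "\<not> set (map h cs) \<subseteq> J" using cs(3) assms(3) car by auto
  ultimately show "h x \<in> cl S J (h ` D)" using cs(1) assms(1) by (intro clI[of _ _ "map h cs"]) auto
next
  assume "h x \<in> cl S J (h ` D)"
  then obtain ds where ds: "set ds \<subseteq> h ` D" "horner S ds (h x) \<in> J" "\<not> set ds \<subseteq> J" by (auto simp: cl_def)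
  then have "ds \<in> map h ` lists D" by (simp flip: lists_image add: in_lists_conv_set subset_iff)
  then obtain cs where cs: "set cs \<subseteq> D" "ds = map h cs" by auto
  have car: "set cs \<subseteq> carrier R" "horner R cs x \<in> carrier R" using cs assms by auto
  have "horner R cs x \<in> I" using hom_horner[OF car(1) assms(1)] assms(3)[OF car(2)] ds(2) cs(2) by auto
  moreover have "\<not> set cs \<subseteq> I" using ds(3) assms(3) car cs by auto
  ultimately show "x \<in> cl R I D" using cs(1) assms(1) by (intro clI[of _ _ cs]) auto
qed

lemma domain_cong:
  assumes "domain R" "carrier S = carrier R" "monoid.mult S = monoid.mult R" "one S = one R"
    "ring.zero S = ring.zero R" "add S = add R"
  shows "domain S"
proof -
  interpret R: domain R by fact
  have "(\<lambda>x. x) \<in> ring_iso R S" unfolding ring_iso_def ring_hom_def bij_betw_def by (auto simp: assms inj_on_def)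
  from R.ring_iso_imp_img_domain[OF this] show ?thesis by (simp add: assms(5)[symmetric])
qed

definition fraction_hom :: "('k, 'a) module \<Rightarrow> 'a \<Rightarrow> ('a \<times> 'a) set" where
  "fraction_hom R a = fraction R a \<one>\<^bsub>R\<^esub>"

lemma fraction_hom:
  fixes R :: "('k, 'a) module"
  assumes "domain R" shows "fraction_hom R \<in> ring_hom R (Frac R)" "inj_on (fraction_hom R) (carrier R)"
proof -
  interpret domain R by fact
  show "fraction_hom R \<in> ring_hom R (Frac R)" unfolding fraction_hom_def
    by (rule ring_hom_memI)
       (simp_all add: Frac_I[OF assms] Frac_mult[OF assms] Frac_add[OF assms] Frac_one[OF assms])
  show "inj_on (fraction_hom R) (carrier R)" unfolding fraction_hom_def
    by (rule inj_onI) (simp add: frac_eq_iff[OF assms])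
qed

text \<open>\<open>Frac\<close> takes module records; the dummy scalar action lets it be applied to
  a plain ring such as \<open>R Quot P\<close>.\<close>

definition as_module :: "('a, 'm) ring_scheme \<Rightarrow> (unit, 'a) module" where
  "as_module R = \<lparr>carrier = carrier R, monoid.mult = monoid.mult R, one = one R, ring.zero = ring.zero R,
     add = add R, smult = \<lambda>_ x. x\<rparr>"

text \<open>\<open>F\<close> is the fraction field of \<open>R/P\<close>. In it, algebraicity modulo
  \<open>P\<close> becomes algebraicity in the ordinary sense, where field theory is at
  hand.\<close>

lemma (in cring) residue_field:
  assumes "prime_in R (carrier R) P"
  obtains F :: "(unit, ('a set \<times> 'a set) set) module" and h where "field F" "ring_hom_cring R F h"
    "\<And>x. x \<in> carrier R \<Longrightarrow> h x = \<zero>\<^bsub>F\<^esub> \<longleftrightarrow> x \<in> P"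
proof -
  interpret P: primeideal P R using assms primeideal_iff_prime_in by blast
  let ?Q = "as_module (R Quot P)"
  have dom: "domain ?Q" by (rule domain_cong[OF P.quotient_is_domain]) (auto simp: as_module_def)
  interpret F: field "Frac ?Q" by (rule Frac_field[OF dom])
  interpret D: domain ?Q by (rule dom)
  let ?h = "\<lambda>x. fraction_hom ?Q (P +>\<^bsub>R\<^esub> x)"
  have "(\<lambda>x. P +>\<^bsub>R\<^esub> x) \<in> ring_hom R (R Quot P)" using P.rcos_ring_hom .
  then have 1: "(\<lambda>x. P +>\<^bsub>R\<^esub> x) \<in> ring_hom R ?Q" by (simp add: ring_hom_def as_module_def)
  have h: "?h \<in> ring_hom R (Frac ?Q)"
    using ring_hom_trans[OF 1 fraction_hom(1)[OF dom]] by (simp add: comp_def)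
  have "ring_hom_cring R (Frac ?Q) ?h"
    by (intro ring_hom_cring.intro ring_hom_cring_axioms.intro is_cring F.is_cring h)
  moreover have "?h x = \<zero>\<^bsub>Frac ?Q\<^esub> \<longleftrightarrow> x \<in> P" if x: "x \<in> carrier R" for x
  proof -
    have c: "P +>\<^bsub>R\<^esub> x \<in> carrier ?Q" using 1 x by (auto simp: ring_hom_def)
    have "?h x = \<zero>\<^bsub>Frac ?Q\<^esub> \<longleftrightarrow> P +>\<^bsub>R\<^esub> x = \<zero>\<^bsub>?Q\<^esub>"
      using c by (simp add: fraction_hom_def Frac_zero[OF dom] frac_eq_iff[OF dom])
    also have "\<dots> \<longleftrightarrow> P +>\<^bsub>R\<^esub> x = P" by (simp add: as_module_def FactRing_def)
    also have "\<dots> \<longleftrightarrow> x \<in> P" using x P.a_rcos_const P.a_rcos_self by metis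
    finally show ?thesis .
  qed
  ultimately show thesis using that[of "Frac ?Q" ?h] F.field_axioms by blast
qed

context cring begin

lemma cl_closed: "cl R P D \<subseteq> carrier R" by (auto simp: cl_def)

lemma cl_base:
  assumes "prime_in R (carrier R) P" "subring D R" shows "D \<subseteq> cl R P D"
proof
  fix x assume x: "x \<in> D"
  note S = subringE[OF assms(2)]
  have "horner R [\<ominus> x, \<one>] x = \<zero>" using x S by (auto simp: l_neg)
  then show "x \<in> cl R P D" using x S prime_inD[OF assms(1)] by (intro clI[of _ _ "[\<ominus> x, \<one>]"]) auto
qed

text \<open>\<open>cl R P D\<close> is the preimage of the set of elements of the residue field
  algebraic over the image of \<open>D\<close>; both closure properties are pulled back from
  there.\<close>

lemma cl_props:
  assumes P: "prime_in R (carrier R) P" and D: "subring D R"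
  shows cl_subring: "subring (cl R P D) R" and cl_cl: "cl R P (cl R P D) = cl R P D"
proof -
  obtain F :: "(unit, ('a set \<times> 'a set) set) module" and h where F: "field F" "ring_hom_cring R F h"
    "\<And>x. x \<in> carrier R \<Longrightarrow> h x = \<zero>\<^bsub>F\<^esub> \<longleftrightarrow> x \<in> P" using residue_field[OF P] by blast
  interpret F: field F by (rule F)
  interpret h: ring_hom_cring R F h by (rule F)
  have Dc: "D \<subseteq> carrier R" using subringE(1)[OF D] .
  have "ring_hom_ring R F h"
    by (intro ring_hom_ring.intro ring_hom_ring_axioms.intro ring_axioms F.ring_axioms h.homh)
  then have hD: "subring (h ` D) F" by (rule ring_hom_ring.img_is_subring[OF _ D])
  note hs = F.cl_zero_field[OF hD]
  have tr: "x \<in> cl R P E \<longleftrightarrow> h x \<in> cl F {\<zero>\<^bsub>F\<^esub>} (h ` E)" if "x \<in> carrier R" "E \<subseteq> carrier R" for x E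
    using h.hom_cl[of x E "{\<zero>\<^bsub>F\<^esub>}" P] that F(3) by auto
  have eq: "cl R P D = {x \<in> carrier R. h x \<in> cl F {\<zero>\<^bsub>F\<^esub>} (h ` D)}" using tr[OF _ Dc] cl_closed by blast
  show "subring (cl R P D) R" unfolding eq
    by (rule subringI) (use subringE[OF hs(1)] in auto)
  show "cl R P (cl R P D) = cl R P D"
  proof
    show "cl R P (cl R P D) \<subseteq> cl R P D"
    proof
      fix x assume x: "x \<in> cl R P (cl R P D)"
      then have xc: "x \<in> carrier R" using cl_closed by blast
      have "h x \<in> cl F {\<zero>\<^bsub>F\<^esub>} (h ` cl R P D)" using tr[OF xc cl_closed] x by simp
      then have "h x \<in> cl F {\<zero>\<^bsub>F\<^esub>} (cl F {\<zero>\<^bsub>F\<^esub>} (h ` D))"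
        using cl_mono[of "h ` cl R P D" "cl F {\<zero>\<^bsub>F\<^esub>} (h ` D)" F] eq by blast
      then show "x \<in> cl R P D" using hs(2) eq xc by auto
    qed
    show "cl R P D \<subseteq> cl R P (cl R P D)" by (rule cl_mono[OF cl_base[OF P D]])
  qed
qed

lemma cl_least:
  assumes "prime_in R (carrier R) P" "subring D R" "E \<subseteq> cl R P D" shows "cl R P E \<subseteq> cl R P D"
  using cl_mono[OF assms(3), of R P] cl_cl[OF assms(1,2)] by simp

text \<open>A relation of \<open>x\<close> over \<open>D[y]\<close>, read as a polynomial in
  \<open>y\<close> over \<open>D[x]\<close>, must have all its coefficients in \<open>I\<close> if
  \<open>y\<close> is free; freeness of \<open>x\<close> then puts the scalars from \<open>D\<close>
  into \<open>I\<close>, and the relation was trivial. With \<open>I\<close> a mere set this serves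
  prime ideals as well as \<open>{\<zero>}\<close> in a ring with zero divisors.\<close>

lemma cl_exchange:
  assumes D: "D \<subseteq> carrier R" and D0: "\<zero> \<in> D" and x: "x \<in> carrier R" "x \<notin> cl R I D" and y: "y \<in> carrier R" and I: "\<zero> \<in> I"
    and Iy: "\<And>cs. set cs \<subseteq> I \<Longrightarrow> horner R cs y \<in> I" and xy: "x \<in> cl R I (adjoin R D y)"
  shows "y \<in> cl R I (adjoin R D x)"
proof (rule ccontr)
  assume ny: "y \<notin> cl R I (adjoin R D x)"
  obtain es where es: "set es \<subseteq> adjoin R D y" "horner R es x \<in> I" "\<not> set es \<subseteq> I" using xy by (auto simp: cl_def)
  have "\<exists>css. es = map (\<lambda>cs. horner R cs y) css \<and> (\<forall>cs\<in>set css. set cs \<subseteq> D)" using es(1)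
  proof (induction es)
    case (Cons e es)
    then obtain css cs where "es = map (\<lambda>cs. horner R cs y) css \<and> (\<forall>cs\<in>set css. set cs \<subseteq> D)" "e = horner R cs y" "set cs \<subseteq> D"
      by (auto simp: adjoin_def)
    then show ?case by (intro exI[of _ "cs # css"]) auto
  qed simp
  then obtain css where css: "es = map (\<lambda>cs. horner R cs y) css" "\<forall>cs\<in>set css. set cs \<subseteq> D" by blast
  have cc: "\<forall>cs\<in>set css. set cs \<subseteq> carrier R" using css(2) D by blast
  obtain dss where d: "horner R (map (\<lambda>cs. horner R cs y) css) x = horner R (map (\<lambda>ds. horner R ds x) dss) y"
    "\<And>V. \<zero> \<in> V \<Longrightarrow> (\<forall>ds\<in>set dss. set ds \<subseteq> V) \<longleftrightarrow> (\<forall>cs\<in>set css. set cs \<subseteq> V)"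
    using horner_transpose[OF cc x(1) y] by blast
  have dD: "\<forall>ds\<in>set dss. set ds \<subseteq> D"
  proof -

    show ?thesis using d(2)[OF D0] css(2) by blast
  qed
  have "set (map (\<lambda>ds. horner R ds x) dss) \<subseteq> adjoin R D x" using dD by (auto simp: adjoin_def)
  then have "set (map (\<lambda>ds. horner R ds x) dss) \<subseteq> I"
    using not_clD[OF ny y, of "map (\<lambda>ds. horner R ds x) dss"] es(2) css(1) d(1) by metis
  then have "\<forall>ds\<in>set dss. set ds \<subseteq> I" using dD not_clD[OF x(2,1)] by (metis (no_types, lifting) image_subset_iff list.set_map)
  then have "\<forall>cs\<in>set css. set cs \<subseteq> I" using d(2)[OF I] by blast
  then have "set es \<subseteq> I" using css(1) Iy by auto
  then show False using es(3) by blast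
qed

end

section \<open>Rank of a list modulo a prime ideal\<close>

text \<open>The transcendence degree over \<open>D\<close> of the subring generated by the list, computed modulo \<open>P\<close>.\<close>

primrec crk :: "('a, 'm) ring_scheme \<Rightarrow> 'a set \<Rightarrow> 'a set \<Rightarrow> 'a list \<Rightarrow> nat" where
  "crk R P D [] = 0"
| "crk R P D (z # zs) = (if z \<in> cl R P D then 0 else 1) + crk R P (adjoin R D z) zs"

lemma crk_le_length: "crk R P D zs \<le> length zs"
  by (induction zs arbitrary: D) (auto intro: le_SucI)

lemma crk_append: "crk R P D (xs @ ys) = crk R P D xs + crk R P (adjoins R D xs) ys"
  by (induction xs arbitrary: D) auto

context cring begin

context
  fixes P assumes P: "prime_in R (carrier R) P"
begin

lemma cl_adjoin_cong:
  assumes D: "subring D R" and D': "subring D' R" and eq: "cl R P D = cl R P D'" and z: "z \<in> carrier R"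
  shows "cl R P (adjoin R D z) = cl R P (adjoin R D' z)"
proof -
  have "cl R P (adjoin R D z) \<subseteq> cl R P (adjoin R D' z)"
    if D: "subring D R" and D': "subring D' R" and eq: "cl R P D = cl R P D'" for D D'
  proof -
    have S: "subring (adjoin R D' z) R" by (rule adjoin_subring[OF D' z])
    have "D \<subseteq> cl R P (adjoin R D' z)"
      using cl_base[OF P D] eq cl_mono[OF adjoin_base[OF subring_add_closed[OF D'] z], of R P] by blast
    moreover have "z \<in> cl R P (adjoin R D' z)" using cl_base[OF P S] adjoin_self[OF D' z] by blast
    ultimately show ?thesis by (intro cl_least[OF P S] adjoin_least cl_subring[OF P S])
  qed
  then show ?thesis using assms by blast
qed

lemma cl_adjoin_absorb:
  assumes D: "subring D R" and z: "z \<in> cl R P D"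
  shows "cl R P (adjoin R D z) = cl R P D"
proof -
  have "z \<in> carrier R" using z cl_closed by blast
  then have "cl R P D \<subseteq> cl R P (adjoin R D z)" by (intro cl_mono adjoin_base[OF subring_add_closed[OF D]])
  moreover have "cl R P (adjoin R D z) \<subseteq> cl R P D"
    by (intro cl_least[OF P D] adjoin_least cl_subring[OF P D] cl_base[OF P D] z)
  ultimately show ?thesis by blast
qed

lemma crk_cong:
  assumes "subring D R" "subring D' R" "cl R P D = cl R P D'" "set zs \<subseteq> carrier R"
  shows "crk R P D zs = crk R P D' zs"
  using assms
proof (induction zs arbitrary: D D')
  case (Cons z zs)
  have "crk R P (adjoin R D z) zs = crk R P (adjoin R D' z) zs"
    using Cons.prems by (intro Cons.IH adjoin_subring cl_adjoin_cong) auto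
  then show ?case using Cons.prems by simp
qed simp

text \<open>The two orders could give different ranks only if one element became algebraic after
  adjoining the other without being so before. Exchange makes this condition symmetric.\<close>

lemma crk_swap:
  assumes D: "subring D R" and a: "a \<in> carrier R" and b: "b \<in> carrier R"
  shows "crk R P D (a # b # zs) = crk R P D (b # a # zs)"
proof -
  note A = subring_add_closed[OF D]
  have eq: "adjoin R (adjoin R D a) b = adjoin R (adjoin R D b) a" by (rule adjoin_commute[OF A a b])
  have inc: "cl R P D \<subseteq> cl R P (adjoin R D a)" "cl R P D \<subseteq> cl R P (adjoin R D b)"
    using adjoin_base[OF A] a b by (auto intro!: cl_mono)
  have ex: "y \<in> cl R P (adjoin R D x)" if "x \<in> carrier R" "y \<in> carrier R" "x \<notin> cl R P D" "x \<in> cl R P (adjoin R D y)" for x y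
    using cl_exchange[of D x P y] that D subringE(1,2)[OF D] prime_inD(2)[OF P] horner_in_ideal[OF P] by blast
  have ab: "a \<in> cl R P D \<Longrightarrow> cl R P (adjoin R D a) = cl R P D" "b \<in> cl R P D \<Longrightarrow> cl R P (adjoin R D b) = cl R P D"
    using cl_adjoin_absorb[OF D] by auto
  show ?thesis using eq inc ab ex[OF a b] ex[OF b a] by auto
qed

lemma crk_move:
  assumes "subring D R" "y \<in> carrier R" "set zs \<subseteq> carrier R"
  shows "crk R P D (y # zs) = crk R P D (zs @ [y])"
  using assms
proof (induction zs arbitrary: D)
  case (Cons z zs)
  have "crk R P D (y # z # zs) = crk R P D (z # y # zs)" using Cons.prems by (intro crk_swap) auto
  also have "crk R P (adjoin R D z) (y # zs) = crk R P (adjoin R D z) (zs @ [y])"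
    using Cons.prems by (intro Cons.IH adjoin_subring) auto
  then have "crk R P D (z # y # zs) = crk R P D ((z # zs) @ [y])" by simp
  finally show ?case .
qed simp

text \<open>The Steinitz argument: a \<open>y\<close> that is free over \<open>D\<close> goes into
  the base. In front of \<open>zs\<close> it counts one; moved behind \<open>zs\<close> it counts
  nothing, being algebraic over \<open>D[zs]\<close>. So \<open>zs\<close> has lost exactly one over
  the larger base.\<close>

lemma crk_le:
  assumes "subring D R" "set zs \<subseteq> carrier R" "set ys \<subseteq> cl R P (adjoins R D zs)"
  shows "crk R P D ys \<le> crk R P D zs"
  using assms
proof (induction ys arbitrary: D)
  case (Cons y ys)
  have y: "y \<in> carrier R" "set ys \<subseteq> carrier R" using Cons.prems(3) cl_closed by fastforce+
  show ?case
  proof (cases "y \<in> cl R P D")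
    case True
    have "crk R P (adjoin R D y) ys = crk R P D ys"
      using cl_adjoin_absorb[OF Cons.prems(1) True] adjoin_subring[OF Cons.prems(1) y(1)] y Cons.prems(1)
      by (intro crk_cong) auto
    then show ?thesis using Cons.IH[OF Cons.prems(1,2)] Cons.prems(3) True by auto
  next
    case False
    have D': "subring (adjoin R D y) R" by (rule adjoin_subring[OF Cons.prems(1) y(1)])
    have "adjoins R D zs \<subseteq> adjoins R (adjoin R D y) zs"
      by (rule adjoins_mono[OF adjoin_base[OF subring_add_closed[OF Cons.prems(1)] y(1)]])
    then have "set ys \<subseteq> cl R P (adjoins R (adjoin R D y) zs)" 
      using cl_mono[of "adjoins R D zs" "adjoins R (adjoin R D y) zs" R P] Cons.prems(3) by (meson order_trans set_subset_Cons)
    then have "crk R P (adjoin R D y) ys \<le> crk R P (adjoin R D y) zs" using Cons.IH[OF D' Cons.prems(2)] by blast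
    then have "crk R P D (y # ys) \<le> crk R P D (y # zs)" by simp
    also have "\<dots> = crk R P D zs" using crk_move[OF Cons.prems(1) y(1) Cons.prems(2)] Cons.prems(3) by (simp add: crk_append)
    finally show ?thesis .
  qed
qed simp

text \<open>Take the lowest coefficient outside \<open>P\<close> in a relation of \<open>x\<close>.
  The powers of \<open>x\<close> in front of it cancel because \<open>x\<close> is not in
  \<open>P\<close>, so modulo \<open>P\<close> this coefficient is a multiple of \<open>x\<close>
  and lies in \<open>P'\<close>.\<close>

lemma incomparability:
  assumes P': "prime_in R (carrier R) P'" "P \<subseteq> P'" and x: "x \<in> P'" "x \<notin> P" "x \<in> cl R P D" and D: "D \<subseteq> carrier R"
  obtains c where "c \<in> D" "c \<in> P'" "c \<notin> P"
proof -
  obtain cs where cs: "set cs \<subseteq> D" "horner R cs x \<in> P" "\<not> set cs \<subseteq> P" and xc: "x \<in> carrier R" using x(3) by (auto simp: cl_def)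
  have "\<exists>c. c \<in> D \<and> c \<in> P' \<and> c \<notin> P" using cs
  proof (induction cs)
    case (Cons c cs)
    have car: "c \<in> carrier R" "horner R cs x \<in> carrier R" using Cons.prems D xc by auto
    have S: "subring (carrier R) R" by (rule carrier_is_subring)
    show ?case
    proof (cases "c \<in> P")
      case True
      then have "x \<otimes> horner R cs x \<in> P"
        using prime_in_cancel[OF P S, of c "x \<otimes> horner R cs x"] Cons.prems car xc by auto
      then have "horner R cs x \<in> P" using prime_inD(6)[OF P xc car(2)] x by auto
      then show ?thesis using Cons True by auto
    next
      case False
      have "x \<otimes> horner R cs x \<in> P'" using prime_inD(5)[OF P'(1) car(2) x(1)] xc car by (simp add: m_comm)
      then have "c \<in> P'" using prime_in_cancel[OF P'(1) S, of "x \<otimes> horner R cs x" c] Cons.prems P'(2) car xc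
        by (auto simp: a_comm)
      then show ?thesis using False Cons.prems by auto
    qed
  qed simp
  then show thesis using that by blast
qed

lemma adjoin_contract_le:
  assumes "z \<in> carrier R" shows "adjoin R (P \<inter> D) z \<subseteq> P \<inter> adjoin R D z"
proof
  fix x assume "x \<in> adjoin R (P \<inter> D) z"
  then obtain cs where "set cs \<subseteq> P" "set cs \<subseteq> D" "x = horner R cs z" by (auto simp: adjoin_def)
  then show "x \<in> P \<inter> adjoin R D z" using horner_in_ideal[OF P _ assms] by (auto simp: adjoin_def)
qed

lemma adjoin_contract:
  assumes "z \<in> carrier R" "z \<notin> cl R P D" shows "P \<inter> adjoin R D z = adjoin R (P \<inter> D) z"
proof (rule equalityI[OF _ adjoin_contract_le[OF assms(1)]], rule subsetI)
  fix x assume "x \<in> P \<inter> adjoin R D z"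
  then obtain cs where "set cs \<subseteq> D" "x = horner R cs z" "x \<in> P" by (auto simp: adjoin_def)
  then show "x \<in> adjoin R (P \<inter> D) z" using not_clD[OF assms(2,1), of cs] by (auto simp: adjoin_def)
qed

end

end

section \<open>Independent elements and chains of primes\<close>

text \<open>Outside \<open>cl R {\<zero>} D\<close> no polynomial over \<open>D\<close> other than
  zero vanishes. The condition thus says that \<open>D[zs]\<close> is a polynomial ring over
  \<open>D\<close>, also when \<open>R\<close> has zero divisors.\<close>

primrec indep :: "('a, 'm) ring_scheme \<Rightarrow> 'a set \<Rightarrow> 'a list \<Rightarrow> bool" where
  "indep R D [] = True"
| "indep R D (z # zs) = (z \<notin> cl R {\<zero>\<^bsub>R\<^esub>} D \<and> indep R (adjoin R D z) zs)"

context cring begin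

text \<open>Lists adjoin their first element first, but the one-variable chain theorem concerns the
  element adjoined last. \<open>cl_exchange\<close> for \<open>{\<zero>}\<close> carries
  \<open>z\<close> past one element at a time.\<close>

lemma indep_rotate:
  assumes "subring D R" "z \<in> carrier R" "set zs \<subseteq> carrier R" "z \<notin> cl R {\<zero>} D" "indep R (adjoin R D z) zs"
  shows "indep R D zs \<and> z \<notin> cl R {\<zero>} (adjoins R D zs)"
  using assms
proof (induction zs arbitrary: D)
  case (Cons w zs)
  note D = Cons.prems(1)
  have w: "w \<in> carrier R" using Cons.prems by auto
  have w0: "w \<notin> cl R {\<zero>} (adjoin R D z)" using Cons.prems by auto
  then have w1: "w \<notin> cl R {\<zero>} D" using cl_mono[OF adjoin_base[OF subring_add_closed[OF D] \<open>z \<in> carrier R\<close>]] by blast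
  have "horner R cs w \<in> {\<zero>}" if "set cs \<subseteq> {\<zero>}" for cs using horner_zeros that w by blast
  then have z1: "z \<notin> cl R {\<zero>} (adjoin R D w)"
    using cl_exchange[of D z "{\<zero>}" w] subringE(1,2)[OF D] Cons.prems(2,4) w w0 by blast
  have "indep R (adjoin R (adjoin R D w) z) zs"
    using Cons.prems adjoin_commute[OF subring_add_closed[OF D] Cons.prems(2) w] by simp
  then show ?case using Cons.IH[OF adjoin_subring[OF D w] Cons.prems(2) _ z1] Cons.prems w1 by auto
qed simp

lemma adjoins_Int:
  assumes "subring D R" "set zs \<subseteq> carrier R" "indep R D zs" "\<zero> \<in> U" "U \<subseteq> D" "\<zero> \<in> V" "V \<subseteq> D"
  shows "adjoins R U zs \<inter> adjoins R V zs = adjoins R (U \<inter> V) zs"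
  using assms
proof (induction zs arbitrary: D U V)
  case (Cons z zs)
  have z: "z \<in> carrier R" using Cons.prems by auto
  have 0: "\<zero> \<in> adjoin R W z" for W unfolding adjoin_def by (rule CollectI, rule exI[of _ "[]"]) simp
  have "adjoin R U z \<inter> adjoin R V z = adjoin R (U \<inter> V) z" using Cons.prems by (intro adjoin_Int[of D]) auto
  moreover have "adjoins R (adjoin R U z) zs \<inter> adjoins R (adjoin R V z) zs = adjoins R (adjoin R U z \<inter> adjoin R V z) zs"
    using Cons.prems 0 by (intro Cons.IH[of "adjoin R D z"] adjoin_subring adjoin_mono) auto
  ultimately show ?case by simp
qed simp

lemma adjoins_Int_base:
  assumes "subring D R" "set zs \<subseteq> carrier R" "indep R D zs" "\<zero> \<in> U" "U \<subseteq> D"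
  shows "adjoins R U zs \<inter> D = U"
  using assms
proof (induction zs arbitrary: D U)
  case (Cons z zs)
  have z: "z \<in> carrier R" using Cons.prems by auto
  have 0: "\<zero> \<in> adjoin R W z" for W unfolding adjoin_def by (rule CollectI, rule exI[of _ "[]"]) simp
  have "adjoins R (adjoin R U z) zs \<inter> adjoin R D z = adjoin R U z"
    using Cons.prems 0 by (intro Cons.IH adjoin_subring adjoin_mono) auto
  moreover have "adjoin R U z \<inter> D = U" using Cons.prems by (intro adjoin_Int_base) auto
  moreover have "D \<subseteq> adjoin R D z" using adjoin_base[OF subring_add_closed[OF Cons.prems(1)] z] .
  ultimately show ?case by auto
qed auto

lemma prime_in_adjoins:
  assumes "subring D R" "set zs \<subseteq> carrier R" "indep R D zs" "prime_in R D q"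
  shows "prime_in R (adjoins R D zs) (adjoins R q zs)"
  using assms
proof (induction zs arbitrary: D q)
  case (Cons z zs)
  have "prime_in R (adjoin R D z) (adjoin R q z)" using Cons.prems by (intro prime_in_adjoin) auto
  then show ?case using Cons.prems Cons.IH[of "adjoin R D z" "adjoin R q z"] adjoin_subring by auto
qed simp

end

section \<open>Chains of primes in polynomial rings\<close>

primrec chain_to :: "'a set set \<Rightarrow> nat \<Rightarrow> 'a set \<Rightarrow> bool" where
  "chain_to S 0 P = (P \<in> S)"
| "chain_to S (Suc n) P = (P \<in> S \<and> (\<exists>Q. Q \<subset> P \<and> chain_to S n Q))"

lemma chain_to_mem: "chain_to S n P \<Longrightarrow> P \<in> S" by (cases n) auto

lemma chain_to_pred: "chain_to S (Suc n) P \<Longrightarrow> chain_to S n P"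
proof (induction n arbitrary: P)
  case (Suc n)
  then obtain Q where "Q \<subset> P" "chain_to S (Suc n) Q" "P \<in> S" by auto
  then show ?case using Suc.IH[of Q] by auto
qed simp

lemma chain_to_le: "chain_to S n P \<Longrightarrow> m \<le> n \<Longrightarrow> chain_to S m P"
proof (induction "n - m" arbitrary: m)
  case (Suc k)
  have "chain_to S (Suc m) P" by (rule Suc.hyps(1)) (use Suc in auto)
  then show ?case by (rule chain_to_pred)
qed simp

lemma chain_to_mono: "chain_to S n P \<Longrightarrow> S \<subseteq> S' \<Longrightarrow> chain_to S' n P"
  by (induction n arbitrary: P) auto

lemma chain_to_extend:
  assumes "chain_to {Q \<in> S. U \<subseteq> Q} n P" "U \<in> S" "V \<in> S" "V \<subset> U"
  shows "chain_to {Q \<in> S. V \<subseteq> Q} (Suc n) P"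
  using assms(1)
proof (induction n arbitrary: P)
  case 0
  then show ?case using assms by auto
next
  case (Suc n)
  then obtain Q where "Q \<subset> P" "chain_to {Q \<in> S. U \<subseteq> Q} n Q" "P \<in> S" "U \<subseteq> P" by auto
  then show ?case using Suc.IH[of Q] assms by auto
qed

definition Spec :: "('a, 'm) ring_scheme \<Rightarrow> 'a set set" where
  "Spec R = {P. prime_in R (carrier R) P}"

context cring begin

text \<open>The special chain theorem in one variable. Let \<open>Q\<close> be the member just below
  \<open>P\<close>. If both contract to the same prime of \<open>D\<close>, then \<open>Q\<close> is
  already extended from \<open>D\<close>. Otherwise the chain obtained for \<open>Q\<close> by
  induction is prolonged by the step between the two extended primes.\<close>

lemma chain_adjoin:
  assumes D: "subring D R" and z: "z \<in> carrier R" "z \<notin> cl R {\<zero>} D" and E: "adjoin R D z = carrier R"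
    and P: "chain_to (Spec R) m P"
  shows "P = adjoin R (P \<inter> D) z \<or> chain_to (Spec R) (m - 1) (adjoin R (P \<inter> D) z)"
  using P
proof (induction m arbitrary: P)
  case 0
  then have "prime_in R D (P \<inter> D)" using prime_in_contract[OF _ D subringE(1)[OF D]] by (simp add: Spec_def)
  then show ?case using prime_in_adjoin[OF D _ z] E by (auto simp: Spec_def)
next
  case (Suc m)
  then obtain Q where Q: "Q \<subset> P" "chain_to (Spec R) m Q" by auto
  have pr: "prime_in R (carrier R) P" "prime_in R (carrier R) Q" using Suc.prems chain_to_mem[OF Q(2)] by (auto simp: Spec_def)
  have prD: "prime_in R D (P \<inter> D)" using prime_in_contract[OF pr(1) D subringE(1)[OF D]] .
  have qS: "adjoin R (P \<inter> D) z \<in> Spec R" using prime_in_adjoin[OF D prD z] E by (auto simp: Spec_def)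
  show ?case
  proof (cases "Q \<inter> D = P \<inter> D")
    case True
    \<comment> \<open>Otherwise all of \<open>D[z]\<close> is algebraic over \<open>D\<close> modulo
      \<open>Q\<close>, and incomparability would separate the contractions of \<open>Q\<close> and
      \<open>P\<close>.\<close>
    have "z \<notin> cl R Q D"
    proof
      assume zc: "z \<in> cl R Q D"
      have "adjoin R D z \<subseteq> cl R Q D" by (intro adjoin_least cl_subring[OF pr(2) D] cl_base[OF pr(2) D] zc)
      moreover obtain x where "x \<in> P" "x \<notin> Q" using Q by blast
      moreover have "x \<in> carrier R" using prime_inD(1)[OF pr(1)] \<open>x \<in> P\<close> by auto
      ultimately obtain c where "c \<in> D" "c \<in> P" "c \<notin> Q"
        using incomparability[OF pr(2,1), of x D] Q E subringE(1)[OF D] by blast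
      then show False using True by blast
    qed
    then have "Q = adjoin R (Q \<inter> D) z" using adjoin_contract[OF pr(2) z(1)] E prime_inD(1)[OF pr(2)] by blast
    then show ?thesis using True Q by simp
  next
    case False
    then have lt: "Q \<inter> D \<subset> P \<inter> D" using Q by auto
    have eqs: "adjoin R (Q \<inter> D) z \<inter> D = Q \<inter> D" "adjoin R (P \<inter> D) z \<inter> D = P \<inter> D"
      using prime_inD(2)[OF pr(1)] prime_inD(2)[OF pr(2)] subringE(2)[OF D]
      by (simp_all add: adjoin_Int_base[OF D z])
    have "adjoin R (Q \<inter> D) z \<noteq> adjoin R (P \<inter> D) z" 
      using eqs lt by (metis less_irrefl)
    moreover have "adjoin R (Q \<inter> D) z \<subseteq> adjoin R (P \<inter> D) z" by (rule adjoin_mono) (use lt in blast)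
    ultimately have lt': "adjoin R (Q \<inter> D) z \<subset> adjoin R (P \<inter> D) z" by (simp add: psubset_eq)
    from Suc.IH[OF Q(2)] have "chain_to (Spec R) (m - 1) (adjoin R (Q \<inter> D) z)"
      using Q(2) chain_to_le[of "Spec R" m _ "m - 1"] by auto
    \<comment> \<open>The required length is \<open>m\<close>; for \<open>m = 0\<close> the
      truncated subtraction makes \<open>Suc (m - 1)\<close> one larger, which does no harm.\<close>
    then have "chain_to (Spec R) (Suc (m - 1)) (adjoin R (P \<inter> D) z)" using lt' qS by auto
    then show ?thesis using chain_to_le[of "Spec R" "Suc (m - 1)" _ m] by auto
  qed
qed

text \<open>A variable free modulo \<open>P\<close> over the earlier ones costs nothing, since
  contracting \<open>P\<close> commutes with adjoining it; each other variable costs at most one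
  step by \<open>chain_adjoin\<close>.\<close>

lemma chain_adjoins:
  assumes "subring D R" "set zs \<subseteq> carrier R" "indep R D zs" "adjoins R D zs = carrier R" "chain_to (Spec R) m P"
  shows "chain_to (Spec R) (m - (length zs - crk R P D zs)) (adjoins R (P \<inter> D) zs)"
  using assms
proof (induction zs arbitrary: D)
  case Nil
  have "P \<subseteq> carrier R" using chain_to_mem[OF Nil(5)] prime_inD(1)[of R "carrier R" P] by (auto simp: Spec_def)
  then show ?case using Nil by (simp add: Int_absorb2)
next
  case (Cons z zs)
  note D = Cons.prems(1)
  have z: "z \<in> carrier R" "z \<notin> cl R {\<zero>} D" "set zs \<subseteq> carrier R" and iz: "indep R (adjoin R D z) zs" using Cons.prems by auto
  have pr: "prime_in R (carrier R) P" using chain_to_mem[OF Cons.prems(5)] by (simp add: Spec_def)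
  have S: "subring (adjoin R D z) R" by (rule adjoin_subring[OF D z(1)])
  have IH: "chain_to (Spec R) (m - (length zs - crk R P (adjoin R D z) zs)) (adjoins R (P \<inter> adjoin R D z) zs)"
    using Cons.IH[OF S z(3) iz] Cons.prems by auto
  show ?case
  proof (cases "z \<in> cl R P D")
    case False
    then show ?thesis using IH adjoin_contract[OF pr z(1) False] by simp
  next
    case True
    let ?D = "adjoins R D zs" and ?P = "adjoins R (P \<inter> adjoin R D z) zs" and ?q = "adjoins R (P \<inter> D) zs"
    \<comment> \<open>\<open>D[z][zs]\<close> is reread as \<open>D[zs][z]\<close>: after the
      induction has treated \<open>zs\<close>, the ring is a polynomial ring in the single variable
      \<open>z\<close> over \<open>?D\<close>, and \<open>?P\<close> contracts to \<open>?q\<close>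
      there.\<close>
    have rot: "indep R D zs" "z \<notin> cl R {\<zero>} ?D" using indep_rotate[OF D z(1,3,2) iz] by auto
    have a: "adjoin R ?D z = carrier R" using Cons.prems(4) adjoins_adjoin[OF subring_add_closed[OF D] z(1,3)] by simp
    have Dz: "D \<subseteq> adjoin R D z" using adjoin_base[OF subring_add_closed[OF D] z(1)] .
    have "?P \<inter> ?D = adjoins R (P \<inter> adjoin R D z \<inter> D) zs"
      using prime_inD(2)[OF pr] subringE(2)[OF S] subringE(2)[OF D] Dz
      by (intro adjoins_Int[OF S z(3) iz]) auto
    also have "P \<inter> adjoin R D z \<inter> D = P \<inter> D" using Dz by auto
    finally have PD: "?P \<inter> ?D = ?q" .
    have "add_closed R (P \<inter> D)"
      using prime_in_add_closed[OF prime_in_contract[OF pr D subringE(1)[OF D]] subringE(1)[OF D]] .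
    then have q: "adjoin R ?q z = adjoins R (P \<inter> D) (z # zs)" using adjoins_adjoin[of "P \<inter> D" z zs] z by simp
    have "?P = adjoin R ?q z \<or> chain_to (Spec R) (m - (length zs - crk R P (adjoin R D z) zs) - 1) (adjoin R ?q z)"
      using chain_adjoin[OF adjoins_subring[OF D z(3)] z(1) rot(2) a IH] PD by simp
    then have "chain_to (Spec R) (m - (length zs - crk R P (adjoin R D z) zs) - 1) (adjoin R ?q z)"
      by (metis IH diff_le_self chain_to_le)
    moreover have "m - (length zs - crk R P (adjoin R D z) zs) - 1 = m - (length (z # zs) - crk R P D (z # zs))"
      using True crk_le_length[of R P "adjoin R D z" zs] by simp
    ultimately show ?thesis using q by simp
  qed
qed

text \<open>The loss allowed in \<open>chain_adjoins\<close> does occur: for each variable algebraic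
  over the earlier ones modulo \<open>P\<close>, the contraction of \<open>P\<close> is strictly
  larger than the extended prime, which gives one more member at the bottom.\<close>

lemma chain_above_adjoins:
  assumes "subring D R" "set zs \<subseteq> carrier R" "indep R D zs" "adjoins R D zs = carrier R" "P \<in> Spec R"
  shows "chain_to {Q \<in> Spec R. adjoins R (P \<inter> D) zs \<subseteq> Q} (length zs - crk R P D zs) P"
  using assms
proof (induction zs arbitrary: D)
  case Nil
  then show ?case by auto
next
  case (Cons z zs)
  note D = Cons.prems(1)
  have z: "z \<in> carrier R" "z \<notin> cl R {\<zero>} D" "set zs \<subseteq> carrier R" and iz: "indep R (adjoin R D z) zs" using Cons.prems by auto
  have pr: "prime_in R (carrier R) P" using Cons.prems by (simp add: Spec_def)
  have S: "subring (adjoin R D z) R" by (rule adjoin_subring[OF D z(1)])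
  let ?q = "P \<inter> adjoin R D z"
  have IH: "chain_to {Q \<in> Spec R. adjoins R ?q zs \<subseteq> Q} (length zs - crk R P (adjoin R D z) zs) P"
    using Cons.IH[OF S z(3) iz] Cons.prems by auto
  show ?case
  proof (cases "z \<in> cl R P D")
    case False
    then show ?thesis using IH adjoin_contract[OF pr z(1) False] by simp
  next
    case True
    have qq: "prime_in R (adjoin R D z) ?q" by (rule prime_in_contract[OF pr S subringE(1)[OF S]])
    have q: "prime_in R D (P \<inter> D)" by (rule prime_in_contract[OF pr D subringE(1)[OF D]])
    have q': "prime_in R (adjoin R D z) (adjoin R (P \<inter> D) z)" by (rule prime_in_adjoin[OF D q z(1,2)])
    \<comment> \<open>A relation witnessing algebraicity of \<open>z\<close> has its value in
      \<open>?q\<close> but not all of its coefficients in \<open>P\<close>; uniqueness of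
      coefficients keeps that value out of the extended prime.\<close>
    have "adjoin R (P \<inter> D) z \<noteq> ?q"
    proof
      assume e: "adjoin R (P \<inter> D) z = ?q"
      obtain cs where cs: "set cs \<subseteq> D" "horner R cs z \<in> P" "\<not> set cs \<subseteq> P" using True by (auto simp: cl_def)
      then have "horner R cs z \<in> ?q" by (auto simp: adjoin_def)
      then have "horner R cs z \<in> adjoin R (P \<inter> D) z" using e by simp
      then obtain ds where ds: "set ds \<subseteq> P \<inter> D" "horner R cs z = horner R ds z" unfolding adjoin_def by blast
      have "set cs \<subseteq> D \<inter> P"
        using horner_unique[OF subring_add_closed[OF D] subringE(5)[OF D] z(1,2), of D P cs ds] cs ds
          subringE(2)[OF D] prime_inD(2)[OF pr] by auto
      then show False using cs by auto
    qed
    then have lt0: "adjoin R (P \<inter> D) z \<subset> ?q" using adjoin_contract_le[OF pr z(1), of D] by (simp add: psubset_eq)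
    have eqs: "adjoins R (adjoin R (P \<inter> D) z) zs \<inter> adjoin R D z = adjoin R (P \<inter> D) z" "adjoins R ?q zs \<inter> adjoin R D z = ?q"
      using adjoins_Int_base[OF S z(3) iz] prime_inD(1,2)[OF q'] prime_inD(1,2)[OF qq] by simp_all
    have "adjoins R (adjoin R (P \<inter> D) z) zs \<noteq> adjoins R ?q zs" 
      using eqs lt0 by (metis less_irrefl)
    moreover have "adjoins R (adjoin R (P \<inter> D) z) zs \<subseteq> adjoins R ?q zs" by (rule adjoins_mono) (use lt0 in blast)
    ultimately have lt: "adjoins R (adjoin R (P \<inter> D) z) zs \<subset> adjoins R ?q zs" by (simp add: psubset_eq)
    have "adjoins R ?q zs \<in> Spec R" "adjoins R (adjoin R (P \<inter> D) z) zs \<in> Spec R"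
      using prime_in_adjoins[OF S z(3) iz] q' qq Cons.prems(4) by (auto simp: Spec_def)
    then have "chain_to {Q \<in> Spec R. adjoins R (adjoin R (P \<inter> D) z) zs \<subseteq> Q} (Suc (length zs - crk R P (adjoin R D z) zs)) P"
      using chain_to_extend[OF IH _ _ lt] by blast
    moreover have "Suc (length zs - crk R P (adjoin R D z) zs) = length (z # zs) - crk R P D (z # zs)"
      using True crk_le_length[of R P "adjoin R D z" zs] by simp
    ultimately show ?thesis by simp
  qed
qed

end

section \<open>Going down in tensor products\<close>

primrec lc :: "('a, 'm) ring_scheme \<Rightarrow> ('a \<times> 'a) list \<Rightarrow> 'a" where
  "lc R [] = \<zero>\<^bsub>R\<^esub>"
| "lc R (ad # ps) = fst ad \<otimes>\<^bsub>R\<^esub> snd ad \<oplus>\<^bsub>R\<^esub> lc R ps"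

text \<open>Two instances matter: \<open>lcs R p (carrier R)\<close> is the extended ideal
  \<open>pR\<close>, and \<open>lcs R A Q\<close> will turn out to be \<open>QR\<close>. Finite
  lists of pairs keep the number of terms available for induction.\<close>

definition lcs :: "('a, 'm) ring_scheme \<Rightarrow> 'a set \<Rightarrow> 'a set \<Rightarrow> 'a set" where
  "lcs R U V = {lc R ps | ps. set ps \<subseteq> U \<times> V}"

context cring begin

lemma lc_closed [simp]: "set ps \<subseteq> carrier R \<times> carrier R \<Longrightarrow> lc R ps \<in> carrier R"
  by (induction ps) auto

lemma lc_append:
  "set ps \<subseteq> carrier R \<times> carrier R \<Longrightarrow> set qs \<subseteq> carrier R \<times> carrier R \<Longrightarrow> lc R (ps @ qs) = lc R ps \<oplus> lc R qs"
  by (induction ps) (auto simp: a_assoc)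

lemma zip_closed: "set as \<subseteq> U \<Longrightarrow> set ds \<subseteq> V \<Longrightarrow> set (zip as ds) \<subseteq> U \<times> V"
  by (auto dest: set_zip_leftD set_zip_rightD)

lemma lc_zip_add:
  assumes "length as = length ds" "length ds = length es" "set as \<subseteq> carrier R" "set ds \<subseteq> carrier R" "set es \<subseteq> carrier R"
  shows "lc R (zip as (map2 (\<oplus>) ds es)) = lc R (zip as ds) \<oplus> lc R (zip as es)"
  using assms
proof (induction as ds es rule: list_induct3)
  case (Cons a as d ds e es)
  have "lc R (zip as ds) \<in> carrier R" "lc R (zip as es) \<in> carrier R"
    using Cons.prems by (intro lc_closed zip_closed; auto)+
  then show ?case using Cons by (simp add: r_distr a_ac)
qed simp

lemma lc_zip_closed:
  assumes "set as \<subseteq> carrier R" "set ds \<subseteq> carrier R" shows "lc R (zip as ds) \<in> carrier R"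
  by (rule lc_closed[OF zip_closed[OF assms]])

lemma lc_zip_smult_right:
  assumes "length as = length ds" "set as \<subseteq> carrier R" "set ds \<subseteq> carrier R" "c \<in> carrier R"
  shows "lc R (zip as (map ((\<otimes>) c) ds)) = c \<otimes> lc R (zip as ds)"
  using assms
proof (induction as ds rule: list_induct2)
  case (Cons a as d ds)
  then show ?case using lc_zip_closed[of as ds] by (simp add: r_distr m_lcomm)
qed simp

lemma lc_zip_smult_left:
  assumes "length as = length ds" "set as \<subseteq> carrier R" "set ds \<subseteq> carrier R" "c \<in> carrier R"
  shows "lc R (zip (map ((\<otimes>) c) as) ds) = c \<otimes> lc R (zip as ds)"
  using assms
proof (induction as ds rule: list_induct2)
  case (Cons a as d ds)
  then show ?case using lc_zip_closed[of as ds] by (simp add: r_distr m_assoc)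
qed simp

lemmas lc_zip_smult = lc_zip_smult_right lc_zip_smult_left

lemma lc_smult:
  assumes "set ps \<subseteq> carrier R \<times> carrier R" "c \<in> carrier R"
  shows "c \<otimes> lc R ps = lc R (map (\<lambda>(a, d). (c \<otimes> a, d)) ps)" "c \<otimes> lc R ps = lc R (map (\<lambda>(a, d). (a, c \<otimes> d)) ps)"
  using assms by (induction ps) (auto simp: r_distr m_assoc m_lcomm)

lemma lcs_closed: "U \<subseteq> carrier R \<Longrightarrow> V \<subseteq> carrier R \<Longrightarrow> lcs R U V \<subseteq> carrier R"
proof -
  assume h: "U \<subseteq> carrier R" "V \<subseteq> carrier R"
  have "lc R ps \<in> carrier R" if "set ps \<subseteq> U \<times> V" for ps
    by (rule lc_closed) (use that h in blast)
  then show ?thesis by (auto simp: lcs_def)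
qed

lemma lcs_add:
  assumes "U \<subseteq> carrier R" "V \<subseteq> carrier R" "x \<in> lcs R U V" "y \<in> lcs R U V" shows "x \<oplus> y \<in> lcs R U V"
proof -
  obtain ps qs where ps: "set ps \<subseteq> U \<times> V" "x = lc R ps" and qs: "set qs \<subseteq> U \<times> V" "y = lc R qs"
    using assms(3,4) by (auto simp: lcs_def)
  have "U \<times> V \<subseteq> carrier R \<times> carrier R" using assms by blast
  then have "x \<oplus> y = lc R (ps @ qs)" using ps qs lc_append[of ps qs] by simp
  moreover have "set (ps @ qs) \<subseteq> U \<times> V" using ps qs by auto
  ultimately show ?thesis unfolding lcs_def by blast
qed

lemma lcs_zero: "\<zero> \<in> lcs R U V"
  unfolding lcs_def by (rule CollectI, rule exI[of _ "[]"]) simp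

lemma lcs_single:
  assumes "U \<subseteq> carrier R" "V \<subseteq> carrier R" "u \<in> U" "v \<in> V" shows "u \<otimes> v \<in> lcs R U V"
  unfolding lcs_def using assms by (intro CollectI exI[of _ "[(u, v)]"]) (auto simp: subset_iff)

lemma lcs_smult:
  assumes "U \<subseteq> carrier R" "V \<subseteq> carrier R" "c \<in> carrier R" "x \<in> lcs R U V"
  shows "(\<And>u. u \<in> U \<Longrightarrow> c \<otimes> u \<in> U) \<Longrightarrow> c \<otimes> x \<in> lcs R U V" "(\<And>v. v \<in> V \<Longrightarrow> c \<otimes> v \<in> V) \<Longrightarrow> c \<otimes> x \<in> lcs R U V"
proof -
  obtain ps where ps: "set ps \<subseteq> U \<times> V" "x = lc R ps" using assms(4) by (auto simp: lcs_def)
  have car: "set ps \<subseteq> carrier R \<times> carrier R" using ps assms by blast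
  show "c \<otimes> x \<in> lcs R U V" if "\<And>u. u \<in> U \<Longrightarrow> c \<otimes> u \<in> U"
    unfolding lcs_def ps(2) lc_smult(1)[OF car assms(3)] using ps(1) that
    by (intro CollectI exI[of _ "map (\<lambda>(a, d). (c \<otimes> a, d)) ps"]) auto
  show "c \<otimes> x \<in> lcs R U V" if "\<And>v. v \<in> V \<Longrightarrow> c \<otimes> v \<in> V"
    unfolding lcs_def ps(2) lc_smult(2)[OF car assms(3)] using ps(1) that
    by (intro CollectI exI[of _ "map (\<lambda>(a, d). (a, c \<otimes> d)) ps"]) auto
qed

text \<open>Krull's argument: among the ideals that contain \<open>J\<close> and miss the
  multiplicative set \<open>S\<close>, a maximal one is prime, for two elements outside it would
  yield two members of \<open>S\<close> whose product lies in it.\<close>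

lemma prime_avoidance:
  assumes J: "add_closed R J" "\<And>r x. r \<in> carrier R \<Longrightarrow> x \<in> J \<Longrightarrow> r \<otimes> x \<in> J"
    and S: "S \<subseteq> carrier R" "\<one> \<in> S" "\<And>x y. x \<in> S \<Longrightarrow> y \<in> S \<Longrightarrow> x \<otimes> y \<in> S" "J \<inter> S = {}"
  obtains P where "prime_in R (carrier R) P" "J \<subseteq> P" "P \<inter> S = {}"
proof -
  define good where "good I \<longleftrightarrow> add_closed R I \<and> (\<forall>r\<in>carrier R. \<forall>x\<in>I. r \<otimes> x \<in> I) \<and> J \<subseteq> I \<and> I \<inter> S = {}" for I
  have "\<exists>M\<in>Collect good. \<forall>I\<in>Collect good. M \<subseteq> I \<longrightarrow> I = M"
  proof (rule subset_Zorn_nonempty)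
    show "Collect good \<noteq> {}" using J S by (auto simp: good_def)
    fix C assume C: "C \<noteq> {}" "subset.chain (Collect good) C"
    then have g: "good I" if "I \<in> C" for I using that by (auto simp: subset_chain_def)
    have add: "x \<oplus> y \<in> \<Union>C" if xy: "x \<in> \<Union>C" "y \<in> \<Union>C" for x y
    proof -
      obtain I I' where I: "I \<in> C" "x \<in> I" "I' \<in> C" "y \<in> I'" using xy by blast
      then have "I \<subseteq> I' \<or> I' \<subseteq> I" using C(2) by (auto simp: subset_chain_def)
      then obtain I0 where "I0 \<in> C" "x \<in> I0" "y \<in> I0" using I by blast
      then show ?thesis using g[of I0] by (auto simp: good_def add_closed_def)
    qed
    have "\<zero> \<in> \<Union>C" "\<Union>C \<subseteq> carrier R" "J \<subseteq> \<Union>C" "\<Union>C \<inter> S = {}" using C(1) g unfolding good_def add_closed_def by blast+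
    moreover have "\<forall>r\<in>carrier R. \<forall>x\<in>\<Union>C. r \<otimes> x \<in> \<Union>C" using g unfolding good_def by blast
    ultimately show "\<Union>C \<in> Collect good" using add by (auto simp: good_def add_closed_def)
  qed
  then obtain M where M: "good M" "\<And>I. good I \<Longrightarrow> M \<subseteq> I \<Longrightarrow> I = M" by blast
  have Mc: "M \<subseteq> carrier R" and M0: "\<zero> \<in> M" and MJ: "J \<subseteq> M" and MS: "M \<inter> S = {}"
    and Ma: "\<And>x y. x \<in> M \<Longrightarrow> y \<in> M \<Longrightarrow> x \<oplus> y \<in> M"
    and Mm: "\<And>r x. r \<in> carrier R \<Longrightarrow> x \<in> M \<Longrightarrow> r \<otimes> x \<in> M"
    using M(1) by (auto simp: good_def add_closed_def)
  have ext: "\<exists>m\<in>M. \<exists>r\<in>carrier R. m \<oplus> r \<otimes> x \<in> S" if x: "x \<in> carrier R" "x \<notin> M" for x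
  proof (rule ccontr)
    assume no: "\<not> (\<exists>m\<in>M. \<exists>r\<in>carrier R. m \<oplus> r \<otimes> x \<in> S)"
    define I where "I = {m \<oplus> r \<otimes> x | m r. m \<in> M \<and> r \<in> carrier R}"
    have II: "y \<in> I" if "m \<in> M" "r \<in> carrier R" "y = m \<oplus> r \<otimes> x" for m r y unfolding I_def using that by blast
    have MI: "M \<subseteq> I"
    proof
      fix m assume m: "m \<in> M"
      then have "m \<in> carrier R" using Mc by auto
      then show "m \<in> I" using x by (intro II[OF m zero_closed]) simp
    qed
    have xI: "x \<in> I" using x by (intro II[OF M0 one_closed]) simp
    have add: "a \<oplus> b \<in> I" if ab: "a \<in> I" "b \<in> I" for a b
    proof -
      obtain m r where h: "m \<in> M" "r \<in> carrier R" "a = m \<oplus> r \<otimes> x" using ab(1) unfolding I_def by blast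
      obtain m' r' where h': "m' \<in> M" "r' \<in> carrier R" "b = m' \<oplus> r' \<otimes> x" using ab(2) unfolding I_def by blast
      have car: "m \<in> carrier R" "m' \<in> carrier R" using h h' Mc by auto
      show ?thesis
      proof (rule II)
        show "a \<oplus> b = (m \<oplus> m') \<oplus> (r \<oplus> r') \<otimes> x" using h h' car x by (simp add: l_distr a_ac)
      qed (use h h' Ma in auto)
    qed
    have mul: "s \<otimes> a \<in> I" if s: "s \<in> carrier R" and a: "a \<in> I" for s a
    proof -
      obtain m r where h: "m \<in> M" "r \<in> carrier R" "a = m \<oplus> r \<otimes> x" using a unfolding I_def by blast
      have car: "m \<in> carrier R" using h Mc by auto
      show ?thesis
      proof (rule II)
        show "s \<otimes> a = s \<otimes> m \<oplus> (s \<otimes> r) \<otimes> x" using h car x s by (simp add: r_distr m_assoc)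
      qed (use h Mm s in auto)
    qed
    have "I \<subseteq> carrier R" using Mc x unfolding I_def by auto
    moreover have "I \<inter> S = {}" using no unfolding I_def by blast
    moreover have "\<zero> \<in> I" "J \<subseteq> I" using M0 MI MJ by auto
    ultimately have "good I" using add mul by (simp add: good_def add_closed_def)
    then show False using M(2) MI xI x by blast
  qed
  have "prime_in R (carrier R) M" unfolding prime_in_def
  proof (intro conjI ballI impI)
    show "\<one> \<notin> M" using MS S by blast
    fix x y assume xy: "x \<in> carrier R" "y \<in> carrier R" "x \<otimes> y \<in> M"
    show "x \<in> M \<or> y \<in> M"
    proof (rule ccontr)
      assume no: "\<not> (x \<in> M \<or> y \<in> M)"
      obtain m r where h: "m \<in> M" "r \<in> carrier R" "m \<oplus> r \<otimes> x \<in> S" using ext[of x] xy no by blast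
      obtain n s where h': "n \<in> M" "s \<in> carrier R" "n \<oplus> s \<otimes> y \<in> S" using ext[of y] xy no by blast
      have car: "m \<in> carrier R" "n \<in> carrier R" using h h' Mc by auto
      have "(m \<oplus> r \<otimes> x) \<otimes> (n \<oplus> s \<otimes> y) = (n \<oplus> s \<otimes> y) \<otimes> m \<oplus> ((r \<otimes> x) \<otimes> n \<oplus> (r \<otimes> s) \<otimes> (x \<otimes> y))"
        using h h' car xy by (simp add: l_distr r_distr m_ac a_ac)
      moreover have "(n \<oplus> s \<otimes> y) \<otimes> m \<in> M" "(r \<otimes> x) \<otimes> n \<in> M" "(r \<otimes> s) \<otimes> (x \<otimes> y) \<in> M"
        using h h' car xy by (auto intro!: Mm)
      ultimately have "(m \<oplus> r \<otimes> x) \<otimes> (n \<oplus> s \<otimes> y) \<in> M" using Ma by simp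
      then show False using S(3)[OF h(3) h'(3)] MS by blast
    qed
  qed (use Mc M0 Ma Mm in auto)
  then show thesis using that MJ MS by blast
qed

lemma lc_in_prime:
  assumes "prime_in R (carrier R) P" "set ps \<subseteq> carrier R \<times> carrier R" "\<And>a d. (a, d) \<in> set ps \<Longrightarrow> a \<in> P \<or> d \<in> P"
  shows "lc R ps \<in> P"
  using assms(2,3)
proof (induction ps)
  case Nil
  then show ?case using prime_inD(2)[OF assms(1)] by simp
next
  case (Cons ad ps)
  obtain a d where ad: "ad = (a, d)" by (cases ad)
  then have c: "a \<in> carrier R" "d \<in> carrier R" "a \<in> P \<or> d \<in> P" using Cons.prems by auto
  then have "a \<otimes> d \<in> P" using prime_inD(5)[OF assms(1), of a d] prime_inD(5)[OF assms(1), of d a] by (auto simp: m_comm)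
  then show ?case using Cons ad prime_inD(4)[OF assms(1)] by auto
qed

end

text \<open>The functionals \<open>\<phi>\<close> stand for the maps \<open>id \<otimes> f\<close> from \<open>A \<otimes> B\<close> to
  \<open>A\<close>, where \<open>f\<close> ranges over the linear forms on \<open>B\<close>.\<close>

locale tensor_pair = cring +
  fixes k A B :: "'a set" and F :: "('a \<Rightarrow> 'a) set"
  assumes subr: "subring k R" "subring A R" "subring B R" "k \<subseteq> A" "k \<subseteq> B"
    and k_inv: "\<And>c. c \<in> k \<Longrightarrow> c \<noteq> \<zero> \<Longrightarrow> \<exists>d\<in>k. c \<otimes> d = \<one>"
    and gen: "carrier R \<subseteq> lcs R A B"
    and F_closed: "\<And>\<phi> t. \<phi> \<in> F \<Longrightarrow> t \<in> carrier R \<Longrightarrow> \<phi> t \<in> A"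
    and F_add: "\<And>\<phi> s t. \<phi> \<in> F \<Longrightarrow> s \<in> carrier R \<Longrightarrow> t \<in> carrier R \<Longrightarrow> \<phi> (s \<oplus> t) = \<phi> s \<oplus> \<phi> t"
    and F_smult: "\<And>\<phi> a t. \<phi> \<in> F \<Longrightarrow> a \<in> A \<Longrightarrow> t \<in> carrier R \<Longrightarrow> \<phi> (a \<otimes> t) = a \<otimes> \<phi> t"
    and F_base: "\<And>\<phi> b. \<phi> \<in> F \<Longrightarrow> b \<in> B \<Longrightarrow> \<phi> b \<in> k"
    and F_sep: "\<And>t. t \<in> carrier R \<Longrightarrow> (\<And>\<phi>. \<phi> \<in> F \<Longrightarrow> \<phi> t = \<zero>) \<Longrightarrow> t = \<zero>"
begin

lemma Ac: "A \<subseteq> carrier R" and Bc: "B \<subseteq> carrier R" 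
  using subringE(1)[OF subr(2)] subringE(1)[OF subr(3)] .

lemma F_zero: "\<phi> \<in> F \<Longrightarrow> \<phi> \<zero> = \<zero>"
  using F_smult[of \<phi> \<zero> \<zero>] F_closed[of \<phi> \<zero>] subringE(2)[OF subr(2)] Ac by auto

lemma F_lc:
  assumes "\<phi> \<in> F" "length as = length ds" "set as \<subseteq> A" "set ds \<subseteq> carrier R"
  shows "\<phi> (lc R (zip as ds)) = lc R (zip as (map \<phi> ds))"
  using assms(2,3,4)
proof (induction as ds rule: list_induct2)
  case (Cons a as d ds)
  have "lc R (zip as ds) \<in> carrier R" using Cons.prems Ac by (intro lc_closed zip_closed; auto)
  then show ?case using Cons F_add[OF assms(1), of "a \<otimes> d"] F_smult[OF assms(1)] Ac by auto
qed (simp add: F_zero assms)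

lemma F_adjoins:
  assumes "\<phi> \<in> F" "set zs \<subseteq> A" "D \<subseteq> carrier R" "D' \<subseteq> carrier R" "\<And>d. d \<in> D \<Longrightarrow> \<phi> d \<in> D'" "x \<in> adjoins R D zs"
  shows "\<phi> x \<in> adjoins R D' zs"
  using assms(2-)
proof (induction zs arbitrary: D D')
  case (Cons z zs)
  have z: "z \<in> A" "z \<in> carrier R" using Cons.prems Ac by auto
  have h: "\<phi> (horner R cs z) = horner R (map \<phi> cs) z" if "set cs \<subseteq> carrier R" for cs
    using that
  proof (induction cs)
    case (Cons c cs)
    then show ?case using F_add[OF assms(1), of c "z \<otimes> horner R cs z"] F_smult[OF assms(1) z(1)] z by auto
  qed (simp add: F_zero assms)
  have "\<phi> d \<in> adjoin R D' z" if "d \<in> adjoin R D z" for d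
  proof -
    obtain cs where cs: "set cs \<subseteq> D" "d = horner R cs z" using \<open>d \<in> adjoin R D z\<close> by (auto simp: adjoin_def)
    have "\<phi> d = horner R (map \<phi> cs) z" using h[of cs] cs Cons.prems(2) by auto
    moreover have "set (map \<phi> cs) \<subseteq> D'" using cs Cons.prems(4) by auto
    ultimately show ?thesis unfolding adjoin_def by blast
  qed
  then show ?case using Cons.IH[of "adjoin R D z" "adjoin R D' z"] Cons.prems adjoin_closed z by auto
qed auto

text \<open>Being linear over \<open>A\<close>, a functional acts on the coefficients of a relation
  and sends them from \<open>B[zs]\<close> to \<open>k[zs]\<close>, where freeness of
  \<open>z\<close> makes them vanish. As the functionals separate elements, the coefficients were
  zero.\<close>

lemma cl_base_change:
  assumes "z \<in> A" "set zs \<subseteq> A" "z \<notin> cl R {\<zero>} (adjoins R k zs)"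
  shows "z \<notin> cl R {\<zero>} (adjoins R B zs)"
proof
  have z: "z \<in> carrier R" using assms Ac by auto
  assume "z \<in> cl R {\<zero>} (adjoins R B zs)"
  then obtain cs where cs: "set cs \<subseteq> adjoins R B zs" "horner R cs z = \<zero>" "\<not> set cs \<subseteq> {\<zero>}" by (auto simp: cl_def)
  have car: "set cs \<subseteq> carrier R" using cs subringE(1)[OF adjoins_subring[OF subr(3)]] assms(2) Ac by blast
  have "c = \<zero>" if "c \<in> set cs" for c
  proof (rule F_sep)
    show "c \<in> carrier R" using that car by auto
    fix \<phi> assume \<phi>: "\<phi> \<in> F"
    have h: "\<phi> (horner R cs z) = horner R (map \<phi> cs) z" using car
    proof (induction cs)
      case (Cons c cs)
      then show ?case using F_add[OF \<phi>, of c "z \<otimes> horner R cs z"] F_smult[OF \<phi> assms(1)] z by auto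
    qed (simp add: F_zero \<phi>)
    have "\<phi> c' \<in> adjoins R k zs" if "c' \<in> set cs" for c'
      using F_adjoins[OF \<phi> assms(2), of B k c'] F_base[OF \<phi>] Bc subringE(1)[OF subr(1)] cs(1) that by blast
    then have "set (map \<phi> cs) \<subseteq> {\<zero>}"
      using h cs(2) F_zero[OF \<phi>] by (intro not_clD[OF assms(3) z]) auto
    then show "\<phi> c = \<zero>" using that by auto
  qed
  then show False using cs(3) by auto
qed

end

text \<open>For \<open>zs\<close> in \<open>A\<close>, the ring \<open>R\<close> is also the tensor
  product of \<open>A\<close> and \<open>C = B[zs]\<close> over \<open>K0 = k[zs]\<close>, and
  \<open>FC\<close> is what remains of this fact: the functionals restrict to
  \<open>K0\<close>-linear forms on \<open>C\<close>. The conditions on \<open>p\<close> and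
  \<open>Q\<close> say that these primes survive when the nonzero elements of \<open>K0\<close> are
  inverted.\<close>

locale tensor_relative = tensor_pair +
  fixes K0 C p Q :: "'a set"
  assumes K0: "subring K0 R" "K0 \<subseteq> A" "K0 \<subseteq> C" and C: "subring C R" "B \<subseteq> C"
    and FC: "\<And>\<phi> c. \<phi> \<in> F \<Longrightarrow> c \<in> C \<Longrightarrow> \<phi> c \<in> K0"
    and p: "prime_in R A p" "p \<inter> K0 = {\<zero>}"
    and Q: "prime_in R C Q" "Q \<inter> K0 = {\<zero>}"
begin

text \<open>Linear independence over \<open>K0\<close> of the residue classes in \<open>A/p\<close>.
  Denominators can be cleared, so it amounts to independence over the fraction field of
  \<open>K0\<close>.\<close>

definition lin :: "'a list \<Rightarrow> bool" where
  "lin as \<longleftrightarrow> set as \<subseteq> A \<and> (\<forall>rs. length rs = length as \<longrightarrow> set rs \<subseteq> K0 \<longrightarrow> lc R (zip as rs) \<in> p \<longrightarrow> set rs \<subseteq> {\<zero>})"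

definition J where "J = {u \<oplus> v | u v. u \<in> lcs R p (carrier R) \<and> v \<in> lcs R A Q}"

lemma cars: "p \<subseteq> carrier R" "Q \<subseteq> carrier R" "K0 \<subseteq> carrier R" "C \<subseteq> carrier R" "p \<subseteq> A" "Q \<subseteq> C"
  using prime_inD(1)[OF p(1)] prime_inD(1)[OF Q(1)] Ac subringE(1)[OF C(1)] subringE(1)[OF K0(1)] by auto

lemma K0_domain: "r \<in> K0 - {\<zero>} \<Longrightarrow> s \<in> K0 - {\<zero>} \<Longrightarrow> r \<otimes> s \<in> K0 - {\<zero>}"
  using prime_inD(2)[OF p(1)] prime_inD(6)[OF p(1), of r s] subringE(6)[OF K0(1), of r s] K0(2) p(2) by blast

lemma one_K0: "\<one> \<in> K0 - {\<zero>}"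
  using prime_inD(2,3)[OF p(1)] subringE(3)[OF K0(1)] by auto

lemma not_lin:
  assumes "a \<in> A" "lin as" "\<not> lin (a # as)"
  obtains r rs where "r \<in> K0 - {\<zero>}" "set rs \<subseteq> K0" "length rs = length as" "r \<otimes> a \<oplus> lc R (zip as rs) \<in> p"
proof -
  obtain rs' where h: "length rs' = Suc (length as)" "set rs' \<subseteq> K0" "lc R (zip (a # as) rs') \<in> p" "\<not> set rs' \<subseteq> {\<zero>}"
    using assms by (auto simp: lin_def)
  then obtain r rs where rr: "rs' = r # rs" by (cases rs') auto
  have as: "set as \<subseteq> A" using assms by (auto simp: lin_def)
  have car: "r \<in> carrier R" "a \<in> carrier R" using h rr cars assms Ac by auto
  have "lc R (zip as rs) \<in> carrier R" using h rr cars as Ac by (intro lc_closed zip_closed; auto)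
  have "r \<noteq> \<zero>"
  proof
    assume "r = \<zero>"
    then have "lc R (zip as rs) \<in> p" using h(3) rr car \<open>lc R (zip as rs) \<in> carrier R\<close> by simp
    then have "set rs \<subseteq> {\<zero>}" using assms(2) h rr by (auto simp: lin_def)
    then show False using h(4) rr \<open>r = \<zero>\<close> by auto
  qed
  then show thesis using that[of r rs] h rr car by (auto simp: m_comm)
qed

lemma lcs_p_smult: "c \<in> carrier R \<Longrightarrow> x \<in> lcs R p (carrier R) \<Longrightarrow> c \<otimes> x \<in> lcs R p (carrier R)"
  by (rule lcs_smult(2)) (use cars in auto)

lemma lcs_p_add: "x \<in> lcs R p (carrier R) \<Longrightarrow> y \<in> lcs R p (carrier R) \<Longrightarrow> x \<oplus> y \<in> lcs R p (carrier R)"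
  by (rule lcs_add) (use cars in auto)

lemma lcs_p_closed: "x \<in> lcs R p (carrier R) \<Longrightarrow> x \<in> carrier R"
  using lcs_closed[of p "carrier R"] cars by auto

lemma lcs_p_minus: "x \<in> lcs R p (carrier R) \<Longrightarrow> \<ominus> x \<in> lcs R p (carrier R)"
  using lcs_p_smult[of "\<ominus> \<one>" x] lcs_p_closed[of x] by (simp add: l_minus)

lemma F_lcs_p:
  assumes "\<phi> \<in> F" "x \<in> lcs R p (carrier R)" shows "\<phi> x \<in> p"
proof -
  obtain ps where ps: "set ps \<subseteq> p \<times> carrier R" "x = lc R ps" using assms(2) by (auto simp: lcs_def)
  have "\<phi> (lc R ps) \<in> p" using ps(1)
  proof (induction ps)
    case Nil
    then show ?case using F_zero[OF assms(1)] prime_inD(2)[OF p(1)] by simp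
  next
    case (Cons ad ps)
    obtain a d where ad: "ad = (a, d)" by (cases ad)
    have c: "a \<in> p" "a \<in> A" "a \<in> carrier R" "d \<in> carrier R" using Cons.prems ad cars by auto
    have l: "lc R ps \<in> carrier R" by (rule lc_closed) (use Cons.prems cars in auto)
    have "\<phi> (lc R (ad # ps)) = \<phi> d \<otimes> a \<oplus> \<phi> (lc R ps)"
      using ad c l F_add[OF assms(1), of "a \<otimes> d" "lc R ps"] F_smult[OF assms(1), of a d] cars F_closed[OF assms(1) c(4)] Ac
      by (auto simp: m_comm)
    then show ?case using Cons prime_inD(4,5)[OF p(1)] F_closed[OF assms(1) c(4)] c by auto
  qed
  then show ?thesis using ps by simp
qed

lemma map2_linear_closed:
  assumes E: "subring E R" and h: "r \<in> E" "w \<in> E" "set ds \<subseteq> E" "set rs \<subseteq> E"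
  shows "set (map2 (\<oplus>) (map ((\<otimes>) r) ds) (map ((\<otimes>) w) rs)) \<subseteq> E"
proof
  fix x assume "x \<in> set (map2 (\<oplus>) (map ((\<otimes>) r) ds) (map ((\<otimes>) w) rs))"
  then obtain d e where de: "(d, e) \<in> set (zip ds rs)" "x = r \<otimes> d \<oplus> w \<otimes> e" by (auto simp: zip_map_map)
  then have "d \<in> E" "e \<in> E" using h set_zip_leftD[OF de(1)] set_zip_rightD[OF de(1)] by auto
  then show "x \<in> E" using h de(2) subringE(6,7)[OF E] by simp
qed

text \<open>Up to factors from \<open>K0\<close>, classes independent in \<open>A/p\<close> stay
  independent over \<open>C/Q\<close> in the tensor product of \<open>A/p\<close> and
  \<open>C/Q\<close> over \<open>K0\<close>. The terms of \<open>qs\<close> are moved to the left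
  one by one: an independent \<open>a\<close> joins the list \<open>as\<close>, a dependent one is
  eliminated.\<close>

lemma generic_freeness:
  assumes "lin as" "length ds = length as" "set ds \<subseteq> C" "u \<in> lcs R p (carrier R)" "set qs \<subseteq> A \<times> Q"
    "lc R (zip as ds) \<oplus> u = lc R qs"
  shows "\<exists>s\<in>K0 - {\<zero>}. \<forall>d\<in>set ds. s \<otimes> d \<in> Q"
  using assms
proof (induction "length qs" arbitrary: qs as ds u)
  case 0
  note Nil = 0(2-7)
  have Nil0: "qs = []" using 0 by simp
  have as: "set as \<subseteq> A" using Nil(1) by (auto simp: lin_def)
  have z: "lc R (zip as ds) \<in> carrier R" using Nil(1-3) cars as Ac by (intro lc_closed zip_closed; auto)
  \<comment> \<open>Once the right side is empty, a functional \<open>\<phi>\<close> gives a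
    relation of \<open>as\<close> modulo \<open>p\<close> with coefficients \<open>\<phi> d\<close>
    in \<open>K0\<close>. They vanish by independence, and then \<open>d\<close> vanishes by
    separation.\<close>
  have "d = \<zero>" if d: "d \<in> set ds" for d
  proof (rule F_sep)
    show "d \<in> carrier R" using d Nil(3) cars by auto
    fix \<phi> assume \<phi>: "\<phi> \<in> F"
    have "lc R (zip as ds) \<oplus> u = \<zero>" using Nil(6) Nil0 by simp
    then have "lc R (zip as ds) = \<ominus> u" using z lcs_p_closed[OF Nil(4)] by (simp add: minus_equality[symmetric])
    then have "\<phi> (lc R (zip as ds)) \<in> p" using F_lcs_p[OF \<phi> lcs_p_minus[OF Nil(4)]] by simp
    then have "lc R (zip as (map \<phi> ds)) \<in> p" using F_lc[OF \<phi>, of as ds] Nil(2,3) as cars by auto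
    moreover have "length (map \<phi> ds) = length as" "set (map \<phi> ds) \<subseteq> K0" using Nil(2,3) FC[OF \<phi>] by auto
    ultimately have "set (map \<phi> ds) \<subseteq> {\<zero>}" using Nil(1) unfolding lin_def by blast
    then show "\<phi> d = \<zero>" using d by auto
  qed
  then have "\<one> \<otimes> d \<in> Q" if "d \<in> set ds" for d using prime_inD(2)[OF Q(1)] that by fastforce
  then show ?case using one_K0 by blast
next
  case (Suc n qs0)
  then obtain a g qs where ag: "qs0 = (a, g) # qs" and n: "n = length qs" by (cases qs0) auto
  note prems = Suc(3-8)[unfolded ag]
  have as: "set as \<subseteq> A" using prems by (auto simp: lin_def)
  have a: "a \<in> A" "a \<in> carrier R" and g: "g \<in> Q" "g \<in> C" "g \<in> carrier R" using prems ag cars Ac by auto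
  have "A \<times> Q \<subseteq> carrier R \<times> carrier R" using cars Ac by blast
  then have car: "lc R (zip as ds) \<in> carrier R" "u \<in> carrier R" "lc R qs \<in> carrier R"
    using prems cars as Ac lcs_p_closed by (auto intro!: lc_zip_closed)
  have eq: "lc R (zip as ds) \<oplus> u = a \<otimes> g \<oplus> lc R qs" using prems ag by simp
  show ?case
  proof (cases "lin (a # as)")
    case True
    have "lc R (zip (a # as) (\<ominus> g # ds)) \<oplus> u = \<ominus> (a \<otimes> g) \<oplus> (lc R (zip as ds) \<oplus> u)"
      using a g car by (simp add: r_minus a_ac)
    also have "\<dots> = lc R qs" unfolding eq using a g car by (simp add: r_neg1)
    finally have "\<exists>s\<in>K0 - {\<zero>}. \<forall>d\<in>set (\<ominus> g # ds). s \<otimes> d \<in> Q"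
      using prems g subringE(5)[OF C(1)] True by (intro Suc(1)[OF n True]) auto
    then show ?thesis by auto
  next
    case False
    obtain r rs where r: "r \<in> K0 - {\<zero>}" "set rs \<subseteq> K0" "length rs = length as" "r \<otimes> a \<oplus> lc R (zip as rs) \<in> p"
      using not_lin[OF a(1) prems(1) False] by blast
    let ?e = "r \<otimes> a \<oplus> lc R (zip as rs)"
    \<comment> \<open>The equation is multiplied by \<open>r\<close>, and
      \<open>r \<otimes> a\<close> is replaced by \<open>?e \<ominus> lc R (zip as rs)\<close>. The
      combination changes the coefficients on the left, while \<open>?e\<close>, lying in
      \<open>p\<close>, goes into the error term \<open>u\<close>.\<close>
    let ?ds = "map2 (\<oplus>) (map ((\<otimes>) r) ds) (map ((\<otimes>) g) rs)"
    have rc: "r \<in> carrier R" "lc R (zip as rs) \<in> carrier R" "set rs \<subseteq> carrier R" "set as \<subseteq> carrier R" "set ds \<subseteq> carrier R"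
      using r cars as Ac prems by (auto intro!: lc_zip_closed)
    have ec: "?e \<in> carrier R" using rc a by simp
    have l: "lc R (zip as ?ds) = r \<otimes> lc R (zip as ds) \<oplus> g \<otimes> lc R (zip as rs)"
      using prems(2) r(3) rc g
      by (subst lc_zip_add) (auto simp: lc_zip_smult)
    have u': "r \<otimes> u \<oplus> \<ominus> (?e \<otimes> g) \<in> lcs R p (carrier R)"
      using lcs_p_smult[OF rc(1) prems(4)] lcs_single[of p "carrier R" ?e g] r(4) g cars
      by (intro lcs_p_add lcs_p_minus) auto
    have "lc R (zip as ?ds) \<oplus> (r \<otimes> u \<oplus> \<ominus> (?e \<otimes> g)) = r \<otimes> (lc R (zip as ds) \<oplus> u) \<oplus> \<ominus> (r \<otimes> (a \<otimes> g))"
    proof -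
      define w where "w = g \<otimes> lc R (zip as rs)"
      have w: "w \<in> carrier R" using g rc by (simp add: w_def)
      have "?e \<otimes> g = (r \<otimes> a) \<otimes> g \<oplus> lc R (zip as rs) \<otimes> g" by (rule l_distr) (use rc a g in auto)
      then have e: "?e \<otimes> g = r \<otimes> (a \<otimes> g) \<oplus> w" using rc a g by (simp add: m_assoc w_def m_comm[of g])
      have "(r \<otimes> lc R (zip as ds) \<oplus> w) \<oplus> (r \<otimes> u \<oplus> (y \<oplus> w')) = (w \<oplus> w') \<oplus> (r \<otimes> (lc R (zip as ds) \<oplus> u) \<oplus> y)"
        if "w' \<in> carrier R" "y \<in> carrier R" for w' y using rc car w that by (simp add: r_distr a_ac)
      from this[of "\<ominus> w" "\<ominus> (r \<otimes> (a \<otimes> g))"] show ?thesis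
        unfolding l e w_def[symmetric] using rc car a g w by (simp add: r_neg minus_add)
    qed
    also have "\<dots> = r \<otimes> lc R qs" unfolding eq using rc car a g by (simp add: r_distr a_ac r_neg r_neg1 r_neg2)
    also have "\<dots> = lc R (map (\<lambda>(a, d). (r \<otimes> a, d)) qs)"
      by (rule lc_smult(1)) (use prems cars rc Ac in auto)
    finally have e2: "lc R (zip as ?ds) \<oplus> (r \<otimes> u \<oplus> \<ominus> (?e \<otimes> g)) = lc R (map (\<lambda>(a, d). (r \<otimes> a, d)) qs)" .
    have len: "length ?ds = length as" using prems r by simp
    have dsC: "set ?ds \<subseteq> C"
      by (rule map2_linear_closed[OF C(1)]) (use r prems(3) g K0 in auto)
    have qs': "set (map (\<lambda>(a, d). (r \<otimes> a, d)) qs) \<subseteq> A \<times> Q"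
    proof -
      have "r \<in> A" using r K0 by auto
      then show ?thesis using prems(5) subringE(6)[OF subr(2)] by fastforce
    qed
    obtain s where s: "s \<in> K0 - {\<zero>}" "\<forall>d\<in>set ?ds. s \<otimes> d \<in> Q"
      using Suc(1)[OF _ prems(1) len dsC u' qs' e2] n by auto
    have sc: "s \<in> carrier R" "s \<in> C" using s K0 cars by auto
    \<comment> \<open>The summand that was added to \<open>r \<otimes> d\<close> is a multiple of
      \<open>g\<close>, hence in \<open>Q\<close>, and can be cancelled again.\<close>
    have "(s \<otimes> r) \<otimes> d \<in> Q" if d: "d \<in> set ds" for d
    proof -
      obtain i where i: "i < length ds" "d = ds ! i" using d by (metis in_set_conv_nth)
      have ri: "rs ! i \<in> K0" "rs ! i \<in> carrier R" "rs ! i \<in> C" using r i prems cars K0 by (auto simp: subset_iff)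
      have dc: "d \<in> carrier R" "d \<in> C" using d prems cars by auto
      have "r \<otimes> d \<oplus> g \<otimes> rs ! i = ?ds ! i" using i prems(2) r(3) by simp
      moreover have "?ds ! i \<in> set ?ds" using i prems(2) r(3) by (intro nth_mem) simp
      ultimately have "s \<otimes> (r \<otimes> d \<oplus> g \<otimes> rs ! i) \<in> Q" using s(2) by metis
      moreover have "s \<otimes> (r \<otimes> d \<oplus> g \<otimes> rs ! i) = (s \<otimes> rs ! i) \<otimes> g \<oplus> (s \<otimes> r) \<otimes> d"
        using sc rc dc g ri by (simp add: r_distr m_ac a_ac)
      moreover have "(s \<otimes> rs ! i) \<otimes> g \<in> Q"
        by (rule prime_inD(5)[OF Q(1)]) (use sc ri g subringE(6)[OF C(1)] in auto)
      ultimately show ?thesis using prime_in_cancel[OF Q(1) C(1)] sc rc dc by simp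
    qed
    moreover have "s \<otimes> r \<in> K0 - {\<zero>}" using K0_domain s r by blast
    ultimately show ?thesis by blast
  qed
qed

text \<open>A replacement for expanding in a basis of \<open>A/p\<close> over the fraction field of
  \<open>K0\<close>: only the finitely many left factors are reduced to independent ones, at the
  price of a factor \<open>s\<close> and an error in \<open>pR\<close>.\<close>

lemma generic_expansion:
  assumes "set ps \<subseteq> A \<times> C"
  shows "\<exists>s as ds v. s \<in> K0 - {\<zero>} \<and> lin as \<and> length ds = length as \<and> set ds \<subseteq> C \<and> v \<in> lcs R p (carrier R)
    \<and> s \<otimes> lc R ps = lc R (zip as ds) \<oplus> v"
  using assms
proof (induction ps)
  case Nil
  have "\<one> \<otimes> lc R [] = lc R (zip [] []) \<oplus> \<zero>" by simp
  moreover have "lin []" by (simp add: lin_def)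
  ultimately show ?case using one_K0 lcs_zero by (metis empty_subsetI list.set(1))
next
  case (Cons ac ps)
  obtain a c where ac: "ac = (a, c)" by (cases ac)
  obtain s as ds v where h: "s \<in> K0 - {\<zero>}" "lin as" "length ds = length as" "set ds \<subseteq> C" "v \<in> lcs R p (carrier R)"
    "s \<otimes> lc R ps = lc R (zip as ds) \<oplus> v" using Cons by auto
  have as: "set as \<subseteq> A" using h by (auto simp: lin_def)
  have a: "a \<in> A" "a \<in> carrier R" and c: "c \<in> C" "c \<in> carrier R" using Cons.prems ac cars Ac by auto
  have sc: "s \<in> carrier R" "s \<in> C" using h K0 cars by auto
  have "A \<times> C \<subseteq> carrier R \<times> carrier R" using cars Ac by blast
  then have psc: "set ps \<subseteq> carrier R \<times> carrier R" using Cons.prems by auto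
  have car: "lc R (zip as ds) \<in> carrier R" "v \<in> carrier R" "lc R ps \<in> carrier R"
    using h cars as Ac psc lcs_p_closed by (auto intro!: lc_zip_closed)
  show ?case
  proof (cases "lin (a # as)")
    case True
    have "s \<otimes> lc R (ac # ps) = a \<otimes> (s \<otimes> c) \<oplus> s \<otimes> lc R ps" using ac a c sc car by (simp add: r_distr m_lcomm)
    also have "\<dots> = lc R (zip (a # as) (s \<otimes> c # ds)) \<oplus> v" unfolding h(6) using a c sc car by (simp add: a_ac)
    finally show ?thesis using True h sc c subringE(6)[OF C(1)]
      by (intro exI[of _ s] exI[of _ "a # as"] exI[of _ "s \<otimes> c # ds"] exI[of _ v]) auto
  next
    case False
    obtain r rs where r: "r \<in> K0 - {\<zero>}" "set rs \<subseteq> K0" "length rs = length as" "r \<otimes> a \<oplus> lc R (zip as rs) \<in> p"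
      using not_lin[OF a(1) h(2) False] by blast
    let ?e = "r \<otimes> a \<oplus> lc R (zip as rs)" and ?w = "\<ominus> (s \<otimes> c)"
    let ?ds = "map2 (\<oplus>) (map ((\<otimes>) r) ds) (map ((\<otimes>) ?w) rs)"
    have rc: "r \<in> carrier R" "lc R (zip as rs) \<in> carrier R" "set rs \<subseteq> carrier R" "set as \<subseteq> carrier R" "set ds \<subseteq> carrier R"
      using r cars as Ac h by (auto intro!: lc_zip_closed)
    have wc: "?w \<in> carrier R" "?w \<in> C" using sc c subringE(5,6)[OF C(1)] by auto
    have l: "lc R (zip as ?ds) = r \<otimes> lc R (zip as ds) \<oplus> ?w \<otimes> lc R (zip as rs)"
      using h(3) r(3) rc wc by (subst lc_zip_add) (auto simp: lc_zip_smult)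
    have v': "r \<otimes> v \<oplus> ?e \<otimes> (s \<otimes> c) \<in> lcs R p (carrier R)"
      using lcs_p_smult[OF rc(1) h(5)] lcs_single[of p "carrier R" ?e "s \<otimes> c"] r(4) sc c cars
      by (intro lcs_p_add) auto
    have "lc R (zip as ?ds) \<oplus> (r \<otimes> v \<oplus> ?e \<otimes> (s \<otimes> c)) = r \<otimes> (lc R (zip as ds) \<oplus> v) \<oplus> (r \<otimes> a) \<otimes> (s \<otimes> c)"
    proof -
      define w where "w = (s \<otimes> c) \<otimes> lc R (zip as rs)"
      have w: "w \<in> carrier R" using sc c rc by (simp add: w_def)
      have "?e \<otimes> (s \<otimes> c) = (r \<otimes> a) \<otimes> (s \<otimes> c) \<oplus> lc R (zip as rs) \<otimes> (s \<otimes> c)"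
        by (rule l_distr) (use rc a sc c in auto)
      then have 1: "?e \<otimes> (s \<otimes> c) = (r \<otimes> a) \<otimes> (s \<otimes> c) \<oplus> w"
        using rc sc c by (simp add: w_def m_comm[of "lc R (zip as rs)"])
      have 2: "?w \<otimes> lc R (zip as rs) = \<ominus> w" using sc c rc by (simp add: l_minus w_def)
      define y where "y = (r \<otimes> a) \<otimes> (s \<otimes> c)"
      have y: "y \<in> carrier R" using rc a sc c by (simp add: y_def)
      have "(r \<otimes> lc R (zip as ds) \<oplus> w') \<oplus> (r \<otimes> v \<oplus> (y \<oplus> w)) = (w \<oplus> w') \<oplus> (r \<otimes> (lc R (zip as ds) \<oplus> v) \<oplus> y)"
        if "w' \<in> carrier R" for w' using rc car w y that by (simp add: r_distr a_ac)
      from this[of "\<ominus> w"] show ?thesis unfolding l 1 2 y_def[symmetric] using rc car w y by (simp add: r_neg)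
    qed
    also have "\<dots> = (r \<otimes> s) \<otimes> lc R (ac # ps)"
      unfolding h(6)[symmetric] using ac rc car a c sc by (simp add: r_distr m_ac a_ac)
    finally have "(r \<otimes> s) \<otimes> lc R (ac # ps) = lc R (zip as ?ds) \<oplus> (r \<otimes> v \<oplus> ?e \<otimes> (s \<otimes> c))" by simp
    moreover have "length ?ds = length as" using h r by simp
    moreover have "set ?ds \<subseteq> C"
      by (rule map2_linear_closed[OF C(1)]) (use r h(4) wc K0 in auto)
    ultimately show ?thesis using K0_domain[OF r(1) h(1)] h(2) v' by blast
  qed
qed

text \<open>\<open>J\<close> is \<open>pR + QR\<close>. The second summand is stable under
  \<open>R\<close> because \<open>R\<close> is generated by products from \<open>A\<close> and
  \<open>B\<close>, and \<open>B\<close> lies in \<open>C\<close>, in which \<open>Q\<close> is an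
  ideal.\<close>

lemma J_ideal:
  shows J_add_closed: "add_closed R J" and J_smult: "\<And>t x. t \<in> carrier R \<Longrightarrow> x \<in> J \<Longrightarrow> t \<otimes> x \<in> J"
proof -
  have c2: "lcs R A Q \<subseteq> carrier R" using lcs_closed cars Ac by blast
  have c1: "lcs R p (carrier R) \<subseteq> carrier R" using lcs_closed cars by blast
  have "\<zero> \<oplus> \<zero> \<in> J" unfolding J_def using lcs_zero by blast
  moreover have "J \<subseteq> carrier R" unfolding J_def using c1 c2 by blast
  moreover have Jadd: "x \<oplus> y \<in> J" if x: "x \<in> J" and y: "y \<in> J" for x y
  proof -
    obtain u v u' v' where h: "u \<in> lcs R p (carrier R)" "v \<in> lcs R A Q" "x = u \<oplus> v"
      "u' \<in> lcs R p (carrier R)" "v' \<in> lcs R A Q" "y = u' \<oplus> v'" using x y unfolding J_def by blast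
    have car: "u \<in> carrier R" "v \<in> carrier R" "u' \<in> carrier R" "v' \<in> carrier R" using h c1 c2 by auto
    have "x \<oplus> y = (u \<oplus> u') \<oplus> (v \<oplus> v')" using h car by (simp add: a_ac)
    moreover have "v \<oplus> v' \<in> lcs R A Q" using lcs_add[of A Q v v'] h cars Ac by auto
    ultimately show ?thesis unfolding J_def using lcs_p_add h by blast
  qed
  ultimately show "add_closed R J" by (auto simp: add_closed_def)
  fix t x assume t: "t \<in> carrier R" and x: "x \<in> J"
  then obtain ps where ps: "set ps \<subseteq> A \<times> B" "t = lc R ps" using gen by (auto simp: lcs_def)
  obtain u v where uv: "u \<in> lcs R p (carrier R)" "v \<in> lcs R A Q" "x = u \<oplus> v" using x unfolding J_def by blast
  have car: "u \<in> carrier R" "v \<in> carrier R" using uv c1 c2 by auto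
  have xc: "x \<in> carrier R" using uv car by simp
  have "lc R ps \<otimes> x \<in> J" using ps(1)
  proof (induction ps)
    case Nil
    then show ?case using \<open>\<zero> \<oplus> \<zero> \<in> J\<close> xc by simp
  next
    case (Cons ab ps)
    obtain a b where ab: "ab = (a, b)" by (cases ab)
    have abc: "a \<in> A" "a \<in> carrier R" "b \<in> B" "b \<in> carrier R" using Cons.prems ab Ac Bc by auto
    have "A \<times> B \<subseteq> carrier R \<times> carrier R" using Ac Bc by blast
    then have l: "lc R ps \<in> carrier R" using Cons.prems by (intro lc_closed) auto
    have bv: "b \<otimes> v \<in> lcs R A Q"
      by (rule lcs_smult(2)) (use uv abc cars Ac C prime_inD(5)[OF Q(1)] in auto)
    have "a \<otimes> (b \<otimes> v) \<in> lcs R A Q"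
      by (rule lcs_smult(1)[OF _ _ _ bv]) (use abc cars Ac subringE(6)[OF subr(2)] in auto)
    moreover have "(a \<otimes> b) \<otimes> u \<in> lcs R p (carrier R)" using lcs_p_smult uv abc by auto
    moreover have "(a \<otimes> b) \<otimes> x = (a \<otimes> b) \<otimes> u \<oplus> a \<otimes> (b \<otimes> v)" using uv car abc by (simp add: r_distr m_assoc)
    ultimately have "(a \<otimes> b) \<otimes> x \<in> J" unfolding J_def by blast
    moreover have "lc R (ab # ps) \<otimes> x = (a \<otimes> b) \<otimes> x \<oplus> lc R ps \<otimes> x" using ab abc l xc by (simp add: l_distr)
    ultimately show ?case using Jadd Cons by auto
  qed
  then show "t \<otimes> x \<in> J" using ps by simp
qed

text \<open>Expand \<open>s \<otimes> u\<close> in elements independent modulo \<open>p\<close>. As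
  \<open>p\<close> is prime, multiplying them by \<open>x\<close> keeps them independent, so
  \<open>generic_freeness\<close> puts each \<open>c \<otimes> d\<close> into \<open>Q\<close> up to
  a factor from \<open>K0\<close>. Since \<open>c\<close> and that factor are outside
  \<open>Q\<close>, each \<open>d\<close> is inside.\<close>

lemma torsion:
  assumes "u \<in> carrier R" "x \<in> A - p" "c \<in> C - Q" "x \<otimes> c \<otimes> u \<in> J"
  shows "\<exists>s\<in>K0 - {\<zero>}. s \<otimes> u \<in> J"
proof -
  obtain ps where "set ps \<subseteq> A \<times> B" "u = lc R ps" using gen assms(1) by (auto simp: lcs_def)
  then have ps: "set ps \<subseteq> A \<times> C" "u = lc R ps" using C(2) by auto
  obtain s as ds v where h: "s \<in> K0 - {\<zero>}" "lin as" "length ds = length as" "set ds \<subseteq> C" "v \<in> lcs R p (carrier R)"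
    "s \<otimes> lc R ps = lc R (zip as ds) \<oplus> v" using generic_expansion[OF ps(1)] by blast
  have as: "set as \<subseteq> A" using h by (auto simp: lin_def)
  have car: "x \<in> carrier R" "c \<in> carrier R" "s \<in> carrier R" "v \<in> carrier R" "set as \<subseteq> carrier R" "set ds \<subseteq> carrier R"
    using assms Ac cars h as lcs_p_closed by auto
  have lz: "lc R (zip as ds) \<in> carrier R" using car by (intro lc_closed zip_closed)
  let ?as = "map ((\<otimes>) x) as" and ?ds = "map ((\<otimes>) c) ds"
  have lin: "lin ?as" unfolding lin_def
  proof (intro conjI allI impI)
    show "set ?as \<subseteq> A" using as assms(2) subringE(6)[OF subr(2)] by auto
    fix rs assume rs: "length rs = length ?as" "set rs \<subseteq> K0" "lc R (zip ?as rs) \<in> p"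
    have rsA: "set rs \<subseteq> A" "set rs \<subseteq> carrier R" using rs K0 cars by auto
    have lA: "lc R (zip as rs) \<in> A" using rs(1) as rsA(1)
    proof (induction as arbitrary: rs)
      case (Cons a as)
      then obtain r rs' where "rs = r # rs'" by (cases rs) auto
      then show ?case using Cons subringE(6,7)[OF subr(2)] by auto
    qed (simp add: subringE(2)[OF subr(2)])
    have "x \<otimes> lc R (zip as rs) \<in> p" using lc_zip_smult(2)[of as rs x] rs rsA car by simp
    then have "lc R (zip as rs) \<in> p" using prime_inD(6)[OF p(1) _ lA] assms(2) by blast
    then show "set rs \<subseteq> {\<zero>}" using h(2) rs unfolding lin_def by auto
  qed
  have "s \<otimes> (x \<otimes> c \<otimes> u) \<in> J" using J_smult assms(4) car by blast
  then obtain u1 qs where q: "u1 \<in> lcs R p (carrier R)" "set qs \<subseteq> A \<times> Q" "s \<otimes> (x \<otimes> c \<otimes> u) = u1 \<oplus> lc R qs"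
    by (auto simp: J_def lcs_def)
  have u1: "u1 \<in> carrier R" using q lcs_p_closed by auto
  have "A \<times> Q \<subseteq> carrier R \<times> carrier R" using cars Ac by blast
  then have lq: "lc R qs \<in> carrier R" using q(2) by (intro lc_closed) auto
  have "lc R (zip ?as ?ds) = x \<otimes> (c \<otimes> lc R (zip as ds))"
    using lc_zip_smult(2)[of as ?ds x] lc_zip_smult(1)[of as ds c] h(3) car by auto
  moreover have "s \<otimes> (x \<otimes> c \<otimes> u) = x \<otimes> (c \<otimes> (s \<otimes> u))" using car assms(1) by (simp add: m_ac)
  then have "s \<otimes> (x \<otimes> c \<otimes> u) = x \<otimes> (c \<otimes> lc R (zip as ds)) \<oplus> (x \<otimes> c) \<otimes> v"
    using h(6) ps(2) car lz by (simp add: r_distr m_assoc)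
  ultimately have "lc R (zip ?as ?ds) \<oplus> ((x \<otimes> c) \<otimes> v \<oplus> \<ominus> u1) = (u1 \<oplus> lc R qs) \<oplus> \<ominus> u1"
    using q(3) car lz u1 by (simp add: a_assoc)
  also have "\<dots> = lc R qs" using u1 lq by (simp add: a_ac r_neg1 r_neg2)
  finally have e: "lc R (zip ?as ?ds) \<oplus> ((x \<otimes> c) \<otimes> v \<oplus> \<ominus> u1) = lc R qs" .
  have "(x \<otimes> c) \<otimes> v \<oplus> \<ominus> u1 \<in> lcs R p (carrier R)" using lcs_p_smult h(5) car q(1) by (intro lcs_p_add lcs_p_minus) auto
  moreover have "length ?ds = length ?as" "set ?ds \<subseteq> C" using h assms(3) subringE(6)[OF C(1)] by auto
  ultimately obtain s' where s': "s' \<in> K0 - {\<zero>}" "\<forall>d\<in>set ?ds. s' \<otimes> d \<in> Q"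
    using generic_freeness[OF lin _ _ _ q(2) e] by blast
  have "d \<in> Q" if d: "d \<in> set ds" for d
  proof -
    have dC: "d \<in> C" "d \<in> carrier R" "s' \<in> C" "s' \<in> carrier R" using d h(4) cars s' K0 by auto
    have "s' \<otimes> (c \<otimes> d) \<in> Q" using s' d by auto
    then have "s' \<in> Q \<or> c \<otimes> d \<in> Q" using prime_inD(6)[OF Q(1) dC(3)] subringE(6)[OF C(1)] dC assms(3) by auto
    then show ?thesis using prime_inD(6)[OF Q(1)] dC assms(3) s'(1) Q(2) by auto
  qed
  then have "set (zip as ds) \<subseteq> A \<times> Q" using as by (intro zip_closed) auto
  then have "lc R (zip as ds) \<in> lcs R A Q" unfolding lcs_def by blast
  then have "v \<oplus> lc R (zip as ds) \<in> J" using h(5) unfolding J_def by blast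
  then show ?thesis using h(1,6) ps(2) lz car by (metis a_comm)
qed

text \<open>\<open>S\<close> contains the complement of \<open>p\<close> in \<open>A\<close>, of
  \<open>Q\<close> in \<open>C\<close> and of \<open>P\<close> in \<open>R\<close>, so a prime that
  contains \<open>J\<close> and misses \<open>S\<close> has all the required properties. If
  \<open>J\<close> met \<open>S\<close>, then \<open>torsion\<close> would give
  \<open>s \<otimes> u\<close> in \<open>P\<close> with neither factor in \<open>P\<close>.\<close>

lemma going_down:
  assumes P: "prime_in R (carrier R) P" "p \<subseteq> P" "Q \<subseteq> P" "P \<inter> K0 = {\<zero>}"
  obtains P' where "prime_in R (carrier R) P'" "P' \<subseteq> P" "P' \<inter> A = p" "P' \<inter> C = Q"
proof -
  define S where "S = {x \<otimes> c \<otimes> u | x c u. x \<in> A - p \<and> c \<in> C - Q \<and> u \<in> carrier R - P}"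
  have ones: "\<one> \<in> A - p" "\<one> \<in> C - Q" "\<one> \<in> carrier R - P"
    using prime_inD(3)[OF p(1)] prime_inD(3)[OF Q(1)] prime_inD(3)[OF P(1)] subringE(3)[OF subr(2)] subringE(3)[OF C(1)] by auto
  have JP: "J \<subseteq> P"
  proof
    fix t assume "t \<in> J"
    then obtain ps qs where h: "set ps \<subseteq> p \<times> carrier R" "set qs \<subseteq> A \<times> Q" "t = lc R ps \<oplus> lc R qs"
      by (auto simp: J_def lcs_def)
    have "lc R ps \<in> P" "lc R qs \<in> P" using h P cars Ac by (auto intro!: lc_in_prime)
    then show "t \<in> P" using h prime_inD(4)[OF P(1)] by blast
  qed
  have JS: "J \<inter> S = {}"
  proof (rule ccontr)
    assume "J \<inter> S \<noteq> {}"
    then obtain x c u where h: "x \<in> A - p" "c \<in> C - Q" "u \<in> carrier R - P" "x \<otimes> c \<otimes> u \<in> J" by (auto simp: S_def)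
    then obtain s where s: "s \<in> K0 - {\<zero>}" "s \<otimes> u \<in> J" using torsion[of u x c] by blast
    then have "s \<in> P \<or> u \<in> P" using JP prime_inD(6)[OF P(1), of s u] h cars by auto
    then show False using s P(4) h by auto
  qed
  have Sc: "S \<subseteq> carrier R"
  proof
    fix s assume "s \<in> S"
    then obtain x c u where "s = x \<otimes> c \<otimes> u" "x \<in> A" "c \<in> C" "u \<in> carrier R" by (auto simp: S_def)
    moreover from this have "x \<in> carrier R" "c \<in> carrier R" using Ac cars by auto
    ultimately show "s \<in> carrier R" by simp
  qed
  have "\<one> \<otimes> \<one> \<otimes> \<one> \<in> S" unfolding S_def using ones by blast
  then have S0: "\<one> \<in> S" by simp
  have Sm: "s \<otimes> t \<in> S" if st: "s \<in> S" "t \<in> S" for s t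
  proof -
    obtain x c u x' c' u' where h: "x \<in> A - p" "c \<in> C - Q" "u \<in> carrier R - P" "s = x \<otimes> c \<otimes> u"
      "x' \<in> A - p" "c' \<in> C - Q" "u' \<in> carrier R - P" "t = x' \<otimes> c' \<otimes> u'" using st unfolding S_def by blast
    have car: "x \<in> carrier R" "c \<in> carrier R" "x' \<in> carrier R" "c' \<in> carrier R" using h Ac cars by auto
    have "s \<otimes> t = (x \<otimes> x') \<otimes> (c \<otimes> c') \<otimes> (u \<otimes> u')" using h car by (simp add: m_ac)
    moreover have "x \<otimes> x' \<in> A - p" using prime_inD(6)[OF p(1)] h subringE(6)[OF subr(2)] by blast
    moreover have "c \<otimes> c' \<in> C - Q" using prime_inD(6)[OF Q(1)] h subringE(6)[OF C(1)] by blast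
    moreover have "u \<otimes> u' \<in> carrier R - P" using prime_inD(6)[OF P(1)] h by blast
    ultimately show ?thesis unfolding S_def by blast
  qed
  obtain P' where P': "prime_in R (carrier R) P'" "J \<subseteq> P'" "P' \<inter> S = {}"
    by (rule prime_avoidance[OF J_add_closed J_smult Sc S0 Sm JS])
  have S1: "x \<in> S" if "x \<in> A - p" for x
  proof -
    have "x = x \<otimes> \<one> \<otimes> \<one>" using that Ac by auto
    then show ?thesis unfolding S_def using that ones by blast
  qed
  have S2: "x \<in> S" if "x \<in> C - Q" for x
  proof -
    have "x = \<one> \<otimes> x \<otimes> \<one>" using that cars by auto
    then show ?thesis unfolding S_def using that ones by blast
  qed
  have S3: "x \<in> S" if "x \<in> carrier R - P" for x
  proof -
    have "x = \<one> \<otimes> \<one> \<otimes> x" using that by auto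
    then show ?thesis unfolding S_def using that ones by blast
  qed
  have pJ: "x \<in> J" if "x \<in> p" for x
  proof -
    have "x \<otimes> \<one> \<in> lcs R p (carrier R)" using that cars by (intro lcs_single) auto
    moreover have "x \<in> carrier R" using that cars by auto
    ultimately have "x \<oplus> \<zero> \<in> J" unfolding J_def using lcs_zero[of A Q] r_one[of x] by fastforce
    then show ?thesis using \<open>x \<in> carrier R\<close> by simp
  qed
  have QJ: "x \<in> J" if "x \<in> Q" for x
  proof -
    have "\<one> \<otimes> x \<in> lcs R A Q" using that cars ones Ac by (intro lcs_single) auto
    moreover have "x \<in> carrier R" using that cars by auto
    ultimately have "\<zero> \<oplus> x \<in> J" unfolding J_def using lcs_zero[of p "carrier R"] l_one[of x] by fastforce
    then show ?thesis using \<open>x \<in> carrier R\<close> by simp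
  qed
  show thesis
  proof (rule that[OF P'(1)])
    show "P' \<subseteq> P" using S3 P' prime_inD(1)[OF P'(1)] by blast
    show "P' \<inter> A = p" using S1 P' pJ cars by blast
    show "P' \<inter> C = Q" using S2 P' QJ cars by blast
  qed
qed

end

section \<open>Comparing chains of primes\<close>

lemma chain_to_weaken_top: "chain_to S n Q \<Longrightarrow> Q \<subseteq> P \<Longrightarrow> P \<in> S \<Longrightarrow> chain_to S n P"
proof (cases n)
  case (Suc n')
  assume h: "chain_to S n Q" "Q \<subseteq> P" "P \<in> S"
  then obtain Q' where "Q' \<subset> Q" "chain_to S n' Q'" using Suc by auto
  then show ?thesis using h Suc by (auto intro!: exI[of _ Q'])
qed simp

context cring begin

lemma adjoins_in_prime:
  assumes P: "prime_in R (carrier R) P" and "set zs \<subseteq> carrier R" "U \<subseteq> P"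
  shows "adjoins R U zs \<subseteq> P"
  using assms(2,3)
proof (induction zs arbitrary: U)
  case (Cons z zs)
  have "adjoin R U z \<subseteq> P"
  proof
    fix x assume "x \<in> adjoin R U z"
    then obtain cs where "set cs \<subseteq> U" "x = horner R cs z" by (auto simp: adjoin_def)
    then show "x \<in> P" using horner_in_ideal[OF P, of cs z] Cons.prems by auto
  qed
  then show ?case using Cons by simp
qed simp

lemma subring_restrict:
  assumes "subring D R" "D \<subseteq> C" "subring C R" shows "subring D (R\<lparr>carrier := C\<rparr>)"
proof -
  interpret C: ring "R\<lparr>carrier := C\<rparr>" by (rule subring_is_ring[OF assms(3)])
  show ?thesis by (rule C.ring_incl_imp_subring) (use assms subring_is_ring in auto)
qed

lemma cring_restrict:
  assumes "subring C R" shows "cring (R\<lparr>carrier := C\<rparr>)"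
  using subcring_iff[OF subringE(1)[OF assms]] subcringI'[OF assms] by simp

lemma horner_subring:
  assumes "subring C R" "set cs \<subseteq> C" "x \<in> C" shows "horner R cs x \<in> C"
  using horner_mem[OF subring_add_closed[OF assms(1)], of x cs] subringE(6)[OF assms(1)] assms by auto

lemma cl_restrict:
  assumes "subring C R" "D \<subseteq> C" "x \<in> C"
  shows "x \<in> cl (R\<lparr>carrier := C\<rparr>) (P \<inter> C) D \<longleftrightarrow> x \<in> cl R P D"
proof -
  have "horner R cs x \<in> C" if "set cs \<subseteq> D" for cs using horner_subring[OF assms(1) _ assms(3)] that assms(2) by auto
  then show ?thesis using assms subringE(1)[OF assms(1)] by (auto simp: cl_def)
qed

lemma crk_restrict:
  assumes "subring C R" "D \<subseteq> C" "set zs \<subseteq> C"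
  shows "crk (R\<lparr>carrier := C\<rparr>) (P \<inter> C) D zs = crk R P D zs"
  using assms(2,3)
proof (induction zs arbitrary: D)
  case (Cons z zs)
  then show ?case using cl_restrict[OF assms(1), of D z P] adjoin_least[OF assms(1), of D z] by simp
qed simp

lemma indep_restrict:
  assumes "subring C R" "D \<subseteq> C" "set zs \<subseteq> C" "indep R D zs"
  shows "indep (R\<lparr>carrier := C\<rparr>) D zs"
  using assms(2,3,4)
proof (induction zs arbitrary: D)
  case (Cons z zs)
  have "{\<zero>} \<inter> C = {\<zero>}" using subringE(2)[OF assms(1)] by auto
  then show ?case using Cons cl_restrict[OF assms(1), of D z "{\<zero>}"] adjoin_least[OF assms(1), of D z] by auto
qed simp

text \<open>\<open>S\<close> consists of the coefficients in \<open>A\<close> of elements witnessing that the inclusions of the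
  chain are strict.\<close>

lemma chain_contract:
  assumes "chain_to (Spec R) m P" "carrier R \<subseteq> lcs R A B" "A \<subseteq> carrier R"
  shows "\<exists>S. finite S \<and> S \<subseteq> A \<and> (\<forall>C. subring C R \<longrightarrow> B \<subseteq> C \<longrightarrow> (\<forall>P'\<in>Spec R. S \<subseteq> cl R P' C)
    \<longrightarrow> chain_to {Q. prime_in R C Q} m (P \<inter> C))"
  using assms(1)
proof (induction m arbitrary: P)
  case 0
  then show ?case using prime_in_contract[OF _ _ subringE(1)] by (intro exI[of _ "{}"]) (auto simp: Spec_def)
next
  case (Suc m)
  then obtain Q where Q: "Q \<subset> P" "chain_to (Spec R) m Q" and PS: "P \<in> Spec R" by auto
  obtain S where S: "finite S" "S \<subseteq> A"
    "\<And>C. subring C R \<Longrightarrow> B \<subseteq> C \<Longrightarrow> \<forall>P'\<in>Spec R. S \<subseteq> cl R P' C \<Longrightarrow> chain_to {Q. prime_in R C Q} m (Q \<inter> C)"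
    using Suc.IH[OF Q(2)] by blast
  have pr: "prime_in R (carrier R) P" "prime_in R (carrier R) Q" using PS chain_to_mem[OF Q(2)] by (auto simp: Spec_def)
  obtain x where x: "x \<in> P" "x \<notin> Q" using Q by blast
  then have "x \<in> carrier R" using prime_inD(1)[OF pr(1)] by auto
  then obtain ps where ps: "set ps \<subseteq> A \<times> B" "x = lc R ps" using assms(2) by (auto simp: lcs_def)
  have "chain_to {Q. prime_in R C Q} (Suc m) (P \<inter> C)"
    if C: "subring C R" "B \<subseteq> C" "\<forall>P'\<in>Spec R. S \<union> fst ` set ps \<subseteq> cl R P' C" for C
  proof -
    have hcQ: "chain_to {Q. prime_in R C Q} m (Q \<inter> C)" using S(3)[OF C(1,2)] C(3) by blast
    have sub: "subring (cl R Q C) R" and base: "C \<subseteq> cl R Q C" using cl_subring[OF pr(2) C(1)] cl_base[OF pr(2) C(1)] .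
    have "fst ` set ps \<subseteq> cl R Q C" using C(3) pr(2) by (auto simp: Spec_def)
    then have "lc R ps \<in> cl R Q C" using ps(1)
    proof (induction ps)
      case Nil
      then show ?case using subringE(2)[OF sub] by simp
    next
      case (Cons ab ps)
      then have "snd ab \<in> cl R Q C" using C(2) base by auto
      then show ?case using Cons subringE(6,7)[OF sub] by auto
    qed
    \<comment> \<open>The element \<open>x\<close> that shows strictness is algebraic over
      \<open>C\<close> modulo \<open>Q\<close>, since \<open>C\<close> contains \<open>B\<close> and
      the left factors of \<open>x\<close> are algebraic. Incomparability exchanges it for a witness
      in \<open>C\<close>.\<close>
    then obtain c where "c \<in> C" "c \<in> P" "c \<notin> Q"
      using incomparability[OF pr(2,1) _ x, of C] Q(1) ps(2) subringE(1)[OF C(1)] by blast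
    then have "Q \<inter> C \<subset> P \<inter> C" using Q(1) by blast
    then show ?thesis using hcQ prime_in_contract[OF pr(1) C(1) subringE(1)[OF C(1)]] by auto
  qed
  moreover have "finite (S \<union> fst ` set ps)" "S \<union> fst ` set ps \<subseteq> A" using S ps by auto
  ultimately show ?case by blast
qed

end

section \<open>Lifting chains to the tensor product and comparing their lengths\<close>

context tensor_pair begin

lemma kc: "k \<subseteq> carrier R" using subringE(1)[OF subr(1)] .

lemma prime_Int_k:
  assumes "prime_in R E p" "k \<subseteq> E" shows "p \<inter> k = {\<zero>}"
proof -
  have "c = \<zero>" if c: "c \<in> p" "c \<in> k" for c
  proof (rule ccontr)
    assume "c \<noteq> \<zero>"
    then obtain d where d: "d \<in> k" "c \<otimes> d = \<one>" using k_inv c by blast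
    then have "d \<otimes> c = \<one>" using c kc by (simp add: m_comm subset_iff)
    moreover have "d \<otimes> c \<in> p" using prime_inD(5)[OF assms(1)] d c assms(2) by blast
    ultimately show False using prime_inD(3)[OF assms(1)] by simp
  qed
  moreover have "\<zero> \<in> p" "\<zero> \<in> k" using prime_inD(2)[OF assms(1)] subringE(2)[OF subr(1)] .
  ultimately show ?thesis by blast
qed

lemma indep_base_change:
  assumes "indep R (adjoins R k xs) zs" "set xs \<subseteq> A" "set zs \<subseteq> A"
  shows "indep R (adjoins R B xs) zs"
  using assms
proof (induction zs arbitrary: xs)
  case (Cons z zs)
  have "indep R (adjoins R B (xs @ [z])) zs" using Cons.prems by (intro Cons.IH) (auto simp: adjoins_append)
  then show ?case using Cons.prems cl_base_change[of z xs] by (auto simp: adjoins_append)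
qed simp

text \<open>By full rank, a polynomial with value in \<open>P\<close> has its coefficients in
  \<open>P\<close>, hence equal to zero. That \<open>P\<close> meets \<open>D[ys]\<close> only in
  zero is what going down relative to \<open>k[ys]\<close> asks for.\<close>

lemma indep_of_crk:
  assumes P: "prime_in R (carrier R) P" and "set ys \<subseteq> carrier R" "subring D R" "D \<inter> P = {\<zero>}" "crk R P D ys = length ys"
  shows "indep R D ys \<and> adjoins R D ys \<inter> P = {\<zero>}"
  using assms(2-)
proof (induction ys arbitrary: D)
  case (Cons y ys)
  have c: "y \<notin> cl R P D" "crk R P (adjoin R D y) ys = length ys"
    using Cons.prems(4) crk_le_length[of R P "adjoin R D y" ys] by (auto split: if_splits)
  have y: "y \<in> carrier R" using Cons.prems by auto
  have z: "set cs \<subseteq> {\<zero>}" if "set cs \<subseteq> D" "horner R cs y \<in> P" for cs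
    using not_clD[OF c(1) y that] that(1) Cons.prems(3) by blast
  have S: "subring (adjoin R D y) R" by (rule adjoin_subring[OF Cons.prems(2) y])
  have "adjoin R D y \<inter> P = {\<zero>}"
  proof -
    have "x = \<zero>" if x: "x \<in> adjoin R D y" "x \<in> P" for x
    proof -
      obtain cs where cs: "set cs \<subseteq> D" "x = horner R cs y" using x(1) by (auto simp: adjoin_def)
      then show ?thesis using z[OF cs(1)] x(2) horner_zeros y by auto
    qed
    then show ?thesis using subringE(2)[OF S] prime_inD(2)[OF P] by blast
  qed
  moreover have "y \<notin> cl R {\<zero>} D" using z prime_inD(2)[OF P] by (auto simp: cl_def)
  ultimately show ?case using Cons.IH[OF _ S _ c(2)] Cons.prems(1) by auto
qed simp

text \<open>All lifted members lie over the same \<open>p\<close>. Since \<open>K0\<close> lies in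
  \<open>A\<close>, each of them meets \<open>K0\<close> exactly in \<open>p \<inter> K0\<close>,
  that is in zero, and going down can be repeated.\<close>

lemma lift_chain:
  assumes K0: "subring K0 R" "K0 \<subseteq> A" "K0 \<subseteq> C" and C: "subring C R" "B \<subseteq> C"
    and FC: "\<And>\<phi> c. \<phi> \<in> F \<Longrightarrow> c \<in> C \<Longrightarrow> \<phi> c \<in> K0"
    and p: "prime_in R A p" "p \<inter> K0 = {\<zero>}"
    and ch: "chain_to {Q. prime_in R C Q \<and> I \<subseteq> Q} n Q"
    and P: "prime_in R (carrier R) P" "P \<inter> A = p" "P \<inter> C = Q"
  shows "chain_to {P' \<in> Spec R. p \<subseteq> P' \<and> I \<subseteq> P'} n P"
  using ch P
proof (induction n arbitrary: P Q)
  case 0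
  then show ?case by (auto simp: Spec_def)
next
  case (Suc n)
  then obtain Q' where Q': "Q' \<subset> Q" "chain_to {Q. prime_in R C Q \<and> I \<subseteq> Q} n Q'" and IQ: "I \<subseteq> Q" by auto
  have prQ: "prime_in R C Q'" using chain_to_mem[OF Q'(2)] by simp
  have PK: "P \<inter> K0 = {\<zero>}" using p(2) Suc.prems(3) K0(2) by blast
  have QK: "Q' \<inter> K0 = {\<zero>}" using PK Q'(1) Suc.prems(4) prime_inD(2)[OF prQ] subringE(2)[OF K0(1)] by blast
  interpret rel: tensor_relative R k A B F K0 C p Q'
    by (intro tensor_relative.intro tensor_relative_axioms.intro tensor_pair_axioms) (fact K0 C FC p prQ QK)+
  obtain P' where P': "prime_in R (carrier R) P'" "P' \<subseteq> P" "P' \<inter> A = p" "P' \<inter> C = Q'"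
    using rel.going_down[OF Suc.prems(2) _ _ PK] Suc.prems(3,4) Q'(1) by blast
  have "chain_to {P' \<in> Spec R. p \<subseteq> P' \<and> I \<subseteq> P'} n P'" by (rule Suc.IH[OF Q'(2) P'(1,3,4)])
  moreover have "P' \<subset> P" using P' Q'(1) Suc.prems(4) by blast
  ultimately show ?case using Suc.prems IQ by (auto simp: Spec_def)
qed

text \<open>The instance \<open>K0 = k\<close>, \<open>C = B\<close>: \<open>k\<close> is a field,
  so every prime meets it only in zero.\<close>

lemma going_down_pair:
  assumes p: "prime_in R A p" and q: "prime_in R B q" and P: "prime_in R (carrier R) P" "p \<subseteq> P" "q \<subseteq> P"
  obtains P' where "prime_in R (carrier R) P'" "P' \<subseteq> P" "P' \<inter> A = p" "P' \<inter> B = q"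
proof -
  interpret rel: tensor_relative R k A B F k B p q
    by (intro tensor_relative.intro tensor_relative_axioms.intro tensor_pair_axioms) (fact subr subset_refl F_base p q prime_Int_k[OF p subr(4)] prime_Int_k[OF q subr(5)])+
  show thesis using rel.going_down[OF P prime_Int_k[OF P(1) kc]] that by blast
qed

text \<open>Walking down the chain of \<open>A\<close> below \<open>p\<close> with the contraction
  to \<open>B\<close> held at \<open>q\<close> ends over the zero ideal of \<open>A\<close>, where a
  chain of length \<open>m\<close> is waiting; the two lengths add.\<close>

lemma descend_chain:
  assumes q: "prime_in R B q" and zero: "prime_in R A {\<zero>}"
    and base: "\<And>Q. prime_in R (carrier R) Q \<Longrightarrow> Q \<inter> A = {\<zero>} \<Longrightarrow> Q \<inter> B = q \<Longrightarrow> chain_to (Spec R) m Q"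
    and "chain_to {p. prime_in R A p} h p" "prime_in R (carrier R) Q" "Q \<inter> A = p" "Q \<inter> B = q"
  shows "chain_to (Spec R) (m + h) Q"
  using assms(4-)
proof (induction h arbitrary: p Q)
  case 0
  have sub: "{\<zero>} \<subseteq> Q" "q \<subseteq> Q" using prime_inD(2)[OF 0(2)] by simp (use 0(4) in blast)
  obtain Q' where Q': "prime_in R (carrier R) Q'" "Q' \<subseteq> Q" "Q' \<inter> A = {\<zero>}" "Q' \<inter> B = q"
    by (rule going_down_pair[OF zero q 0(2) sub])
  then show ?case using chain_to_weaken_top[OF base[OF Q'(1,3,4)] Q'(2)] 0(2) by (simp add: Spec_def)
next
  case (Suc h)
  then obtain p' where p': "p' \<subset> p" "chain_to {p. prime_in R A p} h p'" by auto
  have pr: "prime_in R A p'" using chain_to_mem[OF p'(2)] by simp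
  have sub: "p' \<subseteq> Q" "q \<subseteq> Q" using p'(1) Suc.prems(3) by blast (use Suc.prems(4) in blast)
  obtain Q' where Q': "prime_in R (carrier R) Q'" "Q' \<subseteq> Q" "Q' \<inter> A = p'" "Q' \<inter> B = q"
    by (rule going_down_pair[OF pr q Suc.prems(2) sub])
  have "chain_to (Spec R) (m + h) Q'" by (rule Suc.IH[OF p'(2) Q'(1,3,4)])
  moreover have "Q' \<subset> Q" using Q' p'(1) Suc.prems by blast
  ultimately show ?case using Suc.prems(2) by (auto simp: Spec_def)
qed

text \<open>Here \<open>ys\<close> lifts independent elements of \<open>A\<close> modulo
  \<open>P \<inter> A\<close>. The same \<open>e\<close> is realized by a chain above both
  contractions and bounds the loss when a chain is moved from \<open>P\<close> to any prime
  \<open>Q\<close> above them; the two statements yield the two inequalities between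
  heights.\<close>

lemma chain_comparison:
  assumes P: "prime_in R (carrier R) P" and zero: "prime_in R A {\<zero>}"
    and hA: "chain_to {p. prime_in R A p} h (P \<inter> A)"
    and ys: "set ys \<subseteq> A" "crk R P k ys = length ys"
    and normalization: "\<And>S. finite S \<Longrightarrow> S \<subseteq> A \<Longrightarrow> \<exists>zs. set zs \<subseteq> A \<and> indep R k zs \<and> length zs \<le> h + length ys
      \<and> (\<forall>P'\<in>Spec R. S \<subseteq> cl R P' (adjoins R k zs))"
  shows "\<exists>e. chain_to {P' \<in> Spec R. P \<inter> A \<subseteq> P' \<and> P \<inter> B \<subseteq> P'} e P \<and>
    (\<forall>m Q. chain_to (Spec R) m P \<longrightarrow> Q \<in> Spec R \<longrightarrow> P \<inter> A \<subseteq> Q \<longrightarrow> P \<inter> B \<subseteq> Q \<longrightarrow> chain_to (Spec R) (m - e) Q)"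
proof -
  \<comment> \<open>By \<open>chain_above_adjoins\<close> this is the length of a chain in
    \<open>B[ys]\<close> from the extension of \<open>P \<inter> B\<close> up to the contraction of
    \<open>P\<close>.\<close>
  define e where "e = length ys - crk R P B ys"
  have pA: "prime_in R A (P \<inter> A)" and qB: "prime_in R B (P \<inter> B)"
    using prime_in_contract[OF P subr(2) Ac] prime_in_contract[OF P subr(3) Bc] .
  have ext: "subring (adjoins R k zs) R" "adjoins R k zs \<subseteq> A" "adjoins R k zs \<subseteq> adjoins R B zs"
    "subring (adjoins R B zs) R" "B \<subseteq> adjoins R B zs" "set zs \<subseteq> adjoins R B zs" "set zs \<subseteq> carrier R"
    "\<phi> \<in> F \<Longrightarrow> c \<in> adjoins R B zs \<Longrightarrow> \<phi> c \<in> adjoins R k zs"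
    if zs: "set zs \<subseteq> A" for zs \<phi> c
  proof -
    show zc: "set zs \<subseteq> carrier R" using zs Ac by auto
    show "subring (adjoins R k zs) R" "subring (adjoins R B zs) R"
      using adjoins_subring[OF subr(1) zc] adjoins_subring[OF subr(3) zc] .
    show "adjoins R k zs \<subseteq> A" by (rule adjoins_least[OF subr(2,4) zs])
    show "adjoins R k zs \<subseteq> adjoins R B zs" by (rule adjoins_mono) (rule subr)
    show "B \<subseteq> adjoins R B zs" using adjoins_base[OF subring_add_closed[OF subr(3)] zc] .
    show "set zs \<subseteq> adjoins R B zs" using adjoins_self[OF subr(3) zc] .
    show "\<phi> c \<in> adjoins R k zs" if "\<phi> \<in> F" "c \<in> adjoins R B zs"
      using F_adjoins[OF that(1) zs Bc kc F_base[OF that(1)] that(2)] .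
  qed
  have ind: "indep R k ys" "adjoins R k ys \<inter> P = {\<zero>}"
    using indep_of_crk[OF P ext(7)[OF ys(1)] subr(1)] prime_Int_k[OF P kc] ys(2) by (auto simp: Int_commute)
  \<comment> \<open>Going down relative to \<open>k[ys]\<close> is possible over
    \<open>P \<inter> A\<close> here, because \<open>k[ys]\<close> meets \<open>P\<close> only in
    zero.\<close>
  have above: "chain_to {P' \<in> Spec R. P \<inter> A \<subseteq> P' \<and> P \<inter> B \<subseteq> P'} e P"
  proof -
    let ?C = "adjoins R B ys"
    note x = ext[OF ys(1)]
    interpret C: cring "R\<lparr>carrier := ?C\<rparr>" by (rule cring_restrict[OF x(4)])
    have iB: "indep (R\<lparr>carrier := ?C\<rparr>) B ys"
      using indep_restrict[OF x(4,5,6)] indep_base_change[of "[]" ys] ind(1) ys(1) by simp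
    have PC: "P \<inter> ?C \<in> Spec (R\<lparr>carrier := ?C\<rparr>)"
      using prime_in_contract[OF P x(4) subringE(1)[OF x(4)]] by (simp add: Spec_def)
    have eqB: "P \<inter> ?C \<inter> B = P \<inter> B" using x(5) by auto
    have "chain_to {Q \<in> Spec (R\<lparr>carrier := ?C\<rparr>). adjoins R (P \<inter> B) ys \<subseteq> Q} e (P \<inter> ?C)"
      using C.chain_above_adjoins[OF subring_restrict[OF subr(3) x(5,4)] _ iB _ PC] x(6) eqB crk_restrict[OF x(4,5,6)]
      by (simp add: e_def)
    then have "chain_to {Q. prime_in R ?C Q \<and> adjoins R (P \<inter> B) ys \<subseteq> Q} e (P \<inter> ?C)" by (simp add: Spec_def)
    then have "chain_to {P' \<in> Spec R. P \<inter> A \<subseteq> P' \<and> adjoins R (P \<inter> B) ys \<subseteq> P'} e P"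
      using x ind(2) by (intro lift_chain[of "adjoins R k ys" ?C "P \<inter> A"] pA P) auto
    moreover have "P \<inter> B \<subseteq> adjoins R (P \<inter> B) ys"
      by (rule adjoins_base[OF prime_in_add_closed[OF qB Bc] x(7)])
    ultimately show ?thesis by (elim chain_to_mono) auto
  qed
  have "chain_to (Spec R) (m - e) Q"
    if m: "chain_to (Spec R) m P" and Q: "Q \<in> Spec R" "P \<inter> A \<subseteq> Q" "P \<inter> B \<subseteq> Q" for m Q
  proof -
    obtain S where S: "finite S" "S \<subseteq> A" and SC: "\<And>C. subring C R \<Longrightarrow> B \<subseteq> C \<Longrightarrow> \<forall>P'\<in>Spec R. S \<subseteq> cl R P' C
      \<Longrightarrow> chain_to {Q. prime_in R C Q} m (P \<inter> C)" using chain_contract[OF m gen Ac] by blast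
    \<comment> \<open>Including \<open>ys\<close> in the normalized set makes it algebraic over
      \<open>k[zs]\<close> modulo every prime, so \<open>zs\<close> has at least the rank of
      \<open>ys\<close> over \<open>B\<close> modulo \<open>P\<close>.\<close>
    obtain zs where zs: "set zs \<subseteq> A" "indep R k zs" "length zs \<le> h + length ys"
      "\<forall>P'\<in>Spec R. S \<union> set ys \<subseteq> cl R P' (adjoins R k zs)"
      using normalization[of "S \<union> set ys"] S ys(1) by auto
    let ?C = "adjoins R B zs" and ?K = "adjoins R k zs" and ?I = "adjoins R (P \<inter> B) zs"
    note x = ext[OF zs(1)]
    have cls: "S \<union> set ys \<subseteq> cl R P' ?C" if "P' \<in> Spec R" for P' using zs(4) that cl_mono[OF x(3), of R P'] by blast
    define m' where "m' = m - (length zs - crk R P B zs)"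
    have crk: "crk R P B ys \<le> crk R P B zs"
      using crk_le[OF P subr(3) x(7)] cls[of P] P by (simp add: Spec_def)
    interpret C: cring "R\<lparr>carrier := ?C\<rparr>" by (rule cring_restrict[OF x(4)])
    have iB: "indep R B zs" using indep_base_change[of "[]" zs] zs(1,2) by simp
    have iC: "indep (R\<lparr>carrier := ?C\<rparr>) B zs" by (rule indep_restrict[OF x(4,5,6) iB])
    have eqB: "P \<inter> ?C \<inter> B = P \<inter> B" using x(5) by auto
    have chC: "chain_to (Spec (R\<lparr>carrier := ?C\<rparr>)) m (P \<inter> ?C)" using SC[OF x(4,5)] cls by (simp add: Spec_def)
    have "chain_to (Spec (R\<lparr>carrier := ?C\<rparr>)) m' ?I"
      using C.chain_adjoins[OF subring_restrict[OF subr(3) x(5,4)] _ iC _ chC] x(6) eqB crk_restrict[OF x(4,5,6)]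
      by (simp add: m'_def)
    then have chI: "chain_to {Q. prime_in R ?C Q \<and> {} \<subseteq> Q} m' ?I" by (simp add: Spec_def)
    have prI: "prime_in R ?C ?I" using chain_to_mem[OF chI] by simp
    \<comment> \<open>\<open>P \<inter> A\<close> may contain nonzero elements of
      \<open>k[zs]\<close>, so the chain of \<open>B[zs]\<close> cannot be lifted over it. Over the
      zero ideal of \<open>A\<close> the condition on \<open>K0\<close> holds, and the height
      \<open>h\<close> of \<open>P \<inter> A\<close> is added afterwards by
      \<open>descend_chain\<close>.\<close>
    have base: "chain_to (Spec R) m' Q0" if Q0: "prime_in R (carrier R) Q0" "Q0 \<inter> A = {\<zero>}" "Q0 \<inter> B = P \<inter> B" for Q0
    proof -
      have IQ: "?I \<subseteq> Q0" by (rule adjoins_in_prime[OF Q0(1) x(7)]) (use Q0 in auto)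
      have IK: "?I \<inter> ?K = {\<zero>}" using IQ x(2) Q0(2) prime_inD(2)[OF prI] subringE(2)[OF x(1)] by blast
      have QK: "Q0 \<inter> ?K = {\<zero>}" using x(2) Q0(2) subringE(2)[OF x(1)] by blast
      have zK: "{\<zero>} \<inter> ?K = {\<zero>}" using subringE(2)[OF x(1)] by auto
      interpret rel: tensor_relative R k A B F ?K ?C "{\<zero>}" ?I
        by (intro tensor_relative.intro tensor_relative_axioms.intro tensor_pair_axioms) (fact x zero prI IK zK)+
      obtain Q1 where Q1: "prime_in R (carrier R) Q1" "Q1 \<subseteq> Q0" "Q1 \<inter> A = {\<zero>}" "Q1 \<inter> ?C = ?I"
        by (rule rel.going_down[OF Q0(1) _ IQ QK]) (use prime_inD(2)[OF Q0(1)] in auto)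
      have "chain_to {P' \<in> Spec R. {\<zero>} \<subseteq> P' \<and> {} \<subseteq> P'} m' Q1"
        using x zK by (intro lift_chain[OF _ _ _ _ _ _ zero _ chI Q1(1,3,4)]) auto
      then have "chain_to (Spec R) m' Q1" by (elim chain_to_mono) auto
      then show ?thesis using chain_to_weaken_top Q1(2) Q0(1) by (auto simp: Spec_def)
    qed
    have Qp: "prime_in R (carrier R) Q" using Q(1) by (simp add: Spec_def)
    obtain Q' where Q': "prime_in R (carrier R) Q'" "Q' \<subseteq> Q" "Q' \<inter> A = P \<inter> A" "Q' \<inter> B = P \<inter> B"
      by (rule going_down_pair[OF pA qB Qp Q(2,3)])
    have "chain_to (Spec R) (m' + h) Q'" by (rule descend_chain[OF qB zero base hA Q'(1,3,4)])
    then have "chain_to (Spec R) (m' + h) Q" using chain_to_weaken_top Q'(2) Q(1) by blast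
    \<comment> \<open>The loss \<open>length zs - crk R P B zs\<close> is at most
      \<open>h + length ys - crk R P B ys\<close>, which is \<open>h + e\<close>.\<close>
    moreover have "m - e \<le> m' + h" using zs(3) crk crk_le_length[of R P B zs] by (simp add: e_def m'_def)
    ultimately show ?thesis by (rule chain_to_le)
  qed
  then show ?thesis using above by blast
qed

end

section \<open>Linear forms\<close>

definition linear_form :: "'k ring \<Rightarrow> ('k, 'b) module \<Rightarrow> ('b \<Rightarrow> 'k) \<Rightarrow> bool" where
  "linear_form K B f \<longleftrightarrow> (\<forall>x\<in>carrier B. f x \<in> carrier K)
    \<and> (\<forall>x\<in>carrier B. \<forall>y\<in>carrier B. f (x \<oplus>\<^bsub>B\<^esub> y) = f x \<oplus>\<^bsub>K\<^esub> f y)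
    \<and> (\<forall>c\<in>carrier K. \<forall>x\<in>carrier B. f (c \<odot>\<^bsub>B\<^esub> x) = c \<otimes>\<^bsub>K\<^esub> f x)"

definition subspace :: "'k ring \<Rightarrow> ('k, 'b) module \<Rightarrow> 'b set \<Rightarrow> bool" where
  "subspace K B W \<longleftrightarrow> W \<subseteq> carrier B \<and> \<zero>\<^bsub>B\<^esub> \<in> W \<and> (\<forall>x\<in>W. \<forall>y\<in>W. x \<oplus>\<^bsub>B\<^esub> y \<in> W) \<and> (\<forall>c\<in>carrier K. \<forall>x\<in>W. c \<odot>\<^bsub>B\<^esub> x \<in> W)"

text \<open>Let \<open>M\<close> be maximal among the subspaces that contain \<open>W\<close> but
  not \<open>b\<close>. Then \<open>B\<close> is the direct sum of \<open>M\<close> and the line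
  through \<open>b\<close>, and \<open>f\<close> is the coordinate along that line.\<close>

lemma linear_form_exists:
  fixes K :: "'k ring" and B :: "('k, 'b) module"
  assumes K: "field K" and B: "algebra K B" and W: "subspace K B W" and b: "b \<in> carrier B" "b \<notin> W"
  obtains f where "linear_form K B f" "\<And>w. w \<in> W \<Longrightarrow> f w = \<zero>\<^bsub>K\<^esub>" "f b = \<one>\<^bsub>K\<^esub>"
proof -
  interpret K: field K by (rule K)
  interpret B: algebra K B by (rule B)
  define good where "good V \<longleftrightarrow> subspace K B V \<and> W \<subseteq> V \<and> b \<notin> V" for V
  have "\<exists>M\<in>Collect good. \<forall>I\<in>Collect good. M \<subseteq> I \<longrightarrow> I = M"
  proof (rule subset_Zorn_nonempty)
    show "Collect good \<noteq> {}" using W b by (auto simp: good_def)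
    fix C assume C: "C \<noteq> {}" "subset.chain (Collect good) C"
    then have g: "good I" if "I \<in> C" for I using that by (auto simp: subset_chain_def)
    have add: "x \<oplus>\<^bsub>B\<^esub> y \<in> \<Union>C" if xy: "x \<in> \<Union>C" "y \<in> \<Union>C" for x y
    proof -
      obtain I I' where I: "I \<in> C" "x \<in> I" "I' \<in> C" "y \<in> I'" using xy by blast
      then have "I \<subseteq> I' \<or> I' \<subseteq> I" using C(2) by (auto simp: subset_chain_def)
      then obtain I0 where "I0 \<in> C" "x \<in> I0" "y \<in> I0" using I by blast
      then show ?thesis using g[of I0] by (auto simp: good_def subspace_def)
    qed
    obtain I1 where I1: "I1 \<in> C" using C(1) by blast
    have "\<zero>\<^bsub>B\<^esub> \<in> \<Union>C" "W \<subseteq> \<Union>C" using I1 g[OF I1] by (auto simp: good_def subspace_def)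
    moreover have "I \<subseteq> carrier B" "b \<notin> I" if "I \<in> C" for I using g[OF that] by (auto simp: good_def subspace_def)
    then have "\<Union>C \<subseteq> carrier B" "b \<notin> \<Union>C" by blast+
    moreover have "c \<odot>\<^bsub>B\<^esub> x \<in> I" if "I \<in> C" "c \<in> carrier K" "x \<in> I" for c x I
      using g[OF that(1)] that by (auto simp: good_def subspace_def)
    then have "\<forall>c\<in>carrier K. \<forall>x\<in>\<Union>C. c \<odot>\<^bsub>B\<^esub> x \<in> \<Union>C" by blast
    ultimately show "\<Union>C \<in> Collect good" using add by (simp add: good_def subspace_def)
  qed
  then obtain M where M: "good M" "\<And>I. good I \<Longrightarrow> M \<subseteq> I \<Longrightarrow> I = M" by blast
  have Mc: "M \<subseteq> carrier B" and M0: "\<zero>\<^bsub>B\<^esub> \<in> M" and MW: "W \<subseteq> M" and Mb: "b \<notin> M"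
    and Ma: "\<And>x y. x \<in> M \<Longrightarrow> y \<in> M \<Longrightarrow> x \<oplus>\<^bsub>B\<^esub> y \<in> M"
    and Ms: "\<And>c x. c \<in> carrier K \<Longrightarrow> x \<in> M \<Longrightarrow> c \<odot>\<^bsub>B\<^esub> x \<in> M"
    using M(1) by (auto simp: good_def subspace_def)
  have ex: "\<exists>c\<in>carrier K. \<exists>m\<in>M. x = m \<oplus>\<^bsub>B\<^esub> c \<odot>\<^bsub>B\<^esub> b" if x: "x \<in> carrier B" for x
  proof (cases "x \<in> M")
    case True
    then have "x = x \<oplus>\<^bsub>B\<^esub> \<zero>\<^bsub>K\<^esub> \<odot>\<^bsub>B\<^esub> b" using x b by simp
    then show ?thesis using True K.zero_closed by blast
  next
    case False
    define I where "I = {m \<oplus>\<^bsub>B\<^esub> c \<odot>\<^bsub>B\<^esub> x | m c. m \<in> M \<and> c \<in> carrier K}"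
    have II: "y \<in> I" if "m \<in> M" "c \<in> carrier K" "y = m \<oplus>\<^bsub>B\<^esub> c \<odot>\<^bsub>B\<^esub> x" for m c y unfolding I_def using that by blast
    have MI: "M \<subseteq> I"
    proof
      fix m assume m: "m \<in> M"
      then have "m \<in> carrier B" using Mc by auto
      then show "m \<in> I" using x by (intro II[OF m K.zero_closed]) simp
    qed
    have xI: "x \<in> I" using x by (intro II[OF M0 K.one_closed]) simp
    have add: "u \<oplus>\<^bsub>B\<^esub> v \<in> I" if uv: "u \<in> I" "v \<in> I" for u v
    proof -
      obtain m c where h: "m \<in> M" "c \<in> carrier K" "u = m \<oplus>\<^bsub>B\<^esub> c \<odot>\<^bsub>B\<^esub> x" using uv(1) unfolding I_def by blast
      obtain m' c' where h': "m' \<in> M" "c' \<in> carrier K" "v = m' \<oplus>\<^bsub>B\<^esub> c' \<odot>\<^bsub>B\<^esub> x" using uv(2) unfolding I_def by blast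
      have car: "m \<in> carrier B" "m' \<in> carrier B" using h h' Mc by auto
      show ?thesis
      proof (rule II)
        show "u \<oplus>\<^bsub>B\<^esub> v = (m \<oplus>\<^bsub>B\<^esub> m') \<oplus>\<^bsub>B\<^esub> (c \<oplus>\<^bsub>K\<^esub> c') \<odot>\<^bsub>B\<^esub> x" using h h' car x by (simp add: B.smult_l_distr B.a_ac)
      qed (use h h' Ma in auto)
    qed
    have mul: "c \<odot>\<^bsub>B\<^esub> u \<in> I" if c: "c \<in> carrier K" and u: "u \<in> I" for c u
    proof -
      obtain m d where h: "m \<in> M" "d \<in> carrier K" "u = m \<oplus>\<^bsub>B\<^esub> d \<odot>\<^bsub>B\<^esub> x" using u unfolding I_def by blast
      have car: "m \<in> carrier B" using h Mc by auto
      show ?thesis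
      proof (rule II)
        show "c \<odot>\<^bsub>B\<^esub> u = c \<odot>\<^bsub>B\<^esub> m \<oplus>\<^bsub>B\<^esub> (c \<otimes>\<^bsub>K\<^esub> d) \<odot>\<^bsub>B\<^esub> x" using h car x c by (simp add: B.smult_r_distr B.smult_assoc1)
      qed (use h Ms c in auto)
    qed
    have "I \<subseteq> carrier B" using Mc x unfolding I_def by auto
    then have "subspace K B I" "W \<subseteq> I" using add mul MI M0 MW by (auto simp: subspace_def)
    \<comment> \<open>Maximality: a subspace properly larger than \<open>M\<close> must contain
      \<open>b\<close>. The resulting expression for \<open>b\<close> has a nonzero coefficient at
      \<open>x\<close> and can be solved for \<open>x\<close>.\<close>
    then have "b \<in> I" using M(2)[of I] MI xI False by (auto simp: good_def)
    then obtain m c where h: "m \<in> M" "c \<in> carrier K" "b = m \<oplus>\<^bsub>B\<^esub> c \<odot>\<^bsub>B\<^esub> x" unfolding I_def by blast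
    have car: "m \<in> carrier B" using h Mc by auto
    have c0: "c \<noteq> \<zero>\<^bsub>K\<^esub>" using h Mb car x by auto
    then have ic: "inv\<^bsub>K\<^esub> c \<in> carrier K" "inv\<^bsub>K\<^esub> c \<otimes>\<^bsub>K\<^esub> c = \<one>\<^bsub>K\<^esub>" using h(2) K.field_Units by auto
    have "inv\<^bsub>K\<^esub> c \<odot>\<^bsub>B\<^esub> b = inv\<^bsub>K\<^esub> c \<odot>\<^bsub>B\<^esub> m \<oplus>\<^bsub>B\<^esub> x"
      using h(3) car x ic h(2) by (simp add: B.smult_r_distr B.smult_assoc1[symmetric])
    moreover have "(\<ominus>\<^bsub>K\<^esub> (inv\<^bsub>K\<^esub> c)) \<odot>\<^bsub>B\<^esub> m = \<ominus>\<^bsub>B\<^esub> (inv\<^bsub>K\<^esub> c \<odot>\<^bsub>B\<^esub> m)"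
      using ic car by (simp add: B.smult_l_minus)
    ultimately have "x = (\<ominus>\<^bsub>K\<^esub> (inv\<^bsub>K\<^esub> c)) \<odot>\<^bsub>B\<^esub> m \<oplus>\<^bsub>B\<^esub> inv\<^bsub>K\<^esub> c \<odot>\<^bsub>B\<^esub> b"
      using ic car x by (simp add: B.r_neg1)
    then show ?thesis using ic(1) Ms[OF _ h(1)] K.a_inv_closed by blast
  qed
  have unique: "c = c'" if h: "c \<in> carrier K" "c' \<in> carrier K" "m \<in> M" "m' \<in> M"
    "m \<oplus>\<^bsub>B\<^esub> c \<odot>\<^bsub>B\<^esub> b = m' \<oplus>\<^bsub>B\<^esub> c' \<odot>\<^bsub>B\<^esub> b" for c c' m m'
  proof (rule ccontr)
    assume "c \<noteq> c'"
    define d where "d = c \<ominus>\<^bsub>K\<^esub> c'"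
    have d: "d \<in> carrier K" "d \<noteq> \<zero>\<^bsub>K\<^esub>" using h(1,2) \<open>c \<noteq> c'\<close> by (auto simp: d_def)
    have car: "m \<in> carrier B" "m' \<in> carrier B" using h Mc by auto
    have nm: "\<ominus>\<^bsub>B\<^esub> m \<in> M"
    proof -
      have "(\<ominus>\<^bsub>K\<^esub> \<one>\<^bsub>K\<^esub>) \<odot>\<^bsub>B\<^esub> m \<in> M" using Ms h(3) by auto
      then show ?thesis using car by (simp add: B.smult_l_minus)
    qed
    have c: "c = d \<oplus>\<^bsub>K\<^esub> c'" using h(1,2) by (simp add: d_def K.minus_eq K.a_assoc K.l_neg)
    have "m \<oplus>\<^bsub>B\<^esub> (d \<odot>\<^bsub>B\<^esub> b \<oplus>\<^bsub>B\<^esub> c' \<odot>\<^bsub>B\<^esub> b) = m' \<oplus>\<^bsub>B\<^esub> c' \<odot>\<^bsub>B\<^esub> b"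
      using h(5) d h(2) b by (simp add: c B.smult_l_distr)
    then have "(m \<oplus>\<^bsub>B\<^esub> d \<odot>\<^bsub>B\<^esub> b) \<oplus>\<^bsub>B\<^esub> c' \<odot>\<^bsub>B\<^esub> b = m' \<oplus>\<^bsub>B\<^esub> c' \<odot>\<^bsub>B\<^esub> b"
      using car d h(2) b by (simp add: B.a_assoc)
    then have "m \<oplus>\<^bsub>B\<^esub> d \<odot>\<^bsub>B\<^esub> b = m'" using car d h(2) b by (simp add: B.add.right_cancel)
    then have "d \<odot>\<^bsub>B\<^esub> b = \<ominus>\<^bsub>B\<^esub> m \<oplus>\<^bsub>B\<^esub> m'" using car d b by (auto simp: B.r_neg1)
    then have "d \<odot>\<^bsub>B\<^esub> b \<in> M" using Ma[OF nm h(4)] by simp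
    moreover have id: "inv\<^bsub>K\<^esub> d \<in> carrier K" "inv\<^bsub>K\<^esub> d \<otimes>\<^bsub>K\<^esub> d = \<one>\<^bsub>K\<^esub>" using d K.field_Units by auto
    ultimately have "inv\<^bsub>K\<^esub> d \<odot>\<^bsub>B\<^esub> (d \<odot>\<^bsub>B\<^esub> b) \<in> M" using Ms by blast
    moreover have "inv\<^bsub>K\<^esub> d \<odot>\<^bsub>B\<^esub> (d \<odot>\<^bsub>B\<^esub> b) = b"
      using d b id by (simp add: B.smult_assoc1[symmetric])
    ultimately show False using Mb by simp
  qed
  define f where "f x = (THE c. c \<in> carrier K \<and> (\<exists>m\<in>M. x = m \<oplus>\<^bsub>B\<^esub> c \<odot>\<^bsub>B\<^esub> b))" for x
  have f_eq: "f (m \<oplus>\<^bsub>B\<^esub> c \<odot>\<^bsub>B\<^esub> b) = c" if "m \<in> M" "c \<in> carrier K" for m c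
    unfolding f_def
  proof (rule the_equality)
    show "c \<in> carrier K \<and> (\<exists>m'\<in>M. m \<oplus>\<^bsub>B\<^esub> c \<odot>\<^bsub>B\<^esub> b = m' \<oplus>\<^bsub>B\<^esub> c \<odot>\<^bsub>B\<^esub> b)" using that by blast
    fix d assume "d \<in> carrier K \<and> (\<exists>m'\<in>M. m \<oplus>\<^bsub>B\<^esub> c \<odot>\<^bsub>B\<^esub> b = m' \<oplus>\<^bsub>B\<^esub> d \<odot>\<^bsub>B\<^esub> b)"
    then obtain m' where "d \<in> carrier K" "m' \<in> M" "m \<oplus>\<^bsub>B\<^esub> c \<odot>\<^bsub>B\<^esub> b = m' \<oplus>\<^bsub>B\<^esub> d \<odot>\<^bsub>B\<^esub> b" by blast
    then show "d = c" using unique[of c d m m'] that by simp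
  qed
  have "linear_form K B f" unfolding linear_form_def
  proof (intro conjI ballI)
    fix x assume "x \<in> carrier B"
    then obtain m c where h: "m \<in> M" "c \<in> carrier K" "x = m \<oplus>\<^bsub>B\<^esub> c \<odot>\<^bsub>B\<^esub> b" using ex by blast
    then show "f x \<in> carrier K" using f_eq by simp
    have car: "m \<in> carrier B" using h Mc by auto
    { fix y assume "y \<in> carrier B"
      then obtain m' c' where h': "m' \<in> M" "c' \<in> carrier K" "y = m' \<oplus>\<^bsub>B\<^esub> c' \<odot>\<^bsub>B\<^esub> b" using ex by blast
      have car': "m' \<in> carrier B" using h' Mc by auto
      have "x \<oplus>\<^bsub>B\<^esub> y = (m \<oplus>\<^bsub>B\<^esub> m') \<oplus>\<^bsub>B\<^esub> (c \<oplus>\<^bsub>K\<^esub> c') \<odot>\<^bsub>B\<^esub> b" using h h' car car' b by (simp add: B.smult_l_distr B.a_ac)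
      then show "f (x \<oplus>\<^bsub>B\<^esub> y) = f x \<oplus>\<^bsub>K\<^esub> f y" using h h' f_eq Ma by simp }
    fix d assume d: "d \<in> carrier K"
    have "d \<odot>\<^bsub>B\<^esub> x = d \<odot>\<^bsub>B\<^esub> m \<oplus>\<^bsub>B\<^esub> (d \<otimes>\<^bsub>K\<^esub> c) \<odot>\<^bsub>B\<^esub> b" using h car d b by (simp add: B.smult_r_distr B.smult_assoc1)
    then show "f (d \<odot>\<^bsub>B\<^esub> x) = d \<otimes>\<^bsub>K\<^esub> f x" using h f_eq Ms d by simp
  qed
  moreover have "f w = \<zero>\<^bsub>K\<^esub>" if "w \<in> W" for w
  proof -
    have "w \<in> M" "w \<in> carrier B" using that MW Mc by auto
    then show ?thesis using f_eq[of w "\<zero>\<^bsub>K\<^esub>"] b by simp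
  qed
  moreover have "f b = \<one>\<^bsub>K\<^esub>" using f_eq[OF M0 K.one_closed] b by simp
  ultimately show thesis using that by blast
qed

section \<open>The tensor product of two algebras\<close>

locale two_algebras =
  fixes K :: "'k ring" and A :: "('k, 'a) module" and B :: "('k, 'b) module"
  assumes K: "field K" and A: "algebra K A" and B: "algebra K B"
begin

sublocale K: field K by (rule K)
sublocale A: algebra K A by (rule A)
sublocale B: algebra K B by (rule B)

abbreviation "FT \<equiv> free_tensor A B"
abbreviation "I \<equiv> tensor_ideal K A B"
abbreviation "T \<equiv> tensor K A B"
abbreviation "pure \<equiv> pure_tensor K A B"

sublocale F: cring FT by (rule free_tensor_cring[OF algebra.axioms(2)[OF A] algebra.axioms(2)[OF B]])
sublocale I: ideal I FT by (rule tensor_ideal_ideal[OF A B])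
sublocale T: cring T by (rule tensor_cring[OF A B])

lemma FT_simps: "x \<oplus>\<^bsub>FT\<^esub> y = x + y" "\<zero>\<^bsub>FT\<^esub> = 0" "\<one>\<^bsub>FT\<^esub> = frag_of (\<one>\<^bsub>A\<^esub>, \<one>\<^bsub>B\<^esub>)"
  "x \<in> carrier FT \<longleftrightarrow> Poly_Mapping.keys x \<subseteq> carrier A \<times> carrier B"
  by (simp_all add: free_tensor_def)

lemma FT_minus: "x \<in> carrier FT \<Longrightarrow> \<ominus>\<^bsub>FT\<^esub> x = - x"
  by (rule F.minus_equality) (auto simp: FT_simps)

lemma FT_diff_closed: "x \<in> carrier FT \<Longrightarrow> y \<in> carrier FT \<Longrightarrow> x - y \<in> carrier FT"
  using F.minus_closed[of x y] by (simp add: a_minus_def FT_minus FT_simps)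

lemma FT_of: "a \<in> carrier A \<Longrightarrow> b \<in> carrier B \<Longrightarrow> frag_of (a, b) \<in> carrier FT"
  by (simp add: FT_simps)

lemma FT_mult_of: "frag_of (a, b) \<otimes>\<^bsub>FT\<^esub> frag_of (a', b') = frag_of (a \<otimes>\<^bsub>A\<^esub> a', b \<otimes>\<^bsub>B\<^esub> b')"
  by (simp add: free_tensor_def)

lemma FT_of_mult_diff: "frag_of (a, b) \<otimes>\<^bsub>FT\<^esub> (x - y) = frag_of (a, b) \<otimes>\<^bsub>FT\<^esub> x - frag_of (a, b) \<otimes>\<^bsub>FT\<^esub> y"
  by (simp add: free_tensor_def frag_extend_diff)

lemma FT_diff_mult: "(x - y) \<otimes>\<^bsub>FT\<^esub> z = x \<otimes>\<^bsub>FT\<^esub> z - y \<otimes>\<^bsub>FT\<^esub> z"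
  by (simp add: free_tensor_def frag_extend_diff)

lemma FT_zero_mult: "0 \<otimes>\<^bsub>FT\<^esub> z = 0"
  by (simp add: free_tensor_def)

lemma FT_induct [consumes 1, case_names zero of diff]:
  assumes "x \<in> carrier FT" "P 0" "\<And>a b. a \<in> carrier A \<Longrightarrow> b \<in> carrier B \<Longrightarrow> P (frag_of (a, b))"
    "\<And>x y. x \<in> carrier FT \<Longrightarrow> y \<in> carrier FT \<Longrightarrow> P x \<Longrightarrow> P y \<Longrightarrow> P (x - y)"
  shows "P x"
  using free_Abelian_group_induct[of x "carrier A \<times> carrier B" P] assms by (auto simp: FT_simps)

definition proj where "proj x = I +>\<^bsub>FT\<^esub> x"

lemma proj_hom: "proj \<in> ring_hom FT T"
  using I.rcos_ring_hom by (simp add: proj_def[abs_def] tensor_def)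

sublocale proj: ring_hom_cring FT T proj
  by (intro ring_hom_cring.intro ring_hom_cring_axioms.intro proj_hom F.is_cring T.is_cring)

lemma proj_surj: "carrier T = proj ` carrier FT"
  by (auto simp: tensor_def FactRing_def A_RCOSETS_def' proj_def)

lemma proj_eq_zero: "x \<in> carrier FT \<Longrightarrow> proj x = \<zero>\<^bsub>T\<^esub> \<longleftrightarrow> x \<in> I"
  using I.a_rcos_const I.a_rcos_self by (auto simp: proj_def tensor_def FactRing_def)

lemma proj_diff: "x \<in> carrier FT \<Longrightarrow> y \<in> carrier FT \<Longrightarrow> proj (x - y) = proj x \<ominus>\<^bsub>T\<^esub> proj y"
  using proj.hom_add[of x "\<ominus>\<^bsub>FT\<^esub> y"] proj.hom_a_inv[of y] by (simp add: FT_minus FT_simps T.minus_eq)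

lemma pure_proj: "pure a b = proj (frag_of (a, b))"
  by (simp add: pure_tensor_def proj_def)

lemma pure_closed [simp]: "a \<in> carrier A \<Longrightarrow> b \<in> carrier B \<Longrightarrow> pure a b \<in> carrier T"
  by (simp add: pure_proj FT_of)

lemma pure_mult: "a \<in> carrier A \<Longrightarrow> b \<in> carrier B \<Longrightarrow> a' \<in> carrier A \<Longrightarrow> b' \<in> carrier B \<Longrightarrow>
    pure a b \<otimes>\<^bsub>T\<^esub> pure a' b' = pure (a \<otimes>\<^bsub>A\<^esub> a') (b \<otimes>\<^bsub>B\<^esub> b')"
  by (simp add: pure_proj FT_of FT_mult_of[symmetric])

lemma pure_one: "pure \<one>\<^bsub>A\<^esub> \<one>\<^bsub>B\<^esub> = \<one>\<^bsub>T\<^esub>"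
  using proj.hom_one by (simp add: pure_proj FT_simps)

lemma relation_eq:
  assumes "x \<in> carrier FT" "y \<in> carrier FT" "x - y \<in> tensor_relations K A B"
  shows "proj x = proj y"
proof -
  have "x - y \<in> I" unfolding tensor_ideal_def
    using F.genideal_self[OF tensor_relations_subset[OF A B]] assms(3) by blast
  then have "proj x \<ominus>\<^bsub>T\<^esub> proj y = \<zero>\<^bsub>T\<^esub>"
    using proj_eq_zero[of "x - y"] proj_diff[OF assms(1,2)] FT_diff_closed[OF assms(1,2)] by simp
  then show ?thesis using assms(1,2) by simp
qed

lemma pure_add_left:
  assumes "a \<in> carrier A" "a' \<in> carrier A" "b \<in> carrier B"
  shows "pure (a \<oplus>\<^bsub>A\<^esub> a') b = pure a b \<oplus>\<^bsub>T\<^esub> pure a' b"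
proof -
  have "proj (frag_of (a \<oplus>\<^bsub>A\<^esub> a', b)) = proj (frag_of (a, b) \<oplus>\<^bsub>FT\<^esub> frag_of (a', b))"
  proof (rule relation_eq)
    have "frag_of (a \<oplus>\<^bsub>A\<^esub> a', b) - (frag_of (a, b) \<oplus>\<^bsub>FT\<^esub> frag_of (a', b)) =
      frag_of (a \<oplus>\<^bsub>A\<^esub> a', b) - frag_of (a, b) - frag_of (a', b)" by (simp add: FT_simps(1))
    then show "frag_of (a \<oplus>\<^bsub>A\<^esub> a', b) - (frag_of (a, b) \<oplus>\<^bsub>FT\<^esub> frag_of (a', b)) \<in> tensor_relations K A B"
      using assms unfolding tensor_relations_def by blast
  qed (use assms in \<open>auto intro!: F.a_closed FT_of\<close>)
  then show ?thesis using assms by (simp add: pure_proj FT_of)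
qed

lemma pure_add_right:
  assumes "a \<in> carrier A" "b \<in> carrier B" "b' \<in> carrier B"
  shows "pure a (b \<oplus>\<^bsub>B\<^esub> b') = pure a b \<oplus>\<^bsub>T\<^esub> pure a b'"
proof -
  have "proj (frag_of (a, b \<oplus>\<^bsub>B\<^esub> b')) = proj (frag_of (a, b) \<oplus>\<^bsub>FT\<^esub> frag_of (a, b'))"
  proof (rule relation_eq)
    have "frag_of (a, b \<oplus>\<^bsub>B\<^esub> b') - (frag_of (a, b) \<oplus>\<^bsub>FT\<^esub> frag_of (a, b')) =
      frag_of (a, b \<oplus>\<^bsub>B\<^esub> b') - frag_of (a, b) - frag_of (a, b')" by (simp add: FT_simps(1))
    then show "frag_of (a, b \<oplus>\<^bsub>B\<^esub> b') - (frag_of (a, b) \<oplus>\<^bsub>FT\<^esub> frag_of (a, b')) \<in> tensor_relations K A B"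
      using assms unfolding tensor_relations_def by blast
  qed (use assms in \<open>auto intro!: F.a_closed FT_of\<close>)
  then show ?thesis using assms by (simp add: pure_proj FT_of)
qed

lemma pure_smult:
  assumes "c \<in> carrier K" "a \<in> carrier A" "b \<in> carrier B"
  shows "pure (c \<odot>\<^bsub>A\<^esub> a) b = pure a (c \<odot>\<^bsub>B\<^esub> b)"
  unfolding pure_proj
  by (rule relation_eq) (use assms in \<open>auto simp: tensor_relations_def intro!: FT_of\<close>)

text \<open>\<open>h\<close> is the additive lift of id \<otimes> \<open>f\<close> to the free
  abelian group, before the tensor relations are divided out.\<close>

definition extends :: "('b \<Rightarrow> 'k) \<Rightarrow> (('a \<times> 'b \<Rightarrow>\<^sub>0 int) \<Rightarrow> 'a) \<Rightarrow> bool" where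
  "extends f h \<longleftrightarrow> h \<in> carrier FT \<rightarrow> carrier A \<and> (\<forall>x\<in>carrier FT. \<forall>y\<in>carrier FT. h (x \<oplus>\<^bsub>FT\<^esub> y) = h x \<oplus>\<^bsub>A\<^esub> h y)
    \<and> (\<forall>a\<in>carrier A. \<forall>b\<in>carrier B. h (frag_of (a, b)) = f b \<odot>\<^bsub>A\<^esub> a)"

lemma extends_exists:
  assumes f: "linear_form K B f" shows "\<exists>h. extends f h"
proof -
  let ?S = "carrier A \<times> carrier B"
  have "(\<lambda>(a, b). f b \<odot>\<^bsub>A\<^esub> a) ` ?S \<subseteq> carrier (add_monoid A)"
    using f by (auto simp: linear_form_def)
  then obtain h where h: "h \<in> hom (free_Abelian_group ?S) (add_monoid A)"
    "\<And>x. x \<in> ?S \<Longrightarrow> h (frag_of x) = (\<lambda>(a, b). f b \<odot>\<^bsub>A\<^esub> a) x"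
    using comm_group.free_Abelian_group_universal[OF A.a_comm_group, of "\<lambda>(a, b). f b \<odot>\<^bsub>A\<^esub> a" ?S] by blast
  have "extends f h" unfolding extends_def using h by (auto simp: hom_def FT_simps)
  then show ?thesis by blast
qed

lemma extends_diff:
  assumes "extends f h" "x \<in> carrier FT" "y \<in> carrier FT" shows "h (x - y) = h x \<ominus>\<^bsub>A\<^esub> h y"
proof -
  have "h (x - y) \<oplus>\<^bsub>A\<^esub> h y = h x"
  proof -
    have "h ((x - y) \<oplus>\<^bsub>FT\<^esub> y) = h (x - y) \<oplus>\<^bsub>A\<^esub> h y"
      using assms FT_diff_closed[OF assms(2,3)] by (simp add: extends_def)
    then show ?thesis by (simp add: FT_simps(1))
  qed
  moreover have "h (x - y) \<in> carrier A" "h y \<in> carrier A" using assms FT_diff_closed by (auto simp: extends_def)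
  ultimately show ?thesis by (metis A.add.inv_solve_right A.add.m_closed a_minus_def)
qed

lemma extends_zero:
  assumes "extends f h" shows "h 0 = \<zero>\<^bsub>A\<^esub>"
proof -
  have z: "0 \<in> carrier FT" by (simp add: FT_simps)
  then have "h 0 \<in> carrier A" using assms by (auto simp: extends_def)
  then show ?thesis using extends_diff[OF assms z z] by (simp add: A.minus_eq A.r_neg)
qed

text \<open>\<open>tensor_ideal\<close> is generated as an ideal, while \<open>h\<close> is only
  additive and its kernel need not be an ideal. \<open>N\<close> is the largest ideal inside that
  kernel.\<close>

lemma extends_kills:
  assumes f: "linear_form K B f" and h: "extends f h" and x: "x \<in> I"
  shows "h x = \<zero>\<^bsub>A\<^esub>"
proof -
  define N where "N = {x \<in> carrier FT. \<forall>y\<in>carrier FT. h (y \<otimes>\<^bsub>FT\<^esub> x) = \<zero>\<^bsub>A\<^esub>}"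
  have hof: "h (frag_of (a, b)) = f b \<odot>\<^bsub>A\<^esub> a" if "a \<in> carrier A" "b \<in> carrier B" for a b using h that by (simp add: extends_def)
  have hadd: "h (x \<oplus>\<^bsub>FT\<^esub> y) = h x \<oplus>\<^bsub>A\<^esub> h y" if "x \<in> carrier FT" "y \<in> carrier FT" for x y using h that by (simp add: extends_def)
  have "ideal N FT"
  proof (rule idealI[OF F.ring_axioms])
    show "subgroup N (add_monoid FT)"
    proof (rule F.add.subgroupI)
      show "N \<subseteq> carrier FT" by (auto simp: N_def)
      have "\<zero>\<^bsub>FT\<^esub> \<in> N" using extends_zero[OF h] by (simp add: N_def flip: FT_simps(2))
      then show "N \<noteq> {}" by auto
      fix x assume x: "x \<in> N"
      have "h (y \<otimes>\<^bsub>FT\<^esub> \<ominus>\<^bsub>FT\<^esub> x) = \<zero>\<^bsub>A\<^esub>" if y: "y \<in> carrier FT" for y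
      proof -
        have "y \<otimes>\<^bsub>FT\<^esub> \<ominus>\<^bsub>FT\<^esub> x = \<ominus>\<^bsub>FT\<^esub> y \<otimes>\<^bsub>FT\<^esub> x" using x y by (simp add: N_def F.r_minus F.l_minus)
        then show ?thesis using x y by (simp add: N_def)
      qed
      then show "\<ominus>\<^bsub>FT\<^esub> x \<in> N" using x by (simp add: N_def)
      fix y assume y: "y \<in> N"
      then show "x \<oplus>\<^bsub>FT\<^esub> y \<in> N" using x by (simp add: N_def F.r_distr hadd)
    qed
    fix a x assume a: "a \<in> N" and x: "x \<in> carrier FT"
    show "x \<otimes>\<^bsub>FT\<^esub> a \<in> N" using a x by (simp add: N_def flip: F.m_assoc)
    then show "a \<otimes>\<^bsub>FT\<^esub> x \<in> N" using a x by (simp add: N_def F.m_comm)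
  qed
  moreover have "tensor_relations K A B \<subseteq> N"
  proof
    fix r assume r: "r \<in> tensor_relations K A B"
    then have rc: "r \<in> carrier FT" using tensor_relations_subset[OF A B] by auto
    have fc: "f b \<in> carrier K" if "b \<in> carrier B" for b using f that by (simp add: linear_form_def)
    have fadd: "f (b \<oplus>\<^bsub>B\<^esub> b') = f b \<oplus>\<^bsub>K\<^esub> f b'" if "b \<in> carrier B" "b' \<in> carrier B" for b b' using f that by (simp add: linear_form_def)
    have fsm: "f (c \<odot>\<^bsub>B\<^esub> b) = c \<otimes>\<^bsub>K\<^esub> f b" if "b \<in> carrier B" "c \<in> carrier K" for b c using f that by (simp add: linear_form_def)
    \<comment> \<open>By additivity \<open>y\<close> may be taken to be a generator; the three kinds
      of relations then reduce to distributivity in \<open>A\<close>, additivity of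
      \<open>f\<close>, and its homogeneity.\<close>
    have "h (y \<otimes>\<^bsub>FT\<^esub> r) = \<zero>\<^bsub>A\<^esub>" if "y \<in> carrier FT" for y
      using that
    proof (induction y rule: FT_induct)
      case zero
      then show ?case using extends_zero[OF h] by (simp add: FT_zero_mult)
    next
      case (of a0 b0)
      note ab = of
      from r consider (1) a a' b where "r = frag_of (a \<oplus>\<^bsub>A\<^esub> a', b) - frag_of (a, b) - frag_of (a', b)"
          "a \<in> carrier A" "a' \<in> carrier A" "b \<in> carrier B"
        | (2) a b b' where "r = frag_of (a, b \<oplus>\<^bsub>B\<^esub> b') - frag_of (a, b) - frag_of (a, b')"
          "a \<in> carrier A" "b \<in> carrier B" "b' \<in> carrier B"
        | (3) c a b where "r = frag_of (c \<odot>\<^bsub>A\<^esub> a, b) - frag_of (a, c \<odot>\<^bsub>B\<^esub> b)"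
          "c \<in> carrier K" "a \<in> carrier A" "b \<in> carrier B"
        unfolding tensor_relations_def by blast
      then show ?case
      proof cases
        case 1
        have "h (frag_of (a0, b0) \<otimes>\<^bsub>FT\<^esub> r) = f (b0 \<otimes>\<^bsub>B\<^esub> b) \<odot>\<^bsub>A\<^esub> (a0 \<otimes>\<^bsub>A\<^esub> (a \<oplus>\<^bsub>A\<^esub> a'))
          \<ominus>\<^bsub>A\<^esub> f (b0 \<otimes>\<^bsub>B\<^esub> b) \<odot>\<^bsub>A\<^esub> (a0 \<otimes>\<^bsub>A\<^esub> a) \<ominus>\<^bsub>A\<^esub> f (b0 \<otimes>\<^bsub>B\<^esub> b) \<odot>\<^bsub>A\<^esub> (a0 \<otimes>\<^bsub>A\<^esub> a')"
          using 1 ab by (simp add: FT_of_mult_diff FT_mult_of extends_diff[OF h] FT_of FT_diff_closed hof)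
        also have "\<dots> = \<zero>\<^bsub>A\<^esub>"
          using 1 ab fc by (simp add: A.r_distr A.smult_r_distr A.minus_eq A.a_ac A.r_neg A.r_neg1 A.r_neg2)
        finally show ?thesis .
      next
        case 2
        have "h (frag_of (a0, b0) \<otimes>\<^bsub>FT\<^esub> r) = f (b0 \<otimes>\<^bsub>B\<^esub> (b \<oplus>\<^bsub>B\<^esub> b')) \<odot>\<^bsub>A\<^esub> (a0 \<otimes>\<^bsub>A\<^esub> a)
          \<ominus>\<^bsub>A\<^esub> f (b0 \<otimes>\<^bsub>B\<^esub> b) \<odot>\<^bsub>A\<^esub> (a0 \<otimes>\<^bsub>A\<^esub> a) \<ominus>\<^bsub>A\<^esub> f (b0 \<otimes>\<^bsub>B\<^esub> b') \<odot>\<^bsub>A\<^esub> (a0 \<otimes>\<^bsub>A\<^esub> a)"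
          using 2 ab by (simp add: FT_of_mult_diff FT_mult_of extends_diff[OF h] FT_of FT_diff_closed hof)
        also have "\<dots> = \<zero>\<^bsub>A\<^esub>"
          using 2 ab fc fadd by (simp add: B.r_distr A.smult_l_distr A.minus_eq A.a_ac A.r_neg A.r_neg1 A.r_neg2)
        finally show ?thesis .
      next
        case 3
        have m: "a0 \<otimes>\<^bsub>A\<^esub> (c \<odot>\<^bsub>A\<^esub> a) = c \<odot>\<^bsub>A\<^esub> (a0 \<otimes>\<^bsub>A\<^esub> a)" "b0 \<otimes>\<^bsub>B\<^esub> (c \<odot>\<^bsub>B\<^esub> b) = c \<odot>\<^bsub>B\<^esub> (b0 \<otimes>\<^bsub>B\<^esub> b)"
          using 3 ab A.smult_assoc2[of c a a0] B.smult_assoc2[of c b b0] by (simp_all add: A.m_comm B.m_comm)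
        have "h (frag_of (a0, b0) \<otimes>\<^bsub>FT\<^esub> r) = f (b0 \<otimes>\<^bsub>B\<^esub> b) \<odot>\<^bsub>A\<^esub> (c \<odot>\<^bsub>A\<^esub> (a0 \<otimes>\<^bsub>A\<^esub> a))
          \<ominus>\<^bsub>A\<^esub> (c \<otimes>\<^bsub>K\<^esub> f (b0 \<otimes>\<^bsub>B\<^esub> b)) \<odot>\<^bsub>A\<^esub> (a0 \<otimes>\<^bsub>A\<^esub> a)"
          using 3 ab by (simp add: FT_of_mult_diff FT_mult_of extends_diff[OF h] FT_of FT_diff_closed hof m fsm)
        also have "\<dots> = \<zero>\<^bsub>A\<^esub>" using 3 ab fc by (simp add: K.m_comm[of c] A.smult_assoc1)
        finally show ?thesis .
      qed
    next
      case (diff x y)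
      have "h (x \<otimes>\<^bsub>FT\<^esub> r - y \<otimes>\<^bsub>FT\<^esub> r) = h (x \<otimes>\<^bsub>FT\<^esub> r) \<ominus>\<^bsub>A\<^esub> h (y \<otimes>\<^bsub>FT\<^esub> r)"
        using diff rc by (intro extends_diff[OF h]) auto
      then show ?case using diff by (simp add: FT_diff_mult)
    qed
    then show "r \<in> N" using rc by (simp add: N_def)
  qed
  ultimately have "I \<subseteq> N" unfolding tensor_ideal_def by (rule F.genideal_minimal)
  then have "x \<in> N" using x by blast
  then have "x \<in> carrier FT" "h (\<one>\<^bsub>FT\<^esub> \<otimes>\<^bsub>FT\<^esub> x) = \<zero>\<^bsub>A\<^esub>" unfolding N_def using F.one_closed by blast+
  then show ?thesis by simp
qed

text \<open>\<open>\<Phi>\<close> evaluates \<open>h\<close> at a chosen representative. Two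
  representatives differ by an element of the tensor ideal, which \<open>h\<close> kills.\<close>

lemma functional_exists:
  assumes f: "linear_form K B f"
  shows "\<exists>\<Phi>. \<Phi> \<in> carrier T \<rightarrow> carrier A \<and> (\<forall>s\<in>carrier T. \<forall>t\<in>carrier T. \<Phi> (s \<oplus>\<^bsub>T\<^esub> t) = \<Phi> s \<oplus>\<^bsub>A\<^esub> \<Phi> t)
    \<and> (\<forall>a\<in>carrier A. \<forall>b\<in>carrier B. \<Phi> (pure a b) = f b \<odot>\<^bsub>A\<^esub> a)"
proof -
  obtain h where h: "extends f h" using extends_exists[OF f] by blast
  define \<Phi> where "\<Phi> t = h (SOME x. x \<in> carrier FT \<and> proj x = t)" for t
  have \<Phi>: "\<Phi> (proj x) = h x" if x: "x \<in> carrier FT" for x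
  proof -
    let ?y = "SOME y. y \<in> carrier FT \<and> proj y = proj x"
    have y: "?y \<in> carrier FT" "proj ?y = proj x" using someI[of "\<lambda>y. y \<in> carrier FT \<and> proj y = proj x" x] x by auto
    have "proj (?y - x) = \<zero>\<^bsub>T\<^esub>" using proj_diff[OF y(1) x] y(2) x by simp
    then have "?y - x \<in> I" using proj_eq_zero[OF FT_diff_closed[OF y(1) x]] by simp
    then have "h (?y - x) = \<zero>\<^bsub>A\<^esub>" by (rule extends_kills[OF f h])
    then have "h ?y \<ominus>\<^bsub>A\<^esub> h x = \<zero>\<^bsub>A\<^esub>" using extends_diff[OF h y(1) x] by simp
    moreover have "h ?y \<in> carrier A" "h x \<in> carrier A" using h y x by (auto simp: extends_def)
    ultimately show ?thesis unfolding \<Phi>_def by simp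
  qed
  have "\<Phi> \<in> carrier T \<rightarrow> carrier A" using \<Phi> h by (auto simp: proj_surj extends_def)
  moreover have "\<Phi> (s \<oplus>\<^bsub>T\<^esub> t) = \<Phi> s \<oplus>\<^bsub>A\<^esub> \<Phi> t" if st: "s \<in> carrier T" "t \<in> carrier T" for s t
  proof -
    obtain x y where xy: "x \<in> carrier FT" "s = proj x" "y \<in> carrier FT" "t = proj y" using st proj_surj by auto
    have "\<Phi> (s \<oplus>\<^bsub>T\<^esub> t) = \<Phi> (proj (x \<oplus>\<^bsub>FT\<^esub> y))" using xy by simp
    also have "\<dots> = h x \<oplus>\<^bsub>A\<^esub> h y" using xy h by (subst \<Phi>) (auto simp: extends_def)
    finally show ?thesis using xy \<Phi> by simp
  qed
  moreover have "\<Phi> (pure a b) = f b \<odot>\<^bsub>A\<^esub> a" if "a \<in> carrier A" "b \<in> carrier B" for a b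
    using that h \<Phi>[OF FT_of[OF that]] by (simp add: pure_proj extends_def)
  ultimately show ?thesis by blast
qed


section \<open>Embeddings of the two factors and separation by linear forms\<close>

abbreviation "\<iota> a \<equiv> pure a \<one>\<^bsub>B\<^esub>"
abbreviation "\<kappa> b \<equiv> pure \<one>\<^bsub>A\<^esub> b"

lemma pure_zero [simp]: "b \<in> carrier B \<Longrightarrow> pure \<zero>\<^bsub>A\<^esub> b = \<zero>\<^bsub>T\<^esub>" "a \<in> carrier A \<Longrightarrow> pure a \<zero>\<^bsub>B\<^esub> = \<zero>\<^bsub>T\<^esub>"
  using pure_add_left[of "\<zero>\<^bsub>A\<^esub>" "\<zero>\<^bsub>A\<^esub>" b] pure_add_right[of a "\<zero>\<^bsub>B\<^esub>" "\<zero>\<^bsub>B\<^esub>"] by auto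

lemma iota_hom: "\<iota> \<in> ring_hom A T"
  by (rule ring_hom_memI) (simp_all add: pure_mult pure_add_left pure_one)

lemma kappa_hom: "\<kappa> \<in> ring_hom B T"
  by (rule ring_hom_memI) (simp_all add: pure_mult pure_add_right pure_one)

sublocale \<iota>: ring_hom_cring A T "\<lambda>a. pure a \<one>\<^bsub>B\<^esub>"
  by (intro ring_hom_cring.intro ring_hom_cring_axioms.intro iota_hom A.is_cring T.is_cring)

sublocale \<kappa>: ring_hom_cring B T "\<lambda>b. pure \<one>\<^bsub>A\<^esub> b"
  by (intro ring_hom_cring.intro ring_hom_cring_axioms.intro kappa_hom B.is_cring T.is_cring)

primrec tsum :: "('a \<times> 'b) list \<Rightarrow> (('a \<times> 'b) \<Rightarrow>\<^sub>0 int) set" where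
  "tsum [] = \<zero>\<^bsub>T\<^esub>"
| "tsum (ab # ps) = pure (fst ab) (snd ab) \<oplus>\<^bsub>T\<^esub> tsum ps"

text \<open>The value of id \<otimes> \<open>f\<close> on \<open>tsum ps\<close>, computed from the
  list alone; the agreement with a map on \<open>T\<close> is
  \<open>functional_tsum\<close>.\<close>

primrec fval :: "('b \<Rightarrow> 'k) \<Rightarrow> ('a \<times> 'b) list \<Rightarrow> 'a" where
  "fval f [] = \<zero>\<^bsub>A\<^esub>"
| "fval f (ab # ps) = f (snd ab) \<odot>\<^bsub>A\<^esub> fst ab \<oplus>\<^bsub>A\<^esub> fval f ps"

primrec bcomb :: "'k list \<Rightarrow> ('a \<times> 'b) list \<Rightarrow> 'b" where
  "bcomb cs [] = \<zero>\<^bsub>B\<^esub>"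
| "bcomb cs (ab # ps) = hd cs \<odot>\<^bsub>B\<^esub> snd ab \<oplus>\<^bsub>B\<^esub> bcomb (tl cs) ps"

text \<open>By bilinearity, \<open>a\<close> tensored with a combination of the right entries can be
  absorbed into the left entries. This shortens a representation whose right entries are linearly
  dependent.\<close>

primrec shift :: "'a \<Rightarrow> 'k list \<Rightarrow> ('a \<times> 'b) list \<Rightarrow> ('a \<times> 'b) list" where
  "shift a cs [] = []"
| "shift a cs (ab # ps) = (fst ab \<oplus>\<^bsub>A\<^esub> hd cs \<odot>\<^bsub>A\<^esub> a, snd ab) # shift a (tl cs) ps"

lemma tsum_closed [simp]: "set ps \<subseteq> carrier A \<times> carrier B \<Longrightarrow> tsum ps \<in> carrier T"
  by (induction ps) auto

lemma fval_closed [simp]: "linear_form K B f \<Longrightarrow> set ps \<subseteq> carrier A \<times> carrier B \<Longrightarrow> fval f ps \<in> carrier A"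
  by (induction ps) (auto simp: linear_form_def)

lemma bcomb_closed [simp]: "set ps \<subseteq> carrier A \<times> carrier B \<Longrightarrow> length cs = length ps \<Longrightarrow> set cs \<subseteq> carrier K \<Longrightarrow> bcomb cs ps \<in> carrier B"
proof (induction ps arbitrary: cs)
  case (Cons ab ps)
  then obtain c cs' where "cs = c # cs'" by (cases cs) auto
  then show ?case using Cons by auto
qed simp

lemma shift_props:
  assumes "set ps \<subseteq> carrier A \<times> carrier B" "length cs = length ps" "set cs \<subseteq> carrier K" "a \<in> carrier A"
  shows "set (shift a cs ps) \<subseteq> carrier A \<times> carrier B \<and> length (shift a cs ps) = length ps
    \<and> tsum (shift a cs ps) = tsum ps \<oplus>\<^bsub>T\<^esub> pure a (bcomb cs ps)
    \<and> (\<forall>f. linear_form K B f \<longrightarrow> fval f (shift a cs ps) = fval f ps \<oplus>\<^bsub>A\<^esub> f (bcomb cs ps) \<odot>\<^bsub>A\<^esub> a)"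
  using assms(1-3)
proof (induction ps arbitrary: cs)
  case Nil
  have "fval f [] = fval f [] \<oplus>\<^bsub>A\<^esub> f \<zero>\<^bsub>B\<^esub> \<odot>\<^bsub>A\<^esub> a" if "linear_form K B f" for f
  proof -
    have fz: "f (\<zero>\<^bsub>K\<^esub> \<odot>\<^bsub>B\<^esub> \<zero>\<^bsub>B\<^esub>) = \<zero>\<^bsub>K\<^esub> \<otimes>\<^bsub>K\<^esub> f \<zero>\<^bsub>B\<^esub>" "f \<zero>\<^bsub>B\<^esub> \<in> carrier K"
      using that K.zero_closed B.zero_closed unfolding linear_form_def by blast+
    then have "f \<zero>\<^bsub>B\<^esub> = \<zero>\<^bsub>K\<^esub>" by simp
    then show ?thesis using assms(4) by simp
  qed
  then show ?case using assms(4) by simp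
next
  case (Cons ab ps)
  then obtain c cs' where cs: "cs = c # cs'" by (cases cs) auto
  obtain a' b where ab: "ab = (a', b)" by (cases ab)
  have car: "a' \<in> carrier A" "b \<in> carrier B" "c \<in> carrier K" "set ps \<subseteq> carrier A \<times> carrier B" "set cs' \<subseteq> carrier K" "length cs' = length ps"
    using Cons.prems ab cs by auto
  note IH = Cons.IH[OF car(4,6,5)]
  have bc: "bcomb cs' ps \<in> carrier B" "tsum ps \<in> carrier T" using car by auto
  have "pure (a' \<oplus>\<^bsub>A\<^esub> c \<odot>\<^bsub>A\<^esub> a) b = pure a' b \<oplus>\<^bsub>T\<^esub> pure a (c \<odot>\<^bsub>B\<^esub> b)"
    using car assms(4) by (simp add: pure_add_left pure_smult)
  then have "tsum (shift a cs (ab # ps)) = tsum (ab # ps) \<oplus>\<^bsub>T\<^esub> pure a (bcomb cs (ab # ps))"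
    using IH ab cs car assms(4) bc by (simp add: pure_add_right T.a_ac)
  moreover have "fval f (shift a cs (ab # ps)) = fval f (ab # ps) \<oplus>\<^bsub>A\<^esub> f (bcomb cs (ab # ps)) \<odot>\<^bsub>A\<^esub> a" if f: "linear_form K B f" for f
  proof -
    have fb: "f b \<in> carrier K" "f (bcomb cs' ps) \<in> carrier K" "f (c \<odot>\<^bsub>B\<^esub> b \<oplus>\<^bsub>B\<^esub> bcomb cs' ps) = c \<otimes>\<^bsub>K\<^esub> f b \<oplus>\<^bsub>K\<^esub> f (bcomb cs' ps)"
      using f car bc by (auto simp: linear_form_def)
    have fv: "fval f ps \<in> carrier A" using f car by simp
    have e: "f b \<odot>\<^bsub>A\<^esub> (a' \<oplus>\<^bsub>A\<^esub> c \<odot>\<^bsub>A\<^esub> a) = f b \<odot>\<^bsub>A\<^esub> a' \<oplus>\<^bsub>A\<^esub> (c \<otimes>\<^bsub>K\<^esub> f b) \<odot>\<^bsub>A\<^esub> a"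
      using fb car assms(4) by (simp add: A.smult_r_distr A.smult_assoc1[symmetric] K.m_comm)
    show ?thesis using IH f ab cs car assms(4) fb fv e by (simp add: A.smult_l_distr A.a_ac)
  qed
  ultimately show ?case using IH ab cs car assms(4) by auto
qed

lemma bcomb_add:
  assumes "set ps \<subseteq> carrier A \<times> carrier B" "length cs = length ps" "set cs \<subseteq> carrier K" "length ds = length ps" "set ds \<subseteq> carrier K"
  shows "bcomb (map2 (\<oplus>\<^bsub>K\<^esub>) cs ds) ps = bcomb cs ps \<oplus>\<^bsub>B\<^esub> bcomb ds ps"
  using assms
proof (induction ps arbitrary: cs ds)
  case (Cons ab ps)
  then obtain c cs' d ds' where cs: "cs = c # cs'" "ds = d # ds'" by (cases cs; cases ds) auto
  have "bcomb cs' ps \<in> carrier B" "bcomb ds' ps \<in> carrier B" using Cons.prems cs by auto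
  then show ?case using Cons cs by (auto simp: B.smult_l_distr B.a_ac)
qed simp

lemma bcomb_smult:
  assumes "set ps \<subseteq> carrier A \<times> carrier B" "length cs = length ps" "set cs \<subseteq> carrier K" "c \<in> carrier K"
  shows "bcomb (map ((\<otimes>\<^bsub>K\<^esub>) c) cs) ps = c \<odot>\<^bsub>B\<^esub> bcomb cs ps"
  using assms(1-3)
proof (induction ps arbitrary: cs)
  case Nil
  then show ?case using assms(4) by simp
next
  case (Cons ab ps)
  then obtain d cs' where cs: "cs = d # cs'" by (cases cs) auto
  have "bcomb cs' ps \<in> carrier B" using Cons.prems cs by auto
  then show ?case using Cons cs assms(4) by (auto simp: B.smult_r_distr B.smult_assoc1)
qed

text \<open>If the first right entry \<open>b\<close> is a combination of the others,
  \<open>shift\<close> shortens the list. If not, a linear form equal to one at \<open>b\<close> and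
  to zero at the others shows that \<open>a\<close> is zero.\<close>

lemma tsum_separation:
  assumes "set ps \<subseteq> carrier A \<times> carrier B" "\<And>f. linear_form K B f \<Longrightarrow> fval f ps = \<zero>\<^bsub>A\<^esub>"
  shows "tsum ps = \<zero>\<^bsub>T\<^esub>"
  using assms
proof (induction "length ps" arbitrary: ps)
  case (Suc n)
  then obtain a b qs where ps: "ps = (a, b) # qs" and n: "n = length qs" by (cases ps) auto
  have car: "a \<in> carrier A" "b \<in> carrier B" "set qs \<subseteq> carrier A \<times> carrier B" using Suc.prems ps by auto
  define W where "W = {bcomb cs qs | cs. length cs = length qs \<and> set cs \<subseteq> carrier K}"
  have WI: "x \<in> W" if "length cs = length qs" "set cs \<subseteq> carrier K" "x = bcomb cs qs" for x cs using that by (auto simp: W_def)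
  have W: "subspace K B W" unfolding subspace_def
  proof (intro conjI ballI)
    show "W \<subseteq> carrier B" using car by (auto simp: W_def)
    have "bcomb (replicate (length qs) \<zero>\<^bsub>K\<^esub>) qs = \<zero>\<^bsub>B\<^esub>" using car(3) by (induction qs) auto
    then show "\<zero>\<^bsub>B\<^esub> \<in> W" by (intro WI[of "replicate (length qs) \<zero>\<^bsub>K\<^esub>"]) auto
    fix x assume "x \<in> W"
    then obtain cs where cs: "length cs = length qs" "set cs \<subseteq> carrier K" "x = bcomb cs qs" by (auto simp: W_def)
    { fix y assume "y \<in> W"
      then obtain ds where ds: "length ds = length qs" "set ds \<subseteq> carrier K" "y = bcomb ds qs" by (auto simp: W_def)
      show "x \<oplus>\<^bsub>B\<^esub> y \<in> W"
      proof (rule WI)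
        show "set (map2 (\<oplus>\<^bsub>K\<^esub>) cs ds) \<subseteq> carrier K"
        proof
          fix z assume "z \<in> set (map2 (\<oplus>\<^bsub>K\<^esub>) cs ds)"
          then obtain c d where z: "(c, d) \<in> set (zip cs ds)" "z = c \<oplus>\<^bsub>K\<^esub> d" by auto
          then have "c \<in> carrier K" "d \<in> carrier K" using set_zip_leftD[OF z(1)] set_zip_rightD[OF z(1)] cs ds by auto
          then show "z \<in> carrier K" using z by simp
        qed
      qed (use cs ds car bcomb_add in auto) }
    fix c assume "c \<in> carrier K"
    then show "c \<odot>\<^bsub>B\<^esub> x \<in> W" using cs car(3) bcomb_smult by (intro WI[of "map ((\<otimes>\<^bsub>K\<^esub>) c) cs"]) auto
  qed
  show ?case
  proof (cases "b \<in> W")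
    case True
    then obtain cs where cs: "length cs = length qs" "set cs \<subseteq> carrier K" "b = bcomb cs qs" by (auto simp: W_def)
    note sp = shift_props[OF car(3) cs(1,2) car(1)]
    have "fval f (shift a cs qs) = \<zero>\<^bsub>A\<^esub>" if f: "linear_form K B f" for f
    proof -
      have "f b \<in> carrier K" "fval f qs \<in> carrier A" using f car by (auto simp: linear_form_def)
      then show ?thesis using sp f Suc.prems(2)[OF f] ps cs(3) car by (simp add: A.a_comm)
    qed
    then have "tsum (shift a cs qs) = \<zero>\<^bsub>T\<^esub>" using Suc.hyps(1)[of "shift a cs qs"] sp n by simp
    then show ?thesis using sp ps cs(3) car by (simp add: T.a_comm)
  next
    case False
    obtain f where f: "linear_form K B f" "\<And>w. w \<in> W \<Longrightarrow> f w = \<zero>\<^bsub>K\<^esub>" "f b = \<one>\<^bsub>K\<^esub>"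
      using linear_form_exists[OF K B W car(2) False] by blast
    have "f b' = \<zero>\<^bsub>K\<^esub>" if b': "(a', b') \<in> set qs" for a' b'
    proof -
      have "b' \<in> W" unfolding W_def using b' car(3)
      proof (induction qs)
        case (Cons ab qs)
        have bc: "bcomb (replicate (length qs) \<zero>\<^bsub>K\<^esub>) qs = \<zero>\<^bsub>B\<^esub>" using Cons.prems(2) by (induction qs) auto
        show ?case
        proof (cases "ab = (a', b')")
          case True
          then have "b' = bcomb (\<one>\<^bsub>K\<^esub> # replicate (length qs) \<zero>\<^bsub>K\<^esub>) (ab # qs)" using Cons.prems bc by auto
          then show ?thesis by (intro CollectI exI[of _ "\<one>\<^bsub>K\<^esub> # replicate (length qs) \<zero>\<^bsub>K\<^esub>"]) auto
        next
          case False
          then obtain cs where "length cs = length qs" "set cs \<subseteq> carrier K" "b' = bcomb cs qs" using Cons by auto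
          moreover from this have "bcomb cs qs \<in> carrier B" using Cons.prems by auto
          ultimately have "b' = bcomb (\<zero>\<^bsub>K\<^esub> # cs) (ab # qs)" "length (\<zero>\<^bsub>K\<^esub> # cs) = length (ab # qs)" "set (\<zero>\<^bsub>K\<^esub> # cs) \<subseteq> carrier K"
            using Cons.prems by auto
          then show ?thesis by blast
        qed
      qed simp
      then show ?thesis by (rule f(2))
    qed
    then have "\<forall>ab\<in>set qs. f (snd ab) = \<zero>\<^bsub>K\<^esub>" by auto
    then have "fval f qs = \<zero>\<^bsub>A\<^esub>" using car(3) by (induction qs) auto
    then have "a = \<zero>\<^bsub>A\<^esub>" using Suc.prems(2)[OF f(1)] ps f(3) car by simp
    moreover from this have "fval g qs = \<zero>\<^bsub>A\<^esub>" if g: "linear_form K B g" for g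
    proof -
      have "g b \<in> carrier K" "fval g qs \<in> carrier A" using g car by (auto simp: linear_form_def)
      then show ?thesis using Suc.prems(2)[OF g] ps \<open>a = _\<close> by simp
    qed
    then have "tsum qs = \<zero>\<^bsub>T\<^esub>" using Suc.hyps(1)[OF n car(3)] by blast
    ultimately show ?thesis using ps car by simp
  qed
qed simp

lemma tsum_surj: "t \<in> carrier T \<Longrightarrow> \<exists>ps. set ps \<subseteq> carrier A \<times> carrier B \<and> t = tsum ps"
proof -
  have neg: "\<exists>qs. set qs \<subseteq> carrier A \<times> carrier B \<and> \<ominus>\<^bsub>T\<^esub> tsum ps = tsum qs" if "set ps \<subseteq> carrier A \<times> carrier B" for ps
    using that
  proof (induction ps)
    case Nil
    show ?case by (rule exI[of _ "[]"]) simp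
  next
    case (Cons ab ps)
    then obtain qs where qs: "set qs \<subseteq> carrier A \<times> carrier B" "\<ominus>\<^bsub>T\<^esub> tsum ps = tsum qs" by auto
    obtain a b where ab: "ab = (a, b)" "a \<in> carrier A" "b \<in> carrier B" using Cons.prems by (cases ab) auto
    have "pure (\<ominus>\<^bsub>A\<^esub> a) b \<oplus>\<^bsub>T\<^esub> pure a b = \<zero>\<^bsub>T\<^esub>"
      using ab pure_add_left[of "\<ominus>\<^bsub>A\<^esub> a" a b] by (simp add: A.l_neg)
    then have "\<ominus>\<^bsub>T\<^esub> pure a b = pure (\<ominus>\<^bsub>A\<^esub> a) b" using ab by (intro T.minus_equality) auto
    then show ?case using qs ab Cons.prems by (intro exI[of _ "(\<ominus>\<^bsub>A\<^esub> a, b) # qs"]) (simp add: T.minus_add)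
  qed
  have app: "tsum (ps @ qs) = tsum ps \<oplus>\<^bsub>T\<^esub> tsum qs" if "set ps \<subseteq> carrier A \<times> carrier B" "set qs \<subseteq> carrier A \<times> carrier B" for ps qs
    using that by (induction ps) (auto simp: T.a_assoc)
  assume "t \<in> carrier T"
  then obtain x where x: "x \<in> carrier FT" "t = proj x" using proj_surj by auto
  have "\<exists>ps. set ps \<subseteq> carrier A \<times> carrier B \<and> proj x = tsum ps" using x(1)
  proof (induction x rule: FT_induct)
    case zero
    show ?case using proj.hom_zero by (intro exI[of _ "[]"]) (simp add: FT_simps)
  next
    case (of a b)
    then show ?case by (intro exI[of _ "[(a, b)]"]) (simp add: pure_proj FT_of)
  next
    case (diff x y)
    then obtain ps qs where p: "set ps \<subseteq> carrier A \<times> carrier B" "proj x = tsum ps"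
      and q: "set qs \<subseteq> carrier A \<times> carrier B" "proj y = tsum qs" by blast
    obtain qs' where "set qs' \<subseteq> carrier A \<times> carrier B" "\<ominus>\<^bsub>T\<^esub> tsum qs = tsum qs'" using neg[OF q(1)] by blast
    then show ?case using p q diff(1,2) app[of ps qs'] by (intro exI[of _ "ps @ qs'"]) (simp add: proj_diff T.minus_eq)
  qed
  then show ?thesis using x by simp
qed

end

definition scalars :: "('k, 'n) ring_scheme \<Rightarrow> ('k, 'a, 'm) module_scheme \<Rightarrow> 'a set" where
  "scalars K A = (\<lambda>c. c \<odot>\<^bsub>A\<^esub> \<one>\<^bsub>A\<^esub>) ` carrier K"

text \<open>\<open>S\<close> is contained in the integral closure of \<open>K[zs]\<close>, stated without forming it.\<close>

definition normalizes :: "'k ring \<Rightarrow> ('k, 'a) module \<Rightarrow> 'a list \<Rightarrow> 'a set \<Rightarrow> bool" where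
  "normalizes K A zs S \<longleftrightarrow> (\<forall>U. subring U A \<longrightarrow> scalars K A \<subseteq> U \<longrightarrow> set zs \<subseteq> U \<longrightarrow>
     (\<forall>x\<in>carrier A. \<forall>cs. set cs \<subseteq> U \<longrightarrow> horner A (cs @ [\<one>\<^bsub>A\<^esub>]) x = \<zero>\<^bsub>A\<^esub> \<longrightarrow> x \<in> U) \<longrightarrow> S \<subseteq> U)"

lemma scalars_subring:
  assumes "algebra K M" shows "subring (scalars K M) M"
proof -
  interpret M: algebra K M by fact
  show ?thesis
  proof (rule M.subringI)
    show "scalars K M \<subseteq> carrier M" by (auto simp: scalars_def)
    show "\<one>\<^bsub>M\<^esub> \<in> scalars K M" unfolding scalars_def by (rule image_eqI[of _ _ "\<one>\<^bsub>K\<^esub>"]) auto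
    fix x assume "x \<in> scalars K M"
    then obtain c where c: "c \<in> carrier K" "x = c \<odot>\<^bsub>M\<^esub> \<one>\<^bsub>M\<^esub>" by (auto simp: scalars_def)
    have "\<ominus>\<^bsub>M\<^esub> x = (\<ominus>\<^bsub>K\<^esub> c) \<odot>\<^bsub>M\<^esub> \<one>\<^bsub>M\<^esub>" using c by (simp add: M.smult_l_minus)
    then show "\<ominus>\<^bsub>M\<^esub> x \<in> scalars K M" using c by (auto simp: scalars_def)
    fix y assume "y \<in> scalars K M"
    then obtain d where d: "d \<in> carrier K" "y = d \<odot>\<^bsub>M\<^esub> \<one>\<^bsub>M\<^esub>" by (auto simp: scalars_def)
    have "x \<oplus>\<^bsub>M\<^esub> y = (c \<oplus>\<^bsub>K\<^esub> d) \<odot>\<^bsub>M\<^esub> \<one>\<^bsub>M\<^esub>" using c d by (simp add: M.smult_l_distr)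
    then show "x \<oplus>\<^bsub>M\<^esub> y \<in> scalars K M" using c d by (auto simp: scalars_def)
    have "x \<otimes>\<^bsub>M\<^esub> y = (c \<otimes>\<^bsub>K\<^esub> d) \<odot>\<^bsub>M\<^esub> \<one>\<^bsub>M\<^esub>" using c d by (simp add: M.smult_assoc2 M.smult_assoc1)
    then show "x \<otimes>\<^bsub>M\<^esub> y \<in> scalars K M" using c d by (auto simp: scalars_def)
  qed
qed

section \<open>Ranks, primes and chains under homomorphisms\<close>

context ring_hom_cring begin

lemma hom_adjoin:
  assumes "D \<subseteq> carrier R" "z \<in> carrier R" shows "h ` adjoin R D z = adjoin S (h ` D) (h z)"
proof
  show "h ` adjoin R D z \<subseteq> adjoin S (h ` D) (h z)"
  proof
    fix x assume "x \<in> h ` adjoin R D z"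
    then obtain cs where cs: "set cs \<subseteq> D" "x = h (horner R cs z)" by (auto simp: adjoin_def)
    then have "x = horner S (map h cs) (h z)" using hom_horner[of cs z] assms by auto
    moreover have "set (map h cs) \<subseteq> h ` D" using cs by auto
    ultimately show "x \<in> adjoin S (h ` D) (h z)" unfolding adjoin_def by blast
  qed
  show "adjoin S (h ` D) (h z) \<subseteq> h ` adjoin R D z"
  proof
    fix x assume "x \<in> adjoin S (h ` D) (h z)"
    then obtain ds where ds: "set ds \<subseteq> h ` D" "x = horner S ds (h z)" by (auto simp: adjoin_def)
    then have "ds \<in> map h ` lists D" by (simp flip: lists_image add: in_lists_conv_set subset_iff)
    then obtain cs where cs: "set cs \<subseteq> D" "ds = map h cs" by auto
    then have "x = h (horner R cs z)" using ds hom_horner[of cs z] assms by auto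
    then show "x \<in> h ` adjoin R D z" using cs by (auto simp: adjoin_def)
  qed
qed

lemma hom_crk:
  assumes "D \<subseteq> carrier R" "set zs \<subseteq> carrier R" "\<And>y. y \<in> carrier R \<Longrightarrow> h y \<in> J \<longleftrightarrow> y \<in> I"
  shows "crk S J (h ` D) (map h zs) = crk R I D zs"
  using assms(1,2)
proof (induction zs arbitrary: D)
  case (Cons z zs)
  then show ?case using hom_cl[OF _ Cons.prems(1) assms(3), of z] hom_adjoin[OF Cons.prems(1), of z, symmetric]
      R.adjoin_closed[OF Cons.prems(1), of z] by simp
qed simp

text \<open>The saturation hypothesis \<open>sat\<close> covers both later uses: injective
  homomorphisms, and quotient maps by an ideal contained in \<open>p\<close>.\<close>

lemma hom_prime_in:
  assumes "prime_in R (carrier R) p" and sat: "\<And>x. x \<in> carrier R \<Longrightarrow> h x \<in> h ` p \<Longrightarrow> x \<in> p"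
  shows "prime_in S (h ` carrier R) (h ` p)"
  unfolding prime_in_def
proof (intro conjI ballI impI)
  note p = prime_inD[OF assms(1)]
  have pc: "\<And>x. x \<in> p \<Longrightarrow> x \<in> carrier R" using p(1) by auto
  show "h ` p \<subseteq> h ` carrier R" using p(1) by (rule image_mono)
  show "\<zero>\<^bsub>S\<^esub> \<in> h ` p" by (rule image_eqI[OF _ p(2)]) simp
  show "\<one>\<^bsub>S\<^esub> \<notin> h ` p" using p(3) sat[OF R.one_closed] by auto
  show "x \<oplus>\<^bsub>S\<^esub> y \<in> h ` p" if xy: "x \<in> h ` p" "y \<in> h ` p" for x y
  proof -
    obtain a b where ab: "a \<in> p" "b \<in> p" "x = h a" "y = h b" using xy by (elim imageE)
    then show ?thesis using pc by (intro image_eqI[OF _ p(4)[OF ab(1,2)]]) simp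
  qed
  show "e \<otimes>\<^bsub>S\<^esub> x \<in> h ` p" if ex: "e \<in> h ` carrier R" "x \<in> h ` p" for e x
  proof -
    obtain a b where ab: "a \<in> carrier R" "b \<in> p" "e = h a" "x = h b" using ex by (elim imageE)
    then show ?thesis using pc by (intro image_eqI[OF _ p(5)[OF ab(1,2)]]) simp
  qed
  show "x \<in> h ` p \<or> y \<in> h ` p" if xy: "x \<in> h ` carrier R" "y \<in> h ` carrier R" "x \<otimes>\<^bsub>S\<^esub> y \<in> h ` p" for x y
  proof -
    obtain a b where ab: "a \<in> carrier R" "b \<in> carrier R" "x = h a" "y = h b" using xy(1,2) by (elim imageE)
    then have "a \<otimes> b \<in> p" using xy(3) by (intro sat) auto
    then show ?thesis using p(6)[OF ab(1,2)] ab(3,4) by blast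
  qed
qed

lemma hom_hc:
  assumes "chain_to V n p" "V \<subseteq> Spec R" and sat: "\<And>p x. p \<in> V \<Longrightarrow> x \<in> carrier R \<Longrightarrow> h x \<in> h ` p \<Longrightarrow> x \<in> p"
  shows "chain_to {q. prime_in S (h ` carrier R) q} n (h ` p)"
  using assms(1)
proof (induction n arbitrary: p)
  case 0
  then show ?case using hom_prime_in[OF _ sat, of p] assms(2) by (auto simp: Spec_def)
next
  case (Suc n)
  then obtain q where q: "q \<subset> p" "chain_to V n q" and p: "p \<in> V" by auto
  have pp: "prime_in R (carrier R) p" using p assms(2) by (auto simp: Spec_def)
  obtain x where x: "x \<in> p" "x \<notin> q" using q(1) by blast
  then have "h x \<notin> h ` q" using sat[OF chain_to_mem[OF q(2)]] prime_inD(1)[OF pp] by blast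
  then have "h ` q \<subset> h ` p" using q(1) x(1) by blast
  moreover have "chain_to {q. prime_in S (h ` carrier R) q} n (h ` q)" by (rule Suc.IH[OF q(2)])
  moreover have "h ` p \<in> {q. prime_in S (h ` carrier R) q}" using hom_prime_in[OF pp sat[OF p]] by simp
  ultimately show ?case unfolding chain_to.simps by blast
qed

context
  assumes inj: "inj_on h (carrier R)"
begin

lemma inj_zero: "x \<in> carrier R \<Longrightarrow> h x \<in> {\<zero>\<^bsub>S\<^esub>} \<longleftrightarrow> x \<in> {\<zero>}"
  using inj_onD[OF inj, of x \<zero>] by auto

lemma hom_indep:
  assumes "D \<subseteq> carrier R" "set zs \<subseteq> carrier R"
  shows "indep S (h ` D) (map h zs) \<longleftrightarrow> indep R D zs"
  using assms
proof (induction zs arbitrary: D)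
  case (Cons z zs)
  then show ?case using hom_cl[OF _ Cons.prems(1) inj_zero, of z] hom_adjoin[OF Cons.prems(1), of z, symmetric]
      R.adjoin_closed[OF Cons.prems(1), of z] by simp
qed simp

lemma inj_saturated: "p \<in> Spec R \<Longrightarrow> x \<in> carrier R \<Longrightarrow> h x \<in> h ` p \<Longrightarrow> x \<in> p"
  using inj_on_image_mem_iff[OF inj, of x p] prime_inD(1)[of R "carrier R" p] by (simp add: Spec_def)

end

end

section \<open>The tensor product as an instance of \<open>tensor_pair\<close>\<close>

context two_algebras begin

text \<open>The maps id \<otimes> \<open>f\<close> followed by \<open>\<iota>\<close>, because
  \<open>tensor_pair\<close> has the copy of \<open>A\<close> as a subset of
  \<open>T\<close>.\<close>

definition functionals :: "((('a \<times> 'b) \<Rightarrow>\<^sub>0 int) set \<Rightarrow> (('a \<times> 'b) \<Rightarrow>\<^sub>0 int) set) set" where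
  "functionals = {\<phi>. \<exists>f \<Phi>. linear_form K B f \<and> \<Phi> \<in> carrier T \<rightarrow> carrier A
    \<and> (\<forall>s\<in>carrier T. \<forall>t\<in>carrier T. \<Phi> (s \<oplus>\<^bsub>T\<^esub> t) = \<Phi> s \<oplus>\<^bsub>A\<^esub> \<Phi> t)
    \<and> (\<forall>a\<in>carrier A. \<forall>b\<in>carrier B. \<Phi> (pure a b) = f b \<odot>\<^bsub>A\<^esub> a) \<and> \<phi> = (\<lambda>t. \<iota> (\<Phi> t))}"

lemma one_B:
  assumes "\<one>\<^bsub>T\<^esub> \<noteq> \<zero>\<^bsub>T\<^esub>" shows "\<one>\<^bsub>B\<^esub> \<noteq> \<zero>\<^bsub>B\<^esub>"
proof
  assume "\<one>\<^bsub>B\<^esub> = \<zero>\<^bsub>B\<^esub>"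
  then have "\<one>\<^bsub>T\<^esub> = pure \<one>\<^bsub>A\<^esub> \<zero>\<^bsub>B\<^esub>" using pure_one by metis
  then show False using assms pure_zero(2)[OF A.one_closed] by metis
qed

text \<open>A linear form with value one at the unit of \<open>B\<close> gives the left inverse id
  \<otimes> \<open>f\<close>.\<close>

lemma iota_inj:
  assumes "\<one>\<^bsub>T\<^esub> \<noteq> \<zero>\<^bsub>T\<^esub>" shows "inj_on \<iota> (carrier A)"
proof -
  have "subspace K B {\<zero>\<^bsub>B\<^esub>}" by (simp add: subspace_def)
  then obtain f where f: "linear_form K B f" "f \<one>\<^bsub>B\<^esub> = \<one>\<^bsub>K\<^esub>"
    using linear_form_exists[OF K B _ B.one_closed] one_B[OF assms] by blast
  obtain \<Phi> where "\<And>a b. a \<in> carrier A \<Longrightarrow> b \<in> carrier B \<Longrightarrow> \<Phi> (pure a b) = f b \<odot>\<^bsub>A\<^esub> a"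
    using functional_exists[OF f(1)] by blast
  then have "\<Phi> (\<iota> a) = a" if "a \<in> carrier A" for a using that f(2) by simp
  then show ?thesis by (rule inj_on_inverseI)
qed

lemma functional_tsum:
  assumes "\<Phi> \<in> carrier T \<rightarrow> carrier A" "\<forall>s\<in>carrier T. \<forall>t\<in>carrier T. \<Phi> (s \<oplus>\<^bsub>T\<^esub> t) = \<Phi> s \<oplus>\<^bsub>A\<^esub> \<Phi> t"
    "\<forall>a\<in>carrier A. \<forall>b\<in>carrier B. \<Phi> (pure a b) = f b \<odot>\<^bsub>A\<^esub> a" "linear_form K B f" "set ps \<subseteq> carrier A \<times> carrier B"
  shows "\<Phi> (tsum ps) = fval f ps" and "a \<in> carrier A \<Longrightarrow> \<Phi> (\<iota> a \<otimes>\<^bsub>T\<^esub> tsum ps) = a \<otimes>\<^bsub>A\<^esub> fval f ps"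
proof -
  have "\<Phi> \<zero>\<^bsub>T\<^esub> \<oplus>\<^bsub>A\<^esub> \<Phi> \<zero>\<^bsub>T\<^esub> = \<Phi> \<zero>\<^bsub>T\<^esub>" using assms(2) T.zero_closed by (metis T.l_zero)
  moreover have "\<Phi> \<zero>\<^bsub>T\<^esub> \<in> carrier A" using assms(1) by auto
  ultimately have z: "\<Phi> \<zero>\<^bsub>T\<^esub> = \<zero>\<^bsub>A\<^esub>" by (metis A.add.r_cancel_one)
  show "\<Phi> (tsum ps) = fval f ps" using assms(5)
    by (induction ps) (use z assms in auto)
  assume a: "a \<in> carrier A"
  show "\<Phi> (\<iota> a \<otimes>\<^bsub>T\<^esub> tsum ps) = a \<otimes>\<^bsub>A\<^esub> fval f ps" using assms(5)
  proof (induction ps)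
    case Nil
    then show ?case using a z by simp
  next
    case (Cons ab ps)
    obtain a' b where ab: "ab = (a', b)" "a' \<in> carrier A" "b \<in> carrier B" "set ps \<subseteq> carrier A \<times> carrier B"
      using Cons.prems by (cases ab) auto
    have fb: "f b \<in> carrier K" using assms(4) ab by (auto simp: linear_form_def)
    have fv: "fval f ps \<in> carrier A" using assms(4) ab by simp
    have "\<iota> a \<otimes>\<^bsub>T\<^esub> tsum (ab # ps) = pure (a \<otimes>\<^bsub>A\<^esub> a') b \<oplus>\<^bsub>T\<^esub> \<iota> a \<otimes>\<^bsub>T\<^esub> tsum ps"
      using a ab by (simp add: T.r_distr pure_mult)
    moreover have "\<Phi> (pure (a \<otimes>\<^bsub>A\<^esub> a') b \<oplus>\<^bsub>T\<^esub> \<iota> a \<otimes>\<^bsub>T\<^esub> tsum ps) = \<Phi> (pure (a \<otimes>\<^bsub>A\<^esub> a') b) \<oplus>\<^bsub>A\<^esub> \<Phi> (\<iota> a \<otimes>\<^bsub>T\<^esub> tsum ps)"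
      using assms(2) a ab by auto
    moreover have "\<Phi> (pure (a \<otimes>\<^bsub>A\<^esub> a') b) = f b \<odot>\<^bsub>A\<^esub> (a \<otimes>\<^bsub>A\<^esub> a')" using assms(3) a ab by auto
    moreover have "f b \<odot>\<^bsub>A\<^esub> (a \<otimes>\<^bsub>A\<^esub> a') = a \<otimes>\<^bsub>A\<^esub> (f b \<odot>\<^bsub>A\<^esub> a')"
      using A.smult_assoc2[of "f b" a' a] a ab fb by (simp add: A.m_comm)
    ultimately show ?case using Cons ab a fb fv by (simp add: A.r_distr)
  qed
qed

lemma tsum_lcs:
  "set ps \<subseteq> carrier A \<times> carrier B \<Longrightarrow> tsum ps \<in> lcs T (\<iota> ` carrier A) (\<kappa> ` carrier B)"
proof (induction ps)
  case Nil
  then show ?case using T.lcs_zero by simp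
next
  case (Cons ab ps)
  obtain a b where ab: "ab = (a, b)" "a \<in> carrier A" "b \<in> carrier B" using Cons.prems by (cases ab) auto
  have c: "\<iota> ` carrier A \<subseteq> carrier T" "\<kappa> ` carrier B \<subseteq> carrier T" by auto
  have "pure a b = \<iota> a \<otimes>\<^bsub>T\<^esub> \<kappa> b" using ab by (simp add: pure_mult)
  moreover have "\<iota> a \<otimes>\<^bsub>T\<^esub> \<kappa> b \<in> lcs T (\<iota> ` carrier A) (\<kappa> ` carrier B)" using ab by (intro T.lcs_single c) auto
  ultimately show ?case using Cons ab T.lcs_add[OF c] by simp
qed

lemma hom_subring: 
  assumes "ring_hom_cring R S h" "subring D R" shows "subring (h ` D) S"
proof -
  interpret h: ring_hom_cring R S h by fact
  have "ring_hom_ring R S h"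
    by (intro ring_hom_ring.intro ring_hom_ring_axioms.intro h.R.ring_axioms h.S.ring_axioms h.homh)
  then show ?thesis by (rule ring_hom_ring.img_is_subring[OF _ assms(2)])
qed

lemma tensor_pair_T:
  assumes "\<one>\<^bsub>T\<^esub> \<noteq> \<zero>\<^bsub>T\<^esub>"
  shows "tensor_pair T (\<iota> ` scalars K A) (\<iota> ` carrier A) (\<kappa> ` carrier B) functionals"
proof -
  note inj = iota_inj[OF assms]
  have iz: "x = \<zero>\<^bsub>A\<^esub>" if "x \<in> carrier A" "\<iota> x = \<zero>\<^bsub>T\<^esub>" for x
    using inj_onD[OF inj, of x "\<zero>\<^bsub>A\<^esub>"] that by simp
  have kA: "scalars K A \<subseteq> carrier A" using subringE(1)[OF scalars_subring[OF A]] .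
  have kB: "\<iota> (c \<odot>\<^bsub>A\<^esub> \<one>\<^bsub>A\<^esub>) = \<kappa> (c \<odot>\<^bsub>B\<^esub> \<one>\<^bsub>B\<^esub>)" if "c \<in> carrier K" for c using that by (simp add: pure_smult)
  show ?thesis
  proof (intro tensor_pair.intro tensor_pair_axioms.intro T.is_cring)
    show "subring (\<iota> ` scalars K A) T" by (rule hom_subring[OF \<iota>.ring_hom_cring_axioms scalars_subring[OF A]])
    show "subring (\<iota> ` carrier A) T" by (rule hom_subring[OF \<iota>.ring_hom_cring_axioms A.carrier_is_subring])
    show "subring (\<kappa> ` carrier B) T" by (rule hom_subring[OF \<kappa>.ring_hom_cring_axioms B.carrier_is_subring])
    show "\<iota> ` scalars K A \<subseteq> \<iota> ` carrier A" using kA by blast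
    show "\<iota> ` scalars K A \<subseteq> \<kappa> ` carrier B" using kB by (auto simp: scalars_def)
    show "carrier T \<subseteq> lcs T (\<iota> ` carrier A) (\<kappa> ` carrier B)"
    proof
      fix t assume "t \<in> carrier T"
      then obtain ps where "set ps \<subseteq> carrier A \<times> carrier B" "t = tsum ps" using tsum_surj by blast
      then show "t \<in> lcs T (\<iota> ` carrier A) (\<kappa> ` carrier B)" using tsum_lcs by blast
    qed
    show "\<exists>d\<in>\<iota> ` scalars K A. c \<otimes>\<^bsub>T\<^esub> d = \<one>\<^bsub>T\<^esub>" if c: "c \<in> \<iota> ` scalars K A" "c \<noteq> \<zero>\<^bsub>T\<^esub>" for c
    proof -
      obtain x where x: "x \<in> carrier K" "c = \<iota> (x \<odot>\<^bsub>A\<^esub> \<one>\<^bsub>A\<^esub>)" using c(1) by (auto simp: scalars_def)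
      then have "x \<noteq> \<zero>\<^bsub>K\<^esub>" using c(2) by auto
      then have i: "inv\<^bsub>K\<^esub> x \<in> carrier K" "x \<otimes>\<^bsub>K\<^esub> inv\<^bsub>K\<^esub> x = \<one>\<^bsub>K\<^esub>" using x K.field_Units by auto
      have "c \<otimes>\<^bsub>T\<^esub> \<iota> (inv\<^bsub>K\<^esub> x \<odot>\<^bsub>A\<^esub> \<one>\<^bsub>A\<^esub>) = \<one>\<^bsub>T\<^esub>"
        using x i by (simp add: pure_mult pure_one A.smult_assoc2 A.smult_assoc1[symmetric])
      then show ?thesis using i by (auto simp: scalars_def)
    qed
    fix \<phi> assume "\<phi> \<in> functionals"
    then obtain f \<Phi> where f: "linear_form K B f" and P: "\<Phi> \<in> carrier T \<rightarrow> carrier A"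
      "\<forall>s\<in>carrier T. \<forall>t\<in>carrier T. \<Phi> (s \<oplus>\<^bsub>T\<^esub> t) = \<Phi> s \<oplus>\<^bsub>A\<^esub> \<Phi> t"
      "\<forall>a\<in>carrier A. \<forall>b\<in>carrier B. \<Phi> (pure a b) = f b \<odot>\<^bsub>A\<^esub> a" and \<phi>: "\<phi> = (\<lambda>t. \<iota> (\<Phi> t))"
      unfolding functionals_def by blast
    show "\<phi> t \<in> \<iota> ` carrier A" if "t \<in> carrier T" for t using P(1) that \<phi> by auto
    show "\<phi> (s \<oplus>\<^bsub>T\<^esub> t) = \<phi> s \<oplus>\<^bsub>T\<^esub> \<phi> t" if st: "s \<in> carrier T" "t \<in> carrier T" for s t
    proof -
      have "\<Phi> s \<in> carrier A" "\<Phi> t \<in> carrier A" using P(1) st by auto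
      then show ?thesis using P(2) st \<phi> by simp
    qed
    show "\<phi> (a \<otimes>\<^bsub>T\<^esub> t) = a \<otimes>\<^bsub>T\<^esub> \<phi> t" if at: "a \<in> \<iota> ` carrier A" "t \<in> carrier T" for a t
    proof -
      obtain a0 where a0: "a0 \<in> carrier A" "a = \<iota> a0" using at by blast
      obtain ps where ps: "set ps \<subseteq> carrier A \<times> carrier B" "t = tsum ps" using tsum_surj at by blast
      have "\<Phi> (\<iota> a0 \<otimes>\<^bsub>T\<^esub> t) = a0 \<otimes>\<^bsub>A\<^esub> \<Phi> t"
        using functional_tsum[OF P f ps(1)] a0 ps by simp
      moreover have "\<Phi> t \<in> carrier A" using P(1) at by auto
      ultimately show ?thesis using a0 \<phi> by simp
    qed
    show "\<phi> b \<in> \<iota> ` scalars K A" if b: "b \<in> \<kappa> ` carrier B" for b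
    proof -
      obtain b0 where b0: "b0 \<in> carrier B" "b = \<kappa> b0" using b by blast
      then have "\<phi> b = \<iota> (f b0 \<odot>\<^bsub>A\<^esub> \<one>\<^bsub>A\<^esub>)" using P(3) \<phi> by simp
      moreover have "f b0 \<in> carrier K" using f b0 by (auto simp: linear_form_def)
      ultimately show ?thesis by (auto simp: scalars_def)
    qed
  next
    fix t assume t: "t \<in> carrier T" "\<And>\<phi>. \<phi> \<in> functionals \<Longrightarrow> \<phi> t = \<zero>\<^bsub>T\<^esub>"
    obtain ps where ps: "set ps \<subseteq> carrier A \<times> carrier B" "t = tsum ps" using tsum_surj t by blast
    have "fval f ps = \<zero>\<^bsub>A\<^esub>" if f: "linear_form K B f" for f
    proof -
      obtain \<Phi> where P: "\<Phi> \<in> carrier T \<rightarrow> carrier A"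
        "\<forall>s\<in>carrier T. \<forall>t\<in>carrier T. \<Phi> (s \<oplus>\<^bsub>T\<^esub> t) = \<Phi> s \<oplus>\<^bsub>A\<^esub> \<Phi> t"
        "\<forall>a\<in>carrier A. \<forall>b\<in>carrier B. \<Phi> (pure a b) = f b \<odot>\<^bsub>A\<^esub> a" using functional_exists[OF f] by blast
      have "(\<lambda>t. \<iota> (\<Phi> t)) \<in> functionals" unfolding functionals_def using f P by blast
      then have "\<iota> (\<Phi> t) = \<zero>\<^bsub>T\<^esub>" using t(2)[of "\<lambda>t. \<iota> (\<Phi> t)"] by simp
      moreover have "\<Phi> t \<in> carrier A" using P(1) t(1) by auto
      ultimately have "\<Phi> t = \<zero>\<^bsub>A\<^esub>" using iz by blast
      then show ?thesis using functional_tsum(1)[OF P f ps(1)] ps by simp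
    qed
    then show "t = \<zero>\<^bsub>T\<^esub>" using tsum_separation[OF ps(1)] ps(2) by simp
  qed
qed

lemma tensor_chain_comparison:
  assumes P: "prime_in T (carrier T) P" and dom: "domain A"
    and p: "p = contr_left K A B P" "chain_to (Spec A) h p"
    and ys: "set ys \<subseteq> carrier A" "crk A p (scalars K A) ys = length ys"
    and normalization: "\<And>S. finite S \<Longrightarrow> S \<subseteq> carrier A \<Longrightarrow> \<exists>zs. set zs \<subseteq> carrier A \<and> indep A (scalars K A) zs
      \<and> length zs \<le> h + length ys \<and> normalizes K A zs S"
  shows "\<exists>e. chain_to {P' \<in> Spec T. \<iota> ` p \<subseteq> P' \<and> \<kappa> ` contr_right K A B P \<subseteq> P'} e P \<and>
    (\<forall>m Q. chain_to (Spec T) m P \<longrightarrow> Q \<in> Spec T \<longrightarrow> \<iota> ` p \<subseteq> Q \<longrightarrow> \<kappa> ` contr_right K A B P \<subseteq> Q \<longrightarrow> chain_to (Spec T) (m - e) Q)"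
proof -
  interpret dom: domain A by (rule dom)
  \<comment> \<open>The existence of the prime \<open>P\<close> excludes the zero ring; this is what
    makes \<open>\<iota>\<close> injective.\<close>
  have T1: "\<one>\<^bsub>T\<^esub> \<noteq> \<zero>\<^bsub>T\<^esub>" using prime_inD(2,3)[OF P] by metis
  note inj = iota_inj[OF T1]
  interpret tp: tensor_pair T "\<iota> ` scalars K A" "\<iota> ` carrier A" "\<kappa> ` carrier B" functionals
    by (rule tensor_pair_T[OF T1])
  have kA: "scalars K A \<subseteq> carrier A" using subringE(1)[OF scalars_subring[OF A]] .
  have PA: "P \<inter> \<iota> ` carrier A = \<iota> ` p" and PB: "P \<inter> \<kappa> ` carrier B = \<kappa> ` contr_right K A B P"
    by (auto simp: p contr_left_def contr_right_def)
  note sat = \<iota>.inj_saturated[OF inj]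
  have zA: "prime_in A (carrier A) {\<zero>\<^bsub>A\<^esub>}" using dom.zeroprimeideal A.primeideal_iff_prime_in by blast
  then have "{\<zero>\<^bsub>A\<^esub>} \<in> Spec A" by (simp add: Spec_def)
  from \<iota>.hom_prime_in[OF zA sat[OF this]] have zero: "prime_in T (\<iota> ` carrier A) {\<zero>\<^bsub>T\<^esub>}" by simp
  have hA: "chain_to {q. prime_in T (\<iota> ` carrier A) q} h (P \<inter> \<iota> ` carrier A)"
    unfolding PA by (rule \<iota>.hom_hc[OF p(2) subset_refl sat])
  have ys': "set (map \<iota> ys) \<subseteq> \<iota> ` carrier A" "crk T P (\<iota> ` scalars K A) (map \<iota> ys) = length (map \<iota> ys)"
    using ys \<iota>.hom_crk[OF kA ys(1), of P p] by (auto simp: p contr_left_def)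
  have "\<exists>zs. set zs \<subseteq> \<iota> ` carrier A \<and> indep T (\<iota> ` scalars K A) zs \<and> length zs \<le> h + length (map \<iota> ys)
      \<and> (\<forall>P'\<in>Spec T. S \<subseteq> cl T P' (adjoins T (\<iota> ` scalars K A) zs))"
    if S: "finite S" "S \<subseteq> \<iota> ` carrier A" for S
  proof -
    obtain S0 where S0: "finite S0" "S0 \<subseteq> carrier A" "S = \<iota> ` S0" using finite_subset_image[OF S] by blast
    obtain zs where zs: "set zs \<subseteq> carrier A" "indep A (scalars K A) zs" "length zs \<le> h + length ys" "normalizes K A zs S0"
      using normalization[OF S0(1,2)] by blast
    have "S \<subseteq> cl T P' (adjoins T (\<iota> ` scalars K A) (map \<iota> zs))" if "P' \<in> Spec T" for P'
    proof -
      have P': "prime_in T (carrier T) P'" using that by (simp add: Spec_def)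
      let ?D = "adjoins T (\<iota> ` scalars K A) (map \<iota> zs)"
      \<comment> \<open>The subring at which \<open>normalizes\<close> is applied. Elements
        algebraic modulo \<open>P'\<close> form a closed set, so \<open>U\<close> contains every
        element integral over it. The same \<open>zs\<close> therefore works for all primes
        \<open>P'\<close>.\<close>
      define U where "U = {a \<in> carrier A. \<iota> a \<in> cl T P' ?D}"
      have zc: "set (map \<iota> zs) \<subseteq> carrier T" using zs(1) by auto
      have D: "subring ?D T" by (rule T.adjoins_subring[OF tp.subr(1) zc])
      have sub: "subring (cl T P' ?D) T" and base: "?D \<subseteq> cl T P' ?D"
        using T.cl_subring[OF P' D] T.cl_base[OF P' D] .
      have U1: "subring U A" unfolding U_def
        by (rule A.subringI) (use subringE[OF sub] in simp_all)
      have U2: "scalars K A \<subseteq> U"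
        using kA base T.adjoins_base[OF T.subring_add_closed[OF tp.subr(1)] zc] by (auto simp: U_def)
      have U3: "set zs \<subseteq> U" using zs(1) base T.adjoins_self[OF tp.subr(1) zc] by (auto simp: U_def)
      have U4: "x \<in> U" if x: "x \<in> carrier A" "set cs \<subseteq> U" "horner A (cs @ [\<one>\<^bsub>A\<^esub>]) x = \<zero>\<^bsub>A\<^esub>" for x cs
      proof -
        have c: "set (cs @ [\<one>\<^bsub>A\<^esub>]) \<subseteq> carrier A" using x(2) by (auto simp: U_def)
        have "horner T (map \<iota> (cs @ [\<one>\<^bsub>A\<^esub>])) (\<iota> x) = \<iota> \<zero>\<^bsub>A\<^esub>" using \<iota>.hom_horner[OF c x(1)] x(3) by simp
        then have h1: "horner T (map \<iota> (cs @ [\<one>\<^bsub>A\<^esub>])) (\<iota> x) \<in> P'" using prime_inD(2)[OF P'] by simp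
        have h2: "set (map \<iota> (cs @ [\<one>\<^bsub>A\<^esub>])) \<subseteq> cl T P' ?D" using x(2) subringE(3)[OF sub] by (auto simp: U_def pure_one)
        have "\<one>\<^bsub>T\<^esub> \<in> set (map \<iota> (cs @ [\<one>\<^bsub>A\<^esub>]))" by (simp add: pure_one)
        then have h3: "\<not> set (map \<iota> (cs @ [\<one>\<^bsub>A\<^esub>])) \<subseteq> P'" using prime_inD(3)[OF P'] by blast
        have "\<iota> x \<in> cl T P' (cl T P' ?D)" by (rule clI[OF \<iota>.hom_closed[OF x(1)] h2 h1 h3])
        then show ?thesis using T.cl_cl[OF P' D] x(1) by (simp add: U_def)
      qed
      have "S0 \<subseteq> U"
        using mp[OF mp[OF mp[OF spec[OF zs(4)[unfolded normalizes_def], of U] U1] U2] U3] U4 by blast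
      then show ?thesis using S0(3) by (auto simp: U_def)
    qed
    moreover have "indep T (\<iota> ` scalars K A) (map \<iota> zs)" using \<iota>.hom_indep[OF inj kA zs(1)] zs(2) by simp
    ultimately show ?thesis using zs(1,3) by (intro exI[of _ "map \<iota> zs"]) auto
  qed
  then show ?thesis using tp.chain_comparison[OF P zero hA ys'] unfolding PA PB by blast
qed

end

section \<open>Heights and quotients\<close>

lemma chain_to_iff:
  "chain_to S n P \<longleftrightarrow> (\<exists>C. (\<forall>i\<le>n. C i \<in> S) \<and> (\<forall>i<n. C i \<subset> C (Suc i)) \<and> C n = P)"
proof (induction n arbitrary: P)
  case 0
  show ?case
  proof
    assume "chain_to S 0 P"
    then show "\<exists>C. (\<forall>i\<le>0. C i \<in> S) \<and> (\<forall>i<0. C i \<subset> C (Suc i)) \<and> C 0 = P"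
      by (intro exI[of _ "\<lambda>_. P"]) simp
  qed auto
next
  case (Suc n)
  show ?case
  proof
    assume "chain_to S (Suc n) P"
    then obtain Q where Q: "Q \<subset> P" "chain_to S n Q" "P \<in> S" by auto
    obtain C where C: "\<forall>i\<le>n. C i \<in> S" "\<forall>i<n. C i \<subset> C (Suc i)" "C n = Q"
      using Q(2)[unfolded Suc.IH] by (elim exE conjE)
    show "\<exists>C. (\<forall>i\<le>Suc n. C i \<in> S) \<and> (\<forall>i<Suc n. C i \<subset> C (Suc i)) \<and> C (Suc n) = P"
    proof (intro exI[of _ "\<lambda>i. if i \<le> n then C i else P"] conjI allI impI)
      fix i assume "i < Suc n"
      then show "(if i \<le> n then C i else P) \<subset> (if Suc i \<le> n then C (Suc i) else P)"
        using C Q(1) by (cases "i = n") auto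
    qed (use C Q in auto)
  next
    assume "\<exists>C. (\<forall>i\<le>Suc n. C i \<in> S) \<and> (\<forall>i<Suc n. C i \<subset> C (Suc i)) \<and> C (Suc n) = P"
    then obtain C where C: "\<forall>i\<le>Suc n. C i \<in> S" "\<forall>i<Suc n. C i \<subset> C (Suc i)" "C (Suc n) = P" by (elim exE conjE)
    have "chain_to S n (C n)" unfolding Suc.IH by (rule exI[of _ C]) (use C in simp)
    moreover have "C n \<subset> P" "P \<in> S" using C by auto
    ultimately show "chain_to S (Suc n) P" by auto
  qed
qed

lemma prime_ht_eq:
  assumes "cring R" shows "prime_ht R P = Sup {enat n | n. chain_to (Spec R) n P}"
proof -
  have "primeideal Q R \<longleftrightarrow> Q \<in> Spec R" for Q using cring.primeideal_iff_prime_in[OF assms] by (simp add: Spec_def)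
  then show ?thesis unfolding prime_ht_def chain_to_iff by simp
qed

lemma enat_add_Sup_le:
  fixes c d :: enat
  assumes "S \<noteq> {}" "\<And>x. x \<in> S \<Longrightarrow> c + x \<le> d" shows "c + Sup S \<le> d"
proof (cases d)
  case (enat d')
  obtain x where "x \<in> S" using assms(1) by blast
  then obtain c' where c: "c = enat c'" using assms(2)[of x] enat by (cases c) auto
  have "x \<le> enat (d' - c')" if "x \<in> S" for x
    using assms(2)[OF that] c enat by (cases x) auto
  then have "Sup S \<le> enat (d' - c')" by (rule Sup_least)
  moreover have "c' \<le> d'" using assms(2)[OF \<open>x \<in> S\<close>] c enat by (cases x) auto
  ultimately show ?thesis using c enat by (cases "Sup S") auto
qed simp

text \<open>An infinite set of \<open>enat\<close> values has supremum \<infinity>, so a finite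
  supremum is the maximum of a finite set.\<close>

lemma enat_Sup_attained:
  assumes "Sup {enat n | n. Q n} = enat N" "Q n0" shows "Q N"
proof -
  let ?S = "{enat n | n. Q n}"
  have ne: "?S \<noteq> {}" using assms(2) by blast
  have "finite ?S"
  proof (rule ccontr)
    assume "infinite ?S"
    then have "Sup ?S = \<infinity>" using ne unfolding Sup_enat_def by (simp only: if_False)
    then show False using assms(1) by simp
  qed
  then have "Sup ?S \<in> ?S" using ne Max_in[of ?S] by (simp add: Sup_enat_def)
  then show ?thesis using assms(1) by auto
qed

text \<open>\<open>Q\<close> is the bottom member of the given chain, onto which further chains can
  be glued.\<close>

lemma chain_to_append:
  assumes "chain_to {P' \<in> S. J \<subseteq> P'} n P"
  obtains Q where "Q \<in> S" "J \<subseteq> Q" "\<And>a. chain_to S a Q \<Longrightarrow> chain_to S (a + n) P"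
  using assms
proof (induction n arbitrary: P thesis)
  case 0
  then show ?case by auto
next
  case (Suc n)
  then obtain P0 where P0: "P0 \<subset> P" "chain_to {P' \<in> S. J \<subseteq> P'} n P0" "P \<in> S" by auto
  obtain Q where Q: "Q \<in> S" "J \<subseteq> Q" "\<And>a. chain_to S a Q \<Longrightarrow> chain_to S (a + n) P0" using Suc.IH[OF _ P0(2)] by blast
  have "chain_to S (a + Suc n) P" if "chain_to S a Q" for a using Q(3)[OF that] P0 by auto
  then show ?case using Suc.prems(1) Q by blast
qed

lemma (in ideal) quotient_surj: "carrier (R Quot I) = (+>) I ` carrier R"
  unfolding FactRing_def A_RCOSETS_def' ring_record_simps partial_object.simps by blast

lemma (in ideal) quotient_saturated:
  assumes "P \<in> Spec R" "I \<subseteq> P" "x \<in> carrier R" "I +> x \<in> (+>) I ` P" shows "x \<in> P"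
proof -
  obtain y where y: "y \<in> P" "I +> x = I +> y" using assms(4) by (elim imageE)
  have "x \<in> I +> y" using y(2) a_rcos_self[OF assms(3)] by simp
  then obtain i where "i \<in> I" "x = i \<oplus> y" by (auto simp: a_r_coset_def')
  then show ?thesis using prime_inD(4)[of R "carrier R" P] assms(1,2) y(1) by (auto simp: Spec_def)
qed

lemma (in ideal) chain_to_quotient:
  assumes "cring R" "P \<in> Spec R" "I \<subseteq> P"
  shows "chain_to (Spec (R Quot I)) n ((+>) I ` P) \<longleftrightarrow> chain_to {P' \<in> Spec R. I \<subseteq> P'} n P"
proof -
  interpret Q: cring "R Quot I" by (rule quotient_is_cring[OF assms(1)])
  interpret q: ring_hom_cring R "R Quot I" "(+>) I"
    by (intro ring_hom_cring.intro ring_hom_cring_axioms.intro assms(1) Q.is_cring rcos_ring_hom)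
  note preimage = ring_hom_ring.primeideal_vimage[OF rcos_ring_hom_ring assms(1)]
  have pull: "chain_to {P' \<in> Spec R. I \<subseteq> P'} n {x \<in> carrier R. I +> x \<in> Q}" if "chain_to (Spec (R Quot I)) n Q" for n Q
    using that
  proof (induction n arbitrary: Q)
    case 0
    then have prQ: "prime_in (R Quot I) (carrier (R Quot I)) Q" by (simp add: Spec_def)
    then have "primeideal {x \<in> carrier R. I +> x \<in> Q} R" using preimage Q.primeideal_iff_prime_in by blast
    then have "{x \<in> carrier R. I +> x \<in> Q} \<in> Spec R" using cring.primeideal_iff_prime_in[OF assms(1)] by (simp add: Spec_def)
    moreover have "x \<in> {x \<in> carrier R. I +> x \<in> Q}" if x: "x \<in> I" for x
    proof -
      have "I +> x = \<zero>\<^bsub>R Quot I\<^esub>" unfolding FactRing_def ring_record_simps by (rule a_rcos_const[OF x])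
      then show ?thesis using prime_inD(2)[OF prQ] Icarr[OF x] by simp
    qed
    ultimately show ?case unfolding chain_to.simps by blast
  next
    case (Suc n)
    then obtain Q' where Q': "Q' \<subset> Q" "chain_to (Spec (R Quot I)) n Q'" and QS: "Q \<in> Spec (R Quot I)" by auto
    obtain y where y: "y \<in> Q" "y \<notin> Q'" using Q'(1) by blast
    then have "y \<in> carrier (R Quot I)" using prime_inD(1)[of "R Quot I" _ Q] QS by (auto simp: Spec_def)
    then obtain x where x: "x \<in> carrier R" "y = I +> x" using quotient_surj by blast
    have "{x \<in> carrier R. I +> x \<in> Q'} \<subset> {x \<in> carrier R. I +> x \<in> Q}" using x y Q'(1) by blast
    moreover note chain_to_mem[OF Suc.IH[OF chain_to_pred[OF Suc.prems]]] Suc.IH[OF Q'(2)]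
    ultimately show ?case unfolding chain_to.simps by blast
  qed
  have "{x \<in> carrier R. I +> x \<in> (+>) I ` P} = P"
    using quotient_saturated[OF assms(2,3)] prime_inD(1)[of R "carrier R" P] assms(2) by (auto simp: Spec_def)
  moreover have "chain_to (Spec (R Quot I)) n ((+>) I ` P)" if "chain_to {P' \<in> Spec R. I \<subseteq> P'} n P"
  proof -
    have "{P' \<in> Spec R. I \<subseteq> P'} \<subseteq> Spec R" by auto
    from q.hom_hc[OF that this] quotient_saturated show ?thesis by (simp add: Spec_def quotient_surj)
  qed
  ultimately show ?thesis using pull[of n "(+>) I ` P"] by auto
qed

text \<open>One inequality holds in general, by glueing chains at a prime over \<open>J\<close>. For
  the other, \<open>Q\<close> is a prime over \<open>J\<close> of least height, and every chain up
  to \<open>P\<close> is at most \<open>e\<close> longer than some chain up to \<open>Q\<close>; as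
  \<open>e\<close> does not depend on \<open>m\<close>, this covers infinite heights.\<close>

lemma height_formula:
  assumes R: "cring R" and J: "ideal J R" and P: "P \<in> Spec R" "J \<subseteq> P"
    and e: "chain_to {P' \<in> Spec R. J \<subseteq> P'} e P" "\<And>m Q. chain_to (Spec R) m P \<Longrightarrow> Q \<in> Spec R \<Longrightarrow> J \<subseteq> Q \<Longrightarrow> chain_to (Spec R) (m - e) Q"
  shows "prime_ht R P = ht R J + prime_ht (R Quot J) ((\<lambda>x. J +>\<^bsub>R\<^esub> x) ` P)"
proof -
  interpret R: cring R by fact
  interpret J: ideal J R by fact
  let ?X = "{enat n | n. chain_to {P' \<in> Spec R. J \<subseteq> P'} n P}"
  have q: "prime_ht (R Quot J) ((\<lambda>x. J +>\<^bsub>R\<^esub> x) ` P) = Sup ?X"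
    unfolding prime_ht_eq[OF J.quotient_is_cring[OF R]] using J.chain_to_quotient[OF R P] by simp
  have prime: "primeideal Q R \<longleftrightarrow> Q \<in> Spec R" for Q using R.primeideal_iff_prime_in by (simp add: Spec_def)
  have htJ: "ht R J = Inf {prime_ht R Q | Q. Q \<in> Spec R \<and> J \<subseteq> Q}" unfolding ht_def prime ..
  have "ht R J + prime_ht (R Quot J) ((\<lambda>x. J +>\<^bsub>R\<^esub> x) ` P) \<le> prime_ht R P" unfolding q
  proof (rule enat_add_Sup_le)
    show "?X \<noteq> {}" using e(1) by blast
    fix x assume "x \<in> ?X"
    then obtain n where n: "x = enat n" "chain_to {P' \<in> Spec R. J \<subseteq> P'} n P" by blast
    obtain Q where Q: "Q \<in> Spec R" "J \<subseteq> Q" "\<And>a. chain_to (Spec R) a Q \<Longrightarrow> chain_to (Spec R) (a + n) P" using chain_to_append[OF n(2)] by blast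
    have "ht R J \<le> prime_ht R Q" unfolding htJ using Q(1,2) by (intro Inf_lower) blast
    then have "ht R J + x \<le> x + prime_ht R Q" by (simp add: add.commute add_left_mono)
    also have "\<dots> \<le> prime_ht R P" unfolding prime_ht_eq[OF R, of Q]
    proof (rule enat_add_Sup_le)
      have "chain_to (Spec R) 0 Q" using Q(1) by simp
      then show "{enat n | n. chain_to (Spec R) n Q} \<noteq> {}" by blast
      fix y assume "y \<in> {enat n | n. chain_to (Spec R) n Q}"
      then obtain a where a: "y = enat a" "chain_to (Spec R) a Q" by blast
      have "enat (a + n) \<le> prime_ht R P" unfolding prime_ht_eq[OF R] using Q(3)[OF a(2)] by (intro Sup_upper) blast
      then show "x + y \<le> prime_ht R P" using a n by (simp add: add.commute)
    qed
    finally show "ht R J + x \<le> prime_ht R P" .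
  qed
  moreover have "prime_ht R P \<le> ht R J + prime_ht (R Quot J) ((\<lambda>x. J +>\<^bsub>R\<^esub> x) ` P)"
  proof -
    let ?H = "{prime_ht R Q | Q. Q \<in> Spec R \<and> J \<subseteq> Q}"
    have "?H \<noteq> {}" using P by blast
    then have "Inf ?H \<in> ?H" unfolding Inf_enat_def by (auto intro: LeastI)
    then obtain Q where Q: "Q \<in> Spec R" "J \<subseteq> Q" "ht R J = prime_ht R Q" unfolding htJ by blast
    have eX: "enat e \<le> Sup ?X" using e(1) by (intro Sup_upper) blast
    show ?thesis unfolding prime_ht_eq[OF R, of P]
    proof (rule Sup_least)
      fix x assume "x \<in> {enat n | n. chain_to (Spec R) n P}"
      then obtain m where m: "x = enat m" "chain_to (Spec R) m P" by blast
      have "enat (m - e) \<le> prime_ht R Q" unfolding prime_ht_eq[OF R] using e(2)[OF m(2) Q(1,2)] by (intro Sup_upper) blast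
      then have "enat (m - e) + enat e \<le> ht R J + Sup ?X" using eX Q(3) by (intro add_mono) auto
      moreover have "x \<le> enat (m - e) + enat e" using m by simp
      ultimately show "x \<le> ht R J + prime_ht (R Quot J) ((\<lambda>x. J +>\<^bsub>R\<^esub> x) ` P)" unfolding q by (rule order_trans[rotated])
    qed
  qed
  ultimately show ?thesis by (rule antisym[rotated])
qed

section \<open>The height formula for the tensor product\<close>

context two_algebras begin

lemma tensor_sum_ideal_ideal:
  assumes "p \<subseteq> carrier A" "q \<subseteq> carrier B"
  shows "ideal (tensor_sum_ideal K A B p q) T"
    and "prime_in T (carrier T) Q \<Longrightarrow> tensor_sum_ideal K A B p q \<subseteq> Q \<longleftrightarrow> \<iota> ` p \<subseteq> Q \<and> \<kappa> ` q \<subseteq> Q"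
proof -
  let ?G1 = "{pure a b | a b. a \<in> p \<and> b \<in> carrier B}" and ?G2 = "{pure a b | a b. a \<in> carrier A \<and> b \<in> q}"
  have G1: "?G1 \<subseteq> carrier T" and G2: "?G2 \<subseteq> carrier T" 
    using subsetD[OF assms(1)] subsetD[OF assms(2)] by (auto intro!: pure_closed)
  have I1: "ideal (Idl\<^bsub>T\<^esub> ?G1) T" and I2: "ideal (Idl\<^bsub>T\<^esub> ?G2) T" using T.genideal_ideal G1 G2 by blast+
  have eq: "tensor_sum_ideal K A B p q = Idl\<^bsub>T\<^esub> ?G1 <+>\<^bsub>T\<^esub> Idl\<^bsub>T\<^esub> ?G2"
    by (simp add: tensor_sum_ideal_def tensor_span_def)
  show "ideal (tensor_sum_ideal K A B p q) T" unfolding eq by (rule T.add_ideals[OF I1 I2])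
  assume Q: "prime_in T (carrier T) Q"
  have Qi: "ideal Q T" using Q T.primeideal_iff_prime_in primeideal.axioms(1) by blast
  show "tensor_sum_ideal K A B p q \<subseteq> Q \<longleftrightarrow> \<iota> ` p \<subseteq> Q \<and> \<kappa> ` q \<subseteq> Q"
  proof
    assume sub: "tensor_sum_ideal K A B p q \<subseteq> Q"
    have z1: "\<zero>\<^bsub>T\<^esub> \<in> Idl\<^bsub>T\<^esub> ?G1" "\<zero>\<^bsub>T\<^esub> \<in> Idl\<^bsub>T\<^esub> ?G2"
      using additive_subgroup.zero_closed[OF ideal.axioms(1)[OF I1]] additive_subgroup.zero_closed[OF ideal.axioms(1)[OF I2]] .
    have "\<iota> a \<in> Q" if "a \<in> p" for a
    proof -
      have "\<iota> a \<in> Idl\<^bsub>T\<^esub> ?G1" using T.genideal_self[OF G1] that B.one_closed by blast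
      then have "\<iota> a \<oplus>\<^bsub>T\<^esub> \<zero>\<^bsub>T\<^esub> \<in> tensor_sum_ideal K A B p q" unfolding eq set_add_def' using z1 by blast
      moreover have "\<iota> a \<in> carrier T" using that assms by auto
      ultimately show ?thesis using sub by auto
    qed
    moreover have "\<kappa> b \<in> Q" if "b \<in> q" for b
    proof -
      have "\<kappa> b \<in> Idl\<^bsub>T\<^esub> ?G2" using T.genideal_self[OF G2] that A.one_closed by blast
      then have "\<zero>\<^bsub>T\<^esub> \<oplus>\<^bsub>T\<^esub> \<kappa> b \<in> tensor_sum_ideal K A B p q" unfolding eq set_add_def' using z1 by blast
      moreover have "\<kappa> b \<in> carrier T" using that assms by auto
      ultimately show ?thesis using sub by auto
    qed
    ultimately show "\<iota> ` p \<subseteq> Q \<and> \<kappa> ` q \<subseteq> Q" by blast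
  next
    assume h: "\<iota> ` p \<subseteq> Q \<and> \<kappa> ` q \<subseteq> Q"
    have "pure a b \<in> Q" if ab: "a \<in> p" "b \<in> carrier B" for a b
    proof -
      have "a \<in> carrier A" using ab assms by auto
      then have "\<kappa> b \<otimes>\<^bsub>T\<^esub> \<iota> a = pure a b" using ab by (simp add: pure_mult)
      then show ?thesis using prime_inD(5)[OF Q, of "\<kappa> b" "\<iota> a"] h ab by auto
    qed
    then have "Idl\<^bsub>T\<^esub> ?G1 \<subseteq> Q" by (intro T.genideal_minimal[OF Qi]) blast
    moreover have "pure a b \<in> Q" if ab: "a \<in> carrier A" "b \<in> q" for a b
    proof -
      have "b \<in> carrier B" using ab assms by auto
      then have "\<iota> a \<otimes>\<^bsub>T\<^esub> \<kappa> b = pure a b" using ab by (simp add: pure_mult)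
      then show ?thesis using prime_inD(5)[OF Q, of "\<iota> a" "\<kappa> b"] h ab by auto
    qed
    then have "Idl\<^bsub>T\<^esub> ?G2 \<subseteq> Q" by (intro T.genideal_minimal[OF Qi]) blast
    ultimately show "tensor_sum_ideal K A B p q \<subseteq> Q" unfolding eq set_add_def' using prime_inD(4)[OF Q] by blast
  qed
qed

text \<open>Isolates what the AF condition has to supply: the bound of \<open>length zs\<close> by
  \<open>h + length ys\<close>, for normalizations of arbitrary finite sets.\<close>

lemma GSCT_I:
  assumes dom: "domain A"
    and AF: "\<And>p. primeideal p A \<Longrightarrow> \<exists>h ys. chain_to (Spec A) h p \<and> set ys \<subseteq> carrier A \<and> crk A p (scalars K A) ys = length ys \<and>
      (\<forall>S. finite S \<longrightarrow> S \<subseteq> carrier A \<longrightarrow> (\<exists>zs. set zs \<subseteq> carrier A \<and> indep A (scalars K A) zs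
        \<and> length zs \<le> h + length ys \<and> normalizes K A zs S))"
  shows "GSCT K A B"
  unfolding GSCT_def Let_def
proof (intro allI impI)
  fix P assume P: "primeideal P T"
  let ?p = "contr_left K A B P" and ?q = "contr_right K A B P"
  have pr: "prime_in T (carrier T) P" using P T.primeideal_iff_prime_in by blast
  have sub: "?p \<subseteq> carrier A" "?q \<subseteq> carrier B" by (auto simp: contr_left_def contr_right_def)
  have "ring_hom_ring A T \<iota>"
    by (intro ring_hom_ring.intro ring_hom_ring_axioms.intro A.ring_axioms T.ring_axioms iota_hom)
  then have pp: "primeideal ?p A" unfolding contr_left_def by (rule ring_hom_ring.primeideal_vimage[OF _ A.is_cring P])
  obtain h ys where h: "chain_to (Spec A) h ?p" "set ys \<subseteq> carrier A" "crk A ?p (scalars K A) ys = length ys"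
    "\<And>S. finite S \<Longrightarrow> S \<subseteq> carrier A \<Longrightarrow> \<exists>zs. set zs \<subseteq> carrier A \<and> indep A (scalars K A) zs
        \<and> length zs \<le> h + length ys \<and> normalizes K A zs S" using AF[OF pp] by blast
  obtain e where e: "chain_to {P' \<in> Spec T. \<iota> ` ?p \<subseteq> P' \<and> \<kappa> ` ?q \<subseteq> P'} e P"
    "\<And>m Q. chain_to (Spec T) m P \<Longrightarrow> Q \<in> Spec T \<Longrightarrow> \<iota> ` ?p \<subseteq> Q \<Longrightarrow> \<kappa> ` ?q \<subseteq> Q \<Longrightarrow> chain_to (Spec T) (m - e) Q"
    using tensor_chain_comparison[OF pr dom refl h] by blast
  note J = tensor_sum_ideal_ideal[OF sub]
  have JQ: "tensor_sum_ideal K A B ?p ?q \<subseteq> Q \<longleftrightarrow> \<iota> ` ?p \<subseteq> Q \<and> \<kappa> ` ?q \<subseteq> Q" if "Q \<in> Spec T" for Q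
    using J(2)[of Q] that by (simp add: Spec_def)
  have PS: "P \<in> Spec T" using pr by (simp add: Spec_def)
  have eqset: "{P' \<in> Spec T. \<iota> ` ?p \<subseteq> P' \<and> \<kappa> ` ?q \<subseteq> P'} = {P' \<in> Spec T. tensor_sum_ideal K A B ?p ?q \<subseteq> P'}"
    by (rule Collect_cong, rule conj_cong[OF refl]) (simp only: JQ)
  show "prime_ht T P = ht T (tensor_sum_ideal K A B ?p ?q) +
    prime_ht (T Quot tensor_sum_ideal K A B ?p ?q) ((\<lambda>x. tensor_sum_ideal K A B ?p ?q +>\<^bsub>T\<^esub> x) ` P)"
  proof (rule height_formula[OF T.is_cring J(1) PS])
    show "tensor_sum_ideal K A B ?p ?q \<subseteq> P" using JQ[OF PS] by (auto simp: contr_left_def contr_right_def)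
    show "chain_to {P' \<in> Spec T. tensor_sum_ideal K A B ?p ?q \<subseteq> P'} e P" using e(1) unfolding eqset .
    show "chain_to (Spec T) (m - e) Q" if "chain_to (Spec T) m P" "Q \<in> Spec T" "tensor_sum_ideal K A B ?p ?q \<subseteq> Q" for m Q
      using e(2)[OF that(1,2)] that(3) JQ[OF that(2)] by blast
  qed
qed

end

section \<open>Polynomial expressions and algebraic independence\<close>

context cring begin

lemma monomial_value_finprod:
  assumes "finite S" "set_mset m \<subseteq> S" "S \<subseteq> carrier R"
  shows "monomial_value R m = (\<Otimes>s\<in>S. s [^] count m s)"
  unfolding monomial_value_def
  by (rule finprod_mono_neutral_cong_left) (use assms in \<open>auto simp: not_in_iff\<close>)

lemma monomial_value_empty [simp]: "monomial_value R {#} = \<one>"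
  by (simp add: monomial_value_def)

lemma monomial_value_add_mset:
  assumes "z \<in> carrier R" "set_mset m \<subseteq> carrier R"
  shows "monomial_value R (add_mset z m) = z \<otimes> monomial_value R m"
proof -
  let ?S = "set_mset m - {z}"
  have S: "finite (insert z ?S)" "insert z ?S \<subseteq> carrier R" "z \<notin> ?S" "finite ?S" using assms by auto
  have pc: "(\<lambda>s. s [^] count m' s) \<in> ?S \<rightarrow> carrier R" for m' using assms by auto
  have "monomial_value R m' = z [^] count m' z \<otimes> (\<Otimes>s\<in>?S. s [^] count m' s)" if "set_mset m' \<subseteq> insert z ?S" for m'
    unfolding monomial_value_finprod[OF S(1) that S(2)] using finprod_insert[OF S(4,3) pc] assms(1) by simp
  note eq = this[of m] this[of "add_mset z m"]
  have "(\<Otimes>s\<in>?S. s [^] count (add_mset z m) s) = (\<Otimes>s\<in>?S. s [^] count m s)"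
    by (rule finprod_cong') (use assms in auto)
  moreover have "(\<Otimes>s\<in>?S. s [^] count m s) \<in> carrier R" using pc by (rule finprod_closed)
  ultimately show ?thesis using eq assms by (simp add: m_assoc m_lcomm subset_iff)
qed

lemma monomial_value_closed [simp, intro]:
  "set_mset m \<subseteq> carrier R \<Longrightarrow> monomial_value R m \<in> carrier R"
  by (induction m) (auto simp: monomial_value_add_mset)

end

lemma (in ring_hom_cring) hom_monomial_value:
  "set_mset m \<subseteq> carrier R \<Longrightarrow> h (monomial_value R m) = monomial_value S (image_mset h m)"
proof (induction m)
  case (add z m)
  then have "set_mset (image_mset h m) \<subseteq> carrier S" by auto
  then show ?case using add by (simp add: R.monomial_value_add_mset S.monomial_value_add_mset)
qed simp

definition poly_expr :: "('k, 'n) ring_scheme \<Rightarrow> ('k, 'a, 'm) module_scheme \<Rightarrow> 'a set \<Rightarrow> 'a multiset set \<Rightarrow> ('a multiset \<Rightarrow> 'k) \<Rightarrow> 'a \<Rightarrow> bool" where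
  "poly_expr K L Z M c x \<longleftrightarrow> finite M \<and> (\<forall>m\<in>M. set_mset m \<subseteq> Z) \<and> c \<in> M \<rightarrow> carrier K
     \<and> (\<Oplus>\<^bsub>L\<^esub>m\<in>M. c m \<odot>\<^bsub>L\<^esub> monomial_value L m) = x"

lemma alg_independent_iff:
  "alg_independent K L Z \<longleftrightarrow> Z \<subseteq> carrier L \<and> (\<forall>M c. poly_expr K L Z M c \<zero>\<^bsub>L\<^esub> \<longrightarrow> (\<forall>m\<in>M. c m = \<zero>\<^bsub>K\<^esub>))"
  unfolding alg_independent_def poly_expr_def by (simp only: conj_assoc)

lemma alg_independent_subset: "alg_independent K L Z \<Longrightarrow> Z' \<subseteq> Z \<Longrightarrow> alg_independent K L Z'"
  unfolding alg_independent_def by (meson order_trans)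

context algebra begin

lemma poly_expr_zero:
  assumes "poly_expr R M Z N c x" "\<forall>m\<in>N. c m = \<zero>" "Z \<subseteq> carrier M" shows "x = \<zero>\<^bsub>M\<^esub>"
proof -
  have "x = (\<Oplus>\<^bsub>M\<^esub>m\<in>N. c m \<odot>\<^bsub>M\<^esub> monomial_value M m)" using assms(1) by (simp add: poly_expr_def)
  also have "\<dots> = (\<Oplus>\<^bsub>M\<^esub>m\<in>N. \<zero>\<^bsub>M\<^esub>)"
  proof (rule finsum_cong')
    fix m assume m: "m \<in> N"
    then have "set_mset m \<subseteq> carrier M" using assms(1,3) by (auto simp: poly_expr_def)
    then show "c m \<odot>\<^bsub>M\<^esub> monomial_value M m = \<zero>\<^bsub>M\<^esub>" using assms(2) m by simp
  qed auto
  finally show ?thesis by simp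
qed

text \<open>Monomials without \<open>z\<close> come from the leading entry \<open>d\<close> of the
  list, those with \<open>z\<close> from the tail with one factor \<open>z\<close> added. The two
  supports are disjoint, so nothing cancels and vanishing coefficients force \<open>cs\<close> to be
  zero.\<close>

lemma horner_poly_expr:
  assumes z: "z \<in> carrier M" "z \<notin> Z" and Z: "Z \<subseteq> carrier M"
    and D: "\<forall>d\<in>set cs. \<exists>N c. poly_expr R M Z N c d"
  shows "\<exists>N c. poly_expr R M (insert z Z) N c (horner M cs z) \<and> ((\<forall>m\<in>N. c m = \<zero>) \<longrightarrow> set cs \<subseteq> {\<zero>\<^bsub>M\<^esub>})"
  using D
proof (induction cs)
  case Nil
  show ?case by (rule exI[of _ "{}"]) (simp add: poly_expr_def)
next
  case (Cons d cs)
  obtain N0 c0 where 0: "poly_expr R M Z N0 c0 d" using Cons.prems by auto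
  obtain N1 c1 where 1: "poly_expr R M (insert z Z) N1 c1 (horner M cs z)" "(\<forall>m\<in>N1. c1 m = \<zero>) \<longrightarrow> set cs \<subseteq> {\<zero>\<^bsub>M\<^esub>}"
    using Cons.IH Cons.prems by auto
  note e0 = 0[unfolded poly_expr_def] and e1 = 1(1)[unfolded poly_expr_def]
  let ?c = "\<lambda>m. if z \<in># m then c1 (m - {#z#}) else c0 m"
  let ?N1 = "add_mset z ` N1"
  have s0: "set_mset m \<subseteq> carrier M" "z \<notin># m" if "m \<in> N0" for m using e0 that Z z(2) by auto
  have s1: "set_mset m \<subseteq> carrier M" if "m \<in> N1" for m using e1 that Z z(1) by (meson insert_subset order_trans)
  have dis: "N0 \<inter> ?N1 = {}" by (auto dest!: s0(2))
  have cl0: "(\<lambda>m. ?c m \<odot>\<^bsub>M\<^esub> monomial_value M m) \<in> N0 \<rightarrow> carrier M"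
    using e0 s0 by (auto simp: Pi_iff)
  have cl1: "(\<lambda>m. ?c m \<odot>\<^bsub>M\<^esub> monomial_value M m) \<in> ?N1 \<rightarrow> carrier M"
    using e1 s1 z(1) by (auto simp: Pi_iff monomial_value_add_mset)
  have fin: "finite N0" "finite ?N1" using e0 e1 by auto
  have t1: "(\<lambda>m. c1 m \<odot>\<^bsub>M\<^esub> monomial_value M m) \<in> N1 \<rightarrow> carrier M" using e1 s1 by (auto simp: Pi_iff)
  have "(\<Oplus>\<^bsub>M\<^esub>m\<in>N0. ?c m \<odot>\<^bsub>M\<^esub> monomial_value M m) = (\<Oplus>\<^bsub>M\<^esub>m\<in>N0. c0 m \<odot>\<^bsub>M\<^esub> monomial_value M m)"
    by (rule finsum_cong') (use s0 e0 in \<open>auto simp: Pi_iff\<close>)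
  also have "\<dots> = d" using e0 by blast
  finally have sum0: "(\<Oplus>\<^bsub>M\<^esub>m\<in>N0. ?c m \<odot>\<^bsub>M\<^esub> monomial_value M m) = d" .
  have "(\<Oplus>\<^bsub>M\<^esub>m\<in>?N1. ?c m \<odot>\<^bsub>M\<^esub> monomial_value M m)
      = (\<Oplus>\<^bsub>M\<^esub>m\<in>N1. ?c (add_mset z m) \<odot>\<^bsub>M\<^esub> monomial_value M (add_mset z m))"
    by (rule finsum_reindex[OF cl1]) (auto simp: inj_on_def)
  also have "\<dots> = (\<Oplus>\<^bsub>M\<^esub>m\<in>N1. z \<otimes>\<^bsub>M\<^esub> (c1 m \<odot>\<^bsub>M\<^esub> monomial_value M m))"
  proof (rule finsum_cong')
    fix m assume m: "m \<in> N1"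
    then have "c1 m \<in> carrier R" "monomial_value M m \<in> carrier M" using e1 s1 by auto
    then show "?c (add_mset z m) \<odot>\<^bsub>M\<^esub> monomial_value M (add_mset z m) = z \<otimes>\<^bsub>M\<^esub> (c1 m \<odot>\<^bsub>M\<^esub> monomial_value M m)"
      using s1[OF m] z(1) by (simp add: monomial_value_add_mset m_comm[of z] smult_assoc2)
  qed (use t1 z(1) in auto)
  also have "\<dots> = z \<otimes>\<^bsub>M\<^esub> horner M cs z" using finsum_rdistr[OF _ z(1) t1] e1 by simp
  finally have "(\<Oplus>\<^bsub>M\<^esub>m\<in>N0 \<union> ?N1. ?c m \<odot>\<^bsub>M\<^esub> monomial_value M m) = d \<oplus>\<^bsub>M\<^esub> z \<otimes>\<^bsub>M\<^esub> horner M cs z"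
    using finsum_Un_disjoint[OF fin dis cl0 cl1] sum0 by simp
  moreover have "?c \<in> N0 \<union> ?N1 \<rightarrow> carrier R" using e0 e1 s0(2) by (auto simp: Pi_iff)
  moreover have "\<forall>m\<in>N0. set_mset m \<subseteq> Z" "\<forall>m\<in>N1. set_mset m \<subseteq> insert z Z" using e0 e1 by blast+
  then have "\<forall>m\<in>N0 \<union> ?N1. set_mset m \<subseteq> insert z Z" unfolding ball_Un by simp blast
  ultimately have "poly_expr R M (insert z Z) (N0 \<union> ?N1) ?c (horner M (d # cs) z)" using fin unfolding poly_expr_def by simp
  moreover have "set (d # cs) \<subseteq> {\<zero>\<^bsub>M\<^esub>}" if h: "\<forall>m\<in>N0 \<union> ?N1. ?c m = \<zero>"
  proof -
    have "c0 m = \<zero>" if "m \<in> N0" for m using bspec[OF h, of m] s0(2)[OF that] that by simp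
    then have "d = \<zero>\<^bsub>M\<^esub>" using poly_expr_zero[OF 0 _ Z] by blast
    moreover have "c1 m = \<zero>" if "m \<in> N1" for m using bspec[OF h, of "add_mset z m"] that by simp
    ultimately show ?thesis using 1(2) by simp
  qed
  ultimately show ?case by blast
qed

lemma adjoins_poly_expr:
  assumes "set zs \<subseteq> carrier M" "distinct zs" "x \<in> adjoins M (scalars R M) zs"
  shows "\<exists>N c. poly_expr R M (set zs) N c x"
  using assms
proof (induction zs arbitrary: x rule: rev_induct)
  case Nil
  then obtain d where "d \<in> carrier R" "x = d \<odot>\<^bsub>M\<^esub> \<one>\<^bsub>M\<^esub>" by (auto simp: scalars_def)
  then have "poly_expr R M (set []) {{#}} (\<lambda>_. d) x" by (simp add: poly_expr_def)
  then show ?case by blast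
next
  case (snoc z zs)
  then obtain cs where cs: "x = horner M cs z" "set cs \<subseteq> adjoins M (scalars R M) zs"
    by (auto simp: adjoins_append adjoin_def)
  have "\<forall>d\<in>set cs. \<exists>N c. poly_expr R M (set zs) N c d" using snoc cs by auto
  from horner_poly_expr[OF _ _ _ this, of z] snoc.prems(1,2) cs(1) show ?case by auto
qed

end

lemma indep_append: "indep R D (xs @ ys) \<longleftrightarrow> indep R D xs \<and> indep R (adjoins R D xs) ys"
  by (induction xs arbitrary: D) auto

text \<open>Passes from independence of a set, by monomials, to iterated freeness along a list. The
  induction runs from the right, since the last element has to be free over the ring generated by
  the earlier ones.\<close>

lemma alg_independent_indep:
  assumes "algebra K L" "alg_independent K L (set zs)" "distinct zs"
  shows "indep L (scalars K L) zs"
  using assms(2,3)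
proof (induction zs rule: rev_induct)
  case (snoc z zs)
  interpret L: algebra K L by fact
  have zs: "set zs \<subseteq> carrier L" "z \<in> carrier L" "z \<notin> set zs" "distinct zs"
    using snoc.prems by (auto simp: alg_independent_def)
  have "z \<notin> cl L {\<zero>\<^bsub>L\<^esub>} (adjoins L (scalars K L) zs)"
  proof
    assume "z \<in> cl L {\<zero>\<^bsub>L\<^esub>} (adjoins L (scalars K L) zs)"
    then obtain cs where cs: "set cs \<subseteq> adjoins L (scalars K L) zs" "horner L cs z = \<zero>\<^bsub>L\<^esub>" "\<not> set cs \<subseteq> {\<zero>\<^bsub>L\<^esub>}"
      by (auto simp: cl_def)
    have "\<forall>d\<in>set cs. \<exists>N c. poly_expr K L (set zs) N c d" using L.adjoins_poly_expr[OF zs(1,4)] cs(1) by blast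
    from L.horner_poly_expr[OF zs(2,3,1) this] obtain N c where N: "poly_expr K L (insert z (set zs)) N c \<zero>\<^bsub>L\<^esub>"
      "(\<forall>m\<in>N. c m = \<zero>\<^bsub>K\<^esub>) \<longrightarrow> set cs \<subseteq> {\<zero>\<^bsub>L\<^esub>}" using cs(2) by auto
    have "alg_independent K L (insert z (set zs))" using snoc.prems(1) by simp
    then show False using N cs(3) unfolding alg_independent_iff by blast
  qed
  moreover have "indep L (scalars K L) zs" by (rule snoc.IH[OF alg_independent_subset[OF snoc.prems(1)] zs(4)]) auto
  ultimately show ?case by (simp add: indep_append)
qed simp

section \<open>Algebraic independence under embeddings into the fraction field\<close>

lemma poly_expr_image:
  assumes "algebra K A" "algebra K F" "ring_hom_cring A F h" and inj: "inj_on h (carrier A)"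
    and smult: "\<And>c a. c \<in> carrier K \<Longrightarrow> a \<in> carrier A \<Longrightarrow> h (c \<odot>\<^bsub>A\<^esub> a) = c \<odot>\<^bsub>F\<^esub> h a"
    and Z: "Z \<subseteq> carrier A" and e: "poly_expr K A Z N (\<lambda>m. c (image_mset h m)) x"
  shows "poly_expr K F (h ` Z) (image_mset h ` N) c (h x)"
proof -
  interpret A: algebra K A by fact
  interpret F: algebra K F by fact
  interpret h: ring_hom_cring A F h by fact
  note e' = e[unfolded poly_expr_def]
  have N: "set_mset m \<subseteq> carrier A" "c (image_mset h m) \<in> carrier K" if "m \<in> N" for m using e' Z that by auto
  have cl: "(\<lambda>m. c m \<odot>\<^bsub>F\<^esub> monomial_value F m) \<in> image_mset h ` N \<rightarrow> carrier F"
  proof (rule Pi_I, elim imageE)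
    fix m n assume m: "n \<in> N" "m = image_mset h n"
    then have "set_mset m \<subseteq> carrier F" using N(1) by auto
    then show "c m \<odot>\<^bsub>F\<^esub> monomial_value F m \<in> carrier F" using N(2)[OF m(1)] m(2) by simp
  qed
  have "h x = (\<Oplus>\<^bsub>F\<^esub>m\<in>N. h (c (image_mset h m) \<odot>\<^bsub>A\<^esub> monomial_value A m))"
    using h.hom_finsum[of "\<lambda>m. c (image_mset h m) \<odot>\<^bsub>A\<^esub> monomial_value A m" N] e' N by (auto simp: comp_def)
  also have "\<dots> = (\<Oplus>\<^bsub>F\<^esub>m\<in>N. c (image_mset h m) \<odot>\<^bsub>F\<^esub> monomial_value F (image_mset h m))"
    by (rule F.finsum_cong') (use N cl in \<open>auto simp: smult h.hom_monomial_value\<close>)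
  also have "\<dots> = (\<Oplus>\<^bsub>F\<^esub>m\<in>image_mset h ` N. c m \<odot>\<^bsub>F\<^esub> monomial_value F m)"
  proof (rule F.finsum_reindex[OF cl, symmetric], rule inj_onI)
    fix m n assume "m \<in> N" "n \<in> N" "image_mset h m = image_mset h n"
    then show "m = n" using multiset.inj_map_strong[of m n h h] N(1) inj_onD[OF inj] by blast
  qed
  finally show ?thesis using e' unfolding poly_expr_def by auto
qed

text \<open>A relation among the images is pulled back monomial by monomial through an inverse of
  \<open>h\<close> on \<open>Z\<close>; the value of the pulled back relation is zero by
  injectivity.\<close>

lemma alg_independent_image:
  assumes "algebra K A" "algebra K F" "ring_hom_cring A F h" and inj: "inj_on h (carrier A)"
    and smult: "\<And>c a. c \<in> carrier K \<Longrightarrow> a \<in> carrier A \<Longrightarrow> h (c \<odot>\<^bsub>A\<^esub> a) = c \<odot>\<^bsub>F\<^esub> h a"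
    and ind: "alg_independent K A Z"
  shows "alg_independent K F (h ` Z)"
  unfolding alg_independent_iff
proof (intro conjI allI impI ballI)
  interpret A: algebra K A by fact
  interpret h: ring_hom_cring A F h by fact
  have Z: "Z \<subseteq> carrier A" using ind by (simp add: alg_independent_def)
  then show "h ` Z \<subseteq> carrier F" by auto
  fix N c m0 assume e: "poly_expr K F (h ` Z) N c \<zero>\<^bsub>F\<^esub>" and m0: "m0 \<in> N"
  note e' = e[unfolded poly_expr_def]
  let ?g = "inv_into Z h" and ?N = "image_mset (inv_into Z h) ` N"
  have hg: "image_mset h (image_mset ?g m) = m" if "m \<in> N" for m
    unfolding multiset.map_comp
  proof (rule multiset.map_ident_strong)
    fix z assume "z \<in># m"
    then have "z \<in> h ` Z" using e' that by blast
    then show "(h \<circ> ?g) z = z" by (simp add: f_inv_into_f)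
  qed
  have sub: "set_mset m \<subseteq> Z" if m: "m \<in> ?N" for m
  proof -
    obtain n where n: "n \<in> N" "m = image_mset ?g n" using m by blast
    then have "set_mset n \<subseteq> h ` Z" using e' by blast
    then show ?thesis using n(2) inv_into_into[of _ h Z] by auto
  qed
  define x where "x = (\<Oplus>\<^bsub>A\<^esub>m\<in>?N. c (image_mset h m) \<odot>\<^bsub>A\<^esub> monomial_value A m)"
  have x: "poly_expr K A Z ?N (\<lambda>m. c (image_mset h m)) x"
    unfolding poly_expr_def using e' sub hg by (auto simp: x_def Pi_iff)
  have "image_mset h ` ?N = N" using hg by (simp add: image_image)
  then have "poly_expr K F (h ` Z) N c (h x)" using poly_expr_image[OF assms(1-5) Z x] by simp
  then have "h x = \<zero>\<^bsub>F\<^esub>" using e' by (simp add: poly_expr_def)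
  moreover have "x \<in> carrier A" unfolding x_def
    by (rule A.finsum_closed) (use x Z in \<open>auto simp: poly_expr_def Pi_iff\<close>)
  ultimately have "x = \<zero>\<^bsub>A\<^esub>" using inj_onD[OF inj, of x "\<zero>\<^bsub>A\<^esub>"] by simp
  then have "c (image_mset h m) = \<zero>\<^bsub>K\<^esub>" if "m \<in> ?N" for m using ind x that unfolding alg_independent_iff by blast
  from this[of "image_mset ?g m0"] show "c m0 = \<zero>\<^bsub>K\<^esub>" using hg[OF m0] m0 by auto
qed

lemma Frac_algebra:
  assumes "domain A" "algebra K A" shows "algebra K (Frac A)"
proof -
  interpret dom: domain A by fact
  interpret al: algebra K A by fact
  interpret F: field "Frac A" by (rule Frac_field[OF assms(1)])
  note E = Frac_E[OF assms(1)]
  note simps = Frac_smult[OF assms(1,2)] Frac_add[OF assms(1)] Frac_mult[OF assms(1)] frac_eq_iff[OF assms(1)] Frac_I[OF assms(1)]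
    dom.integral_iff
  show ?thesis
  proof (rule algebraI)
    show "cring K" "cring (Frac A)" by (simp_all add: al.R.is_cring F.is_cring)
    show "\<one>\<^bsub>K\<^esub> \<odot>\<^bsub>Frac A\<^esub> x = x" if x: "x \<in> carrier (Frac A)" for x
      by (rule E[OF x]) (simp add: simps)
  next
    fix a x assume a: "a \<in> carrier K" and x: "x \<in> carrier (Frac A)"
    obtain u v where u: "x = fraction A u v" "u \<in> carrier A" "v \<in> carrier A" "v \<noteq> \<zero>\<^bsub>A\<^esub>" using E[OF x] .
    show "a \<odot>\<^bsub>Frac A\<^esub> x \<in> carrier (Frac A)" using u a by (simp add: simps)
    {
      fix b assume b: "b \<in> carrier K"
      show "(a \<oplus>\<^bsub>K\<^esub> b) \<odot>\<^bsub>Frac A\<^esub> x = a \<odot>\<^bsub>Frac A\<^esub> x \<oplus>\<^bsub>Frac A\<^esub> b \<odot>\<^bsub>Frac A\<^esub> x"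
        using u a b by (simp add: simps al.smult_l_distr dom.l_distr dom.m_assoc)
      show "(a \<otimes>\<^bsub>K\<^esub> b) \<odot>\<^bsub>Frac A\<^esub> x = a \<odot>\<^bsub>Frac A\<^esub> (b \<odot>\<^bsub>Frac A\<^esub> x)"
        using u a b by (simp add: simps al.smult_assoc1)
    }
    fix y assume y: "y \<in> carrier (Frac A)"
    obtain w z where w: "y = fraction A w z" "w \<in> carrier A" "z \<in> carrier A" "z \<noteq> \<zero>\<^bsub>A\<^esub>" using E[OF y] .
    show "a \<odot>\<^bsub>Frac A\<^esub> (x \<oplus>\<^bsub>Frac A\<^esub> y) = a \<odot>\<^bsub>Frac A\<^esub> x \<oplus>\<^bsub>Frac A\<^esub> a \<odot>\<^bsub>Frac A\<^esub> y"
      using u w a by (simp add: simps al.smult_r_distr al.smult_assoc2)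
    show "(a \<odot>\<^bsub>Frac A\<^esub> x) \<otimes>\<^bsub>Frac A\<^esub> y = a \<odot>\<^bsub>Frac A\<^esub> (x \<otimes>\<^bsub>Frac A\<^esub> y)"
      using u w a by (simp add: simps al.smult_assoc2)
  qed
qed

lemma fraction_hom_smult:
  assumes "domain A" "algebra K A" "c \<in> carrier K" "a \<in> carrier A"
  shows "fraction_hom A (c \<odot>\<^bsub>A\<^esub> a) = c \<odot>\<^bsub>Frac A\<^esub> fraction_hom A a"
proof -
  interpret domain A by fact
  show ?thesis using assms by (simp add: fraction_hom_def Frac_smult)
qed

lemma alg_independent_card_le_td:
  assumes "domain A" "algebra K A" "finite Z" "alg_independent K A Z"
  shows "enat (card Z) \<le> td K A"
proof -
  interpret A: domain A by fact
  interpret F: field "Frac A" by (rule Frac_field[OF assms(1)])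
  have hom: "ring_hom_cring A (Frac A) (fraction_hom A)"
    by (intro ring_hom_cring.intro ring_hom_cring_axioms.intro A.is_cring F.is_cring fraction_hom(1)[OF assms(1)])
  have Z: "Z \<subseteq> carrier A" using assms(4) by (simp add: alg_independent_def)
  have "alg_independent K (Frac A) (fraction_hom A ` Z)"
    by (rule alg_independent_image[OF assms(2) Frac_algebra[OF assms(1,2)] hom fraction_hom(2)[OF assms(1)]
        fraction_hom_smult[OF assms(1,2)] assms(4)])
  moreover have "card (fraction_hom A ` Z) = card Z" by (rule card_image[OF inj_on_subset[OF fraction_hom(2)[OF assms(1)] Z]])
  ultimately show ?thesis using assms(1,3) unfolding td_def trdeg_def by (auto intro!: Sup_upper exI[of _ "fraction_hom A ` Z"])
qed

section \<open>Noether normalization\<close>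

text \<open>Digits in a positional system: a new variable gets a weight \<open>E\<close> above all
  weights of the remaining parts, so quotient and remainder by \<open>E\<close> recover its exponent
  and the weight of the rest. The weight of \<open>a\<close> is one because \<open>a\<close> itself
  is kept as the variable.\<close>

lemma exists_separating_weights:
  fixes a :: 'a
  assumes "finite S" "finite N" "\<forall>m\<in>N. set_mset m \<subseteq> insert a S" "a \<notin> S"
  shows "\<exists>e :: 'a \<Rightarrow> nat. e a = 1 \<and> (\<forall>x. 1 \<le> e x) \<and> inj_on (\<lambda>m. \<Sum>x\<in>#m. e x) N"
  using assms
proof (induction S arbitrary: N rule: finite_induct)
  case empty
  have "inj_on (\<lambda>m. \<Sum>x\<in>#m. 1 :: nat) N"
  proof (rule inj_onI)
    fix m n assume mn: "m \<in> N" "n \<in> N" "(\<Sum>x\<in>#m. 1 :: nat) = (\<Sum>x\<in>#n. 1)"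
    have "k = replicate_mset (size k) a" if "k \<in> N" for k
      using empty(2) that set_mset_subset_singletonD[of k a] by auto
    then show "m = n" using mn by (metis size_eq_sum_mset)
  qed
  then show ?case by (intro exI[of _ "\<lambda>_. 1"]) simp
next
  case (insert x S)
  let ?r = "filter_mset (\<lambda>y. y \<noteq> x)"
  have "\<forall>m\<in>?r ` N. set_mset m \<subseteq> insert a S" using insert.prems(2) by auto
  moreover have "a \<notin> S" "finite (?r ` N)" using insert.prems by auto
  ultimately have "\<exists>e :: 'a \<Rightarrow> nat. e a = 1 \<and> (\<forall>x. 1 \<le> e x) \<and> inj_on (\<lambda>m. \<Sum>x\<in>#m. e x) (?r ` N)"
    using insert.IH[of "?r ` N"] by blast
  then obtain e :: "'a \<Rightarrow> nat" where e: "e a = 1" "\<forall>y. 1 \<le> e y" "inj_on (\<lambda>m. \<Sum>y\<in>#m. e y) (?r ` N)"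
    by (elim exE conjE)
  let ?w = "\<lambda>m. \<Sum>y\<in>#?r m. e y"
  define E where "E = Suc (Max (insert 0 (?w ` N)))"
  have less: "?w m < E" if "m \<in> N" for m
    unfolding E_def using insert.prems(1) that by (simp add: le_imp_less_Suc)
  have split: "(\<Sum>y\<in>#m. (e(x := E)) y) = ?w m + count m x * E" for m by (induction m) auto
  have "inj_on (\<lambda>m. \<Sum>y\<in>#m. (e(x := E)) y) N"
  proof (rule inj_onI)
    fix m n assume mn: "m \<in> N" "n \<in> N" "(\<Sum>y\<in>#m. (e(x := E)) y) = (\<Sum>y\<in>#n. (e(x := E)) y)"
    then have eq: "?w m + count m x * E = ?w n + count n x * E" by (simp only: split)
    from arg_cong[OF eq, of "\<lambda>k. k div E"] arg_cong[OF eq, of "\<lambda>k. k mod E"]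
    have "count m x = count n x" "?w m = ?w n" using less[OF mn(1)] less[OF mn(2)] by simp_all
    moreover have "?r m = ?r n" using inj_onD[OF e(3)] calculation(2) mn(1,2) by blast
    ultimately show "m = n" by (metis (mono_tags, lifting) count_filter_mset multiset_eqI)
  qed
  moreover have "1 \<le> E" by (simp add: E_def)
  ultimately show ?case using e(1,2) insert.prems(3) by (intro exI[of _ "e(x := E)"]) auto
qed

text \<open>Polynomials in \<open>a\<close> of degree less than the last argument with coefficients in \<open>U\<close>.\<close>

primrec low :: "('a, 'm) ring_scheme \<Rightarrow> 'a set \<Rightarrow> 'a \<Rightarrow> nat \<Rightarrow> 'a set" where
  "low R U a 0 = {\<zero>\<^bsub>R\<^esub>}"
| "low R U a (Suc d) = {c \<oplus>\<^bsub>R\<^esub> a \<otimes>\<^bsub>R\<^esub> y | c y. c \<in> U \<and> y \<in> low R U a d}"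

context cring begin

lemma low_horner: "x \<in> low R U a d \<Longrightarrow> \<exists>bs. set bs \<subseteq> U \<and> length bs = d \<and> x = horner R bs a"
proof (induction d arbitrary: x)
  case (Suc d)
  then obtain c y where "c \<in> U" "y \<in> low R U a d" "x = c \<oplus> a \<otimes> y" by auto
  moreover obtain bs where "set bs \<subseteq> U" "length bs = d" "y = horner R bs a" using Suc.IH calculation(2) by blast
  ultimately show ?case by (intro exI[of _ "c # bs"]) simp
qed simp

lemma horner_append_one:
  "set bs \<subseteq> carrier R \<Longrightarrow> a \<in> carrier R \<Longrightarrow> horner R (bs @ [\<one>]) a = horner R bs a \<oplus> a [^] length bs"
  by (induction bs) (simp_all add: r_distr a_assoc m_comm[of a])

context
  fixes U a assumes U: "subring U R" and a: "a \<in> carrier R"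
begin

lemma low_closed: "low R U a d \<subseteq> carrier R"
proof (induction d)
  case (Suc d)
  then show ?case using subringE(1)[OF U] a by auto
qed simp

lemma low_zero: "\<zero> \<in> low R U a d"
proof (induction d)
  case (Suc d)
  then show ?case using subringE(2)[OF U] a by (auto intro!: exI[of _ \<zero>])
qed simp

lemma low_add: "x \<in> low R U a d \<Longrightarrow> y \<in> low R U a d \<Longrightarrow> x \<oplus> y \<in> low R U a d"
proof (induction d arbitrary: x y)
  case (Suc d)
  obtain c x' where x: "c \<in> U" "x' \<in> low R U a d" "x = c \<oplus> a \<otimes> x'" using Suc.prems by auto
  obtain c' y' where y: "c' \<in> U" "y' \<in> low R U a d" "y = c' \<oplus> a \<otimes> y'" using Suc.prems by auto
  have "c \<in> carrier R" "c' \<in> carrier R" "x' \<in> carrier R" "y' \<in> carrier R"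
    using x y low_closed subringE(1)[OF U] by auto
  then have "x \<oplus> y = (c \<oplus> c') \<oplus> a \<otimes> (x' \<oplus> y')" using x y a by (simp add: r_distr a_ac)
  then show ?case using x y Suc.IH subringE(7)[OF U] unfolding low.simps by blast
qed simp

lemma low_smult: "u \<in> U \<Longrightarrow> x \<in> low R U a d \<Longrightarrow> u \<otimes> x \<in> low R U a d"
proof (induction d arbitrary: x)
  case 0
  then show ?case using subringE(1)[OF U] by auto
next
  case (Suc d)
  obtain c x' where x: "c \<in> U" "x' \<in> low R U a d" "x = c \<oplus> a \<otimes> x'" using Suc.prems by auto
  have "c \<in> carrier R" "x' \<in> carrier R" "u \<in> carrier R"
    using x Suc.prems low_closed subringE(1)[OF U] by auto
  then have "u \<otimes> x = u \<otimes> c \<oplus> a \<otimes> (u \<otimes> x')" using x a by (simp add: r_distr m_lcomm)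
  then show ?case using x Suc subringE(6)[OF U] unfolding low.simps by blast
qed

lemma low_mult: "x \<in> low R U a d \<Longrightarrow> a \<otimes> x \<in> low R U a (Suc d)"
  using subsetD[OF low_closed] subringE(2)[OF U] a unfolding low.simps by (intro CollectI exI[of _ \<zero>] exI[of _ x] conjI) simp_all

lemma low_pow_mult: "x \<in> low R U a d \<Longrightarrow> a [^] n \<otimes> x \<in> low R U a (n + d)"
proof (induction n)
  case 0
  then show ?case using subsetD[OF low_closed] by simp
next
  case (Suc n)
  have "x \<in> carrier R" using Suc.prems low_closed by auto
  then have "a [^] Suc n \<otimes> x = a \<otimes> (a [^] n \<otimes> x)" using a by (simp add: m_ac)
  then show ?case using low_mult[OF Suc.IH[OF Suc.prems]] by simp
qed

lemma low_mono: "d \<le> d' \<Longrightarrow> low R U a d \<subseteq> low R U a d'"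
proof (induction rule: dec_induct)
  case (step n)
  have "low R U a n \<subseteq> low R U a (Suc n)" for n
  proof (induction n)
    case 0
    show ?case using low_zero[of "Suc 0"] by simp
  next
    case (Suc n)
    then show ?case unfolding low.simps(2)[of _ _ _ n] low.simps(2)[of _ _ _ "Suc n"] by blast
  qed
  then show ?case using step by blast
qed simp

lemma low_pow: "a [^] d \<in> low R U a (Suc d)"
proof -
  have "\<one> \<in> low R U a (Suc 0)" using subringE(3)[OF U] a by (auto intro!: exI[of _ \<one>])
  from low_pow_mult[OF this, of d] show ?thesis using a by simp
qed

text \<open>Substituting \<open>b \<oplus> a [^] e x\<close> for each variable turns a monomial of
  weight w into a monic polynomial in \<open>a\<close> of degree w over \<open>U\<close>.\<close>

lemma monomial_low:
  assumes "\<And>x. x \<in> set_mset m \<Longrightarrow> 1 \<le> e x \<and> (\<exists>b\<in>U. x = b \<oplus> a [^] e x)"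
  shows "\<exists>l\<in>low R U a (\<Sum>x\<in>#m. e x). monomial_value R m = a [^] (\<Sum>x\<in>#m. e x) \<oplus> l"
  using assms
proof (induction m)
  case (add x m)
  let ?w = "\<Sum>x\<in>#m. e x"
  obtain l where l: "l \<in> low R U a ?w" "monomial_value R m = a [^] ?w \<oplus> l" using add by auto
  obtain b where b: "b \<in> U" "x = b \<oplus> a [^] e x" "1 \<le> e x" using add.prems[of x] by auto
  have Uc: "u \<in> carrier R" if "u \<in> U" for u using subringE(1)[OF U] that by blast
  have car: "l \<in> carrier R" "b \<in> carrier R" using l b low_closed Uc by auto
  have "x \<in> carrier R" using b(2) car a by (metis a_closed nat_pow_closed)
  moreover have "set_mset m \<subseteq> carrier R"
  proof
    fix y assume "y \<in># m"
    then obtain c where c: "c \<in> U" "y = c \<oplus> a [^] e y" using add.prems[of y] by auto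
    show "y \<in> carrier R" by (subst c(2)) (use Uc[OF c(1)] a in simp)
  qed
  ultimately have "monomial_value R (add_mset x m) = x \<otimes> (a [^] ?w \<oplus> l)" by (simp add: monomial_value_add_mset l(2))
  also have "\<dots> = (b \<oplus> a [^] e x) \<otimes> (a [^] ?w \<oplus> l)" by (subst b(2)) simp
  also have "\<dots> = a [^] (e x + ?w) \<oplus> (a [^] e x \<otimes> l \<oplus> (b \<otimes> a [^] ?w \<oplus> b \<otimes> l))"
    using car a by (simp add: r_distr l_distr a_ac nat_pow_mult)
  finally have "monomial_value R (add_mset x m) = a [^] (e x + ?w) \<oplus> (a [^] e x \<otimes> l \<oplus> (b \<otimes> a [^] ?w \<oplus> b \<otimes> l))" .
  \<comment> \<open>Here \<open>1 \<le> e x\<close> matters: it makes the degree \<open>?w\<close>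
    smaller than \<open>e x + ?w\<close>.\<close>
  moreover have "b \<otimes> a [^] ?w \<in> low R U a (e x + ?w)" "b \<otimes> l \<in> low R U a (e x + ?w)"
    using low_smult[OF b(1) low_pow[of ?w]] low_smult[OF b(1) l(1)] low_mono[of "Suc ?w" "e x + ?w"] low_mono[of ?w "e x + ?w"] b(3) by auto
  then have "a [^] e x \<otimes> l \<oplus> (b \<otimes> a [^] ?w \<oplus> b \<otimes> l) \<in> low R U a (e x + ?w)"
    using low_pow_mult[OF l(1), of "e x"] by (intro low_add)
  ultimately show ?case by auto
qed simp

lemma finsum_low:
  "finite N \<Longrightarrow> f \<in> N \<rightarrow> low R U a d \<Longrightarrow> (\<Oplus>m\<in>N. f m) \<in> low R U a d"
proof (induction N rule: finite_induct)
  case empty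
  then show ?case by (simp add: low_zero)
next
  case (insert m N)
  then have "f \<in> N \<rightarrow> carrier R" "f m \<in> carrier R" using low_closed by blast+
  then show ?case using insert low_add by simp
qed

end

end

lemma alg_independent_empty:
  assumes "field K" "algebra K A" "\<one>\<^bsub>A\<^esub> \<noteq> \<zero>\<^bsub>A\<^esub>" shows "alg_independent K A {}"
  unfolding alg_independent_iff
proof (intro conjI allI impI ballI, rule empty_subsetI, rule ccontr)
  interpret K: field K by fact
  interpret A: algebra K A by fact
  fix N c m assume e: "poly_expr K A {} N c \<zero>\<^bsub>A\<^esub>" and m: "m \<in> N" and nz: "c m \<noteq> \<zero>\<^bsub>K\<^esub>"
  have "k = {#}" if "k \<in> N" for k using e that by (auto simp: poly_expr_def)
  then have "N = {{#}}" "m = {#}" using m by blast+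
  then have z: "c m \<odot>\<^bsub>A\<^esub> \<one>\<^bsub>A\<^esub> = \<zero>\<^bsub>A\<^esub>" "c m \<in> carrier K"
    using e A.finsum_insert[of "{}" "{#}" "\<lambda>m. c m \<odot>\<^bsub>A\<^esub> monomial_value A m"] by (simp_all add: poly_expr_def)
  then have i: "inv\<^bsub>K\<^esub> (c m) \<in> carrier K" "inv\<^bsub>K\<^esub> (c m) \<otimes>\<^bsub>K\<^esub> c m = \<one>\<^bsub>K\<^esub>" using nz K.field_Units by auto
  have "\<one>\<^bsub>A\<^esub> = inv\<^bsub>K\<^esub> (c m) \<odot>\<^bsub>A\<^esub> (c m \<odot>\<^bsub>A\<^esub> \<one>\<^bsub>A\<^esub>)"
    using i z(2) A.smult_assoc1[OF i(1) z(2), of "\<one>\<^bsub>A\<^esub>", symmetric] by simp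
  then show False using assms(3) i(1) z(1) by simp
qed

text \<open>Given a relation between the elements of \<open>S\<close> and \<open>a \<in> S\<close>, replace the other elements \<open>x\<close>
  by \<open>x - a\<^sup>e\<close> with exponents \<open>e = e(x)\<close> for which the monomials of the relation have distinct
  degrees in \<open>a\<close>: the relation becomes integral over the new elements.\<close>

lemma noether_normalization:
  assumes "field K" "algebra K A" "\<one>\<^bsub>A\<^esub> \<noteq> \<zero>\<^bsub>A\<^esub>" "finite S" "S \<subseteq> carrier A"
  shows "\<exists>zs. distinct zs \<and> alg_independent K A (set zs) \<and> normalizes K A zs S"
  using assms(4,5)
proof (induction "card S" arbitrary: S rule: less_induct)
  case less
  interpret K: field K by fact
  interpret A: algebra K A by fact
  show ?case
  proof (cases "alg_independent K A S")
    case True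
    obtain zs where "set zs = S" "distinct zs" using finite_distinct_list[OF less.prems(1)] by blast
    then show ?thesis using True by (intro exI[of _ zs]) (auto simp: normalizes_def)
  next
    case False
    then obtain N0 c m0 where 0: "poly_expr K A S N0 c \<zero>\<^bsub>A\<^esub>" "m0 \<in> N0" "c m0 \<noteq> \<zero>\<^bsub>K\<^esub>"
      using less.prems unfolding alg_independent_iff by blast
    note e0 = 0(1)[unfolded poly_expr_def]
    \<comment> \<open>Terms with coefficient zero are discarded, so that the monomial of largest
      weight has an invertible coefficient.\<close>
    define N where "N = {m \<in> N0. c m \<noteq> \<zero>\<^bsub>K\<^esub>}"
    have N: "finite N" "N \<noteq> {}" using e0 0 by (auto simp: N_def)
    have c: "c m \<in> carrier K" "c m \<noteq> \<zero>\<^bsub>K\<^esub>" "set_mset m \<subseteq> S" "set_mset m \<subseteq> carrier A" if m: "m \<in> N" for m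
    proof -
      have "m \<in> N0" "c m \<noteq> \<zero>\<^bsub>K\<^esub>" using m by (auto simp: N_def)
      moreover from this have "set_mset m \<subseteq> S" using e0 by blast
      ultimately show "c m \<in> carrier K" "c m \<noteq> \<zero>\<^bsub>K\<^esub>" "set_mset m \<subseteq> S" "set_mset m \<subseteq> carrier A"
        using e0 less.prems(2) by auto
    qed
    have c0: "c m \<odot>\<^bsub>A\<^esub> monomial_value A m \<in> carrier A" if m: "m \<in> N0" for m
    proof -
      have "set_mset m \<subseteq> carrier A" using e0 m less.prems(2) by (meson order_trans)
      then show ?thesis using e0 m by auto
    qed
    have rel: "(\<Oplus>\<^bsub>A\<^esub>m\<in>N. c m \<odot>\<^bsub>A\<^esub> monomial_value A m) = \<zero>\<^bsub>A\<^esub>"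
    proof -
      have "(\<Oplus>\<^bsub>A\<^esub>m\<in>N. c m \<odot>\<^bsub>A\<^esub> monomial_value A m) = (\<Oplus>\<^bsub>A\<^esub>m\<in>N0. c m \<odot>\<^bsub>A\<^esub> monomial_value A m)"
      proof (rule A.add.finprod_mono_neutral_cong_left)
        show "c m \<odot>\<^bsub>A\<^esub> monomial_value A m = \<zero>\<^bsub>A\<^esub>" if m: "m \<in> N0 - N" for m
        proof -
          have "set_mset m \<subseteq> carrier A" using e0 m less.prems(2) by (meson DiffD1 order_trans)
          then show ?thesis using m by (simp add: N_def)
        qed
      qed (use c0 e0 in \<open>auto simp: N_def\<close>)
      then show ?thesis using e0 by simp
    qed
    have "S \<noteq> {}" using alg_independent_empty[OF assms(1-3)] False by blast
    then obtain a where a: "a \<in> S" by blast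
    have ac: "a \<in> carrier A" using a less.prems(2) by blast
    have "\<forall>m\<in>N. set_mset m \<subseteq> insert a (S - {a})" using c(3) a by (simp add: insert_absorb)
    from exists_separating_weights[OF _ N(1) this] obtain e :: "'b \<Rightarrow> nat"
      where e: "e a = 1" "\<And>x. 1 \<le> e x" "inj_on (\<lambda>m. \<Sum>x\<in>#m. e x) N" using less.prems(1) by auto
    let ?w = "\<lambda>m. \<Sum>x\<in>#m. e x"
    let ?S = "(\<lambda>x. x \<ominus>\<^bsub>A\<^esub> a [^]\<^bsub>A\<^esub> e x) ` (S - {a})"
    have "card ?S \<le> card (S - {a})" using less.prems(1) by (intro card_image_le) simp
    also have "\<dots> < card S" using less.prems(1) a by (intro card_Diff1_less)
    finally obtain zs where zs: "distinct zs" "alg_independent K A (set zs)" "normalizes K A zs ?S"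
      using less.hyps[of ?S] less.prems ac by (auto simp: subset_iff)
    have "normalizes K A zs S" unfolding normalizes_def
    proof (intro allI impI)
      fix U assume U: "subring U A" "scalars K A \<subseteq> U" "set zs \<subseteq> U"
        and int: "\<forall>x\<in>carrier A. \<forall>cs. set cs \<subseteq> U \<longrightarrow> horner A (cs @ [\<one>\<^bsub>A\<^esub>]) x = \<zero>\<^bsub>A\<^esub> \<longrightarrow> x \<in> U"
      have SU: "?S \<subseteq> U" using zs(3) U int unfolding normalizes_def by blast
      note low = A.low_closed[OF U(1) ac] A.low_add[OF U(1) ac] A.low_smult[OF U(1) ac] A.low_pow[OF U(1) ac]
      have b: "\<exists>b\<in>U. x = b \<oplus>\<^bsub>A\<^esub> a [^]\<^bsub>A\<^esub> e x" if x: "x \<in> S" for x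
      proof (cases "x = a")
        case True
        then show ?thesis using e(1) ac subringE(2)[OF U(1)] by (intro bexI[of _ "\<zero>\<^bsub>A\<^esub>"]) auto
      next
        case False
        then have "x \<ominus>\<^bsub>A\<^esub> a [^]\<^bsub>A\<^esub> e x \<in> U" using SU x by blast
        moreover have "x = (x \<ominus>\<^bsub>A\<^esub> a [^]\<^bsub>A\<^esub> e x) \<oplus>\<^bsub>A\<^esub> a [^]\<^bsub>A\<^esub> e x"
          using x less.prems(2) ac by (auto simp: a_minus_def A.a_assoc A.l_neg)
        ultimately show ?thesis by blast
      qed
      have mono: "\<exists>l\<in>low A U a (?w m). monomial_value A m = a [^]\<^bsub>A\<^esub> ?w m \<oplus>\<^bsub>A\<^esub> l" if m: "m \<in> N" for m
        by (rule A.monomial_low[OF U(1) ac]) (use c(3)[OF m] b e(2) in blast)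
      have smult: "d \<odot>\<^bsub>A\<^esub> l \<in> low A U a n" if d: "d \<in> carrier K" "l \<in> low A U a n" for d l n
      proof -
        have l: "l \<in> carrier A" using low(1) d(2) by blast
        have "(d \<odot>\<^bsub>A\<^esub> \<one>\<^bsub>A\<^esub>) \<otimes>\<^bsub>A\<^esub> l \<in> low A U a n" by (rule low(3)[OF _ d(2)]) (use d(1) U(2) in \<open>auto simp: scalars_def\<close>)
        then show ?thesis using d(1) l by (simp add: A.smult_assoc2)
      qed
      have "Max (?w ` N) \<in> ?w ` N" using N by (intro Max_in) auto
      then obtain m where m: "m \<in> N" "?w m = Max (?w ` N)" by auto
      \<comment> \<open>Distinct weights make the maximum unique, so the other monomials only have
        lower degree in \<open>a\<close> and cannot cancel the leading power.\<close>
      have less_w: "?w n < ?w m" if n: "n \<in> N - {m}" for n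
      proof -
        have "?w n \<le> ?w m" using m(2) N(1) n by simp
        moreover have "?w n \<noteq> ?w m" using inj_onD[OF e(3), of n m] n m(1) by blast
        ultimately show ?thesis by simp
      qed
      obtain l where l: "l \<in> low A U a (?w m)" "monomial_value A m = a [^]\<^bsub>A\<^esub> ?w m \<oplus>\<^bsub>A\<^esub> l" using mono[OF m(1)] by blast
      let ?rest = "\<Oplus>\<^bsub>A\<^esub>n\<in>N - {m}. c n \<odot>\<^bsub>A\<^esub> monomial_value A n"
      have rest: "?rest \<in> low A U a (?w m)"
      proof (rule A.finsum_low[OF U(1) ac])
        show "(\<lambda>n. c n \<odot>\<^bsub>A\<^esub> monomial_value A n) \<in> N - {m} \<rightarrow> low A U a (?w m)"
        proof
          fix n assume n: "n \<in> N - {m}"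
          obtain l where l: "l \<in> low A U a (?w n)" "monomial_value A n = a [^]\<^bsub>A\<^esub> ?w n \<oplus>\<^bsub>A\<^esub> l" using mono[of n] n by blast
          have "l \<in> low A U a (Suc (?w n))" using A.low_mono[OF U(1) ac, of "?w n" "Suc (?w n)"] l(1) by auto
          then have "monomial_value A n \<in> low A U a (Suc (?w n))" unfolding l(2) by (rule low(2)[OF low(4)])
          then have "monomial_value A n \<in> low A U a (?w m)" using A.low_mono[OF U(1) ac, of "Suc (?w n)" "?w m"] less_w[OF n] by auto
          then show "c n \<odot>\<^bsub>A\<^esub> monomial_value A n \<in> low A U a (?w m)" using smult c(1) n by blast
        qed
      qed (use N in simp)
      have car: "l \<in> carrier A" "?rest \<in> carrier A" using l(1) rest low(1) by blast+
      have "c m \<odot>\<^bsub>A\<^esub> monomial_value A m \<oplus>\<^bsub>A\<^esub> ?rest = (\<Oplus>\<^bsub>A\<^esub>n\<in>insert m (N - {m}). c n \<odot>\<^bsub>A\<^esub> monomial_value A n)"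
        using N(1) c m(1) by (subst A.finsum_insert) auto
      also have "\<dots> = \<zero>\<^bsub>A\<^esub>" using rel m(1) by (simp add: insert_absorb)
      finally have z: "c m \<odot>\<^bsub>A\<^esub> (a [^]\<^bsub>A\<^esub> ?w m \<oplus>\<^bsub>A\<^esub> l) \<oplus>\<^bsub>A\<^esub> ?rest = \<zero>\<^bsub>A\<^esub>" unfolding l(2) .
      \<comment> \<open>Division by the leading coefficient makes the relation of \<open>a\<close>
        over \<open>U\<close> monic, as the closure condition on \<open>U\<close> requires.\<close>
      let ?i = "inv\<^bsub>K\<^esub> (c m)"
      have i: "?i \<in> carrier K" "?i \<otimes>\<^bsub>K\<^esub> c m = \<one>\<^bsub>K\<^esub>" using K.field_Units c(1,2)[OF m(1)] by auto
      have pc: "a [^]\<^bsub>A\<^esub> ?w m \<in> carrier A" using ac by simp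
      have "\<zero>\<^bsub>A\<^esub> = ?i \<odot>\<^bsub>A\<^esub> (c m \<odot>\<^bsub>A\<^esub> (a [^]\<^bsub>A\<^esub> ?w m \<oplus>\<^bsub>A\<^esub> l) \<oplus>\<^bsub>A\<^esub> ?rest)" using z i(1) by simp
      also have "\<dots> = (a [^]\<^bsub>A\<^esub> ?w m \<oplus>\<^bsub>A\<^esub> l) \<oplus>\<^bsub>A\<^esub> ?i \<odot>\<^bsub>A\<^esub> ?rest"
        using i c(1)[OF m(1)] car pc by (simp add: A.smult_r_distr A.smult_assoc1[symmetric])
      also have "\<dots> = (l \<oplus>\<^bsub>A\<^esub> ?i \<odot>\<^bsub>A\<^esub> ?rest) \<oplus>\<^bsub>A\<^esub> a [^]\<^bsub>A\<^esub> ?w m"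
        using i(1) car pc by (simp add: A.a_ac)
      finally have z': "(l \<oplus>\<^bsub>A\<^esub> ?i \<odot>\<^bsub>A\<^esub> ?rest) \<oplus>\<^bsub>A\<^esub> a [^]\<^bsub>A\<^esub> ?w m = \<zero>\<^bsub>A\<^esub>" ..
      obtain bs where bs: "set bs \<subseteq> U" "length bs = ?w m" "l \<oplus>\<^bsub>A\<^esub> ?i \<odot>\<^bsub>A\<^esub> ?rest = horner A bs a"
        using A.low_horner[OF low(2)[OF l(1) smult[OF i(1) rest]]] by blast
      have "set bs \<subseteq> carrier A" using bs(1) subringE(1)[OF U(1)] by blast
      then have "horner A (bs @ [\<one>\<^bsub>A\<^esub>]) a = \<zero>\<^bsub>A\<^esub>" using A.horner_append_one[OF _ ac] z' bs by simp
      then have aU: "a \<in> U" using int bs(1) ac by blast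
      show "S \<subseteq> U"
      proof
        fix x assume "x \<in> S"
        then obtain b' where b': "b' \<in> U" "x = b' \<oplus>\<^bsub>A\<^esub> a [^]\<^bsub>A\<^esub> e x" using b by blast
        have "a [^]\<^bsub>A\<^esub> n \<in> U" for n :: nat using aU subringE(3,6)[OF U(1)] by (induction n) auto
        then show "x \<in> U" by (subst b'(2)) (rule subringE(7)[OF U(1) b'(1)])
      qed
    qed
    then show ?thesis using zs by blast
  qed
qed

section \<open>Lifting a transcendence basis, and the theorem\<close>

lemma indep_crk: "indep R D zs \<Longrightarrow> crk R {\<zero>\<^bsub>R\<^esub>} D zs = length zs"
  by (induction zs arbitrary: D) auto

text \<open>An element algebraic over the base is dropped, since adjoining it does not change later
  ranks; the others are kept until \<open>r\<close> of them are found.\<close>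

lemma (in cring) crk_extract:
  assumes "prime_in R (carrier R) P" "subring D R" "set xs \<subseteq> carrier R" "r \<le> crk R P D xs"
  shows "\<exists>ys. set ys \<subseteq> set xs \<and> length ys = r \<and> crk R P D ys = r"
  using assms(2-)
proof (induction xs arbitrary: D r)
  case (Cons x xs)
  have D': "subring (adjoin R D x) R" using Cons.prems adjoin_subring by simp
  show ?case
  proof (cases "x \<in> cl R P D")
    case True
    have "crk R P (adjoin R D x) xs = crk R P D xs"
      using cl_adjoin_absorb[OF assms(1) Cons.prems(1) True] D' Cons.prems by (intro crk_cong[OF assms(1)]) auto
    then have "r \<le> crk R P D xs" using True Cons.prems(3) by simp
    then obtain ys where "set ys \<subseteq> set xs" "length ys = r" "crk R P D ys = r"
      using Cons.IH[OF Cons.prems(1)] Cons.prems(2) by auto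
    then show ?thesis by (intro exI[of _ ys]) auto
  next
    case False
    show ?thesis
    proof (cases r)
      case (Suc n)
      then have "n \<le> crk R P (adjoin R D x) xs" using Cons.prems(3) False by simp
      then obtain ys where "set ys \<subseteq> set xs" "length ys = n" "crk R P (adjoin R D x) ys = n"
        using Cons.IH[OF D'] Cons.prems(2) by auto
      then show ?thesis using False Suc by (intro exI[of _ "x # ys"]) auto
    qed (auto intro: exI[of _ "[]"])
  qed
qed simp

lemma quot_alg_algebra:
  assumes "algebra K A" "ideal I A" shows "algebra K (quot_alg A I)"
proof -
  interpret A: algebra K A by fact
  interpret I: ideal I A by fact
  interpret Q: cring "A Quot I" by (rule I.quotient_is_cring[OF A.is_cring])
  let ?Q = "quot_alg A I"
  have Qc: "cring ?Q"
  proof -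
    have "(\<lambda>x. x) \<in> ring_iso (A Quot I) ?Q"
      unfolding ring_iso_def ring_hom_def bij_betw_def by (auto simp: quot_alg_simps inj_on_def)
    from Q.ring_iso_imp_img_cring[OF this] show ?thesis by (simp add: quot_alg_simps(4)[symmetric])
  qed
  note smult = quot_alg_smult[OF assms]
  have hom: "(+>\<^bsub>A\<^esub>) I \<in> ring_hom A (A Quot I)" by (rule I.rcos_ring_hom)
  have plus: "(I +>\<^bsub>A\<^esub> u) \<oplus>\<^bsub>?Q\<^esub> (I +>\<^bsub>A\<^esub> v) = I +>\<^bsub>A\<^esub> (u \<oplus>\<^bsub>A\<^esub> v)"
    and times: "(I +>\<^bsub>A\<^esub> u) \<otimes>\<^bsub>?Q\<^esub> (I +>\<^bsub>A\<^esub> v) = I +>\<^bsub>A\<^esub> (u \<otimes>\<^bsub>A\<^esub> v)" if "u \<in> carrier A" "v \<in> carrier A" for u v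
    using ring_hom_add[OF hom that] ring_hom_mult[OF hom that] by (simp_all add: quot_alg_simps)
  have E: "\<exists>u\<in>carrier A. x = I +>\<^bsub>A\<^esub> u" if "x \<in> carrier ?Q" for x
    using that I.quotient_surj by (auto simp: quot_alg_simps)
  have coset: "I +>\<^bsub>A\<^esub> u \<in> carrier ?Q" if "u \<in> carrier A" for u using that I.quotient_surj by (auto simp: quot_alg_simps)
  show ?thesis
  proof (rule algebraI[OF A.R.is_cring Qc])
    show "\<one>\<^bsub>K\<^esub> \<odot>\<^bsub>?Q\<^esub> x = x" if x: "x \<in> carrier ?Q" for x using E[OF x] by (auto simp: smult)
  next
    fix a x assume a: "a \<in> carrier K" and x: "x \<in> carrier ?Q"
    obtain u where u: "u \<in> carrier A" "x = I +>\<^bsub>A\<^esub> u" using E[OF x] by blast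
    show "a \<odot>\<^bsub>?Q\<^esub> x \<in> carrier ?Q" using a u by (simp add: smult coset)
    {
      fix b assume b: "b \<in> carrier K"
      show "(a \<oplus>\<^bsub>K\<^esub> b) \<odot>\<^bsub>?Q\<^esub> x = a \<odot>\<^bsub>?Q\<^esub> x \<oplus>\<^bsub>?Q\<^esub> b \<odot>\<^bsub>?Q\<^esub> x"
        using u a b by (simp add: smult plus A.smult_l_distr)
      show "(a \<otimes>\<^bsub>K\<^esub> b) \<odot>\<^bsub>?Q\<^esub> x = a \<odot>\<^bsub>?Q\<^esub> (b \<odot>\<^bsub>?Q\<^esub> x)"
        using u a b by (simp add: smult A.smult_assoc1)
    }
    fix y assume y: "y \<in> carrier ?Q"
    obtain v where v: "v \<in> carrier A" "y = I +>\<^bsub>A\<^esub> v" using E[OF y] by blast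
    show "a \<odot>\<^bsub>?Q\<^esub> (x \<oplus>\<^bsub>?Q\<^esub> y) = a \<odot>\<^bsub>?Q\<^esub> x \<oplus>\<^bsub>?Q\<^esub> a \<odot>\<^bsub>?Q\<^esub> y"
      using u v a by (simp add: smult plus A.smult_r_distr)
    show "(a \<odot>\<^bsub>?Q\<^esub> x) \<otimes>\<^bsub>?Q\<^esub> y = a \<odot>\<^bsub>?Q\<^esub> (x \<otimes>\<^bsub>?Q\<^esub> y)"
      using u v a by (simp add: smult times A.smult_assoc2)
  qed
qed

text \<open>Each element of \<open>Z\<close> is a fraction of residue classes. Numerators and
  denominators together have rank at least \<open>card Z\<close>, as \<open>Z\<close> is algebraic
  over them, and \<open>crk_extract\<close> selects \<open>card Z\<close> of their lifts to
  \<open>A\<close>.\<close>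

lemma transcendental_elements:
  assumes "algebra K A" "primeideal p A" "alg_independent K (Frac (quot_alg A p)) Z" "finite Z"
  shows "\<exists>ys. set ys \<subseteq> carrier A \<and> length ys = card Z \<and> crk A p (scalars K A) ys = card Z"
proof -
  interpret A: algebra K A by fact
  interpret p: primeideal p A by fact
  let ?Q = "quot_alg A p"
  let ?F = "Frac ?Q"
  have dom: "domain ?Q" by (rule domain_cong[OF p.quotient_is_domain]) (simp_all add: quot_alg_simps)
  have Qalg: "algebra K ?Q" by (rule quot_alg_algebra[OF assms(1) p.is_ideal])
  interpret F: field ?F by (rule Frac_field[OF dom])
  interpret Falg: algebra K ?F by (rule Frac_algebra[OF dom Qalg])
  interpret Q: domain ?Q by (rule dom)
  let ?h = "\<lambda>x. fraction_hom ?Q (p +>\<^bsub>A\<^esub> x)"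
  have 1: "(+>\<^bsub>A\<^esub>) p \<in> ring_hom A ?Q" using p.rcos_ring_hom by (simp add: ring_hom_def quot_alg_simps)
  have "?h \<in> ring_hom A ?F" using ring_hom_trans[OF 1 fraction_hom(1)[OF dom]] by (simp add: comp_def)
  then interpret h: ring_hom_cring A ?F ?h
    by (intro ring_hom_cring.intro ring_hom_cring_axioms.intro A.is_cring F.is_cring)
  have cos: "p +>\<^bsub>A\<^esub> x \<in> carrier ?Q" if "x \<in> carrier A" for x using 1 that by (auto simp: ring_hom_def)
  have ker: "?h x = \<zero>\<^bsub>?F\<^esub> \<longleftrightarrow> x \<in> p" if x: "x \<in> carrier A" for x
  proof -
    have "?h x = \<zero>\<^bsub>?F\<^esub> \<longleftrightarrow> p +>\<^bsub>A\<^esub> x = \<zero>\<^bsub>?Q\<^esub>"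
      using cos[OF x] by (simp add: fraction_hom_def Frac_zero[OF dom] frac_eq_iff[OF dom])
    also have "\<dots> \<longleftrightarrow> p +>\<^bsub>A\<^esub> x = p" by (simp add: quot_alg_simps FactRing_def)
    also have "\<dots> \<longleftrightarrow> x \<in> p" using x p.a_rcos_const p.a_rcos_self by metis
    finally show ?thesis .
  qed
  have sc: "?h ` scalars K A = scalars K ?F"
  proof -
    have "?h (c \<odot>\<^bsub>A\<^esub> \<one>\<^bsub>A\<^esub>) = c \<odot>\<^bsub>?F\<^esub> \<one>\<^bsub>?F\<^esub>" if c: "c \<in> carrier K" for c
    proof -
      have "?h (c \<odot>\<^bsub>A\<^esub> \<one>\<^bsub>A\<^esub>) = c \<odot>\<^bsub>?F\<^esub> ?h \<one>\<^bsub>A\<^esub>"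
        using quot_alg_smult[OF assms(1) p.is_ideal c A.one_closed, symmetric]
          fraction_hom_smult[OF dom Qalg c cos[OF A.one_closed]] by simp
      then show ?thesis by (simp only: h.hom_one)
    qed
    then show ?thesis unfolding scalars_def image_image by (rule image_cong[OF refl])
  qed
  have kA: "subring (scalars K A) A" and kF: "subring (scalars K ?F) ?F"
    using scalars_subring assms(1) Falg.algebra_axioms by blast+
  have zero: "prime_in ?F (carrier ?F) {\<zero>\<^bsub>?F\<^esub>}" using F.zeroprimeideal F.primeideal_iff_prime_in by blast
  have pp: "prime_in A (carrier A) p" using assms(2) A.primeideal_iff_prime_in by blast
  have Z: "Z \<subseteq> carrier ?F" using assms(3) by (simp add: alg_independent_def)
  have "\<exists>f. \<forall>z\<in>Z. fst (f z) \<in> carrier A \<and> snd (f z) \<in> carrier A \<and> ?h (snd (f z)) \<noteq> \<zero>\<^bsub>?F\<^esub> \<and> ?h (snd (f z)) \<otimes>\<^bsub>?F\<^esub> z = ?h (fst (f z))"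
  proof (rule bchoice, rule ballI)
    fix z assume "z \<in> Z"
    then have "z \<in> carrier ?F" using Z by blast
    from Frac_E[OF dom this] obtain u v where uv: "z = fraction ?Q u v" "u \<in> carrier ?Q" "v \<in> carrier ?Q" "v \<noteq> \<zero>\<^bsub>?Q\<^esub>" .
    obtain a b where ab: "a \<in> carrier A" "u = p +>\<^bsub>A\<^esub> a" "b \<in> carrier A" "v = p +>\<^bsub>A\<^esub> b"
      using uv(2,3) p.quotient_surj by (auto simp: quot_alg_simps)
    have "?h b \<noteq> \<zero>\<^bsub>?F\<^esub>" using uv(3,4) ab(4) by (simp add: fraction_hom_def Frac_zero[OF dom] frac_eq_iff[OF dom])
    moreover have "?h b \<otimes>\<^bsub>?F\<^esub> z = ?h a" using uv ab
      by (simp add: fraction_hom_def Frac_mult[OF dom] frac_eq_iff[OF dom] Q.m_comm)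
    ultimately show "\<exists>w. fst w \<in> carrier A \<and> snd w \<in> carrier A \<and> ?h (snd w) \<noteq> \<zero>\<^bsub>?F\<^esub> \<and> ?h (snd w) \<otimes>\<^bsub>?F\<^esub> z = ?h (fst w)"
      using ab(1,3) by (intro exI[of _ "(a, b)"]) simp
  qed
  then obtain f where f: "\<And>z. z \<in> Z \<Longrightarrow> fst (f z) \<in> carrier A" "\<And>z. z \<in> Z \<Longrightarrow> snd (f z) \<in> carrier A"
    "\<And>z. z \<in> Z \<Longrightarrow> ?h (snd (f z)) \<noteq> \<zero>\<^bsub>?F\<^esub>" "\<And>z. z \<in> Z \<Longrightarrow> ?h (snd (f z)) \<otimes>\<^bsub>?F\<^esub> z = ?h (fst (f z))" by blast
  obtain zs where zs: "set zs = Z" "distinct zs" using finite_distinct_list[OF assms(4)] by blast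
  let ?xs = "map (\<lambda>z. fst (f z)) zs @ map (\<lambda>z. snd (f z)) zs"
  have xs: "set ?xs \<subseteq> carrier A" using f(1,2) zs(1) by auto
  have hxs: "set (map ?h ?xs) \<subseteq> carrier ?F" using xs by auto
  have "Z \<subseteq> cl ?F {\<zero>\<^bsub>?F\<^esub>} (adjoins ?F (scalars K ?F) (map ?h ?xs))"
  proof
    fix z assume z: "z \<in> Z"
    let ?D = "adjoins ?F (scalars K ?F) (map ?h ?xs)"
    have sub: "subring ?D ?F" by (rule F.adjoins_subring[OF kF hxs])
    have "?h (fst (f z)) \<in> set (map ?h ?xs)" "?h (snd (f z)) \<in> set (map ?h ?xs)" using z zs(1) by auto
    then have D: "?h (fst (f z)) \<in> ?D" "?h (snd (f z)) \<in> ?D" using F.adjoins_self[OF kF hxs] by blast+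
    have car: "?h (fst (f z)) \<in> carrier ?F" "?h (snd (f z)) \<in> carrier ?F" "z \<in> carrier ?F" using f(1,2)[OF z] z Z by auto
    \<comment> \<open>The linear relation saying that denominator times \<open>z\<close> equals
      numerator; its leading coefficient, the denominator, is nonzero.\<close>
    have "horner ?F [\<ominus>\<^bsub>?F\<^esub> ?h (fst (f z)), ?h (snd (f z))] z = \<ominus>\<^bsub>?F\<^esub> ?h (fst (f z)) \<oplus>\<^bsub>?F\<^esub> ?h (snd (f z)) \<otimes>\<^bsub>?F\<^esub> z"
      using car by (simp add: F.m_comm)
    also have "\<dots> = \<zero>\<^bsub>?F\<^esub>" unfolding f(4)[OF z] using car by (simp add: F.l_neg)
    finally have "horner ?F [\<ominus>\<^bsub>?F\<^esub> ?h (fst (f z)), ?h (snd (f z))] z \<in> {\<zero>\<^bsub>?F\<^esub>}" by simp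
    then show "z \<in> cl ?F {\<zero>\<^bsub>?F\<^esub>} ?D"
      using subringE(5)[OF sub D(1)] D(2) f(3)[OF z] by (intro clI[OF car(3), of "[\<ominus>\<^bsub>?F\<^esub> ?h (fst (f z)), ?h (snd (f z))]"]) simp_all
  qed
  then have "crk ?F {\<zero>\<^bsub>?F\<^esub>} (scalars K ?F) zs \<le> crk ?F {\<zero>\<^bsub>?F\<^esub>} (scalars K ?F) (map ?h ?xs)"
    by (intro F.crk_le[OF zero kF hxs]) (simp add: zs(1))
  also have "\<dots> = crk A p (scalars K A) ?xs"
    using h.hom_crk[OF subringE(1)[OF kA] xs, of "{\<zero>\<^bsub>?F\<^esub>}" p] ker by (simp only: sc singleton_iff)
  finally have "card Z \<le> crk A p (scalars K A) ?xs"
    using indep_crk[OF alg_independent_indep[OF Falg.algebra_axioms _ zs(2)]] assms(3) zs distinct_card[OF zs(2)] by simp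
  from A.crk_extract[OF pp kA xs this] obtain ys where ys: "set ys \<subseteq> set ?xs" "length ys = card Z" "crk A p (scalars K A) ys = card Z"
    by (elim exE conjE)
  from order_trans[OF ys(1) xs] ys(2,3) show ?thesis by (intro exI[of _ ys] conjI)
qed

theorem proposition2p5:
  fixes K :: "'k ring" and A :: "('k, 'a) module"
  assumes "field K"
    and "algebra K A"
    and "td K A < \<infinity>"
    and "AF_domain K A"
  shows "GAF_domain TYPE('b) K A"
proof -
  have dom: "domain A" and AF: "\<And>p. primeideal p A \<Longrightarrow> prime_ht A p + td K (quot_alg A p) = td K A"
    using assms(4) by (simp_all add: AF_domain_def)
  interpret A: domain A by (rule dom)
  obtain d where d: "td K A = enat d" using assms(3) by (cases "td K A") simp_all
  have "GSCT K A B" if B: "algebra K B" for B :: "('k, 'b) module"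
  proof -
    interpret two_algebras K A B by (intro two_algebras.intro assms(1,2) B)
    show ?thesis
    proof (rule GSCT_I[OF dom])
      fix p assume p: "primeideal p A"
      interpret p: primeideal p A by (rule p)
      have Qdom: "domain (quot_alg A p)" by (rule domain_cong[OF p.quotient_is_domain]) (simp_all add: quot_alg_simps)
      \<comment> \<open>Finiteness of \<open>td K A\<close> forces both summands in the AF equation
        to be finite.\<close>
      obtain h r where hr: "prime_ht A p = enat h" "td K (quot_alg A p) = enat r" "h + r = d"
        using AF[OF p] unfolding d by (cases "prime_ht A p"; cases "td K (quot_alg A p)") auto
      have "chain_to (Spec A) 0 p" using p A.primeideal_iff_prime_in by (simp add: Spec_def)
      then have h: "chain_to (Spec A) h p" using hr(1) unfolding prime_ht_eq[OF A.is_cring] by (rule enat_Sup_attained[rotated])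
      let ?Q = "\<lambda>n. \<exists>Z. n = card Z \<and> finite Z \<and> alg_independent K (Frac (quot_alg A p)) Z"
      have "{enat n | n. ?Q n} = {enat (card Z) | Z. finite Z \<and> alg_independent K (Frac (quot_alg A p)) Z}" by blast
      then have r: "Sup {enat n | n. ?Q n} = enat r" using hr(2) Qdom by (simp add: td_def trdeg_def)
      have Qalg: "algebra K (quot_alg A p)" by (rule quot_alg_algebra[OF assms(2) p.is_ideal])
      interpret Q: field "Frac (quot_alg A p)" by (rule Frac_field[OF Qdom])
      \<comment> \<open>The empty set makes the set of cardinalities nonempty, so the supremum
        \<open>r\<close> is attained also when it is zero.\<close>
      have "?Q 0" using alg_independent_empty[OF assms(1) Frac_algebra[OF Qdom Qalg] Q.one_not_zero] by (intro exI[of _ "{}"]) simp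
      from enat_Sup_attained[of ?Q, OF r this]
      obtain Z where Z: "r = card Z" "finite Z" "alg_independent K (Frac (quot_alg A p)) Z" by (elim exE conjE)
      obtain ys where ys: "set ys \<subseteq> carrier A" "length ys = r" "crk A p (scalars K A) ys = r"
        using transcendental_elements[OF assms(2) p Z(3,2)] unfolding Z(1) by (elim exE conjE)
      have "\<exists>zs. set zs \<subseteq> carrier A \<and> indep A (scalars K A) zs \<and> length zs \<le> h + length ys \<and> normalizes K A zs S"
        if S: "finite S" "S \<subseteq> carrier A" for S
      proof -
        obtain zs where zs: "distinct zs" "alg_independent K A (set zs)" "normalizes K A zs S"
          using noether_normalization[OF assms(1,2) A.one_not_zero S] by blast
        \<comment> \<open>Independent elements of \<open>A\<close> are bounded in number by the
          transcendence degree \<open>d\<close>, and the AF equation rewrites \<open>d\<close> as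
          \<open>h + r\<close>, the bound wanted by \<open>GSCT_I\<close>.\<close>
        have "enat (length zs) \<le> enat d"
          using alg_independent_card_le_td[OF dom assms(2) _ zs(2)] distinct_card[OF zs(1)] d by simp
        then show ?thesis using zs alg_independent_indep[OF assms(2) zs(2,1)] hr(3) ys(2)
          by (intro exI[of _ zs]) (auto simp: alg_independent_def)
      qed
      then show "\<exists>h ys. chain_to (Spec A) h p \<and> set ys \<subseteq> carrier A \<and> crk A p (scalars K A) ys = length ys \<and>
          (\<forall>S. finite S \<longrightarrow> S \<subseteq> carrier A \<longrightarrow> (\<exists>zs. set zs \<subseteq> carrier A \<and> indep A (scalars K A) zs
            \<and> length zs \<le> h + length ys \<and> normalizes K A zs S))"
        using h ys by (intro exI[of _ h] exI[of _ ys]) simp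
    qed
  qed
  then show ?thesis using dom by (simp add: GAF_domain_def)
qed

end
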